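(* Let $y\in|\mathbb{P}^1|$ be of degree $d$ with $y\neq x$, and let $\lambda\in\mathbb{C}^{\times}$. The map $$\mathcal{A}^{K'}(\Phi_y',\lambda)\longrightarrow\bigoplus_{\mathfrak{N}_d'}\mathbb{C},\qquad f\longmapsto(f(g))_{g\in\mathfrak{N}_d'}$$ is an isomorphism of $\mathbb{C}$-vector spaces, where $$\mathfrak{N}_d'=\left(\{c_0'\}\cup\{c_{nx,w}'\mid n\in\{1,\dots,d\},\ w\in\mathbb{P}^1(\mathbb{F}_q)\}\right)\setminus\{c_{dx,[1:0]}'\}.$$ In particular, $\dim\mathcal{A}^{K'}(\Phi_y',\lambda)=d(q+1)$.
   Context: Let $q$ be a prime power and $F=\mathbb{F}_q(t)$ the function field of $\mathbb{P}^1$ over $\mathbb{F}_q$; $|\mathbb{P}^1|$ is the set of closed points (equivalently, places of $F$). For $y\in|\mathbb{P}^1|$: $F_y$ is the completion of $F$ at $y$, $\mathcal{O}_y$ its ring of integers, $\pi_y\in F$ a uniformizer, $\kappa(y)=\mathcal{O}_y/(\pi_y)$, the degree of $y$ is $|y|=[\kappa(y):\mathbb{F}_q]$, and $|\cdot|_y$ is the absolute value with $|\pi_y|_y=q^{-|y|}$. $\mathbb{A}$ is the adele ring of $F$, $\mathcal{O}_{\mathbb{A}}=\prod_y\mathcal{O}_y$, $G=\mathrm{GL}_2$, $Z$ is the center of $G(\mathbb{A})$, $K=\mathrm{GL}_2(\mathcal{O}_{\mathbb{A}})$, $K_y=\mathrm{GL}_2(\mathcal{O}_y)$. A matrix in $\mathrm{GL}_2(F_y)$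 is viewed in $G(\mathbb{A})$ by putting the identity at all other places; for $g\in\mathrm{GL}_2(F_x)$ the resulting adelic matrix is written $(g)_x$. $G(\mathbb{A})$ carries the Haar measure with $\mathrm{vol}(K)=1$. Fix the place $x$ of degree one with uniformizer $\pi_x=t$, and let $K'=K_x'\times\prod_{z\neq x}K_z$ with $K_x'=\{k\in K_x\mid k\equiv\mathrm{id}\bmod(\pi_x)\}$. Put $p_{nx}=\begin{pmatrix}\pi_x^{-n}&0\\0&1\end{pmatrix}$, $\vartheta_{[0:1]}=\begin{pmatrix}0&1\\1&0\end{pmatrix}$, and $\vartheta_{[1:a]}=\begin{pmatrix}1&0\\ a&1\end{pmatrix}$ for $a\in\mathbb{F}_q$. Let $c_0'$ be the class of the identity and, for $n\ge1$ and $w\in\mathbb{P}^1(\mathbb{F}_q)$, $c_{nx,w}'$ the class of $(p_{nx}\vartheta_w)_x$ in $G(F)\backslash G(\mathbb{A})/ZK'$; these classes are pairwise distinct and exhaust the double coset space. $\Phi_y'$ is the characteristic function of $K'\begin{pmatrix}\pi_y&0\\0&1\end{pmatrix}K'$ (matrix placed at $y$) divided by the volume of $K'$; it acts on functions by $\Phi_y'(f)(g)=\int_{G(\mathbb{A})}\Phi_y'(h)f(gh)\,dh$. $\mathcal{A}^{K'}$ is the complex vector space of functions $f:G(\mathbb{A})\to\mathbb{C}$ that are left $G(F)$-invariant, $Z$-invariant, right $K'$-invariant (so functions on $G(F)\backslash G(\mathbb{A})/ZK'$), and of moderate growth, i.e. there are constants $C,N$ with $|f(g)|\le C|g|^N$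 for all $g\in G(\mathbb{A})$. Here $|g|=\prod_y |g_y|_y$, with $|g_y|_y$ the maximum of the $y$-adic absolute values of the entries of $g_y$ and of $\det(g_y)^{-1}$. $\mathcal{A}^{K'}(\Phi_y',\lambda)=\{f\in\mathcal{A}^{K'}\mid\Phi_y'(f)=\lambda f\}$. *)

theory Defs
  imports
    "HOL-Analysis.Analysis"
    "HOL-Algebra.QuotRing"
    "HOL-Algebra.Embedded_Algebras"
    "HOL-Computational_Algebra.Polynomial"
    "HOL-Computational_Algebra.Fraction_Field"
    "HOL-Library.Function_Algebras"
begin

text \<open>
  The finite field is a type \<open>'k\<close> of sort \<open>{field, finite}\<close>, so \<open>q = CARD('k)\<close> and
  \<open>F = 'k poly fract\<close>. Global objects (F, the adele ring and its matrices) live in type classes;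
  the completions at the places form a family of rings indexed by terms and hence are
  rings in the sense of HOL-Algebra.
\<close>

type_synonym 'k ratfun = "'k poly fract"

definition ratfun_const :: "'k::{field,finite} \<Rightarrow> 'k ratfun"
  where "ratfun_const a = Fract [:a:] 1"

definition ratfun_t :: "'k::{field,finite} ratfun"
  where "ratfun_t = Fract [:0, 1:] 1"


section \<open>Places\<close>

text \<open>
  A place is a normalised discrete valuation of F; triviality on the constants is automatic
  because these form a finite field. The value at 0 is not meaningful and is set to 0.
\<close>

definition is_place :: "('k::{field,finite} ratfun \<Rightarrow> int) \<Rightarrow> bool"
  where "is_place v \<longleftrightarrow> v 0 = 0 \<and>
    (\<forall>a b. a \<noteq> 0 \<longrightarrow> b \<noteq> 0 \<longrightarrow> v (a * b) = v a + v b) \<and>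
    (\<forall>a b. a \<noteq> 0 \<longrightarrow> b \<noteq> 0 \<longrightarrow> a + b \<noteq> 0 \<longrightarrow> min (v a) (v b) \<le> v (a + b)) \<and>
    (\<exists>a. a \<noteq> 0 \<and> v a = 1)"

lemma is_place_exists: "\<exists>v :: 'k::{field,finite} ratfun \<Rightarrow> int. is_place v"
proof -
  define w :: "'k ratfun \<Rightarrow> int" where
    "w f = (if f = 0 then 0 else (THE k. \<forall>a b. b \<noteq> 0 \<longrightarrow> f = Fract a b \<longrightarrow>
       k = int (degree b) - int (degree a)))" for f
  have w: "w (Fract a b) = int (degree b) - int (degree a)" if ab: "a \<noteq> 0" "b \<noteq> 0" for a b :: "'k poly"
  proof -
    have nz: "Fract a b \<noteq> 0" using ab by (simp add: Zero_fract_def eq_fract)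
    have eq: "int (degree b) - int (degree a) = int (degree d) - int (degree c)"
      if cd: "d \<noteq> 0" "Fract a b = Fract c d" for c d
    proof -
      have e: "a * d = c * b" using cd ab by (simp add: eq_fract)
      then have "c \<noteq> 0" using ab cd by auto
      have "degree a + degree d = degree c + degree b"
        using arg_cong[OF e, of degree] ab cd \<open>c \<noteq> 0\<close> by (simp add: degree_mult_eq)
      then show ?thesis by linarith
    qed
    have "(THE k. \<forall>c d. d \<noteq> 0 \<longrightarrow> Fract a b = Fract c d \<longrightarrow>
       k = int (degree d) - int (degree c)) = int (degree b) - int (degree a)"
    proof (rule the_equality)
      show "\<forall>c d. d \<noteq> 0 \<longrightarrow> Fract a b = Fract c d \<longrightarrow>
        int (degree b) - int (degree a) = int (degree d) - int (degree c)"
        using eq by blast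
    qed (use ab in blast)
    then show ?thesis using nz by (simp add: w_def)
  qed
  have "is_place w" unfolding is_place_def
  proof (intro conjI allI impI)
    show "w 0 = 0" by (simp add: w_def)
  next
    fix f g :: "'k ratfun" assume "f \<noteq> 0" "g \<noteq> 0"
    then obtain a b c d where "f = Fract a b" "a \<noteq> 0" "b \<noteq> 0" "g = Fract c d" "c \<noteq> 0" "d \<noteq> 0"
      by (metis Fract_cases_nonzero)
    then show "w (f * g) = w f + w g" by (simp add: w degree_mult_eq)
  next
    fix f g :: "'k ratfun" assume nz: "f \<noteq> 0" "g \<noteq> 0" "f + g \<noteq> 0"
    then obtain a b c d where f: "f = Fract a b" "a \<noteq> 0" "b \<noteq> 0" "g = Fract c d" "c \<noteq> 0" "d \<noteq> 0"
      by (metis Fract_cases_nonzero)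
    have s: "f + g = Fract (a * d + c * b) (b * d)" using f by simp
    have n: "a * d + c * b \<noteq> 0" using nz s by (auto simp: fract_collapse)
    have "degree (a * d + c * b) \<le> max (degree a + degree d) (degree c + degree b)"
      using degree_add_le_max[of "a * d" "c * b"] f by (simp add: degree_mult_eq)
    moreover have "w (f + g) = int (degree b + degree d) - int (degree (a * d + c * b))"
      unfolding s using n f by (simp add: w degree_mult_eq)
    moreover have "w f = int (degree b) - int (degree a)" "w g = int (degree d) - int (degree c)"
      using f by (simp_all add: w)
    ultimately show "min (w f) (w g) \<le> w (f + g)" by linarith
  next
    show "\<exists>a. a \<noteq> 0 \<and> w a = 1"
      by (rule exI[of _ "Fract 1 [:0, 1:]"]) (simp add: w Zero_fract_def eq_fract)
  qed
  then show ?thesis by blast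
qed

typedef (overloaded) ('k::"{field,finite}") place = "{v :: 'k ratfun \<Rightarrow> int. is_place v}"
  morphisms val Abs_place
  using is_place_exists by blast

definition is_uniformizer :: "'k::{field,finite} place \<Rightarrow> 'k ratfun \<Rightarrow> bool"
  where "is_uniformizer y a \<longleftrightarrow> val y a = 1"

definition val_ge :: "'k::{field,finite} place \<Rightarrow> int \<Rightarrow> 'k ratfun \<Rightarrow> bool"
  where "val_ge y k a \<longleftrightarrow> a = 0 \<or> k \<le> val y a"

lemma val_zero [simp]: "val y 0 = 0"
  using val[of y] by (simp add: is_place_def)

lemma val_mult: "a \<noteq> 0 \<Longrightarrow> b \<noteq> 0 \<Longrightarrow> val y (a * b) = val y a + val y b"
  using val[of y] by (simp add: is_place_def)

lemma val_add: "a \<noteq> 0 \<Longrightarrow> b \<noteq> 0 \<Longrightarrow> a + b \<noteq> 0 \<Longrightarrow> min (val y a) (val y b) \<le> val y (a + b)"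
  using val[of y] by (simp add: is_place_def)

lemma val_one [simp]: "val y 1 = 0"
  using val_mult[of 1 1 y] by simp

lemma val_minus [simp]: "val y (- a) = val y a"
proof (cases "a = 0")
  case False
  have "val y (- 1) = 0" using val_mult[of "-1" "-1" y] by simp
  then show ?thesis using val_mult[of "-1" a y] False by simp
qed simp

lemma val_ge_zero [simp]: "val_ge y k 0"
  by (simp add: val_ge_def)

lemma val_ge_one [simp]: "val_ge y 0 1"
  by (simp add: val_ge_def)

lemma val_ge_minus [simp]: "val_ge y k (- a) = val_ge y k a"
  by (simp add: val_ge_def)

lemma val_ge_add: "val_ge y k a \<Longrightarrow> val_ge y k b \<Longrightarrow> val_ge y k (a + b)"
  using val_add[of a b y] by (cases "a = 0 \<or> b = 0 \<or> a + b = 0") (auto simp: val_ge_def)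

lemma val_ge_diff: "val_ge y k a \<Longrightarrow> val_ge y k b \<Longrightarrow> val_ge y k (a - b)"
  using val_ge_add[of y k a "- b"] by simp

lemma val_ge_mult: "val_ge y k a \<Longrightarrow> val_ge y l b \<Longrightarrow> val_ge y (k + l) (a * b)"
  using val_mult[of a b y] by (cases "a = 0"; cases "b = 0") (auto simp: val_ge_def)

lemma val_ge_mono: "val_ge y k a \<Longrightarrow> l \<le> k \<Longrightarrow> val_ge y l a"
  by (auto simp: val_ge_def)

lemma val_add_eq: "a \<noteq> 0 \<Longrightarrow> val_ge y (val y a + 1) b \<Longrightarrow> a + b \<noteq> 0 \<and> val y (a + b) = val y a"
proof -
  assume a: "a \<noteq> 0" and b: "val_ge y (val y a + 1) b"
  show ?thesis
  proof (cases "b = 0")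
    case False
    with b have lt: "val y a < val y b" by (simp add: val_ge_def)
    have nz: "a + b \<noteq> 0" using lt by (metis add_eq_0_iff less_irrefl val_minus)
    have "val y a \<le> val y (a + b)" using val_add[OF a False nz, of y] lt by simp
    moreover have "min (val y (a + b)) (val y (- b)) \<le> val y (a + b + - b)"
      using nz False a by (intro val_add) auto
    ultimately show ?thesis using nz lt by simp
  qed (use a in simp)
qed


section \<open>Completions\<close>

definition cauchy_at :: "'k::{field,finite} place \<Rightarrow> (nat \<Rightarrow> 'k ratfun) \<Rightarrow> bool"
  where "cauchy_at y s \<longleftrightarrow> (\<forall>k. \<exists>N. \<forall>m\<ge>N. \<forall>n\<ge>N. val_ge y k (s m - s n))"

definition null_at :: "'k::{field,finite} place \<Rightarrow> (nat \<Rightarrow> 'k ratfun) \<Rightarrow> bool"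
  where "null_at y s \<longleftrightarrow> (\<forall>k. \<exists>N. \<forall>n\<ge>N. val_ge y k (s n))"

definition cauchy_ring :: "'k::{field,finite} place \<Rightarrow> (nat \<Rightarrow> 'k ratfun) ring"
  where "cauchy_ring y = \<lparr>carrier = {s. cauchy_at y s}, mult = (\<lambda>s u n. s n * u n), one = (\<lambda>n. 1),
    zero = (\<lambda>n. 0), add = (\<lambda>s u n. s n + u n)\<rparr>"

type_synonym 'k local_elt = "(nat \<Rightarrow> 'k ratfun) set"

definition local_field :: "'k::{field,finite} place \<Rightarrow> 'k local_elt ring"
  where "local_field y = cauchy_ring y Quot {s. null_at y s}"

definition local_of :: "'k::{field,finite} place \<Rightarrow> 'k ratfun \<Rightarrow> 'k local_elt"
  where "local_of y a = {s. null_at y s} +>\<^bsub>cauchy_ring y\<^esub> (\<lambda>n. a)"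

text \<open>
  Along a Cauchy sequence that is not a null sequence the valuation is eventually constant.
  As for F itself, the value at 0 is not meaningful.
\<close>

definition local_val :: "'k::{field,finite} place \<Rightarrow> 'k local_elt \<Rightarrow> int"
  where "local_val y X = (THE k. \<forall>s\<in>X. \<exists>N. \<forall>n\<ge>N. val y (s n) = k)"

definition integer_ring :: "'k::{field,finite} place \<Rightarrow> 'k local_elt ring"
  where "integer_ring y = (local_field y)\<lparr>carrier :=
    {X \<in> carrier (local_field y). X = \<zero>\<^bsub>local_field y\<^esub> \<or> 0 \<le> local_val y X}\<rparr>"

text \<open>The principal ideal below does not depend on the choice of the uniformizer.\<close>

definition residue_field :: "'k::{field,finite} place \<Rightarrow> 'k local_elt set ring"
  where "residue_field y = integer_ring y Quot
    (PIdl\<^bsub>integer_ring y\<^esub> (local_of y (SOME a. is_uniformizer y a)))"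

definition residue_of :: "'k::{field,finite} place \<Rightarrow> 'k local_elt \<Rightarrow> 'k local_elt set"
  where "residue_of y X =
    (PIdl\<^bsub>integer_ring y\<^esub> (local_of y (SOME a. is_uniformizer y a))) +>\<^bsub>integer_ring y\<^esub> X"

text \<open>The dimension of the residue field over the image of the constants.\<close>

definition place_degree :: "'k::{field,finite} place \<Rightarrow> nat"
  where "place_degree y = ring.dim (residue_field y)
    (range (\<lambda>c. residue_of y (local_of y (ratfun_const c)))) (carrier (residue_field y))"

definition local_abs :: "'k::{field,finite} place \<Rightarrow> 'k local_elt \<Rightarrow> real"
  where "local_abs y X = (if X = \<zero>\<^bsub>local_field y\<^esub> then 0
    else real CARD('k) powi (- (int (place_degree y) * local_val y X)))"

definition local_open :: "'k::{field,finite} place \<Rightarrow> 'k local_elt set \<Rightarrow> bool"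
  where "local_open y U \<longleftrightarrow> U \<subseteq> carrier (local_field y) \<and>
    (\<forall>a\<in>U. \<exists>\<epsilon>>0. \<forall>b\<in>carrier (local_field y). local_abs y (b \<ominus>\<^bsub>local_field y\<^esub> a) < \<epsilon> \<longrightarrow> b \<in> U)"

lemma cauchy_at_const: "cauchy_at y (\<lambda>n. a)"
  by (simp add: cauchy_at_def)

lemma cauchy_at_add:
  assumes "cauchy_at y s" "cauchy_at y u" shows "cauchy_at y (\<lambda>n. s n + u n)"
  unfolding cauchy_at_def
proof
  fix k
  obtain N M where "\<forall>m\<ge>N. \<forall>n\<ge>N. val_ge y k (s m - s n)" "\<forall>m\<ge>M. \<forall>n\<ge>M. val_ge y k (u m - u n)"
    using assms unfolding cauchy_at_def by meson
  then have "val_ge y k ((s m - s n) + (u m - u n))" if "m \<ge> max N M" "n \<ge> max N M" for m n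
    using that by (intro val_ge_add) auto
  then show "\<exists>N. \<forall>m\<ge>N. \<forall>n\<ge>N. val_ge y k (s m + u m - (s n + u n))"
    by (metis add_diff_add)
qed

lemma cauchy_at_minus: "cauchy_at y s \<Longrightarrow> cauchy_at y (\<lambda>n. - s n)"
  unfolding cauchy_at_def by (metis minus_diff_minus val_ge_minus)

lemma cauchy_at_bdd:
  assumes "cauchy_at y s" shows "\<exists>k N. \<forall>n\<ge>N. val_ge y k (s n)"
proof -
  obtain N where N: "\<forall>m\<ge>N. \<forall>n\<ge>N. val_ge y 0 (s m - s n)"
    using assms unfolding cauchy_at_def by meson
  have "val_ge y (min 0 (val y (s N))) (s n)" if "n \<ge> N" for n
  proof -
    have "val_ge y (min 0 (val y (s N))) ((s n - s N) + s N)"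
    proof (rule val_ge_add)
      have "val_ge y 0 (s n - s N)" using N that by simp
      then show "val_ge y (min 0 (val y (s N))) (s n - s N)" by (rule val_ge_mono) simp
    qed (simp add: val_ge_def)
    then show ?thesis by simp
  qed
  then show ?thesis by blast
qed

lemma null_at_add:
  assumes "null_at y s" "null_at y u" shows "null_at y (\<lambda>n. s n + u n)"
  unfolding null_at_def
proof
  fix k
  obtain N M where "\<forall>n\<ge>N. val_ge y k (s n)" "\<forall>n\<ge>M. val_ge y k (u n)"
    using assms unfolding null_at_def by meson
  then have "val_ge y k (s n + u n)" if "n \<ge> max N M" for n
    using that by (intro val_ge_add) auto
  then show "\<exists>N. \<forall>n\<ge>N. val_ge y k (s n + u n)" by blast
qed

lemma null_at_minus: "null_at y s \<Longrightarrow> null_at y (\<lambda>n. - s n)"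
  unfolding null_at_def by simp

lemma null_at_mult:
  assumes "null_at y s" "cauchy_at y u" shows "null_at y (\<lambda>n. s n * u n)"
  unfolding null_at_def
proof
  fix k
  obtain l M where M: "\<forall>n\<ge>M. val_ge y l (u n)" using cauchy_at_bdd[OF assms(2)] by meson
  obtain N where "\<forall>n\<ge>N. val_ge y (k - l) (s n)" using assms(1) unfolding null_at_def by meson
  with M have "val_ge y ((k - l) + l) (s n * u n)" if "n \<ge> max N M" for n
    using that by (intro val_ge_mult) auto
  then show "\<exists>N. \<forall>n\<ge>N. val_ge y k (s n * u n)" by (metis diff_add_cancel)
qed

lemma null_at_imp_cauchy_at: "null_at y s \<Longrightarrow> cauchy_at y s"
  unfolding null_at_def cauchy_at_def by (metis val_ge_diff)

lemma cauchy_at_mult: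
  assumes "cauchy_at y s" "cauchy_at y u" shows "cauchy_at y (\<lambda>n. s n * u n)"
  unfolding cauchy_at_def
proof
  fix k
  obtain l1 M1 where M1: "\<forall>n\<ge>M1. val_ge y l1 (s n)" using cauchy_at_bdd[OF assms(1)] by meson
  obtain l2 M2 where M2: "\<forall>n\<ge>M2. val_ge y l2 (u n)" using cauchy_at_bdd[OF assms(2)] by meson
  obtain N1 where N1: "\<forall>m\<ge>N1. \<forall>n\<ge>N1. val_ge y (k - l2) (s m - s n)"
    using assms(1) unfolding cauchy_at_def by meson
  obtain N2 where N2: "\<forall>m\<ge>N2. \<forall>n\<ge>N2. val_ge y (k - l1) (u m - u n)"
    using assms(2) unfolding cauchy_at_def by meson
  define N where "N = max (max M1 M2) (max N1 N2)"
  have "val_ge y k (s m * u m - s n * u n)" if "m \<ge> N" "n \<ge> N" for m n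
  proof -
    have "val_ge y (l1 + (k - l1)) (s m * (u m - u n))"
      using M1 N2 that by (intro val_ge_mult) (auto simp: N_def)
    moreover have "val_ge y ((k - l2) + l2) ((s m - s n) * u n)"
      using M2 N1 that by (intro val_ge_mult) (auto simp: N_def)
    ultimately have "val_ge y k (s m * (u m - u n) + (s m - s n) * u n)"
      by (intro val_ge_add) simp_all
    then show ?thesis by (simp add: algebra_simps)
  qed
  then show "\<exists>N. \<forall>m\<ge>N. \<forall>n\<ge>N. val_ge y k (s m * u m - s n * u n)" by blast
qed

lemma cauchy_ring_cring: "cring (cauchy_ring y)"
proof (rule cringI)
  show "abelian_group (cauchy_ring y)"
  proof (rule abelian_groupI)
    fix s assume "s \<in> carrier (cauchy_ring y)"
    then show "\<exists>u\<in>carrier (cauchy_ring y). u \<oplus>\<^bsub>cauchy_ring y\<^esub> s = \<zero>\<^bsub>cauchy_ring y\<^esub>"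
      by (intro bexI[of _ "\<lambda>n. - s n"]) (auto simp: cauchy_ring_def cauchy_at_minus)
  qed (auto simp: cauchy_ring_def cauchy_at_add cauchy_at_const algebra_simps)
  show "comm_monoid (cauchy_ring y)"
    by (rule comm_monoidI) (auto simp: cauchy_ring_def cauchy_at_mult cauchy_at_const algebra_simps)
qed (auto simp: cauchy_ring_def algebra_simps)

lemma null_ideal: "ideal {s. null_at y s} (cauchy_ring y)"
proof -
  interpret cring "cauchy_ring y" by (rule cauchy_ring_cring)
  have inv: "inv\<^bsub>add_monoid (cauchy_ring y)\<^esub> s = (\<lambda>n. - s n)" if "cauchy_at y s" for s
  proof -
    have "\<ominus>\<^bsub>cauchy_ring y\<^esub> s = (\<lambda>n. - s n)"
      by (rule minus_equality) (use that in \<open>auto simp: cauchy_ring_def cauchy_at_minus\<close>)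
    then show ?thesis by (simp add: a_inv_def)
  qed
  show ?thesis
  proof (rule idealI)
    show "ring (cauchy_ring y)" by (rule ring_axioms)
    show "subgroup {s. null_at y s} (add_monoid (cauchy_ring y))"
    proof (rule subgroup.intro)
      show "{s. null_at y s} \<subseteq> carrier (add_monoid (cauchy_ring y))"
        by (auto simp: cauchy_ring_def null_at_imp_cauchy_at)
      show "\<one>\<^bsub>add_monoid (cauchy_ring y)\<^esub> \<in> {s. null_at y s}"
        by (simp add: cauchy_ring_def null_at_def)
      show "inv\<^bsub>add_monoid (cauchy_ring y)\<^esub> s \<in> {s. null_at y s}" if "s \<in> {s. null_at y s}" for s
        using that inv[OF null_at_imp_cauchy_at, of s] by (simp add: null_at_minus)
    qed (auto simp: cauchy_ring_def null_at_add)
  qed (use null_at_mult in \<open>auto simp: cauchy_ring_def mult.commute\<close>)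
qed

lemma local_field_cring: "cring (local_field y)"
  unfolding local_field_def by (rule ideal.quotient_is_cring[OF null_ideal cauchy_ring_cring])

lemma local_field_simps:
  "carrier (local_field y) = (+>\<^bsub>cauchy_ring y\<^esub>) {s. null_at y s} ` {s. cauchy_at y s}"
  "\<zero>\<^bsub>local_field y\<^esub> = {s. null_at y s}"
  "\<one>\<^bsub>local_field y\<^esub> = {s. null_at y s} +>\<^bsub>cauchy_ring y\<^esub> (\<lambda>n. 1)"
proof -
  have c: "carrier (cauchy_ring y) = {s. cauchy_at y s}" "\<one>\<^bsub>cauchy_ring y\<^esub> = (\<lambda>n. 1)"
    by (simp_all add: cauchy_ring_def)
  show "carrier (local_field y) = (+>\<^bsub>cauchy_ring y\<^esub>) {s. null_at y s} ` {s. cauchy_at y s}"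
    by (auto simp: local_field_def FactRing_def A_RCOSETS_defs a_r_coset_def c)
qed (simp_all add: local_field_def FactRing_def cauchy_ring_def)

lemma null_coset: "{s. null_at y s} +>\<^bsub>cauchy_ring y\<^esub> u = {s. null_at y (\<lambda>n. s n - u n)}"
proof (rule Set.set_eqI)
  fix s
  have "s \<in> {s. null_at y s} +>\<^bsub>cauchy_ring y\<^esub> u \<longleftrightarrow> (\<exists>h. null_at y h \<and> s = (\<lambda>n. h n + u n))"
    by (auto simp: a_r_coset_def r_coset_def cauchy_ring_def)
  also have "\<dots> \<longleftrightarrow> null_at y (\<lambda>n. s n - u n)"
    by (auto intro!: exI[of _ "\<lambda>n. s n - u n"])
  finally show "s \<in> {s. null_at y s} +>\<^bsub>cauchy_ring y\<^esub> u \<longleftrightarrow> s \<in> {s. null_at y (\<lambda>n. s n - u n)}"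
    by simp
qed

lemma not_null_at_val:
  assumes "cauchy_at y s" "\<not> null_at y s"
  shows "\<exists>k N. \<forall>n\<ge>N. s n \<noteq> 0 \<and> val y (s n) = k"
proof -
  obtain k where k: "\<forall>N. \<exists>n\<ge>N. \<not> val_ge y k (s n)"
    using assms(2) unfolding null_at_def by blast
  obtain N where N: "\<forall>m\<ge>N. \<forall>n\<ge>N. val_ge y k (s m - s n)"
    using assms(1) unfolding cauchy_at_def by blast
  obtain M where M: "M \<ge> N" "s M \<noteq> 0" "val y (s M) < k"
    using k[rule_format, of N] by (auto simp: val_ge_def)
  have "s n \<noteq> 0 \<and> val y (s n) = val y (s M)" if "n \<ge> N" for n
    using val_add_eq[of "s M" y "s n - s M"] val_ge_mono[of y k "s n - s M" "val y (s M) + 1"] M N that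
    by auto
  then show ?thesis by blast
qed

lemma local_val_coset:
  assumes "cauchy_at y s" "\<forall>n\<ge>N. s n \<noteq> 0 \<and> val y (s n) = k"
  shows "local_val y ({s. null_at y s} +>\<^bsub>cauchy_ring y\<^esub> s) = k"
  unfolding local_val_def null_coset
proof (rule the_equality)
  show "\<forall>u\<in>{u. null_at y (\<lambda>n. u n - s n)}. \<exists>N. \<forall>n\<ge>N. val y (u n) = k"
  proof
    fix u assume "u \<in> {u. null_at y (\<lambda>n. u n - s n)}"
    then obtain M where M: "\<forall>n\<ge>M. val_ge y (k + 1) (u n - s n)" unfolding null_at_def by blast
    have "val y (u n) = k" if "n \<ge> max N M" for n
      using val_add_eq[of "s n" y "u n - s n"] M assms(2) that by auto
    then show "\<exists>N. \<forall>n\<ge>N. val y (u n) = k" by blast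
  qed
next
  fix l assume "\<forall>u\<in>{u. null_at y (\<lambda>n. u n - s n)}. \<exists>N. \<forall>n\<ge>N. val y (u n) = l"
  then have "\<exists>N. \<forall>n\<ge>N. val y (s n) = l" by (simp add: null_at_def)
  then obtain M where "\<forall>n\<ge>M. val y (s n) = l" by blast
  then show "l = k" using assms(2) by (metis linear)
qed

lemma coset_integral_iff:
  assumes "cauchy_at y s"
  shows "{s. null_at y s} +>\<^bsub>cauchy_ring y\<^esub> s \<in> carrier (integer_ring y) \<longleftrightarrow> (\<exists>N. \<forall>n\<ge>N. val_ge y 0 (s n))"
proof (cases "null_at y s")
  case True
  have "{s. null_at y s} +>\<^bsub>cauchy_ring y\<^esub> s = {s. null_at y s}"
    unfolding null_coset using null_at_add[OF _ True] null_at_add[OF _ null_at_minus[OF True]]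
    by (auto dest: null_at_add[OF _ True])
  moreover have "\<exists>N. \<forall>n\<ge>N. val_ge y 0 (s n)" using True by (simp add: null_at_def)
  ultimately show ?thesis
    using assms by (auto simp: integer_ring_def local_field_simps)
next
  case False
  obtain k N where kN: "\<forall>n\<ge>N. s n \<noteq> 0 \<and> val y (s n) = k" using not_null_at_val[OF assms False] by blast
  have "{s. null_at y s} +>\<^bsub>cauchy_ring y\<^esub> s \<noteq> {s. null_at y s}"
  proof
    assume "{s. null_at y s} +>\<^bsub>cauchy_ring y\<^esub> s = {s. null_at y s}"
    moreover have "s \<in> {s. null_at y s} +>\<^bsub>cauchy_ring y\<^esub> s" unfolding null_coset by (simp add: null_at_def)
    ultimately show False using False by blast
  qed
  then have "{s. null_at y s} +>\<^bsub>cauchy_ring y\<^esub> s \<in> carrier (integer_ring y) \<longleftrightarrow> 0 \<le> k"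
    using assms local_val_coset[OF assms kN] by (auto simp: integer_ring_def local_field_simps)
  also have "\<dots> \<longleftrightarrow> (\<exists>N. \<forall>n\<ge>N. val_ge y 0 (s n))"
    using kN by (metis linear val_ge_def)
  finally show ?thesis .
qed

lemma integer_ring_subset: "carrier (integer_ring y) \<subseteq> carrier (local_field y)"
  by (auto simp: integer_ring_def)

lemma local_field_add_coset:
  assumes "cauchy_at y s" "cauchy_at y u"
  shows "({s. null_at y s} +>\<^bsub>cauchy_ring y\<^esub> s) \<oplus>\<^bsub>local_field y\<^esub> ({s. null_at y s} +>\<^bsub>cauchy_ring y\<^esub> u)
    = {s. null_at y s} +>\<^bsub>cauchy_ring y\<^esub> (\<lambda>n. s n + u n)"
  using ring_hom_add[OF ideal.rcos_ring_hom[OF null_ideal[of y]], of s u] assms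
  by (simp add: local_field_def) (simp add: cauchy_ring_def)

lemma local_field_mult_coset:
  assumes "cauchy_at y s" "cauchy_at y u"
  shows "({s. null_at y s} +>\<^bsub>cauchy_ring y\<^esub> s) \<otimes>\<^bsub>local_field y\<^esub> ({s. null_at y s} +>\<^bsub>cauchy_ring y\<^esub> u)
    = {s. null_at y s} +>\<^bsub>cauchy_ring y\<^esub> (\<lambda>n. s n * u n)"
  using ring_hom_mult[OF ideal.rcos_ring_hom[OF null_ideal[of y]], of s u] assms
  by (simp add: local_field_def) (simp add: cauchy_ring_def)

lemma local_field_zero_coset: "\<zero>\<^bsub>local_field y\<^esub> = {s. null_at y s} +>\<^bsub>cauchy_ring y\<^esub> (\<lambda>n. 0)"
  by (simp add: local_field_simps null_coset)

lemma local_field_uminus_coset: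
  assumes "cauchy_at y s"
  shows "\<ominus>\<^bsub>local_field y\<^esub> ({s. null_at y s} +>\<^bsub>cauchy_ring y\<^esub> s)
    = {s. null_at y s} +>\<^bsub>cauchy_ring y\<^esub> (\<lambda>n. - s n)"
proof -
  interpret cring "local_field y" by (rule local_field_cring)
  show ?thesis
    by (rule minus_equality)
      (use assms in \<open>auto simp: local_field_add_coset cauchy_at_minus local_field_zero_coset local_field_simps(1)\<close>)
qed

lemma local_field_cases:
  assumes "X \<in> carrier (local_field y)"
  obtains s where "cauchy_at y s" "X = {s. null_at y s} +>\<^bsub>cauchy_ring y\<^esub> s"
  using assms by (auto simp: local_field_simps(1))

lemma integer_ring_add:
  assumes "X \<in> carrier (integer_ring y)" "Y \<in> carrier (integer_ring y)"
  shows "X \<oplus>\<^bsub>local_field y\<^esub> Y \<in> carrier (integer_ring y)"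
proof -
  obtain s where s: "cauchy_at y s" "X = {s. null_at y s} +>\<^bsub>cauchy_ring y\<^esub> s"
    using assms integer_ring_subset local_field_cases by blast
  obtain u where u: "cauchy_at y u" "Y = {s. null_at y s} +>\<^bsub>cauchy_ring y\<^esub> u"
    using assms integer_ring_subset local_field_cases by blast
  obtain N M where "\<forall>n\<ge>N. val_ge y 0 (s n)" "\<forall>n\<ge>M. val_ge y 0 (u n)"
    using assms s u by (auto simp: coset_integral_iff)
  then have "\<forall>n\<ge>max N M. val_ge y 0 (s n + u n)" by (auto intro: val_ge_add)
  then have "\<exists>N. \<forall>n\<ge>N. val_ge y 0 (s n + u n)" by blast
  then show ?thesis
    using s u by (auto simp: local_field_add_coset cauchy_at_add coset_integral_iff)
qed

lemma integer_ring_mult: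
  assumes "X \<in> carrier (integer_ring y)" "Y \<in> carrier (integer_ring y)"
  shows "X \<otimes>\<^bsub>local_field y\<^esub> Y \<in> carrier (integer_ring y)"
proof -
  obtain s where s: "cauchy_at y s" "X = {s. null_at y s} +>\<^bsub>cauchy_ring y\<^esub> s"
    using assms integer_ring_subset local_field_cases by blast
  obtain u where u: "cauchy_at y u" "Y = {s. null_at y s} +>\<^bsub>cauchy_ring y\<^esub> u"
    using assms integer_ring_subset local_field_cases by blast
  obtain N M where "\<forall>n\<ge>N. val_ge y 0 (s n)" "\<forall>n\<ge>M. val_ge y 0 (u n)"
    using assms s u by (auto simp: coset_integral_iff)
  then have "\<forall>n\<ge>max N M. val_ge y 0 (s n * u n)" using val_ge_mult[of y 0 _ 0] by auto
  then have "\<exists>N. \<forall>n\<ge>N. val_ge y 0 (s n * u n)" by blast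
  then show ?thesis
    using s u by (auto simp: local_field_mult_coset cauchy_at_mult coset_integral_iff)
qed

lemma integer_ring_uminus:
  assumes "X \<in> carrier (integer_ring y)"
  shows "\<ominus>\<^bsub>local_field y\<^esub> X \<in> carrier (integer_ring y)"
proof -
  obtain s where s: "cauchy_at y s" "X = {s. null_at y s} +>\<^bsub>cauchy_ring y\<^esub> s"
    using assms integer_ring_subset local_field_cases by blast
  show ?thesis
    using assms s by (auto simp: local_field_uminus_coset cauchy_at_minus coset_integral_iff)
qed

lemma integer_ring_zero: "\<zero>\<^bsub>local_field y\<^esub> \<in> carrier (integer_ring y)"
  by (simp add: local_field_zero_coset coset_integral_iff cauchy_at_const)

lemma integer_ring_one: "\<one>\<^bsub>local_field y\<^esub> \<in> carrier (integer_ring y)"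
  by (simp add: local_field_simps(3) coset_integral_iff cauchy_at_const)

lemma local_field_zero_neq_one: "\<zero>\<^bsub>local_field y\<^esub> \<noteq> \<one>\<^bsub>local_field y\<^esub>"
proof
  assume "\<zero>\<^bsub>local_field y\<^esub> = \<one>\<^bsub>local_field y\<^esub>"
  moreover have "(\<lambda>n. 0) \<in> \<zero>\<^bsub>local_field y\<^esub>" by (simp add: local_field_simps null_at_def)
  ultimately have "null_at y (\<lambda>n. - 1)" by (simp add: local_field_simps(3) null_coset)
  then have "val_ge y 1 1" by (force simp: null_at_def)
  then show False by (simp add: val_ge_def)
qed


section \<open>The adele ring\<close>

typedef (overloaded) ('k::"{field,finite}") adele =
  "{a :: 'k place \<Rightarrow> 'k local_elt. (\<forall>y. a y \<in> carrier (local_field y)) \<and>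
     finite {y. a y \<notin> carrier (integer_ring y)}}"
  morphisms adele_at Abs_adele
  by (rule exI[of _ "\<lambda>y. \<zero>\<^bsub>local_field y\<^esub>"])
    (use integer_ring_zero integer_ring_subset in auto)

instantiation adele :: ("{field,finite}") comm_ring_1
begin

definition "0 = Abs_adele (\<lambda>y. \<zero>\<^bsub>local_field y\<^esub>)"
definition "1 = Abs_adele (\<lambda>y. \<one>\<^bsub>local_field y\<^esub>)"
definition "a + b = Abs_adele (\<lambda>y. adele_at a y \<oplus>\<^bsub>local_field y\<^esub> adele_at b y)"
definition "a * b = Abs_adele (\<lambda>y. adele_at a y \<otimes>\<^bsub>local_field y\<^esub> adele_at b y)"
definition "- a = Abs_adele (\<lambda>y. \<ominus>\<^bsub>local_field y\<^esub> adele_at a y)"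
definition "a - b = a + - (b :: 'a adele)"

lemma adele_at_closed: "adele_at a y \<in> carrier (local_field y)"
  using adele_at[of a] by simp

lemma adele_at_fin: "finite {y. adele_at a y \<notin> carrier (integer_ring y)}"
  using adele_at[of a] by simp

lemma adele_at_zero: "adele_at 0 y = \<zero>\<^bsub>local_field y\<^esub>"
  unfolding zero_adele_def using integer_ring_zero integer_ring_subset
  by (subst Abs_adele_inverse) auto

lemma adele_at_one: "adele_at 1 y = \<one>\<^bsub>local_field y\<^esub>"
  unfolding one_adele_def using integer_ring_one integer_ring_subset
  by (subst Abs_adele_inverse) auto

lemma adele_at_add: "adele_at (a + b) y = adele_at a y \<oplus>\<^bsub>local_field y\<^esub> adele_at b y"
proof -
  have "finite {y. adele_at a y \<oplus>\<^bsub>local_field y\<^esub> adele_at b y \<notin> carrier (integer_ring y)}"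
    by (rule finite_subset[OF _ finite_UnI[OF adele_at_fin[of a] adele_at_fin[of b]]])
      (auto intro: integer_ring_add)
  moreover have "adele_at a y \<oplus>\<^bsub>local_field y\<^esub> adele_at b y \<in> carrier (local_field y)" for y
    using local_field_cring[of y] adele_at_closed by (intro cring.cring_simprules) auto
  ultimately show ?thesis unfolding plus_adele_def by (subst Abs_adele_inverse) auto
qed

lemma adele_at_mult: "adele_at (a * b) y = adele_at a y \<otimes>\<^bsub>local_field y\<^esub> adele_at b y"
proof -
  have "finite {y. adele_at a y \<otimes>\<^bsub>local_field y\<^esub> adele_at b y \<notin> carrier (integer_ring y)}"
    by (rule finite_subset[OF _ finite_UnI[OF adele_at_fin[of a] adele_at_fin[of b]]])
      (auto intro: integer_ring_mult)
  moreover have "adele_at a y \<otimes>\<^bsub>local_field y\<^esub> adele_at b y \<in> carrier (local_field y)" for y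
    using local_field_cring[of y] adele_at_closed by (intro cring.cring_simprules) auto
  ultimately show ?thesis unfolding times_adele_def by (subst Abs_adele_inverse) auto
qed

lemma adele_at_uminus: "adele_at (- a) y = \<ominus>\<^bsub>local_field y\<^esub> adele_at a y"
proof -
  have "finite {y. \<ominus>\<^bsub>local_field y\<^esub> adele_at a y \<notin> carrier (integer_ring y)}"
    by (rule finite_subset[OF _ adele_at_fin[of a]]) (auto intro: integer_ring_uminus)
  moreover have "\<ominus>\<^bsub>local_field y\<^esub> adele_at a y \<in> carrier (local_field y)" for y
    using local_field_cring[of y] adele_at_closed by (intro cring.cring_simprules) auto
  ultimately show ?thesis unfolding uminus_adele_def by (subst Abs_adele_inverse) auto
qed

lemma adele_eqI: "(\<And>y. adele_at a y = adele_at b y) \<Longrightarrow> a = b"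
  using adele_at_inject by blast

instance
proof
  fix a b c :: "'a adele"
  note s = adele_at_zero adele_at_one adele_at_add adele_at_mult adele_at_uminus
  note r = cring.cring_simprules[OF local_field_cring]
  show "a + b + c = a + (b + c)" "a + b = b + a" "0 + a = a" "- a + a = 0" "a - b = a + - b"
    "a * b * c = a * (b * c)" "a * b = b * a" "(a + b) * c = a * c + b * c"
    by (auto intro!: adele_eqI simp: minus_adele_def s r adele_at_closed)
  show "1 * a = a"
    by (auto intro!: adele_eqI simp only: s cring.cring_simprules(12)[OF local_field_cring] adele_at_closed)
  show "(0::'a adele) \<noteq> 1"
    by (metis adele_at_zero adele_at_one local_field_zero_neq_one)
qed

end

instantiation adele :: ("{field,finite}") topological_space
begin

text \<open>The restricted product topology.\<close>

definition open_adele :: "'a adele set \<Rightarrow> bool"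
  where "open_adele U \<longleftrightarrow> (\<forall>a\<in>U. \<exists>W. (\<forall>y. local_open y (W y)) \<and>
    finite {y. W y \<noteq> carrier (integer_ring y)} \<and>
    (\<forall>y. adele_at a y \<in> W y) \<and> {b. \<forall>y. adele_at b y \<in> W y} \<subseteq> U)"

lemma local_open_carrier: "local_open y (carrier (local_field y))"
  by (auto simp: local_open_def intro: exI[of _ 1])

lemma local_open_Int:
  assumes "local_open y U" "local_open y V" shows "local_open y (U \<inter> V)"
  unfolding local_open_def
proof (intro conjI ballI)
  show "U \<inter> V \<subseteq> carrier (local_field y)" using assms by (auto simp: local_open_def)
  fix a assume "a \<in> U \<inter> V"
  then obtain d where "d > 0" "\<forall>b\<in>carrier (local_field y). local_abs y (b \<ominus>\<^bsub>local_field y\<^esub> a) < d \<longrightarrow> b \<in> U"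
    using assms unfolding local_open_def by blast
  moreover obtain e where "e > 0" "\<forall>b\<in>carrier (local_field y). local_abs y (b \<ominus>\<^bsub>local_field y\<^esub> a) < e \<longrightarrow> b \<in> V"
    using assms \<open>a \<in> U \<inter> V\<close> unfolding local_open_def by blast
  ultimately show "\<exists>\<epsilon>>0. \<forall>b\<in>carrier (local_field y). local_abs y (b \<ominus>\<^bsub>local_field y\<^esub> a) < \<epsilon> \<longrightarrow> b \<in> U \<inter> V"
    by (intro exI[of _ "min d e"]) auto
qed

lemma local_open_integers:
  fixes y :: "'b::{field,finite} place"
  shows "local_open y (carrier (integer_ring y))"
  unfolding local_open_def
proof (intro conjI ballI exI[of _ 1] impI)
  fix a b assume a: "a \<in> carrier (integer_ring y)" and b: "b \<in> carrier (local_field y)"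
    and ab: "local_abs y (b \<ominus>\<^bsub>local_field y\<^esub> a) < 1"
  interpret cring "local_field y" by (rule local_field_cring)
  have ac: "a \<in> carrier (local_field y)" using a integer_ring_subset by blast
  define c where "c = b \<ominus>\<^bsub>local_field y\<^esub> a"
  have cc: "c \<in> carrier (local_field y)" unfolding c_def using ac b by simp
  have "c = \<zero>\<^bsub>local_field y\<^esub> \<or> 0 \<le> local_val y c"
  proof (rule ccontr)
    assume n: "\<not> (c = \<zero>\<^bsub>local_field y\<^esub> \<or> 0 \<le> local_val y c)"
    then have "0 \<le> - (int (place_degree y) * local_val y c)"
      by (simp add: mult_nonneg_nonpos)
    then have "1 \<le> real CARD('b) powi (- (int (place_degree y) * local_val y c))"
      by (intro one_le_power_int) (simp_all add: Suc_leI)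
    then show False using ab n by (simp add: local_abs_def c_def[symmetric])
  qed
  then have "c \<in> carrier (integer_ring y)" using cc by (simp add: integer_ring_def)
  moreover have "b = c \<oplus>\<^bsub>local_field y\<^esub> a" unfolding c_def using ac b by (simp add: a_minus_def a_assoc l_neg)
  ultimately show "b \<in> carrier (integer_ring y)" using a integer_ring_add by simp
qed (use integer_ring_subset in auto)

instance
proof
  show "open (UNIV :: 'a adele set)"
    unfolding open_adele_def
  proof
    fix a :: "'a adele"
    let ?W = "\<lambda>y. if adele_at a y \<in> carrier (integer_ring y) then carrier (integer_ring y)
      else carrier (local_field y)"
    have "finite {y. ?W y \<noteq> carrier (integer_ring y)}"
      by (rule finite_subset[OF _ adele_at_fin[of a]]) auto
    then show "\<exists>W. (\<forall>y. local_open y (W y)) \<and> finite {y. W y \<noteq> carrier (integer_ring y)} \<and>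
      (\<forall>y. adele_at a y \<in> W y) \<and> {b. \<forall>y. adele_at b y \<in> W y} \<subseteq> UNIV"
      by (intro exI[of _ ?W]) (auto simp: local_open_integers local_open_carrier adele_at_closed)
  qed
next
  fix S T :: "'a adele set" assume S: "open S" and T: "open T"
  show "open (S \<inter> T)" unfolding open_adele_def
  proof
    fix a assume a: "a \<in> S \<inter> T"
    obtain V where V: "\<forall>y. local_open y (V y)" "finite {y. V y \<noteq> carrier (integer_ring y)}"
      "\<forall>y. adele_at a y \<in> V y" "{b. \<forall>y. adele_at b y \<in> V y} \<subseteq> S"
      using S a unfolding open_adele_def by blast
    obtain W where W: "\<forall>y. local_open y (W y)" "finite {y. W y \<noteq> carrier (integer_ring y)}"
      "\<forall>y. adele_at a y \<in> W y" "{b. \<forall>y. adele_at b y \<in> W y} \<subseteq> T"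
      using T a unfolding open_adele_def by blast
    have "finite {y. V y \<inter> W y \<noteq> carrier (integer_ring y)}"
      by (rule finite_subset[OF _ finite_UnI[OF V(2) W(2)]]) auto
    then show "\<exists>W. (\<forall>y. local_open y (W y)) \<and> finite {y. W y \<noteq> carrier (integer_ring y)} \<and>
      (\<forall>y. adele_at a y \<in> W y) \<and> {b. \<forall>y. adele_at b y \<in> W y} \<subseteq> S \<inter> T"
      using V W by (intro exI[of _ "\<lambda>y. V y \<inter> W y"]) (auto simp: local_open_Int)
  qed
next
  fix C :: "'a adele set set" assume C: "\<forall>S\<in>C. open S"
  show "open (\<Union>C)" unfolding open_adele_def
  proof
    fix a assume "a \<in> \<Union>C"
    then obtain S where S: "S \<in> C" "a \<in> S" by blast
    with C obtain W where "\<forall>y. local_open y (W y)" "finite {y. W y \<noteq> carrier (integer_ring y)}"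
      "\<forall>y. adele_at a y \<in> W y" "{b. \<forall>y. adele_at b y \<in> W y} \<subseteq> S"
      unfolding open_adele_def by meson
    then show "\<exists>W. (\<forall>y. local_open y (W y)) \<and> finite {y. W y \<noteq> carrier (integer_ring y)} \<and>
      (\<forall>y. adele_at a y \<in> W y) \<and> {b. \<forall>y. adele_at b y \<in> W y} \<subseteq> \<Union>C"
      using S by blast
  qed
qed

end


section \<open>The group of invertible adelic 2x2 matrices\<close>

typedef (overloaded) ('k::"{field,finite}") gl2A = "{g :: 'k adele^2^2. invertible g}"
  morphisms gl2_mat Abs_gl2A
  by (rule exI[of _ "mat 1"]) (auto simp: invertible_def)

instantiation gl2A :: ("{field,finite}") monoid_mult
begin

definition "1 = Abs_gl2A (mat 1)"
definition "g * h = Abs_gl2A (gl2_mat g ** gl2_mat h)"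

lemma gl2_mat_one: "gl2_mat 1 = mat 1"
  unfolding one_gl2A_def by (rule Abs_gl2A_inverse) (auto simp: invertible_def)

lemma gl2_mat_mult: "gl2_mat (g * h) = gl2_mat g ** gl2_mat h"
  unfolding times_gl2A_def
proof (rule Abs_gl2A_inverse)
  obtain g' h' where "gl2_mat g ** g' = mat 1" "g' ** gl2_mat g = mat 1"
    "gl2_mat h ** h' = mat 1" "h' ** gl2_mat h = mat 1"
    using gl2_mat[of g] gl2_mat[of h] by (auto simp: invertible_def)
  then have "(gl2_mat g ** gl2_mat h) ** (h' ** g') = mat 1"
    "(h' ** g') ** (gl2_mat g ** gl2_mat h) = mat 1"
    by (metis matrix_mul_assoc matrix_mul_rid)+
  then show "gl2_mat g ** gl2_mat h \<in> {g. invertible g}" by (auto simp: invertible_def)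
qed

instance
  by standard (simp_all add: gl2_mat_inject[symmetric] gl2_mat_mult gl2_mat_one matrix_mul_assoc)

end

instantiation gl2A :: ("{field,finite}") topological_space
begin

text \<open>
  The topology of the group of units of the matrix ring is induced by \<open>g \<mapsto> (g, g\<^sup>-\<^sup>1)\<close>;
  the topology induced by the matrix entries alone would be too coarse.
\<close>

definition open_gl2A :: "'a gl2A set \<Rightarrow> bool"
  where "open_gl2A U \<longleftrightarrow> (\<exists>V. open V \<and> U = (\<lambda>g. (gl2_mat g, matrix_inv (gl2_mat g))) -` V)"

instance
proof
  show "open (UNIV :: 'a gl2A set)" unfolding open_gl2A_def by (rule exI[of _ UNIV]) simp
next
  fix S T :: "'a gl2A set" assume "open S" "open T"
  then obtain V W where "open V" "S = (\<lambda>g. (gl2_mat g, matrix_inv (gl2_mat g))) -` V"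
    "open W" "T = (\<lambda>g. (gl2_mat g, matrix_inv (gl2_mat g))) -` W"
    unfolding open_gl2A_def by (elim exE conjE)
  then show "open (S \<inter> T)"
    unfolding open_gl2A_def by (intro exI[of _ "V \<inter> W"]) (simp add: open_Int)
next
  fix C :: "'a gl2A set set" assume C: "\<forall>S\<in>C. open S"
  let ?i = "\<lambda>g :: 'a gl2A. (gl2_mat g, matrix_inv (gl2_mat g))"
  let ?V = "\<Union>{V. open V \<and> ?i -` V \<in> C}"
  have "\<Union>C \<subseteq> ?i -` ?V"
  proof
    fix g assume "g \<in> \<Union>C"
    then obtain S where S: "S \<in> C" "g \<in> S" by (elim UnionE)
    from C S(1) have "open S" by (rule bspec)
    then obtain V where V: "open V" "S = ?i -` V" unfolding open_gl2A_def by (elim exE conjE)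
    have "V \<in> {V. open V \<and> ?i -` V \<in> C}" using V S(1) by simp
    moreover have "?i g \<in> V" using V(2) S(2) by simp
    ultimately have "?i g \<in> ?V" by (rule UnionI)
    then show "g \<in> ?i -` ?V" by simp
  qed
  moreover have "?i -` ?V \<subseteq> \<Union>C" by (auto intro: UnionI)
  ultimately have "\<Union>C = ?i -` ?V" by (rule equalityI)
  moreover have "open ?V" by (rule open_Union) simp
  ultimately show "open (\<Union>C)" unfolding open_gl2A_def by (intro exI[of _ ?V] conjI)
qed

end

definition comp_at :: "'k::{field,finite} place \<Rightarrow> 'k gl2A \<Rightarrow> 'k local_elt^2^2"
  where "comp_at y g = (\<chi> i j. adele_at (gl2_mat g $ i $ j) y)"

definition local_mat :: "'k::{field,finite} place \<Rightarrow> 'k ratfun^2^2 \<Rightarrow> 'k local_elt^2^2"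
  where "local_mat y M = (\<chi> i j. local_of y (M $ i $ j))"

definition det2 :: "('r, 'b) ring_scheme \<Rightarrow> 'r^2^2 \<Rightarrow> 'r"
  where "det2 R M = (M $ 1 $ 1 \<otimes>\<^bsub>R\<^esub> M $ 2 $ 2) \<ominus>\<^bsub>R\<^esub> (M $ 1 $ 2 \<otimes>\<^bsub>R\<^esub> M $ 2 $ 1)"

definition GL2 :: "('r, 'b) ring_scheme \<Rightarrow> ('r^2^2) set"
  where "GL2 R = {M. (\<forall>i j. M $ i $ j \<in> carrier R) \<and> det2 R M \<in> Units R}"

text \<open>
  For a matrix over the local field with nonzero determinant: the adelic matrix with this
  component at \<open>y\<close> and the identity elsewhere. It is unique since a matrix over the adeles is
  determined by its components.
\<close>

definition at_place :: "'k::{field,finite} place \<Rightarrow> 'k local_elt^2^2 \<Rightarrow> 'k gl2A"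
  where "at_place y M = (THE g. comp_at y g = M \<and> (\<forall>z. z \<noteq> y \<longrightarrow> comp_at z g = local_mat z (mat 1)))"

text \<open>The image of the diagonal embedding of the invertible matrices over F.\<close>

definition rational_points :: "'k::{field,finite} gl2A set"
  where "rational_points = {g. \<exists>\<gamma>. invertible \<gamma> \<and> (\<forall>y. comp_at y g = local_mat y \<gamma>)}"

definition center :: "'k::{field,finite} gl2A set"
  where "center = {z. \<forall>g. z * g = g * z}"

definition max_compact :: "'k::{field,finite} gl2A set"
  where "max_compact = {g. \<forall>y. comp_at y g \<in> GL2 (integer_ring y)}"

text \<open>Here and below, \<open>p\<close> stands for a uniformizer at the place in question.\<close>

definition congruence_local :: "'k::{field,finite} place \<Rightarrow> 'k ratfun \<Rightarrow> ('k local_elt^2^2) set"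
  where "congruence_local x p = {M \<in> GL2 (integer_ring x). \<forall>i j.
    M $ i $ j \<ominus>\<^bsub>integer_ring x\<^esub> local_mat x (mat 1) $ i $ j \<in> PIdl\<^bsub>integer_ring x\<^esub> (local_of x p)}"

definition congruence_subgroup :: "'k::{field,finite} place \<Rightarrow> 'k ratfun \<Rightarrow> 'k gl2A set"
  where "congruence_subgroup x p = {g. comp_at x g \<in> congruence_local x p \<and>
    (\<forall>z. z \<noteq> x \<longrightarrow> comp_at z g \<in> GL2 (integer_ring z))}"

text \<open>
  Regularity need not be demanded: the group is second countable and locally compact.
\<close>

definition haar_measure :: "'k::{field,finite} gl2A measure \<Rightarrow> bool"
  where "haar_measure \<mu> \<longleftrightarrow> sets \<mu> = sets borel \<and>
    (\<forall>g. \<forall>A\<in>sets \<mu>. emeasure \<mu> ((\<lambda>h. g * h) ` A) = emeasure \<mu> A) \<and>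
    (\<forall>C. compact C \<longrightarrow> emeasure \<mu> C < \<infinity>) \<and>
    (\<forall>U. open U \<longrightarrow> U \<noteq> {} \<longrightarrow> 0 < emeasure \<mu> U)"


section \<open>Automorphic forms and the Hecke operator\<close>

definition local_height :: "'k::{field,finite} place \<Rightarrow> 'k gl2A \<Rightarrow> real"
  where "local_height y g = Max (range (\<lambda>(i, j). local_abs y (comp_at y g $ i $ j)) \<union>
    {local_abs y (m_inv (local_field y) (det2 (local_field y) (comp_at y g)))})"

text \<open>All but finitely many local factors are 1.\<close>

definition height :: "'k::{field,finite} gl2A \<Rightarrow> real"
  where "height g = (\<Prod>y | local_height y g \<noteq> 1. local_height y g)"

definition moderate_growth :: "('k::{field,finite} gl2A \<Rightarrow> complex) \<Rightarrow> bool"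
  where "moderate_growth f \<longleftrightarrow> (\<exists>C N :: real. \<forall>g. cmod (f g) \<le> C * height g powr N)"

definition automorphic_forms :: "'k::{field,finite} gl2A set \<Rightarrow> ('k gl2A \<Rightarrow> complex) set"
  where "automorphic_forms K = {f.
    (\<forall>\<gamma>\<in>rational_points. \<forall>g. f (\<gamma> * g) = f g) \<and> (\<forall>z\<in>center. \<forall>g. f (z * g) = f g) \<and>
    (\<forall>k\<in>K. \<forall>g. f (g * k) = f g) \<and> moderate_growth f}"

definition hecke_function ::
    "'k::{field,finite} gl2A measure \<Rightarrow> 'k gl2A set \<Rightarrow> 'k place \<Rightarrow> 'k ratfun \<Rightarrow> 'k gl2A \<Rightarrow> complex"
  where "hecke_function \<mu> K y p h =
    indicator {k * at_place y (local_mat y (vector [vector [p, 0], vector [0, 1]])) * k' | k k'.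
      k \<in> K \<and> k' \<in> K} h / complex_of_real (measure \<mu> K)"

definition hecke_operator ::
    "'k::{field,finite} gl2A measure \<Rightarrow> 'k gl2A set \<Rightarrow> 'k place \<Rightarrow> 'k ratfun \<Rightarrow>
      ('k gl2A \<Rightarrow> complex) \<Rightarrow> 'k gl2A \<Rightarrow> complex"
  where "hecke_operator \<mu> K y p f g = (\<integral>h. hecke_function \<mu> K y p h * f (g * h) \<partial>\<mu>)"

definition hecke_eigenspace ::
    "'k::{field,finite} gl2A measure \<Rightarrow> 'k gl2A set \<Rightarrow> 'k place \<Rightarrow> 'k ratfun \<Rightarrow> complex \<Rightarrow>
      ('k gl2A \<Rightarrow> complex) set"
  where "hecke_eigenspace \<mu> K y p l =
    {f \<in> automorphic_forms K. hecke_operator \<mu> K y p f = (\<lambda>g. l * f g)}"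


section \<open>Double cosets\<close>

definition double_coset :: "'k::{field,finite} gl2A set \<Rightarrow> 'k gl2A \<Rightarrow> 'k gl2A set"
  where "double_coset K g = {\<gamma> * g * z * k | \<gamma> z k. \<gamma> \<in> rational_points \<and> z \<in> center \<and> k \<in> K}"

text \<open>\<open>proj_point a b\<close> is the point \<open>[a : b]\<close> of the projective line over the finite field.\<close>

definition proj_point :: "'k::{field,finite} \<Rightarrow> 'k \<Rightarrow> ('k \<times> 'k) set"
  where "proj_point a b = {(c * a, c * b) | c. c \<noteq> 0}"

definition proj_line :: "('k::{field,finite} \<times> 'k) set set"
  where "proj_line = {proj_point a b | a b. (a, b) \<noteq> (0, 0)}"

definition theta :: "('k::{field,finite} \<times> 'k) set \<Rightarrow> 'k ratfun^2^2"
  where "theta w = (if w = proj_point 0 1 then vector [vector [0, 1], vector [1, 0]]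
    else vector [vector [1, 0], vector [ratfun_const (THE a. w = proj_point 1 a), 1]])"

definition p_mat :: "nat \<Rightarrow> 'k::{field,finite} ratfun \<Rightarrow> 'k ratfun^2^2"
  where "p_mat n p = vector [vector [inverse p ^ n, 0], vector [0, 1]]"

definition class_zero :: "'k::{field,finite} place \<Rightarrow> 'k ratfun \<Rightarrow> 'k gl2A set"
  where "class_zero x p = double_coset (congruence_subgroup x p) 1"

definition class_at :: "'k::{field,finite} place \<Rightarrow> 'k ratfun \<Rightarrow> nat \<Rightarrow> ('k \<times> 'k) set \<Rightarrow> 'k gl2A set"
  where "class_at x p n w =
    double_coset (congruence_subgroup x p) (at_place x (local_mat x (p_mat n p ** theta w)))"

definition nucleus :: "'k::{field,finite} place \<Rightarrow> 'k ratfun \<Rightarrow> nat \<Rightarrow> 'k gl2A set set"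
  where "nucleus x p d = ({class_zero x p} \<union> {class_at x p n w | n w. n \<in> {1..d} \<and> w \<in> proj_line})
    - {class_at x p d (proj_point 1 0)}"

text \<open>The value at a double coset of a function that is constant on it.\<close>

definition value_on :: "('k::{field,finite} gl2A \<Rightarrow> complex) \<Rightarrow> 'k gl2A set \<Rightarrow> complex"
  where "value_on f c = (THE a. \<forall>g\<in>c. f g = a)"

definition restrict_values ::
    "'k::{field,finite} gl2A set set \<Rightarrow> ('k gl2A \<Rightarrow> complex) \<Rightarrow> 'k gl2A set \<Rightarrow> complex"
  where "restrict_values S f = (\<lambda>c. if c \<in> S then value_on f c else 0)"


section \<open>Complex vector spaces of functions\<close>

definition fun_scale :: "complex \<Rightarrow> ('a \<Rightarrow> complex) \<Rightarrow> 'a \<Rightarrow> complex"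
  where "fun_scale a f = (\<lambda>x. a * f x)"

interpretation fun_space: vector_space "fun_scale :: complex \<Rightarrow> ('a \<Rightarrow> complex) \<Rightarrow> 'a \<Rightarrow> complex"
  by standard (auto simp: fun_scale_def algebra_simps)

definition direct_sum :: "'a set \<Rightarrow> ('a \<Rightarrow> complex) set"
  where "direct_sum S = {\<phi>. finite {c. \<phi> c \<noteq> 0} \<and> (\<forall>c. c \<notin> S \<longrightarrow> \<phi> c = 0)}"

definition linear_iso_on ::
    "(('a \<Rightarrow> complex) \<Rightarrow> 'b \<Rightarrow> complex) \<Rightarrow> ('a \<Rightarrow> complex) set \<Rightarrow> ('b \<Rightarrow> complex) set \<Rightarrow> bool"
  where "linear_iso_on T V W \<longleftrightarrow> fun_space.subspace V \<and> fun_space.subspace W \<and>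
    (\<forall>f\<in>V. \<forall>g\<in>V. T (f + g) = T f + T g) \<and>
    (\<forall>a. \<forall>f\<in>V. T (fun_scale a f) = fun_scale a (T f)) \<and> bij_betw T V W"

end

theory Submission
  imports Defs "HOL-Computational_Algebra.Polynomial_Factorial"
begin

text \<open>
  Put \<open>s = 1/t\<close>. The place \<open>x\<close> is the pole of \<open>s\<close>, the other places correspond to the monic
  irreducible polynomials in \<open>s\<close>, and \<open>y\<close> belongs to a polynomial \<open>P\<close> of degree \<open>d\<close>. Strong
  approximation with respect to \<open>x\<close> (lemmas \<open>adelic_decomposition\<close>, \<open>DC_loc_if_equi\<close>,
  \<open>equi_if_DC_loc\<close>) identifies the double cosets with the orbits of \<open>GL\<^sub>2\<close> over the polynomials in
  \<open>s\<close> on rational matrices, taken up to scalars and up to right multiplication by matrices congruent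
  to 1 at \<open>x\<close>. Row reduction (\<open>equi_rep_exists\<close>) finds the classes \<open>c(n, w)\<close>, and comparing shortest
  vectors (\<open>rep_unique\<close>) separates them.

  Since \<open>y\<close> is different from \<open>x\<close>, the Hecke double coset splits into \<open>q^d + 1\<close> cosets of the congruence
  subgroup, and the Hecke operator becomes a sum over the neighbours of a class
  (\<open>hecke_operator_eq_sum\<close>, \<open>hrep_to_x\<close>). The representatives are \<open>diag(P, 1) M\<close> and
  \<open>(1, -b; 0, P) M\<close> with \<open>deg b < d\<close>. The first one sends \<open>c(n, w)\<close> to \<open>c(n + d, w)\<close>, because \<open>P\<close> is
  monic. All others are strictly smaller for the order that compares \<open>n\<close> first and puts the point
  \<open>[1:0]\<close> last: a class of high level needs a short vector, which these matrices do not have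
  (\<open>equi_lower_neighbour\<close>).

  The eigenvalue equation at a class is therefore a formula for the value at its top neighbour in terms
  of smaller classes. The map to the top neighbour is injective and the classes outside its image are
  exactly the nucleus; the trivial class goes to \<open>c(d, [1:0])\<close>, which is why this one is removed. So an
  eigenform is determined by its values on the nucleus, and these can be prescribed (\<open>recursion_unique\<close>,
  \<open>recursion_exists\<close>). The solution grows at most exponentially with \<open>n\<close> (\<open>recursion_growth\<close>), while by
  the product formula the height on \<open>c(n, w)\<close> is at least \<open>q^(n/3)\<close> (\<open>height_lower_bound\<close>); hence the
  growth is moderate.

  The completions are only accessible through the predicate ``the order at \<open>y\<close> is at least \<open>k\<close>'' on
  adeles, so that all algebra takes place in the commutative ring of adeles, and density of \<open>F\<close> in its
  completions reduces local statements to rational matrices.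
\<close>

section \<open>The rational function field as the fraction field of polynomials in 1/t\<close>

definition ev :: "'k::{field,finite} poly \<Rightarrow> 'k ratfun"
  where "ev p = poly (map_poly ratfun_const p) (inverse ratfun_t)"

lemma poly_power_factor:
  fixes P a :: "'k::field poly"
  assumes P: "0 < degree P" and "a \<noteq> 0"
  shows "\<exists>n c. a = P ^ n * c \<and> \<not> P dvd c"
  using assms(2)
proof (induction "degree a" arbitrary: a rule: less_induct)
  case less
  show ?case
  proof (cases "P dvd a")
    case True
    then obtain b where b: "a = P * b" by blast
    with less have "b \<noteq> 0" "P \<noteq> 0" by auto
    then have "degree b < degree a" using P b by (simp add: degree_mult_eq)
    from less(1)[OF this \<open>b \<noteq> 0\<close>] obtain n c where "b = P ^ n * c" "\<not> P dvd c" by blast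
    then have "a = P ^ Suc n * c" using b by simp
    then show ?thesis using \<open>\<not> P dvd c\<close> by blast
  next
    case False
    then have "a = P ^ 0 * a \<and> \<not> P dvd a" by simp
    then show ?thesis by blast
  qed
qed

lemma ratfun_const_hom:
  "ratfun_const 0 = 0" "ratfun_const 1 = 1"
  "ratfun_const (a + b) = ratfun_const a + ratfun_const b"
  "ratfun_const (a * b) = ratfun_const a * ratfun_const b"
  "ratfun_const (- a) = - ratfun_const a"
  by (simp_all add: ratfun_const_def Zero_fract_def One_fract_def eq_fract one_pCons)

lemma ratfun_const_eq_0_iff: "ratfun_const a = 0 \<longleftrightarrow> a = 0"
  by (simp add: ratfun_const_def Zero_fract_def eq_fract)

lemma ratfun_t_neq_0: "ratfun_t \<noteq> 0"
  by (simp add: ratfun_t_def Zero_fract_def eq_fract)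

lemma ev_pCons: "ev (pCons a p) = ratfun_const a + inverse ratfun_t * ev p"
  by (simp add: ev_def map_poly_pCons ratfun_const_hom)

lemma ev_0 [simp]: "ev 0 = 0"
  by (simp add: ev_def)

lemma ev_const: "ev [:a:] = ratfun_const a"
  by (simp add: ev_pCons)

lemma ev_1 [simp]: "ev 1 = 1"
  by (simp add: one_pCons ev_const ratfun_const_hom)

lemma ev_add: "ev (p + q) = ev p + ev q"
  by (induction p q rule: poly_induct2) (simp_all add: ev_pCons ratfun_const_hom algebra_simps)

lemma ev_smult: "ev (Polynomial.smult a p) = ratfun_const a * ev p"
  by (induction p) (simp_all add: ev_pCons ratfun_const_hom algebra_simps)

lemma ev_mult: "ev (p * q) = ev p * ev q"
  by (induction p) (simp_all add: ev_pCons ev_add ev_smult ratfun_const_hom algebra_simps)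

lemma ev_minus: "ev (- p) = - ev p"
  by (induction p) (simp_all add: ev_pCons ratfun_const_hom)

lemma ev_diff: "ev (p - q) = ev p - ev q"
  using ev_add[of p "- q"] by (simp add: ev_minus)

lemma ev_power: "ev (p ^ n) = ev p ^ n"
  by (induction n) (simp_all add: ev_mult)

text \<open>
  A nonzero constant has finite multiplicative order.
\<close>
lemma val_const: "val y (ratfun_const a) = 0"
proof (cases "a = 0")
  case False
  have "\<not> inj (\<lambda>n::nat. a ^ n)"
    using finite_imageD[of "\<lambda>n. a ^ n" "UNIV :: nat set"] by auto
  then obtain i j where ij: "i \<noteq> j" "a ^ i = a ^ j" by (auto simp: inj_def)
  have "ratfun_const a \<noteq> 0" using False by (simp add: ratfun_const_eq_0_iff)
  have p: "ratfun_const a ^ n \<noteq> 0 \<and> val y (ratfun_const a ^ n) = int n * val y (ratfun_const a)" for n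
    using \<open>ratfun_const a \<noteq> 0\<close> by (induction n) (simp_all add: val_mult algebra_simps)
  have "ratfun_const (a ^ n) = ratfun_const a ^ n" for n
    by (induction n) (simp_all add: ratfun_const_hom)
  then have "int i * val y (ratfun_const a) = int j * val y (ratfun_const a)"
    using p[of i] p[of j] ij by metis
  then show ?thesis using ij by simp
qed (simp add: ratfun_const_hom)

lemma val_ge_const: "val_ge y 0 (ratfun_const a)"
  by (simp add: val_ge_def val_const)

lemma val_inverse: "val y (inverse a) = - val y a"
proof (cases "a = 0")
  case False
  then have "val y (a * inverse a) = val y a + val y (inverse a)" by (intro val_mult) auto
  then show ?thesis using False by simp
qed simp

lemma val_divide: "a \<noteq> 0 \<Longrightarrow> b \<noteq> 0 \<Longrightarrow> val y (a / b) = val y a - val y b"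
  by (simp add: divide_inverse val_mult val_inverse)

lemma val_power: "val y (a ^ n) = int n * val y a"
proof (cases "a = 0")
  case False
  then show ?thesis by (induction n) (simp_all add: val_mult algebra_simps)
qed (cases n; simp)

lemma val_ge_mult_iff: "a \<noteq> 0 \<Longrightarrow> val_ge y k (a * b) \<longleftrightarrow> val_ge y (k - val y a) b"
  by (cases "b = 0") (auto simp: val_ge_def val_mult)

lemma val_ge_ev:
  assumes "val_ge y 0 (inverse ratfun_t)" shows "val_ge y 0 (ev p)"
proof (induction p)
  case (pCons a p)
  show ?case unfolding ev_pCons
    using val_ge_mult[OF assms pCons(2)] by (intro val_ge_add val_ge_const) simp
qed simp

lemma place_eqI:
  assumes "\<And>a. a \<noteq> 0 \<Longrightarrow> val y a = val z a" shows "y = z"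
proof -
  have "val y = val z" by (rule ext) (metis assms val_zero)
  then show ?thesis by (simp add: val_inject)
qed


lemma finite_low_degree: "finite {p :: 'k::{zero,finite} poly. degree p < n}"
proof -
  have "{p :: 'k poly. degree p < n} \<subseteq> Poly ` {xs. set xs \<subseteq> UNIV \<and> length xs \<le> n}"
  proof
    fix p :: "'k poly" assume "p \<in> {p. degree p < n}"
    then have "length (coeffs p) \<le> n" by (cases "p = 0") (auto simp: length_coeffs_degree)
    then show "p \<in> Poly ` {xs. set xs \<subseteq> UNIV \<and> length xs \<le> n}"
      by (intro image_eqI[of _ _ "coeffs p"]) simp_all
  qed
  then show ?thesis
    by (rule finite_subset) (intro finite_imageI finite_lists_length_le finite_class.finite_UNIV)
qed


section \<open>The places of the rational function field\<close>

text \<open>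
  The degree-one place at the origin of the line, where \<open>t\<close> is a uniformizer.
\<close>
locale origin_place =
  fixes x :: "'k::{field,finite} place"
  assumes val_x_t: "val x ratfun_t = 1"
begin

text \<open>
  The leading term has strictly the smallest order at \<open>x\<close>, where \<open>1/t\<close> has
  a simple pole.
\<close>
lemma ev_val_x_aux: "p \<noteq> 0 \<Longrightarrow> ev p \<noteq> 0 \<and> val x (ev p) = - int (degree p)"
proof (induction p)
  case (pCons a p)
  show ?case
  proof (cases "p = 0")
    case True
    then show ?thesis using pCons by (simp add: ev_pCons ratfun_const_eq_0_iff val_const)
  next
    case False
    have i: "inverse ratfun_t \<noteq> (0 :: 'k ratfun)" using ratfun_t_neq_0 by simp
    have v: "val x (inverse ratfun_t * ev p) = - 1 - int (degree p)"
      using pCons(2)[OF False] i by (simp add: val_mult val_inverse val_x_t)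
    have "inverse ratfun_t * ev p + ratfun_const a \<noteq> 0 \<and>
      val x (inverse ratfun_t * ev p + ratfun_const a) = val x (inverse ratfun_t * ev p)"
      using pCons(2)[OF False] i v
      by (intro val_add_eq val_ge_mono[OF val_ge_const]) auto
    then show ?thesis using v False by (simp add: ev_pCons add.commute)
  qed
qed simp

lemma ev_eq_0_iff [simp]: "ev p = 0 \<longleftrightarrow> p = (0 :: 'k poly)"
  using ev_val_x_aux ev_0 by blast

lemma val_x_ev: "val x (ev p) = - int (degree p)"
  using ev_val_x_aux[of p] by (cases "p = 0") auto

lemma ev_inj: "ev p = ev q \<longleftrightarrow> p = (q :: 'k poly)"
  using ev_eq_0_iff[of "p - q"] by (simp add: ev_diff)

lemma ev_fraction:
  fixes f :: "'k ratfun" shows "\<exists>a b. b \<noteq> 0 \<and> f = ev a / ev b"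
proof -
  define E where "E = {f :: 'k ratfun. \<exists>a b. b \<noteq> 0 \<and> f = ev a / ev b}"
  have poly: "ev a \<in> E" for a
  proof -
    have "(1 :: 'k poly) \<noteq> 0 \<and> ev a = ev a / ev 1" by simp
    then show ?thesis unfolding E_def by blast
  qed
  have add: "f + g \<in> E" if fg: "f \<in> E" "g \<in> E" for f g
  proof -
    obtain a b c d where "b \<noteq> 0" "f = ev a / ev b" "d \<noteq> 0" "g = ev c / ev d"
      using fg unfolding E_def by auto
    then have "b * d \<noteq> 0" "f + g = ev (a * d + c * b) / ev (b * d)"
      by (simp_all add: ev_add ev_mult add_frac_eq)
    then show ?thesis unfolding E_def by blast
  qed
  have mult: "f * g \<in> E" if fg: "f \<in> E" "g \<in> E" for f g
  proof -
    obtain a b c d where "b \<noteq> 0" "f = ev a / ev b" "d \<noteq> 0" "g = ev c / ev d"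
      using fg unfolding E_def by auto
    then have "b * d \<noteq> 0" "f * g = ev (a * c) / ev (b * d)"
      by (simp_all add: ev_mult)
    then show ?thesis unfolding E_def by blast
  qed
  have inv: "inverse f \<in> E" if f: "f \<in> E" for f
  proof (cases "f = 0")
    case False
    obtain a b where "b \<noteq> 0" "f = ev a / ev b" using f unfolding E_def by auto
    with False have "a \<noteq> 0" "inverse f = ev b / ev a" by auto
    then show ?thesis unfolding E_def by blast
  qed (use poly[of 0] in simp)
  have "ev (pCons 0 (1 :: 'k poly)) = inverse ratfun_t" by (simp add: ev_pCons ratfun_const_hom)
  then have t: "ratfun_t \<in> E" using inv[OF poly[of "pCons 0 1"]] by simp
  have fr: "Fract p 1 \<in> E" for p
  proof (induction p)
    case 0
    then show ?case using poly[of 0] by (simp add: Zero_fract_def)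
  next
    case (pCons a p)
    have "Fract (pCons a p) 1 = ratfun_const a + ratfun_t * Fract p 1"
      by (simp add: ratfun_const_def ratfun_t_def)
    then show ?case using add[OF poly[of "[:a:]"] mult[OF t pCons(2)]] by (simp add: ev_const)
  qed
  obtain p q where "f = Fract p q" "q \<noteq> 0" by (cases f) auto
  then have "f = Fract p 1 * inverse (Fract q 1)" by simp
  then have "f \<in> E" using mult[OF fr inv[OF fr]] by simp
  then show ?thesis by (simp add: E_def)
qed

lemma val_eqI_ev:
  fixes y z :: "'k place"
  assumes "\<And>p. p \<noteq> 0 \<Longrightarrow> val y (ev p) = val z (ev p)" shows "y = z"
proof (rule place_eqI)
  fix f :: "'k ratfun" assume f: "f \<noteq> 0"
  obtain a b where ab: "b \<noteq> 0" "f = ev a / ev b" using ev_fraction by blast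
  then have "a \<noteq> 0" using f by auto
  then show "val y f = val z f" using ab assms by (simp add: val_divide)
qed

text \<open>
  The leading term of a polynomial in \<open>1/t\<close> dominates at a pole of \<open>1/t\<close>,
  so the valuation is a multiple of minus the degree; being normalised, it is the one of
  \<open>x\<close>.
\<close>
lemma place_with_pole:
  fixes y :: "'k place"
  assumes "val y (inverse ratfun_t) < 0" shows "y = x"
proof -
  let ?e = "val y (inverse ratfun_t)"
  have i: "inverse ratfun_t \<noteq> (0 :: 'k ratfun)" using ratfun_t_neq_0 by simp
  have v: "val y (ev p) = ?e * int (degree p)" for p
  proof (induction p)
    case (pCons a p)
    show ?case
    proof (cases "p = 0")
      case False
      have v: "val y (inverse ratfun_t * ev p) = ?e * (1 + int (degree p))"
        using pCons(2) False i by (simp add: val_mult algebra_simps)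
      also have "\<dots> < 0" using assms by (simp add: mult_neg_pos)
      finally have "val y (inverse ratfun_t * ev p + ratfun_const a) = val y (inverse ratfun_t * ev p)"
        using False i by (intro conjunct2[OF val_add_eq] val_ge_mono[OF val_ge_const]) auto
      then show ?thesis using v False by (simp add: ev_pCons add.commute)
    qed (simp add: ev_const val_const)
  qed simp
  obtain f where f: "f \<noteq> 0" "val y f = 1" using val[of y] by (auto simp: is_place_def)
  obtain a b where ab: "b \<noteq> 0" "f = ev a / ev b" using ev_fraction by blast
  then have "a \<noteq> 0" using f by auto
  then have "1 = ?e * (int (degree a) - int (degree b))"
    using ab f by (simp add: val_divide v algebra_simps)
  then have "?e dvd 1" by (rule dvdI)
  then have "\<bar>?e\<bar> = 1" by (simp only: zdvd1_eq)
  then have e: "?e = -1" using assms by linarith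
  show ?thesis
  proof (rule val_eqI_ev)
    fix p :: "'k poly"
    show "val y (ev p) = val x (ev p)" unfolding v val_x_ev e by simp
  qed
qed

lemma val_ge_ev_finite:
  fixes y :: "'k place"
  assumes "y \<noteq> x" shows "val_ge y 0 (ev p)"
proof (rule val_ge_ev)
  have "\<not> val y (inverse ratfun_t) < 0" using assms place_with_pole by blast
  then show "val_ge y 0 (inverse ratfun_t)" unfolding val_ge_def by linarith
qed

text \<open>
  The monic irreducible polynomial in \<open>1/t\<close> that vanishes at \<open>y\<close>,
  characterised as the generator of the ideal of all polynomials vanishing there; at
  \<open>x\<close> there is no such polynomial.
\<close>
definition place_poly :: "'k place \<Rightarrow> 'k poly" where
  "place_poly y = (SOME P. lead_coeff P = 1 \<and> val y (ev P) = 1 \<and> 0 < degree P \<and>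
    (\<forall>p. val_ge y 1 (ev p) \<longleftrightarrow> P dvd p))"

text \<open>
  A nonzero polynomial of least degree among those vanishing at \<open>y\<close> divides all others
  by division with remainder. Every polynomial it does not divide is a unit at \<open>y\<close>, so
  its order divides all orders at \<open>y\<close> and must be 1.
\<close>
lemma place_poly_exists:
  fixes y :: "'k place"
  assumes "y \<noteq> x"
  shows "\<exists>P. lead_coeff P = 1 \<and> val y (ev P) = 1 \<and> 0 < degree P \<and>
    (\<forall>p. val_ge y 1 (ev p) \<longleftrightarrow> P dvd p)"
proof -
  note fin = val_ge_ev_finite[OF assms]
  obtain f where f: "f \<noteq> 0" "val y f = 1" using val[of y] by (auto simp: is_place_def)
  obtain a b where ab: "b \<noteq> 0" "f = ev a / ev b" using ev_fraction by blast
  then have a: "a \<noteq> 0" using f by auto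
  then have va: "val y (ev a) = 1 + val y (ev b)" using ab f by (simp add: val_divide)
  have "0 \<le> val y (ev b)" using fin[of b] ab by (simp add: val_ge_def)
  then have ex: "a \<noteq> 0 \<and> val_ge y 1 (ev a)" using va a by (simp add: val_ge_def)
  \<comment> \<open>the generator, up to a constant factor\<close>
  define m where "m = arg_min degree (\<lambda>p. p \<noteq> 0 \<and> val_ge y 1 (ev p))"
  have m: "m \<noteq> 0" "val_ge y 1 (ev m)" unfolding m_def using arg_min_natI[of "\<lambda>p. p \<noteq> 0 \<and> val_ge y 1 (ev p)", OF ex] by auto
  have min: "degree m \<le> degree p" if "p \<noteq> 0" "val_ge y 1 (ev p)" for p
    unfolding m_def using arg_min_nat_le[of "\<lambda>p. p \<noteq> 0 \<and> val_ge y 1 (ev p)" p degree] that by auto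
  define P where "P = Polynomial.smult (inverse (lead_coeff m)) m"
  have P: "lead_coeff P = 1" "P \<noteq> 0" "degree P = degree m" using m by (simp_all add: P_def)
  have Pv: "val_ge y 1 (ev P)"
    unfolding P_def ev_smult using val_ge_mult[OF val_ge_const m(2)] by simp
  have dvd: "val_ge y 1 (ev p) \<longleftrightarrow> P dvd p" for p
  proof
    assume "P dvd p"
    then obtain q where "p = P * q" by blast
    then show "val_ge y 1 (ev p)" using val_ge_mult[OF Pv fin[of q]] by (simp add: ev_mult)
  next
    assume p: "val_ge y 1 (ev p)"
    have "p mod P = p - P * (p div P)" by (simp add: minus_mult_div_eq_mod)
    then have e: "ev (p mod P) = ev p - ev P * ev (p div P)" by (simp add: ev_diff ev_mult)
    have "val_ge y 1 (ev (p mod P))"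
      unfolding e using val_ge_diff[OF p] val_ge_mult[OF Pv fin[of "p div P"]] by simp
    show "P dvd p"
    proof (rule ccontr)
      assume n: "\<not> P dvd p"
      then have "p mod P \<noteq> 0" by (simp add: mod_eq_0_iff_dvd)
      with min[OF _ \<open>val_ge y 1 (ev (p mod P))\<close>] degree_mod_less_degree[OF P(2) n] P(3)
      show False by simp
    qed
  qed
  have deg: "0 < degree P"
  proof (rule ccontr)
    assume "\<not> 0 < degree P"
    then obtain c where "P = [:c:]" by (meson degree_eq_zeroE not_gr0)
    then have "P = 1" using P(1) by (simp add: one_pCons)
    then show False using Pv by (simp add: val_ge_def)
  qed
  have "val y (ev P) = 1"
  proof (rule ccontr)
    \<comment> \<open>then all orders at \<open>y\<close> would be multiples of the order of \<open>P\<close>, but \<open>f\<close> has order 1\<close>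
    assume "val y (ev P) \<noteq> 1"
    then have v2: "val y (ev P) \<ge> 2" using Pv P by (simp add: val_ge_def)
    obtain n c where n: "a = P ^ n * c" "\<not> P dvd c"
      using poly_power_factor[OF deg a] by blast
    obtain n' c' where n': "b = P ^ n' * c'" "\<not> P dvd c'"
      using poly_power_factor[OF deg ab(1)] by blast
    have c0: "val y (ev p) = 0" if "\<not> P dvd p" for p
      using dvd[of p] fin[of p] that by (auto simp: val_ge_def)
    have "val y (ev a) = int n * val y (ev P)"
      using n a P c0[OF n(2)] by (simp add: ev_mult ev_power val_mult val_power)
    moreover have "val y (ev b) = int n' * val y (ev P)"
      using n' ab P c0[OF n'(2)] by (simp add: ev_mult ev_power val_mult val_power)
    ultimately have "(int n - int n') * val y (ev P) = 1" using va by (simp add: algebra_simps)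
    then have "val y (ev P) dvd 1" by (metis dvd_triv_right)
    then show False using v2 by auto
  qed
  then show ?thesis using P dvd deg by blast
qed

lemma place_poly:
  fixes y :: "'k place"
  assumes "y \<noteq> x"
  shows "lead_coeff (place_poly y) = 1" "val y (ev (place_poly y)) = 1"
    "0 < degree (place_poly y)" "val_ge y 1 (ev p) \<longleftrightarrow> place_poly y dvd p"
  using someI_ex[OF place_poly_exists[OF assms]] unfolding place_poly_def by blast+

lemma place_poly_neq_0:
  fixes y :: "'k place"
  assumes "y \<noteq> x" shows "place_poly y \<noteq> 0"
proof
  assume "place_poly y = 0"
  with place_poly(3)[OF assms] show False by simp
qed

lemma val_ev_eq_0_iff:
  fixes y :: "'k place"
  assumes "y \<noteq> x" "\<not> place_poly y dvd p"
  shows "val y (ev p) = 0"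
  using place_poly(4)[OF assms(1), of p] val_ge_ev_finite[OF assms(1), of p] assms(2)
  unfolding val_ge_def by linarith

lemma place_poly_factor:
  fixes y :: "'k place"
  assumes "y \<noteq> x" "a \<noteq> 0"
  obtains n c where "a = place_poly y ^ n * c" "\<not> place_poly y dvd c" "val y (ev a) = int n"
    "val y (ev c) = 0"
proof -
  let ?P = "place_poly y"
  obtain n c where n: "a = ?P ^ n * c" "\<not> ?P dvd c"
    using poly_power_factor[OF place_poly(3)[OF assms(1)] assms(2)] by blast
  have c: "val y (ev c) = 0"
    using val_ev_eq_0_iff[OF assms(1) n(2)] .
  have "c \<noteq> 0" using n(2) by auto
  then have "val y (ev (?P ^ n * c)) = int n"
    using place_poly(2)[OF assms(1)] place_poly_neq_0[OF assms(1)] c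
    by (simp add: ev_mult ev_power val_mult val_power)
  then have "val y (ev a) = int n" unfolding n(1) .
  then show thesis using that n c by blast
qed

text \<open>
  The polynomial of \<open>z\<close> divides the one of \<open>y\<close>. If the latter did not
  divide the former, it would divide the cofactor, which has smaller degree. So the two monic
  polynomials agree, and they determine the valuations.
\<close>
lemma place_poly_inj:
  fixes y :: "'k place"
  assumes "y \<noteq> x" "z \<noteq> x" "val_ge z 1 (ev (place_poly y))" shows "y = z"
proof -
  have zdvd: "place_poly z dvd place_poly y" using place_poly(4)[OF assms(2)] assms(3) by simp
  have ydvd: "place_poly y dvd place_poly z"
  proof (rule ccontr)
    assume n: "\<not> place_poly y dvd place_poly z"
    obtain r where r: "place_poly y = place_poly z * r" using zdvd by blast
    have "val y (ev (place_poly z)) = 0"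
      by (rule val_ev_eq_0_iff[OF assms(1) n])
    moreover have nz: "place_poly z \<noteq> 0" "r \<noteq> 0"
      using r place_poly_neq_0[OF assms(1)] by (metis mult_zero_left, metis mult_zero_right)
    moreover have "val y (ev (place_poly z) * ev r) = 1"
      unfolding ev_mult[symmetric] r[symmetric] by (rule place_poly(2)[OF assms(1)])
    ultimately have "val y (ev r) = 1" by (simp add: val_mult)
    then have "place_poly y dvd r" using place_poly(4)[OF assms(1), of r] by (simp add: val_ge_def)
    then have "degree (place_poly y) \<le> degree r" using nz by (simp add: dvd_imp_degree_le)
    moreover have "degree (place_poly y) = degree (place_poly z) + degree r"
      unfolding r by (rule degree_mult_eq[OF nz])
    ultimately show False using place_poly(3)[OF assms(2)] by simp
  qed
  have "place_poly y = place_poly z"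
  proof -
    obtain r where r: "place_poly y = place_poly z * r" using zdvd by blast
    then have "r \<noteq> 0" using place_poly_neq_0[OF assms(1)] by (metis mult_zero_right)
    have "degree (place_poly y) \<le> degree (place_poly z)"
      using ydvd place_poly_neq_0[OF assms(2)] by (rule dvd_imp_degree_le)
    moreover have "degree (place_poly y) = degree (place_poly z) + degree r"
      unfolding r by (rule degree_mult_eq[OF place_poly_neq_0[OF assms(2)] \<open>r \<noteq> 0\<close>])
    ultimately obtain c where c: "r = [:c:]" by (metis add_le_same_cancel1 degree_eq_zeroE le_zero_eq)
    have "lead_coeff (place_poly z) * lead_coeff r = 1"
      using place_poly(1)[OF assms(1)] by (simp only: lead_coeff_mult[symmetric] r[symmetric])
    then have "c = 1" unfolding place_poly(1)[OF assms(2)] c by simp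
    then show ?thesis using r c by (simp add: one_pCons[symmetric])
  qed
  show ?thesis
  proof (rule val_eqI_ev)
    fix p :: "'k poly" assume "p \<noteq> 0"
    obtain n c where n: "p = place_poly y ^ n * c" "\<not> place_poly y dvd c" "val y (ev p) = int n"
      using place_poly_factor[OF assms(1) \<open>p \<noteq> 0\<close>] by metis
    have c: "val z (ev c) = 0"
      using val_ev_eq_0_iff[OF assms(2)] n(2) \<open>place_poly y = place_poly z\<close> by simp
    have v: "val z (ev (place_poly y)) = 1"
      using \<open>place_poly y = place_poly z\<close> place_poly(2)[OF assms(2)] by simp
    have "c \<noteq> 0" using n(2) by auto
    then have "val z (ev (place_poly y ^ n * c)) = int n"
      using place_poly_neq_0[OF assms(1)] c v by (simp add: ev_mult ev_power val_mult val_power)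
    then show "val y (ev p) = val z (ev p)" using n(3) unfolding n(1)[symmetric] by simp
  qed
qed


text \<open>
  A prime \<open>Q\<close> defines a valuation, the exponent of \<open>Q\<close> in the numerator
  minus the one in the denominator.
\<close>
lemma place_of_prime_poly:
  fixes Q :: "'k poly"
  assumes Q: "prime_elem Q"
  shows "\<exists>y. y \<noteq> x \<and> val_ge y 1 (ev Q)"
proof -
  have deg: "0 < degree Q"
    using Q by (metis bot_nat_0.not_eq_extremum is_unit_iff_degree prime_elem_not_unit prime_elem_not_zeroI Q)
  have Q0: "Q \<noteq> 0" using deg by auto
  define w where "w f = (THE k. \<exists>m n a b. \<not> Q dvd a \<and> \<not> Q dvd b \<and> k = int m - int n \<and>
    f = ev (Q ^ m * a) / ev (Q ^ n * b))" for f
  have w: "w (ev (Q ^ m * a) / ev (Q ^ n * b)) = int m - int n" if ab: "\<not> Q dvd a" "\<not> Q dvd b" for m n a b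
    unfolding w_def
  proof (rule the_equality)
    fix k assume "\<exists>m' n' a' b'. \<not> Q dvd a' \<and> \<not> Q dvd b' \<and> k = int m' - int n' \<and>
      ev (Q ^ m * a) / ev (Q ^ n * b) = ev (Q ^ m' * a') / ev (Q ^ n' * b')"
    then obtain m' n' a' b' where h: "\<not> Q dvd a'" "\<not> Q dvd b'" "k = int m' - int n'"
      "ev (Q ^ m * a) / ev (Q ^ n * b) = ev (Q ^ m' * a') / ev (Q ^ n' * b')" by blast
    have "Q ^ n * b \<noteq> 0" "Q ^ n' * b' \<noteq> 0" using h ab Q0 by auto
    then have "ev ((Q ^ m * a) * (Q ^ n' * b')) = ev ((Q ^ m' * a') * (Q ^ n * b))"
      using h(4) unfolding ev_mult by (simp add: divide_simps split: if_splits)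
    then have e: "Q ^ (m + n') * (a * b') = Q ^ (m' + n) * (a' * b)"
      unfolding ev_inj by (simp add: power_add mult_ac)
    have n1: "\<not> Q dvd a * b'" "\<not> Q dvd a' * b" using ab h Q by (auto dest: prime_elem_dvd_multD)
    have "m + n' = m' + n"
    proof (rule linorder_cases[of "m + n'" "m' + n"])
      assume l: "m + n' < m' + n"
      then obtain k where "m' + n = Suc (m + n' + k)" by (blast dest: less_imp_Suc_add)
      then have "Q ^ (m' + n) = Q ^ (m + n') * (Q * Q ^ k)" by (simp add: power_add mult_ac)
      then have "Q ^ (m + n') * (a * b') = Q ^ (m + n') * (Q * (Q ^ k * (a' * b)))"
        unfolding e by (simp only: mult.assoc)
      then have "a * b' = Q * (Q ^ k * (a' * b))" using Q0 by simp
      then show ?thesis using n1 by (metis dvd_triv_left)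
    next
      assume l: "m + n' > m' + n"
      then obtain k where "m + n' = Suc (m' + n + k)" by (blast dest: less_imp_Suc_add)
      then have "Q ^ (m + n') = Q ^ (m' + n) * (Q * Q ^ k)" by (simp add: power_add mult_ac)
      then have "Q ^ (m' + n) * (a' * b) = Q ^ (m' + n) * (Q * (Q ^ k * (a * b')))"
        unfolding e[symmetric] by (simp only: mult.assoc)
      then have "a' * b = Q * (Q ^ k * (a * b'))" using Q0 by simp
      then show ?thesis using n1 by (metis dvd_triv_left)
    qed
    then show "k = int m - int n" using h(3) by linarith
  qed (use ab in blast)
  have rep: "\<exists>m n a b. \<not> Q dvd a \<and> \<not> Q dvd b \<and> f = ev (Q ^ m * a) / ev (Q ^ n * b)" if f: "f \<noteq> 0" for f
  proof -
    obtain a b where ab: "b \<noteq> 0" "f = ev a / ev b" using ev_fraction by blast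
    have "a \<noteq> 0" using f ab by auto
    obtain m a' where "a = Q ^ m * a'" "\<not> Q dvd a'" using poly_power_factor[OF deg \<open>a \<noteq> 0\<close>] by blast
    moreover obtain n b' where "b = Q ^ n * b'" "\<not> Q dvd b'" using poly_power_factor[OF deg ab(1)] by blast
    ultimately show ?thesis using ab by blast
  qed
  have wp: "w (ev (Q ^ m * a)) = int m" if "\<not> Q dvd a" for m a
  proof -
    have "\<not> Q dvd 1" using Q by (simp add: prime_elem_def)
    then show ?thesis using w[OF that, of 1 m 0] by simp
  qed
  define v where "v f = (if f = 0 then 0 else w f)" for f
  have add: "min (v f) (v g) \<le> v (f + g)" if fg: "f \<noteq> 0" "g \<noteq> 0" "f + g \<noteq> 0" "v f \<le> v g" for f g
  proof -
    obtain m n a b where f: "\<not> Q dvd a" "\<not> Q dvd b" "f = ev (Q ^ m * a) / ev (Q ^ n * b)" using rep fg by blast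
    obtain m' n' a' b' where g: "\<not> Q dvd a'" "\<not> Q dvd b'" "g = ev (Q ^ m' * a') / ev (Q ^ n' * b')" using rep fg by blast
    have le: "m + n' \<le> m' + n" using fg(1,2,4) w[OF f(1,2), of m n] w[OF g(1,2), of m' n'] unfolding v_def f(3)[symmetric] g(3)[symmetric] by auto
    define c where "c = a * b' + Q ^ (m' + n - (m + n')) * a' * b"
    have pw: "Q ^ (m + n') * Q ^ (m' + n - (m + n')) = Q ^ (m' + n)" using le by (simp add: power_add[symmetric])
    have "Q ^ n * b \<noteq> 0" "Q ^ n' * b' \<noteq> 0" using f g Q0 by auto
    then have "f + g = ev (Q ^ m * a * (Q ^ n' * b') + Q ^ m' * a' * (Q ^ n * b)) / ev (Q ^ n * b * (Q ^ n' * b'))"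
      unfolding f(3) g(3) ev_add ev_mult by (simp add: add_frac_eq)
    also have "Q ^ m * a * (Q ^ n' * b') + Q ^ m' * a' * (Q ^ n * b) = Q ^ (m + n') * c"
      unfolding c_def distrib_left mult.assoc[symmetric] pw by (simp add: power_add mult_ac)
    also have "Q ^ n * b * (Q ^ n' * b') = Q ^ (n + n') * (b * b')" by (simp add: power_add mult_ac)
    finally have s: "f + g = ev (Q ^ (m + n') * c) / ev (Q ^ (n + n') * (b * b'))" .
    then have "c \<noteq> 0" using fg(3) by auto
    then obtain l c' where c: "c = Q ^ l * c'" "\<not> Q dvd c'" using poly_power_factor[OF deg] by blast
    have "f + g = ev (Q ^ (m + n' + l) * c') / ev (Q ^ (n + n') * (b * b'))"
      unfolding s c(1) by (simp add: power_add mult_ac)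
    moreover have "\<not> Q dvd b * b'" using f g Q by (auto dest: prime_elem_dvd_multD)
    ultimately have "w (f + g) = int (m + n' + l) - int (n + n')" using w[OF c(2)] by simp
    then show ?thesis using fg w[OF f(1,2), of m n] f(3) by (simp add: v_def)
  qed
  have "is_place v" unfolding is_place_def
  proof (intro conjI allI impI)
    fix f g :: "'k ratfun" assume fg: "f \<noteq> 0" "g \<noteq> 0"
    obtain m n a b where f: "\<not> Q dvd a" "\<not> Q dvd b" "f = ev (Q ^ m * a) / ev (Q ^ n * b)" using rep fg by blast
    obtain m' n' a' b' where g: "\<not> Q dvd a'" "\<not> Q dvd b'" "g = ev (Q ^ m' * a') / ev (Q ^ n' * b')" using rep fg by blast
    have p: "f * g = ev (Q ^ (m + m') * (a * a')) / ev (Q ^ (n + n') * (b * b'))"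
      unfolding f g ev_mult by (simp add: power_add ev_mult mult_ac)
    have "\<not> Q dvd a * a'" "\<not> Q dvd b * b'" using f g Q by (auto dest: prime_elem_dvd_multD)
    from w[OF this] have "w (f * g) = int (m + m') - int (n + n')" unfolding p .
    then show "v (f * g) = v f + v g"
      using fg w[OF f(1,2), of m n] w[OF g(1,2), of m' n'] unfolding f(3)[symmetric] g(3)[symmetric] by (simp add: v_def)
  next
    fix f g :: "'k ratfun" assume "f \<noteq> 0" "g \<noteq> 0" "f + g \<noteq> 0"
    then show "min (v f) (v g) \<le> v (f + g)"
      using add[of f g] add[of g f] by (cases "v f \<le> v g") (auto simp: add.commute min.commute)
  next
    have "\<not> Q dvd 1" using Q by (simp add: prime_elem_def)
    then have "w (ev Q) = 1" using wp[of 1 1] by simp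
    then show "\<exists>a. a \<noteq> 0 \<and> v a = 1" using Q0 by (intro exI[of _ "ev Q"]) (simp add: v_def)
  qed (simp add: v_def)
  then have v: "val (Abs_place v) = v" by (simp add: Abs_place_inverse)
  have "\<not> Q dvd 1" using Q by (simp add: prime_elem_def)
  then have "val (Abs_place v) (ev Q) = 1" unfolding v using Q0 wp[of 1 1] by (simp add: v_def)
  moreover from this have "Abs_place v \<noteq> x" using val_x_ev[of Q] by auto
  ultimately show ?thesis by (intro exI[of _ "Abs_place v"]) (simp add: val_ge_def)
qed

text \<open>
  A nonconstant divisor of least degree is irreducible, hence prime.
\<close>
lemma place_dividing_poly:
  fixes b :: "'k poly"
  assumes "0 < degree b"
  obtains y where "y \<noteq> x" "val_ge y 1 (ev b)"
proof -
  define Q where "Q = arg_min degree (\<lambda>p. 0 < degree p \<and> p dvd b)"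
  have ex: "0 < degree b \<and> b dvd b" using assms by simp
  have Q: "0 < degree Q" "Q dvd b"
    unfolding Q_def using arg_min_natI[of "\<lambda>p. 0 < degree p \<and> p dvd b", OF ex] by auto
  have min: "degree Q \<le> degree p" if "0 < degree p" "p dvd b" for p
    unfolding Q_def using arg_min_nat_le[of "\<lambda>p. 0 < degree p \<and> p dvd b" p degree] that by auto
  have "irreducible Q"
  proof (rule irreducibleI)
    show "Q \<noteq> 0" using Q by auto
    show "\<not> is_unit Q" using Q by (simp add: is_unit_iff_degree \<open>Q \<noteq> 0\<close>)
    fix c d assume e: "Q = c * d"
    then have nz: "c \<noteq> 0" "d \<noteq> 0" using \<open>Q \<noteq> 0\<close> by auto
    have "degree Q = degree c + degree d" unfolding e by (rule degree_mult_eq[OF nz])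
    moreover have "degree c > 0 \<Longrightarrow> degree Q \<le> degree c" using Q(2) e by (intro min) (auto intro: dvd_mult_left)
    moreover have "degree d > 0 \<Longrightarrow> degree Q \<le> degree d" using Q(2) e by (intro min) (auto intro: dvd_mult_right)
    ultimately have "degree c = 0 \<or> degree d = 0" by auto
    then show "is_unit c \<or> is_unit d" using nz by (simp add: is_unit_iff_degree)
  qed
  then obtain y where y: "y \<noteq> x" "val_ge y 1 (ev Q)"
    using place_of_prime_poly field_poly_irreducible_imp_prime by blast
  have "place_poly y dvd b" using Q(2) y place_poly(4)[OF y(1), of Q] dvd_trans by blast
  then show thesis using that[OF y(1)] place_poly(4)[OF y(1), of b] by simp
qed

lemma finite_val_neq_0_ev: "p \<noteq> (0 :: 'k poly) \<Longrightarrow> finite {y. val y (ev p) \<noteq> 0}"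
proof (induction "degree p" arbitrary: p rule: less_induct)
  case less
  show ?case
  proof (cases "degree p = 0")
    case True
    then obtain c where "p = [:c:]" by (metis degree_eq_zeroE)
    then show ?thesis by (simp add: ev_const val_const)
  next
    case False
    then obtain y where y: "y \<noteq> x" "val_ge y 1 (ev p)" using place_dividing_poly by blast
    then obtain r where r: "p = place_poly y * r" using place_poly(4) by (metis dvdE)
    have nz: "place_poly y \<noteq> 0" "r \<noteq> 0" using r less(2) by auto
    have "degree r < degree p" unfolding r degree_mult_eq[OF nz] using place_poly(3)[OF y(1)] by simp
    from less(1)[OF this nz(2)] have f: "finite {y. val y (ev r) \<noteq> 0}" .
    have "{z. val z (ev p) \<noteq> 0} \<subseteq> {x, y} \<union> {y. val y (ev r) \<noteq> 0}"
    proof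
      fix z assume z: "z \<in> {z. val z (ev p) \<noteq> 0}"
      show "z \<in> {x, y} \<union> {y. val y (ev r) \<noteq> 0}"
      proof (cases "z = x \<or> z = y")
        case False
        then have "\<not> val_ge z 1 (ev (place_poly y))" using place_poly_inj[of y z] y(1) by blast
        then have "val z (ev (place_poly y)) = 0"
          using val_ev_eq_0_iff place_poly(4) False by blast
        then have "val z (ev p) = val z (ev r)" unfolding r using nz by (simp add: ev_mult val_mult)
        then show ?thesis using z by simp
      qed auto
    qed
    then show ?thesis by (rule finite_subset) (use f in simp)
  qed
qed

lemma finite_val_neq_0: "finite {y. val y (f :: 'k ratfun) \<noteq> 0}"
proof (cases "f = 0")
  case False
  obtain a b where ab: "b \<noteq> 0" "f = ev a / ev b" using ev_fraction by blast
  then have "a \<noteq> 0" using False by auto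
  have "{y. val y f \<noteq> 0} \<subseteq> {y. val y (ev a) \<noteq> 0} \<union> {y. val y (ev b) \<noteq> 0}"
    using ab \<open>a \<noteq> 0\<close> by (auto simp: val_divide)
  then show ?thesis
    by (rule finite_subset) (use finite_val_neq_0_ev ab \<open>a \<noteq> 0\<close> in simp)
qed simp

text \<open>
  In a fraction whose denominator has least degree, a place where the denominator vanishes would
  also be a zero of the numerator, and a common factor could be cancelled.
\<close>
lemma regular_outside_x:
  fixes f :: "'k ratfun"
  assumes "\<And>z. z \<noteq> x \<Longrightarrow> val_ge z 0 f"
  shows "\<exists>p. f = ev p"
proof -
  define R where "R b \<longleftrightarrow> b \<noteq> 0 \<and> (\<exists>a. f = ev a / ev b)" for b
  obtain b0 where b0: "R b0" unfolding R_def using ev_fraction by blast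
  define b where "b = arg_min degree R"
  have b: "R b" unfolding b_def using arg_min_natI[of R, OF b0] .
  then obtain a where a: "b \<noteq> 0" "f = ev a / ev b" unfolding R_def by blast
  have "degree b = 0"
  proof (rule ccontr)
    assume "degree b \<noteq> 0"
    then obtain y where y: "y \<noteq> x" "val_ge y 1 (ev b)" using place_dividing_poly by blast
    have "ev a = ev b * f" using a by simp
    then have "val_ge y 1 (ev a)" using val_ge_mult[OF y(2) assms[OF y(1)]] by simp
    then obtain a' where a': "a = place_poly y * a'" using place_poly(4)[OF y(1)] by blast
    obtain b' where b': "b = place_poly y * b'" using place_poly(4)[OF y(1)] y(2) by blast
    have nz: "place_poly y \<noteq> 0" "b' \<noteq> 0" using a(1) b' by auto
    have "f = ev a' / ev b'" unfolding a(2) a' b' using nz by (simp add: ev_mult)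
    then have "R b'" using nz by (auto simp: R_def)
    then have "degree b \<le> degree b'" unfolding b_def by (rule arg_min_nat_le)
    moreover have "degree b = degree (place_poly y) + degree b'" unfolding b' by (rule degree_mult_eq[OF nz])
    ultimately show False using place_poly(3)[OF y(1)] by simp
  qed
  then obtain c where c: "b = [:c:]" by (metis degree_eq_zeroE)
  then have "c \<noteq> 0" using a by auto
  then have "ev ([:inverse c:] * b) = 1" unfolding c by (simp add: one_pCons[symmetric])
  then have "ev [:inverse c:] * ev b = 1" by (simp only: ev_mult)
  then have "inverse (ev b) = ev [:inverse c:]" by (intro inverse_unique) (simp only: mult.commute)
  then have "f = ev (a * [:inverse c:])" unfolding a(2) ev_mult divide_inverse by simp
  then show ?thesis by blast
qed

lemma unit_outside_x:
  fixes f :: "'k ratfun"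
  assumes "f \<noteq> 0" "\<And>z. z \<noteq> x \<Longrightarrow> val z f = 0"
  shows "\<exists>c. c \<noteq> 0 \<and> f = ratfun_const c"
proof -
  obtain p where p: "f = ev p" using regular_outside_x[of f] assms by (auto simp: val_ge_def)
  have "degree p = 0"
  proof (rule ccontr)
    assume "degree p \<noteq> 0"
    then obtain y where "y \<noteq> x" "val_ge y 1 (ev p)" using place_dividing_poly by blast
    then show False using assms p by (simp add: val_ge_def)
  qed
  then obtain c where "p = [:c:]" by (metis degree_eq_zeroE)
  then have "f = ratfun_const c" using p by (simp add: ev_const)
  moreover from this have "c \<noteq> 0" using assms(1) by (auto simp: ratfun_const_hom)
  ultimately show ?thesis by blast
qed

lemma val_place_poly_other:
  fixes y z :: "'k place"
  assumes "y \<noteq> x" "z \<noteq> x" "z \<noteq> y" shows "val z (ev (place_poly y)) = 0"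
  using place_poly_inj[OF assms(1,2)] place_poly(4)[OF assms(2)] val_ev_eq_0_iff[OF assms(2)] assms(3) by metis

text \<open>
  Multiplication by a polynomial prime to \<open>P\<close> is an injective, hence surjective, map on
  the finite set of remainders modulo \<open>P\<close>; so denominators prime to \<open>P\<close>
  can be cleared modulo \<open>P\<close>.
\<close>
lemma residue_polynomial:
  fixes y :: "'k place"
  assumes y: "y \<noteq> x" and f: "val_ge y 0 f"
  shows "\<exists>p. degree p < degree (place_poly y) \<and> val_ge y 1 (f - ev p)"
proof (cases "f = 0")
  case True
  then show ?thesis using place_poly(3)[OF y] by (intro exI[of _ 0]) simp
next
  case False
  let ?P = "place_poly y"
  obtain a0 b0 where ab0: "b0 \<noteq> 0" "f = ev a0 / ev b0" using ev_fraction by blast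
  then have "a0 \<noteq> 0" using False by auto
  obtain m a where a: "a0 = ?P ^ m * a" "\<not> ?P dvd a" "val y (ev a0) = int m"
    using place_poly_factor[OF y \<open>a0 \<noteq> 0\<close>] by metis
  obtain n b where b: "b0 = ?P ^ n * b" "\<not> ?P dvd b" "val y (ev b0) = int n" "val y (ev b) = 0"
    using place_poly_factor[OF y ab0(1)] by metis
  have "val y f = val y (ev a0) - val y (ev b0)"
    unfolding ab0(2) using ab0(1) \<open>a0 \<noteq> 0\<close> by (intro val_divide) auto
  then have "n \<le> m" using f False unfolding a(3) b(3) val_ge_def by simp
  define a1 where "a1 = ?P ^ (m - n) * a"
  have P0: "?P \<noteq> 0" by (rule place_poly_neq_0[OF y])
  have "a0 = ?P ^ n * a1" unfolding a1_def a(1) using \<open>n \<le> m\<close> by (simp add: power_add[symmetric] flip: mult.assoc)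
  then have fe: "f = ev a1 / ev b" unfolding ab0(2) b(1) using P0 by (simp add: ev_mult)
  define D where "D = {p :: 'k poly. degree p < degree ?P}"
  have fin: "finite D" unfolding D_def by (rule finite_low_degree)
  have mod: "q mod ?P \<in> D" for q
    using degree_mod_less_degree[OF P0, of q] place_poly(3)[OF y] by (cases "?P dvd q") (auto simp: D_def)
  have inj: "inj_on (\<lambda>p. (b * p) mod ?P) D"
  proof (rule inj_onI)
    fix p p' assume p: "p \<in> D" "p' \<in> D" and e: "(b * p) mod ?P = (b * p') mod ?P"
    then have "?P dvd b * (p - p')" by (simp add: mod_eq_dvd_iff right_diff_distrib)
    then have "val_ge y 1 (ev b * ev (p - p'))" using place_poly(4)[OF y] by (simp flip: ev_mult)
    moreover have "b \<noteq> 0" using b(2) by auto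
    ultimately have "val_ge y 1 (ev (p - p'))" using b(4) by (simp add: val_ge_mult_iff)
    then have d: "?P dvd p - p'" using place_poly(4)[OF y] by simp
    have "degree (p - p') < degree ?P" using p degree_diff_le_max[of p p'] by (auto simp: D_def)
    then have "p - p' = 0" using dvd_imp_degree_le[OF d] by linarith
    then show "p = p'" by simp
  qed
  have "(\<lambda>p. (b * p) mod ?P) ` D = D"
    using mod by (intro endo_inj_surj[OF fin _ inj]) auto
  then have "a1 mod ?P \<in> (\<lambda>p. (b * p) mod ?P) ` D" using mod[of a1] by (simp only:)
  then obtain p where p: "a1 mod ?P = (b * p) mod ?P" "p \<in> D" by (rule imageE)
  then have "?P dvd a1 - b * p" by (simp only: mod_eq_dvd_iff)
  then have "val_ge y 1 (ev (a1 - b * p))" using place_poly(4)[OF y] by simp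
  moreover have b0: "b \<noteq> 0" using b(2) by auto
  then have "ev (a1 - b * p) = ev b * (f - ev p)" unfolding fe by (simp add: ev_diff ev_mult algebra_simps)
  ultimately have "val_ge y 1 (f - ev p)" using b(4) b0 by (simp add: val_ge_mult_iff)
  then show ?thesis using p(2) unfolding D_def by blast
qed

text \<open>
  Partial fractions: if \<open>f\<close> has a pole of order \<open>n\<close> at \<open>y\<close>,
  subtracting \<open>c / P^n\<close>, where \<open>c\<close> is the residue polynomial of \<open>P^n
  f\<close>, lowers the order of the pole and creates poles only at \<open>x\<close> and
  \<open>y\<close>.
\<close>
lemma polar_part:
  fixes y :: "'k place"
  assumes y: "y \<noteq> x"
  shows "\<exists>g. val_ge y 0 (f - g) \<and> (\<forall>z. z \<noteq> x \<longrightarrow> z \<noteq> y \<longrightarrow> val_ge z 0 g)"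
proof -
  have main: "\<exists>g. val_ge y 0 (f - g) \<and> (\<forall>z. z \<noteq> x \<longrightarrow> z \<noteq> y \<longrightarrow> val_ge z 0 g)"
    if "val_ge y (- int n) f" for n f
    using that
  proof (induction n arbitrary: f)
    case 0
    then show ?case by (intro exI[of _ 0]) simp
  next
    case (Suc n)
    let ?P = "ev (place_poly y)"
    have P0: "?P \<noteq> 0" using place_poly_neq_0[OF y] by simp
    have PS: "val y (?P ^ Suc n) = int (Suc n)" unfolding val_power by (simp add: place_poly(2)[OF y])
    have "val_ge y (int (Suc n) + (- int (Suc n))) (?P ^ Suc n * f)"
      by (rule val_ge_mult[OF _ Suc.prems]) (use PS P0 in \<open>simp only: val_ge_def, simp\<close>)
    then have "val_ge y 0 (?P ^ Suc n * f)" by (simp only: add.right_inverse)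
    then obtain p where p: "val_ge y 1 (?P ^ Suc n * f - ev p)" using residue_polynomial[OF y] by blast
    have nz: "?P ^ Suc n \<noteq> 0" using P0 by simp
    have "a * f - e = a * (f - e / a)" if "a \<noteq> 0" for a e :: "'k ratfun"
      using that by (simp add: right_diff_distrib)
    from this[OF nz] have "?P ^ Suc n * f - ev p = ?P ^ Suc n * (f - ev p / ?P ^ Suc n)" .
    then have "val_ge y (1 - int (Suc n)) (f - ev p / ?P ^ Suc n)"
      using p val_ge_mult_iff[OF nz, of y 1] PS by simp
    then have "val_ge y (- int n) (f - ev p / ?P ^ Suc n)" by simp
    from Suc.IH[OF this] obtain g where g: "val_ge y 0 (f - ev p / ?P ^ Suc n - g)"
      "\<forall>z. z \<noteq> x \<longrightarrow> z \<noteq> y \<longrightarrow> val_ge z 0 g" by blast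
    have "val_ge z 0 (ev p / ?P ^ Suc n)" if z: "z \<noteq> x" "z \<noteq> y" for z
    proof -
      have "val z (?P ^ Suc n) = 0" unfolding val_power val_place_poly_other[OF y z] by simp
      then have "val z (inverse (?P ^ Suc n)) = 0" unfolding val_inverse by simp
      then have "val_ge z 0 (inverse (?P ^ Suc n))" unfolding val_ge_def by linarith
      then show ?thesis using val_ge_mult[OF val_ge_ev_finite[OF z(1), of p]] by (simp add: divide_inverse)
    qed
    then have "\<forall>z. z \<noteq> x \<longrightarrow> z \<noteq> y \<longrightarrow> val_ge z 0 (ev p / ?P ^ Suc n + g)"
      using g(2) by (blast intro: val_ge_add)
    moreover have "val_ge y 0 (f - (ev p / ?P ^ Suc n + g))" using g(1) by (simp only: diff_diff_eq)
    ultimately show ?case by blast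
  qed
  have "val_ge y (- int (nat \<bar>val y f\<bar>)) f" unfolding val_ge_def by linarith
  then show ?thesis by (rule main)
qed

text \<open>
  The degree of a place read off from its polynomial; it is compared with the dimension of the
  residue field below.
\<close>
definition residue_degree :: "'k place \<Rightarrow> nat"
  where "residue_degree y = (if y = x then 1 else degree (place_poly y))"

text \<open>
  By multiplicativity it is enough to treat the polynomial of a place: it has a simple zero there
  and a pole at \<open>x\<close> whose order is its degree. The sum runs over any finite set that
  contains all zeros and poles.
\<close>
lemma product_formula_ev:
  fixes p :: "'k poly"
  shows "p \<noteq> 0 \<Longrightarrow> finite S \<Longrightarrow> x \<in> S \<Longrightarrow> (\<And>y. val y (ev p) \<noteq> 0 \<Longrightarrow> y \<in> S) \<Longrightarrow>
    (\<Sum>y\<in>S. int (residue_degree y) * val y (ev p)) = 0"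
proof (induction "degree p" arbitrary: p rule: less_induct)
  case less
  show ?case
  proof (cases "degree p = 0")
    case True
    then obtain c where "p = [:c:]" by (metis degree_eq_zeroE)
    then show ?thesis by (simp add: ev_const val_const)
  next
    case False
    then obtain y where y: "y \<noteq> x" "val_ge y 1 (ev p)" using place_dividing_poly by blast
    then obtain r where r: "p = place_poly y * r" using place_poly(4) by (metis dvdE)
    have nz: "place_poly y \<noteq> 0" "r \<noteq> 0" using r less(2) by auto
    have dr: "degree r < degree p" unfolding r degree_mult_eq[OF nz] using place_poly(3)[OF y(1)] by simp
    have v: "val z (ev p) = val z (ev (place_poly y)) + val z (ev r)" for z
      unfolding r using nz by (simp add: ev_mult val_mult)
    have yS: "y \<in> S" using y(2) less.prems(1,4) by (force simp: val_ge_def)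
    have sub: "z \<in> S" if "val z (ev r) \<noteq> 0" for z
      using less.prems(3) less.prems(4)[of z] yS v[of z] val_place_poly_other[of y z] y(1) that by (cases "z = x \<or> z = y") auto
    have IH: "(\<Sum>z\<in>S. int (residue_degree z) * val z (ev r)) = 0"
      using less.hyps[OF dr nz(2) less.prems(2,3) sub] by blast
    have "(\<Sum>z\<in>S. int (residue_degree z) * val z (ev (place_poly y))) =
      (\<Sum>z\<in>{x, y}. int (residue_degree z) * val z (ev (place_poly y)))"
      using less.prems(2,3) yS val_place_poly_other[OF y(1)] by (intro sum.mono_neutral_right) auto
    also have "\<dots> = 0" using y(1) place_poly(2)[OF y(1)] by (simp add: residue_degree_def val_x_ev)
    finally show ?thesis using IH by (simp add: v sum.distrib distrib_left)
  qed
qed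

lemma product_formula:
  fixes f :: "'k ratfun"
  assumes "f \<noteq> 0"
  obtains S0 where "finite S0" "\<And>S. finite S \<Longrightarrow> S0 \<subseteq> S \<Longrightarrow> (\<Sum>y\<in>S. int (residue_degree y) * val y f) = 0"
proof -
  obtain a b where ab: "b \<noteq> 0" "f = ev a / ev b" using ev_fraction by blast
  then have a: "a \<noteq> 0" using assms by auto
  let ?S = "insert x ({y. val y (ev a) \<noteq> 0} \<union> {y. val y (ev b) \<noteq> 0})"
  show thesis
  proof (rule that[of ?S])
    show "finite ?S" using finite_val_neq_0_ev ab a by simp
    fix S assume S: "finite S" "?S \<subseteq> S"
    have "val y f = val y (ev a) - val y (ev b)" for y using ab a by (simp add: val_divide)
    then show "(\<Sum>y\<in>S. int (residue_degree y) * val y f) = 0"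
    proof -
      have "(\<Sum>y\<in>S. int (residue_degree y) * val y (ev a)) = 0" "(\<Sum>y\<in>S. int (residue_degree y) * val y (ev b)) = 0"
        using S by (auto intro!: product_formula_ev a ab(1))
      then show ?thesis using \<open>\<And>y. val y f = val y (ev a) - val y (ev b)\<close>
        by (simp add: right_diff_distrib sum_subtractf)
    qed
  qed
qed

end

section \<open>Valuations on the completions and on the adeles\<close>

abbreviation coset :: "'k::{field,finite} place \<Rightarrow> (nat \<Rightarrow> 'k ratfun) \<Rightarrow> 'k local_elt"
  where "coset y s \<equiv> {s. null_at y s} +>\<^bsub>cauchy_ring y\<^esub> s"

text \<open>
  Order at least \<open>k\<close> on the completion. Unlike the valuation itself, it is meaningful
  at 0 and closed under addition.
\<close>
definition local_ge :: "'k::{field,finite} place \<Rightarrow> int \<Rightarrow> 'k local_elt \<Rightarrow> bool"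
  where "local_ge y k X \<longleftrightarrow> (\<forall>s\<in>X. \<exists>N. \<forall>n\<ge>N. val_ge y k (s n))"

lemma local_ge_coset: "local_ge y k (coset y s) \<longleftrightarrow> (\<exists>N. \<forall>n\<ge>N. val_ge y k (s n))"
proof
  assume "local_ge y k (coset y s)"
  moreover have "s \<in> coset y s" unfolding null_coset by (simp add: null_at_def)
  ultimately show "\<exists>N. \<forall>n\<ge>N. val_ge y k (s n)" unfolding local_ge_def by blast
next
  assume "\<exists>N. \<forall>n\<ge>N. val_ge y k (s n)"
  then obtain N where N: "\<forall>n\<ge>N. val_ge y k (s n)" by blast
  show "local_ge y k (coset y s)" unfolding local_ge_def
  proof
    fix u assume "u \<in> coset y s"
    then have "null_at y (\<lambda>n. u n - s n)" by (simp add: null_coset)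
    then obtain M where M: "\<forall>n\<ge>M. val_ge y k (u n - s n)" unfolding null_at_def by blast
    have "val_ge y k (u n)" if "n \<ge> max N M" for n
      using val_ge_add[of y k "u n - s n" "s n"] N M that by simp
    then show "\<exists>N. \<forall>n\<ge>N. val_ge y k (u n)" by blast
  qed
qed

lemma coset_closed: "cauchy_at y s \<Longrightarrow> coset y s \<in> carrier (local_field y)"
  by (simp add: local_field_simps(1))

lemma coset_eqI: "null_at y (\<lambda>n. s n - u n) \<Longrightarrow> coset y s = coset y u"
proof -
  have *: "coset y s \<subseteq> coset y u" if n: "null_at y (\<lambda>n. s n - u n)" for s u
  proof
    fix v assume "v \<in> coset y s"
    then have "null_at y (\<lambda>n. v n - s n)" by (simp add: null_coset)
    from null_at_add[OF this n] show "v \<in> coset y u" by (simp add: null_coset)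
  qed
  assume n: "null_at y (\<lambda>n. s n - u n)"
  then have "null_at y (\<lambda>n. u n - s n)" using null_at_minus[OF n] by simp
  with n show "coset y s = coset y u" using * by blast
qed

lemma local_of_coset: "local_of y a = coset y (\<lambda>n. a)"
  by (simp add: local_of_def)

lemma local_of_closed: "local_of y a \<in> carrier (local_field y)"
  by (simp add: local_of_coset coset_closed cauchy_at_const)

lemma local_of_hom:
  "local_of y 0 = \<zero>\<^bsub>local_field y\<^esub>" "local_of y 1 = \<one>\<^bsub>local_field y\<^esub>"
  "local_of y (a + b) = local_of y a \<oplus>\<^bsub>local_field y\<^esub> local_of y b"
  "local_of y (a * b) = local_of y a \<otimes>\<^bsub>local_field y\<^esub> local_of y b"
  "local_of y (- a) = \<ominus>\<^bsub>local_field y\<^esub> local_of y a"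
  by (simp_all add: local_of_coset local_field_zero_coset local_field_simps(3) local_field_add_coset
    local_field_mult_coset local_field_uminus_coset cauchy_at_const)

lemma local_ge_local_of: "local_ge y k (local_of y a) \<longleftrightarrow> val_ge y k a"
  by (auto simp: local_of_coset local_ge_coset)

lemma local_ge_add:
  assumes "X \<in> carrier (local_field y)" "Y \<in> carrier (local_field y)" "local_ge y k X" "local_ge y k Y"
  shows "local_ge y k (X \<oplus>\<^bsub>local_field y\<^esub> Y)"
proof -
  obtain s where s: "cauchy_at y s" "X = coset y s" using assms local_field_cases by blast
  obtain u where u: "cauchy_at y u" "Y = coset y u" using assms local_field_cases by blast
  obtain N M where "\<forall>n\<ge>N. val_ge y k (s n)" "\<forall>n\<ge>M. val_ge y k (u n)"
    using assms s u by (auto simp: local_ge_coset)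
  then have "\<forall>n\<ge>max N M. val_ge y k (s n + u n)" by (auto intro: val_ge_add)
  then show ?thesis using s u unfolding s u local_field_add_coset[OF s(1) u(1)] local_ge_coset by blast
qed

lemma local_ge_mult:
  assumes "X \<in> carrier (local_field y)" "Y \<in> carrier (local_field y)" "local_ge y k X" "local_ge y l Y"
  shows "local_ge y (k + l) (X \<otimes>\<^bsub>local_field y\<^esub> Y)"
proof -
  obtain s where s: "cauchy_at y s" "X = coset y s" using assms local_field_cases by blast
  obtain u where u: "cauchy_at y u" "Y = coset y u" using assms local_field_cases by blast
  obtain N M where "\<forall>n\<ge>N. val_ge y k (s n)" "\<forall>n\<ge>M. val_ge y l (u n)"
    using assms s u by (auto simp: local_ge_coset)
  then have "\<forall>n\<ge>max N M. val_ge y (k + l) (s n * u n)" by (auto intro: val_ge_mult)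
  then show ?thesis using s u unfolding s u local_field_mult_coset[OF s(1) u(1)] local_ge_coset by blast
qed

lemma local_ge_uminus:
  assumes "X \<in> carrier (local_field y)" "local_ge y k X"
  shows "local_ge y k (\<ominus>\<^bsub>local_field y\<^esub> X)"
proof -
  obtain s where s: "cauchy_at y s" "X = coset y s" using assms local_field_cases by blast
  show ?thesis using assms(2) unfolding s local_field_uminus_coset[OF s(1)] local_ge_coset by simp
qed

lemma local_ge_mono: "local_ge y k X \<Longrightarrow> l \<le> k \<Longrightarrow> local_ge y l X"
  unfolding local_ge_def by (meson val_ge_mono)

lemma local_ge_zero: "local_ge y k \<zero>\<^bsub>local_field y\<^esub>"
  unfolding local_field_zero_coset local_ge_coset by simp

lemma local_ge_exists:
  assumes "X \<in> carrier (local_field y)" shows "\<exists>k. local_ge y k X"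
proof -
  obtain s where s: "cauchy_at y s" "X = coset y s" using assms local_field_cases by blast
  show ?thesis using cauchy_at_bdd[OF s(1)] unfolding s local_ge_coset by blast
qed

lemma local_ge_density:
  assumes "X \<in> carrier (local_field y)"
  shows "\<exists>a. local_ge y k (X \<oplus>\<^bsub>local_field y\<^esub> local_of y (- a))"
proof -
  obtain s where s: "cauchy_at y s" "X = coset y s" using assms local_field_cases by blast
  obtain N where N: "\<forall>m\<ge>N. \<forall>n\<ge>N. val_ge y k (s m - s n)" using s(1) unfolding cauchy_at_def by blast
  then have "local_ge y k (coset y (\<lambda>n. s n + - s N))" unfolding local_ge_coset by auto
  then show ?thesis unfolding s(2) local_of_coset using s(1) by (auto simp: local_field_add_coset cauchy_at_const)
qed

lemma local_ge_iff_local_val: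
  assumes "X \<in> carrier (local_field y)" "X \<noteq> \<zero>\<^bsub>local_field y\<^esub>"
  shows "local_ge y k X \<longleftrightarrow> k \<le> local_val y X"
proof -
  obtain s where s: "cauchy_at y s" "X = coset y s" using assms local_field_cases by blast
  have "\<not> null_at y s"
  proof
    assume "null_at y s"
    then have "coset y s = coset y (\<lambda>n. 0)" by (intro coset_eqI) simp
    then show False using assms(2) unfolding s(2) local_field_zero_coset by simp
  qed
  then obtain l N where lN: "\<forall>n\<ge>N. s n \<noteq> 0 \<and> val y (s n) = l" using not_null_at_val[OF s(1)] by blast
  have v: "local_val y X = l" unfolding s(2) by (rule local_val_coset[OF s(1) lN])
  have "local_ge y k X \<longleftrightarrow> (\<exists>N. \<forall>n\<ge>N. val_ge y k (s n))" unfolding s(2) local_ge_coset ..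
  also have "\<dots> \<longleftrightarrow> k \<le> l" using lN by (metis linear val_ge_def)
  finally show ?thesis using v by simp
qed

lemma integer_ring_iff:
  "X \<in> carrier (integer_ring y) \<longleftrightarrow> X \<in> carrier (local_field y) \<and> local_ge y 0 X"
proof
  assume X: "X \<in> carrier (integer_ring y)"
  then have c: "X \<in> carrier (local_field y)" using integer_ring_subset by blast
  obtain s where s: "cauchy_at y s" "X = coset y s" using c local_field_cases by blast
  show "X \<in> carrier (local_field y) \<and> local_ge y 0 X"
    using X c coset_integral_iff[OF s(1)] unfolding s(2) local_ge_coset by simp
next
  assume X: "X \<in> carrier (local_field y) \<and> local_ge y 0 X"
  obtain s where s: "cauchy_at y s" "X = coset y s" using X local_field_cases by blast
  show "X \<in> carrier (integer_ring y)"
    using X coset_integral_iff[OF s(1)] unfolding s(2) local_ge_coset by simp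
qed

text \<open>
  Order at least \<open>k\<close> at \<open>y\<close>, as a predicate on adeles: the ring of adeles
  is an instance of a type class, whereas the completions form a family of rings that depends on a
  term.
\<close>
definition age :: "'k::{field,finite} place \<Rightarrow> int \<Rightarrow> 'k adele \<Rightarrow> bool"
  where "age y k a \<longleftrightarrow> local_ge y k (adele_at a y)"

definition aeq :: "'k::{field,finite} place \<Rightarrow> 'k adele \<Rightarrow> 'k adele \<Rightarrow> bool"
  where "aeq y a b \<longleftrightarrow> adele_at a y = adele_at b y"

lemma aeq_refl [simp]: "aeq y a a"
  and aeq_sym: "aeq y a b \<Longrightarrow> aeq y b a"
  and aeq_trans: "aeq y a b \<Longrightarrow> aeq y b c \<Longrightarrow> aeq y a c"
  and aeq_add: "aeq y a b \<Longrightarrow> aeq y a' b' \<Longrightarrow> aeq y (a + a') (b + b')"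
  and aeq_mult: "aeq y a b \<Longrightarrow> aeq y a' b' \<Longrightarrow> aeq y (a * a') (b * b')"
  and aeq_minus: "aeq y a b \<Longrightarrow> aeq y (- a) (- b)"
  and aeq_age: "aeq y a b \<Longrightarrow> age y k a = age y k b"
  by (simp_all add: aeq_def age_def adele_at_add adele_at_mult adele_at_uminus)

lemma aeq_diff: "aeq y a b \<Longrightarrow> aeq y a' b' \<Longrightarrow> aeq y (a - a') (b - b')"
  unfolding diff_conv_add_uminus by (intro aeq_add aeq_minus)

lemma adele_eq_aeqI: "(\<And>y. aeq y a b) \<Longrightarrow> a = b"
  unfolding aeq_def by (rule adele_eqI)

lemma age_add: "age y k a \<Longrightarrow> age y k b \<Longrightarrow> age y k (a + b)"
  unfolding age_def adele_at_add by (intro local_ge_add adele_at_closed)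

lemma age_mult: "age y k a \<Longrightarrow> age y l b \<Longrightarrow> age y (k + l) (a * b)"
  unfolding age_def adele_at_mult by (intro local_ge_mult adele_at_closed)

lemma age_uminus: "age y k a \<Longrightarrow> age y k (- a)"
  unfolding age_def adele_at_uminus by (intro local_ge_uminus adele_at_closed)

lemma age_uminus_iff [simp]: "age y k (- a) \<longleftrightarrow> age y k a"
  using age_uminus[of y k a] age_uminus[of y k "- a"] by auto

lemma age_diff: "age y k a \<Longrightarrow> age y k b \<Longrightarrow> age y k (a - b)"
  unfolding diff_conv_add_uminus by (intro age_add age_uminus)

lemma age_mono: "age y k a \<Longrightarrow> l \<le> k \<Longrightarrow> age y l a"
  unfolding age_def by (rule local_ge_mono)

lemma age_zero [simp]: "age y k 0"
  by (simp add: age_def adele_at_zero local_ge_zero)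

lemma age_exists: "\<exists>k. age y k a"
  unfolding age_def by (rule local_ge_exists[OF adele_at_closed])

lemma age_one [simp]: "age y k 1 \<longleftrightarrow> k \<le> 0"
  by (simp add: age_def adele_at_one local_of_hom(2)[symmetric] local_ge_local_of val_ge_def)

lemma age_cancel: "age y k (a - b) \<Longrightarrow> age y k a \<longleftrightarrow> age y k b"
  using age_diff[of y k a "a - b"] age_add[of y k "a - b" b] by auto

lemma finite_not_age: "finite {y. \<not> age y 0 a}"
proof -
  have "{y. \<not> age y 0 a} \<subseteq> {y. adele_at a y \<notin> carrier (integer_ring y)}"
    by (auto simp: age_def integer_ring_iff)
  then show ?thesis using adele_at_fin finite_subset by blast
qed

lemma age_0_iff: "age y 0 a \<longleftrightarrow> adele_at a y \<in> carrier (integer_ring y)"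
  by (simp add: age_def integer_ring_iff adele_at_closed)

definition aunit :: "'k::{field,finite} place \<Rightarrow> 'k adele \<Rightarrow> bool"
  where "aunit y a \<longleftrightarrow> age y 0 a \<and> \<not> age y 1 a"

lemma aunit_one [simp]: "aunit y 1"
  by (simp add: aunit_def)

lemma aeq_aunit: "aeq y a b \<Longrightarrow> aunit y a = aunit y b"
  unfolding aunit_def using aeq_age by blast

lemma aunit_cong: "age y 1 (a - b) \<Longrightarrow> aunit y a \<longleftrightarrow> aunit y b"
  unfolding aunit_def using age_cancel[of y 1 a b] age_cancel[of y 0 a b] age_mono[of y 1 "a - b" 0] by auto

definition emb :: "'k::{field,finite} ratfun \<Rightarrow> 'k adele"
  where "emb a = Abs_adele (\<lambda>y. local_of y a)"

definition splice :: "'k::{field,finite} place \<Rightarrow> 'k adele \<Rightarrow> 'k adele \<Rightarrow> 'k adele"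
  where "splice y a b = Abs_adele (\<lambda>z. if z = y then adele_at a z else adele_at b z)"

lemma adele_at_splice: "adele_at (splice y a b) z = (if z = y then adele_at a z else adele_at b z)"
proof -
  have "{z. (if z = y then adele_at a z else adele_at b z) \<notin> carrier (integer_ring z)}
    \<subseteq> {z. adele_at a z \<notin> carrier (integer_ring z)} \<union> {z. adele_at b z \<notin> carrier (integer_ring z)}" by auto
  then have "finite {z. (if z = y then adele_at a z else adele_at b z) \<notin> carrier (integer_ring z)}"
    by (rule finite_subset) (intro finite_UnI adele_at_fin)
  then show ?thesis unfolding splice_def by (subst Abs_adele_inverse) (auto simp: adele_at_closed)
qed

lemma aeq_splice: "aeq y (splice y a b) a" "z \<noteq> y \<Longrightarrow> aeq z (splice y a b) b"
  by (simp_all add: aeq_def adele_at_splice)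

context origin_place
begin

lemma adele_at_emb: "adele_at (emb (a :: 'k ratfun)) y = local_of y a"
proof -
  have "{y. local_of y a \<notin> carrier (integer_ring y)} \<subseteq> {y. val y a \<noteq> 0}"
    by (auto simp: integer_ring_iff local_of_closed local_ge_local_of val_ge_def)
  then have "finite {y. local_of y a \<notin> carrier (integer_ring y)}"
    by (rule finite_subset) (rule finite_val_neq_0)
  then show ?thesis unfolding emb_def by (subst Abs_adele_inverse) (auto simp: local_of_closed)
qed

lemma emb_hom: "emb 0 = (0 :: 'k adele)" "emb 1 = (1 :: 'k adele)" "emb (a + b) = emb a + (emb b :: 'k adele)"
  "emb (a * b) = emb a * (emb b :: 'k adele)" "emb (- a) = - (emb a :: 'k adele)"
  by (auto intro!: adele_eqI simp: adele_at_emb local_of_hom adele_at_zero adele_at_one adele_at_add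
    adele_at_mult adele_at_uminus)

lemma emb_diff: "emb (a - b) = emb a - (emb b :: 'k adele)"
  by (simp only: diff_conv_add_uminus emb_hom)

lemma age_emb [simp]: "age y k (emb a) \<longleftrightarrow> val_ge y k (a :: 'k ratfun)"
  by (simp add: age_def adele_at_emb local_ge_local_of)

lemma aunit_emb: "aunit y (emb a) \<longleftrightarrow> a \<noteq> 0 \<and> val y (a :: 'k ratfun) = 0"
  by (auto simp: aunit_def val_ge_def)

lemma aeq_emb_iff: "aeq y (emb a) (emb b) \<longleftrightarrow> a = (b :: 'k ratfun)"
proof
  assume "aeq y (emb a) (emb b)"
  then have "aeq y (emb a - emb b) (emb b - emb b)" by (intro aeq_diff) auto
  then have "age y k (emb (a - b))" for k by (simp add: aeq_age emb_diff)
  then have "val_ge y (val y (a - b) + 1) (a - b)" by simp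
  then show "a = b" by (simp add: val_ge_def)
qed simp

lemma emb_inverse: "(a :: 'k ratfun) \<noteq> 0 \<Longrightarrow> emb a * emb (inverse a) = 1"
  by (simp add: emb_hom(4)[symmetric] emb_hom(2))

lemma density: "\<exists>b. age y k (a - emb (b :: 'k ratfun))"
proof -
  obtain b where "local_ge y k (adele_at a y \<oplus>\<^bsub>local_field y\<^esub> local_of y (- b))"
    using local_ge_density[OF adele_at_closed] by blast
  then have "age y k (a + emb (- b))" by (simp add: age_def adele_at_add adele_at_emb)
  then show ?thesis by (auto simp: emb_hom)
qed

text \<open>
  Rational approximations of units have order 0, and on rational functions the order is additive.
\<close>
lemma aunit_mult:
  fixes a b :: "'k adele"
  assumes "aunit y a" "aunit y b" shows "aunit y (a * b)"
proof -
  obtain a' where a': "age y 1 (a - emb a')" using density by blast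
  obtain b' where b': "age y 1 (b - emb b')" using density by blast
  have u: "aunit y (emb a')" "aunit y (emb b')"
    using aunit_cong[OF a'] aunit_cong[OF b'] assms by auto
  then have "aunit y (emb (a' * b'))" by (simp add: aunit_emb val_mult)
  moreover have "age y 1 (a * b - emb (a' * b'))"
  proof -
    have "a * b - emb (a' * b') = a * (b - emb b') + (a - emb a') * emb b'"
      by (simp add: algebra_simps emb_hom)
    moreover have "age y (0 + 1) (a * (b - emb b'))" using assms b' by (intro age_mult) (auto simp: aunit_def)
    moreover have "age y (1 + 0) ((a - emb a') * emb b')" using u a' by (intro age_mult) (auto simp: aunit_def)
    ultimately show ?thesis by (simp add: age_add)
  qed
  ultimately show ?thesis using aunit_cong by blast
qed

text \<open>
  Approximate \<open>a\<close> by a rational function \<open>c\<close> so closely that \<open>c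
  b\<close> is congruent to 1.
\<close>
lemma aunit_inverse:
  fixes a b :: "'k adele"
  assumes "aunit y a" "aeq y (a * b) 1" shows "aunit y b"
proof -
  obtain m where m: "age y m b" using age_exists by blast
  \<comment> \<open>precision 1 makes \<open>c\<close> a unit, precision \<open>1 - m\<close> makes \<open>(a - c) b\<close> small\<close>
  obtain c where c: "age y (max 1 (1 - m)) (a - emb c)" using density by blast
  then have "age y 1 (a - emb c)" by (rule age_mono) simp
  then have u: "aunit y (emb c)" using assms(1) aunit_cong by blast
  then have c0: "c \<noteq> 0" "val y c = 0" by (auto simp: aunit_emb)
  have "age y (1 - m) (a - emb c)" using c by (rule age_mono) simp
  from age_mult[OF this m] have "age y 1 ((a - emb c) * b)" by simp
  moreover have "aeq y ((a - emb c) * b) (1 - emb c * b)"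
    unfolding left_diff_distrib by (intro aeq_diff assms aeq_refl)
  ultimately have "age y 1 (1 - emb c * b)" using aeq_age by blast
  then have u1: "aunit y (emb c * b)" using aunit_cong[of y 1 "emb c * b"] by simp
  have "aunit y (emb (inverse c))" using c0 by (simp add: aunit_emb val_inverse)
  from aunit_mult[OF this u1] show ?thesis
    using emb_inverse[OF c0(1)] by (simp add: mult.assoc[symmetric] mult.commute[of "emb (inverse c)"])
qed

lemma finite_not_aunit:
  fixes a b :: "'k adele"
  assumes "a * b = 1" shows "finite {y. \<not> aunit y a}"
proof -
  have "{y. \<not> aunit y a} \<subseteq> {y. \<not> age y 0 a} \<union> {y. \<not> age y 0 b}"
  proof (rule subsetI, rule ccontr)
    fix y assume y: "y \<in> {y. \<not> aunit y a}" "y \<notin> {y. \<not> age y 0 a} \<union> {y. \<not> age y 0 b}"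
    then have "age y 1 a" "age y 0 b" by (auto simp: aunit_def)
    from age_mult[OF this] show False by (simp add: assms)
  qed
  then show ?thesis by (rule finite_subset) (intro finite_UnI finite_not_age)
qed

lemma Units_integer_ring_iff:
  fixes a b :: "'k adele"
  assumes "aeq y (a * b) 1"
  shows "adele_at a y \<in> Units (integer_ring y) \<longleftrightarrow> aunit y a"
proof
  assume "adele_at a y \<in> Units (integer_ring y)"
  then obtain Y where Y: "adele_at a y \<in> carrier (integer_ring y)" "Y \<in> carrier (integer_ring y)"
    "adele_at a y \<otimes>\<^bsub>local_field y\<^esub> Y = \<one>\<^bsub>local_field y\<^esub>"
    unfolding Units_def by (auto simp: integer_ring_def)
  have "\<not> age y 1 a"
  proof
    assume "age y 1 a"
    then have "local_ge y 1 (adele_at a y)" "local_ge y 0 Y" using Y by (auto simp: age_def integer_ring_iff)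
    then have "local_ge y (1 + 0) (adele_at a y \<otimes>\<^bsub>local_field y\<^esub> Y)"
      using Y integer_ring_subset by (intro local_ge_mult) auto
    then show False unfolding Y(3) local_of_hom(2)[symmetric] local_ge_local_of by (simp add: val_ge_def)
  qed
  then show "aunit y a" using Y(1) by (simp add: aunit_def age_0_iff)
next
  assume u: "aunit y a"
  have ub: "aunit y b" by (rule aunit_inverse[OF u assms])
  have ab: "adele_at a y \<otimes>\<^bsub>local_field y\<^esub> adele_at b y = \<one>\<^bsub>local_field y\<^esub>"
    using assms by (simp add: aeq_def adele_at_mult adele_at_one)
  have "aeq y (b * a) 1" using assms by (simp add: mult.commute)
  then have ba: "adele_at b y \<otimes>\<^bsub>local_field y\<^esub> adele_at a y = \<one>\<^bsub>local_field y\<^esub>"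
    by (simp add: aeq_def adele_at_mult adele_at_one)
  have "adele_at a y \<in> carrier (integer_ring y)" "adele_at b y \<in> carrier (integer_ring y)"
    using u ub by (simp_all add: aunit_def age_0_iff[symmetric])
  moreover have "mult (integer_ring y) = mult (local_field y)" "one (integer_ring y) = one (local_field y)"
    by (simp_all add: integer_ring_def)
  ultimately show "adele_at a y \<in> Units (integer_ring y)"
    using ab ba unfolding Units_def by auto
qed

lemma PIdl_uniformizer_iff:
  fixes X :: "'k local_elt"
  assumes "val y p = 1"
  shows "X \<in> PIdl\<^bsub>integer_ring y\<^esub> (local_of y p) \<longleftrightarrow> X \<in> carrier (local_field y) \<and> local_ge y 1 X"
proof
  assume "X \<in> PIdl\<^bsub>integer_ring y\<^esub> (local_of y p)"
  then obtain Y where Y: "Y \<in> carrier (integer_ring y)" "X = Y \<otimes>\<^bsub>local_field y\<^esub> local_of y p"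
    unfolding cgenideal_def by (auto simp: integer_ring_def)
  have p: "local_ge y 1 (local_of y p)" using assms by (simp add: local_ge_local_of val_ge_def)
  have "local_ge y (0 + 1) X"
    unfolding Y(2) using Y(1) p by (intro local_ge_mult local_of_closed) (auto simp: integer_ring_iff)
  moreover have "X \<in> carrier (local_field y)"
    unfolding Y(2) using Y(1) local_of_closed
    by (intro cring.cring_simprules(5)[OF local_field_cring]) (auto simp: integer_ring_iff)
  ultimately show "X \<in> carrier (local_field y) \<and> local_ge y 1 X" by simp
next
  assume X: "X \<in> carrier (local_field y) \<and> local_ge y 1 X"
  have p0: "p \<noteq> 0" using assms by auto
  interpret L: cring "local_field y" by (rule local_field_cring)
  define Y where "Y = X \<otimes>\<^bsub>local_field y\<^esub> local_of y (inverse p)"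
  have "local_ge y (1 + -1) Y" unfolding Y_def using X assms
    by (intro local_ge_mult local_of_closed) (auto simp: local_ge_local_of val_ge_def val_inverse)
  then have Yc: "Y \<in> carrier (integer_ring y)"
    using X by (simp add: integer_ring_iff Y_def local_of_closed)
  have "Y \<otimes>\<^bsub>local_field y\<^esub> local_of y p = X \<otimes>\<^bsub>local_field y\<^esub> local_of y (inverse p * p)"
    unfolding Y_def local_of_hom using X by (simp add: L.m_assoc local_of_closed)
  also have "\<dots> = X" using p0 X by (simp add: local_of_hom)
  finally show "X \<in> PIdl\<^bsub>integer_ring y\<^esub> (local_of y p)"
    using Yc unfolding cgenideal_def by (force simp: integer_ring_def)
qed

end

section \<open>Degrees of places\<close>

lemma integer_ring_cring: "cring (integer_ring y)"
proof -
  interpret L: cring "local_field y" by (rule local_field_cring)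
  have e: "integer_ring y = (local_field y)\<lparr>carrier := carrier (integer_ring y)\<rparr>"
    by (simp add: integer_ring_def)
  have "subring (carrier (integer_ring y)) (local_field y)"
    by (rule L.subringI) (simp_all add: integer_ring_subset integer_ring_one integer_ring_uminus
      integer_ring_mult integer_ring_add)
  then have "subcring (carrier (integer_ring y)) (local_field y)" by (rule L.subcringI')
  then show ?thesis using L.subcring_iff[OF integer_ring_subset] e by simp
qed

context origin_place
begin

context
  fixes y :: "'k place"
  assumes yx: "y \<noteq> x"
begin

interpretation O: cring "integer_ring y" by (rule integer_ring_cring)

definition "chosen_uniformizer \<equiv> (SOME a. is_uniformizer y a)"

lemma chosen_uniformizer: "val y chosen_uniformizer = 1"
proof -
  have "\<exists>a. is_uniformizer y a" using place_poly(2)[OF yx] unfolding is_uniformizer_def by blast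
  then show ?thesis unfolding chosen_uniformizer_def using someI_ex is_uniformizer_def by metis
qed


definition "residue_ideal \<equiv> PIdl\<^bsub>integer_ring y\<^esub> (local_of y chosen_uniformizer)"

definition "poly_residue p \<equiv> residue_of y (local_of y (ev p))"

lemma residue_ideal: "ideal residue_ideal (integer_ring y)"
  unfolding residue_ideal_def using chosen_uniformizer
  by (intro O.cgenideal_ideal) (simp add: integer_ring_iff local_of_closed local_ge_local_of val_ge_def)

lemma residue_field_eq: "residue_field y = integer_ring y Quot residue_ideal"
  by (simp add: residue_field_def residue_ideal_def chosen_uniformizer_def)

lemma residue_of_eq: "residue_of y X = residue_ideal +>\<^bsub>integer_ring y\<^esub> X"
  by (simp add: residue_of_def residue_ideal_def chosen_uniformizer_def)

lemma residue_ring: "cring (residue_field y)"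
  unfolding residue_field_eq by (rule ideal.quotient_is_cring[OF residue_ideal integer_ring_cring])

lemma integer_ring_ops:
  "X \<oplus>\<^bsub>integer_ring y\<^esub> Y = X \<oplus>\<^bsub>local_field y\<^esub> Y" "X \<otimes>\<^bsub>integer_ring y\<^esub> Y = X \<otimes>\<^bsub>local_field y\<^esub> Y"
  "\<one>\<^bsub>integer_ring y\<^esub> = \<one>\<^bsub>local_field y\<^esub>" "\<zero>\<^bsub>integer_ring y\<^esub> = \<zero>\<^bsub>local_field y\<^esub>"
  by (simp_all add: integer_ring_def)

lemma local_of_ev_closed: "local_of y (ev p) \<in> carrier (integer_ring y)"
  using val_ge_ev_finite[OF yx] by (simp add: integer_ring_iff local_of_closed local_ge_local_of)

lemma residue_eq_iff:
  assumes "X \<in> carrier (integer_ring y)" "val_ge y 0 a"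
  shows "residue_of y X = residue_of y (local_of y a) \<longleftrightarrow>
    local_ge y 1 (X \<oplus>\<^bsub>local_field y\<^esub> local_of y (- a))"
proof -
  interpret L: cring "local_field y" by (rule local_field_cring)
  have c: "local_of y a \<in> carrier (integer_ring y)" "local_of y (- a) \<in> carrier (integer_ring y)"
    using assms(2) by (simp_all add: integer_ring_iff local_of_closed local_ge_local_of)
  have "\<ominus>\<^bsub>integer_ring y\<^esub> local_of y a = local_of y (- a)"
    by (rule O.minus_equality) (use c in \<open>simp_all add: integer_ring_ops local_of_hom(3)[symmetric] local_of_hom(1)\<close>)
  then have e: "X \<ominus>\<^bsub>integer_ring y\<^esub> local_of y a = X \<oplus>\<^bsub>local_field y\<^esub> local_of y (- a)"
    by (simp add: a_minus_def integer_ring_ops)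
  have X: "X \<in> carrier (local_field y)" using assms(1) integer_ring_subset by blast
  have "residue_of y X = residue_of y (local_of y a) \<longleftrightarrow> X \<ominus>\<^bsub>integer_ring y\<^esub> local_of y a \<in> residue_ideal"
    unfolding residue_of_eq using O.quotient_eq_iff_same_a_r_cos[OF residue_ideal assms(1) c(1)] by simp
  then show ?thesis
    unfolding e residue_ideal_def PIdl_uniformizer_iff[OF chosen_uniformizer] using X by (simp add: local_of_closed)
qed

lemma poly_residue_hom:
  "poly_residue p \<in> carrier (residue_field y)"
  "poly_residue (p + q) = poly_residue p \<oplus>\<^bsub>residue_field y\<^esub> poly_residue q"
  "poly_residue (p * q) = poly_residue p \<otimes>\<^bsub>residue_field y\<^esub> poly_residue q"
  "poly_residue 1 = \<one>\<^bsub>residue_field y\<^esub>"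
  "poly_residue 0 = \<zero>\<^bsub>residue_field y\<^esub>"
proof -
  note h = ideal.rcos_ring_hom[OF residue_ideal]
  note c = local_of_ev_closed
  show "poly_residue p \<in> carrier (residue_field y)"
    unfolding poly_residue_def residue_of_eq residue_field_eq by (rule ring_hom_closed[OF h c])
  show "poly_residue (p + q) = poly_residue p \<oplus>\<^bsub>residue_field y\<^esub> poly_residue q"
    unfolding poly_residue_def residue_of_eq residue_field_eq ring_hom_add[OF h c c, symmetric]
    by (simp add: ev_add local_of_hom integer_ring_ops)
  show "poly_residue (p * q) = poly_residue p \<otimes>\<^bsub>residue_field y\<^esub> poly_residue q"
    unfolding poly_residue_def residue_of_eq residue_field_eq ring_hom_mult[OF h c c, symmetric]
    by (simp add: ev_mult local_of_hom integer_ring_ops)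
  show "poly_residue 1 = \<one>\<^bsub>residue_field y\<^esub>"
    unfolding poly_residue_def residue_of_eq residue_field_eq ring_hom_one[OF h, symmetric]
    by (simp add: local_of_hom integer_ring_ops)
  have "\<zero>\<^bsub>residue_field y\<^esub> = residue_ideal" by (simp add: residue_field_eq FactRing_def)
  also have "\<dots> = residue_ideal +>\<^bsub>integer_ring y\<^esub> \<zero>\<^bsub>integer_ring y\<^esub>"
    using O.a_coset_add_zero[of residue_ideal] residue_ideal ideal.Icarr by (metis subsetI)
  finally show "poly_residue 0 = \<zero>\<^bsub>residue_field y\<^esub>"
    unfolding poly_residue_def residue_of_eq by (simp add: local_of_hom integer_ring_ops)
qed

lemma poly_residue_eq_iff: "poly_residue p = poly_residue q \<longleftrightarrow> place_poly y dvd p - q"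
  unfolding poly_residue_def residue_eq_iff[OF local_of_ev_closed val_ge_ev_finite[OF yx]]
    local_of_hom(3)[symmetric] local_ge_local_of place_poly(4)[OF yx, symmetric] ev_diff by simp

lemma poly_residue_surj:
  assumes "X \<in> carrier (residue_field y)"
  shows "\<exists>p. degree p < degree (place_poly y) \<and> X = poly_residue p"
proof -
  interpret L: cring "local_field y" by (rule local_field_cring)
  obtain Y where Y: "Y \<in> carrier (integer_ring y)" "X = residue_of y Y"
    using assms unfolding residue_field_eq residue_of_eq by (auto simp: FactRing_def A_RCOSETS_def RCOSETS_def a_r_coset_def)
  then have Yc: "Y \<in> carrier (local_field y)" using integer_ring_subset by blast
  obtain a where a: "local_ge y 1 (Y \<oplus>\<^bsub>local_field y\<^esub> local_of y (- a))"
    using local_ge_density[OF Yc] by blast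
  have e: "local_of y a = \<ominus>\<^bsub>local_field y\<^esub> (Y \<oplus>\<^bsub>local_field y\<^esub> local_of y (- a)) \<oplus>\<^bsub>local_field y\<^esub> Y"
  proof -
    have "\<ominus>\<^bsub>local_field y\<^esub> (Y \<oplus>\<^bsub>local_field y\<^esub> local_of y (- a)) \<oplus>\<^bsub>local_field y\<^esub> Y
      = Y \<oplus>\<^bsub>local_field y\<^esub> (local_of y a \<oplus>\<^bsub>local_field y\<^esub> \<ominus>\<^bsub>local_field y\<^esub> Y)"
      using Yc by (simp add: local_of_hom local_of_closed L.minus_add L.a_ac)
    also have "\<dots> = local_of y a"
      using Yc by (subst L.a_lcomm) (simp_all add: local_of_closed L.r_neg)
    finally show ?thesis by simp
  qed
  have "local_ge y 0 (local_of y a)"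
    by (subst e, intro local_ge_add local_ge_uminus local_ge_mono[OF a])
      (use Yc Y(1) in \<open>simp_all add: local_of_closed integer_ring_iff\<close>)
  then have a0: "val_ge y 0 a" by (simp add: local_ge_local_of)
  then obtain p where p: "degree p < degree (place_poly y)" "val_ge y 1 (a - ev p)"
    using residue_polynomial[OF yx] by blast
  have "residue_of y Y = residue_of y (local_of y a)" using a residue_eq_iff[OF Y(1) a0] by simp
  also have "local_of y a \<in> carrier (integer_ring y)" using a0 by (simp add: integer_ring_iff local_of_closed local_ge_local_of)
  then have "residue_of y (local_of y a) = residue_of y (local_of y (ev p))"
    using residue_eq_iff[OF _ val_ge_ev_finite[OF yx]] p(2)
    by (simp add: local_of_hom(3)[symmetric] local_ge_local_of)
  finally show ?thesis using p(1) Y(2) unfolding poly_residue_def by blast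
qed

definition "residue_constants \<equiv> range (\<lambda>c. residue_of y (local_of y (ratfun_const c)))"

lemma residue_constants_eq: "residue_constants = range (\<lambda>c. poly_residue [:c:])"
  by (simp add: residue_constants_def poly_residue_def ev_const)

lemma not_dvd_low_degree: "p \<noteq> 0 \<Longrightarrow> degree p < degree (place_poly y) \<Longrightarrow> \<not> place_poly y dvd p"
  using dvd_imp_degree_le linorder_not_le by blast

lemma residue_constants_subfield: "subfield residue_constants (residue_field y)"
proof -
  interpret R: cring "residue_field y" by (rule residue_ring)
  have uminus: "\<ominus>\<^bsub>residue_field y\<^esub> poly_residue p = poly_residue (- p)" for p
    by (rule R.minus_equality) (simp_all add: poly_residue_hom(1) poly_residue_hom(2)[symmetric] poly_residue_hom(5))
  have ops: "poly_residue [:c:] \<otimes>\<^bsub>residue_field y\<^esub> poly_residue [:d:] = poly_residue [:c * d:]"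
    "poly_residue [:c:] \<oplus>\<^bsub>residue_field y\<^esub> poly_residue [:d:] = poly_residue [:c + d:]" for c d
    by (simp_all add: poly_residue_hom(2,3)[symmetric] mult.commute)
  have one: "\<one>\<^bsub>residue_field y\<^esub> = poly_residue [:1:]" by (simp add: poly_residue_hom(4)[symmetric] one_pCons)
  have zero_iff: "poly_residue [:c:] = \<zero>\<^bsub>residue_field y\<^esub> \<longleftrightarrow> c = 0" for c
    unfolding poly_residue_hom(5)[symmetric] poly_residue_eq_iff
    using not_dvd_low_degree[of "[:c:]"] place_poly(3)[OF yx] by (cases "c = 0") auto
  have sr: "subring residue_constants (residue_field y)"
    by (rule R.subringI) (auto simp: residue_constants_eq poly_residue_hom(1) one uminus ops)
  show ?thesis
  proof (rule R.subfieldI[OF R.subcringI'[OF sr]])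
    show "Units (residue_field y\<lparr>carrier := residue_constants\<rparr>) = residue_constants - {\<zero>\<^bsub>residue_field y\<^esub>}"
    proof (intro equalityI subsetI)
      fix X assume "X \<in> Units (residue_field y\<lparr>carrier := residue_constants\<rparr>)"
      then obtain c d where X: "X = poly_residue [:c:]" and "poly_residue [:c:] \<otimes>\<^bsub>residue_field y\<^esub> poly_residue [:d:] = poly_residue [:1:]"
        unfolding Units_def residue_constants_eq by (auto simp: one)
      then have "c \<noteq> 0" using zero_iff[of 1] zero_iff[of 0] unfolding ops by auto
      then show "X \<in> residue_constants - {\<zero>\<^bsub>residue_field y\<^esub>}"
        unfolding X residue_constants_eq using zero_iff[of c] by blast
    next
      fix X assume "X \<in> residue_constants - {\<zero>\<^bsub>residue_field y\<^esub>}"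
      then have X: "X \<in> range (\<lambda>c. poly_residue [:c:])" "X \<noteq> \<zero>\<^bsub>residue_field y\<^esub>"
        unfolding residue_constants_eq by blast+
      from X(1) obtain c where c: "X = poly_residue [:c:]" by (rule rangeE)
      then have c0: "c \<noteq> 0" using X(2) zero_iff[of c] by blast
      have e: "X \<otimes>\<^bsub>residue_field y\<^esub> poly_residue [:inverse c:] = \<one>\<^bsub>residue_field y\<^esub>"
        "poly_residue [:inverse c:] \<otimes>\<^bsub>residue_field y\<^esub> X = \<one>\<^bsub>residue_field y\<^esub>"
        unfolding c ops one using c0 by simp_all
      have "X \<in> residue_constants" "poly_residue [:inverse c:] \<in> residue_constants"
        unfolding residue_constants_eq c by (rule rangeI)+
      with e show "X \<in> Units (residue_field y\<lparr>carrier := residue_constants\<rparr>)"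
        unfolding Units_def by auto
    qed
  qed
qed

text \<open>
  Each new power of \<open>1/t\<close> is independent of the smaller ones as long as no nonzero
  polynomial of that degree vanishes at \<open>y\<close>; so the residues of polynomials of degree
  less than \<open>j\<close> have dimension \<open>j\<close>.
\<close>
lemma dimension_low_degree:
  assumes "j \<le> degree (place_poly y)"
  shows "ring.dimension (residue_field y) j residue_constants (poly_residue ` {p. \<forall>i\<ge>j. poly.coeff p i = 0})"
  using assms
proof (induction j)
  interpret R: cring "residue_field y" by (rule residue_ring)
  case 0
  have "{p. \<forall>i\<ge>0. poly.coeff p i = 0} = {0 :: 'k poly}" by (auto simp: poly_eq_iff)
  then show ?case using R.zero_dim by (simp add: poly_residue_hom(5))
next
  interpret R: cring "residue_field y" by (rule residue_ring)
  case (Suc j)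
  let ?E = "poly_residue ` {p. \<forall>i\<ge>j. poly.coeff p i = 0}"
  let ?v = "poly_residue (Polynomial.monom 1 j)"
  have "?v \<notin> ?E"
  proof
    assume "?v \<in> ?E"
    then obtain p where p: "\<forall>i\<ge>j. poly.coeff p i = 0" "place_poly y dvd Polynomial.monom 1 j - p"
      by (auto simp: poly_residue_eq_iff)
    have c: "poly.coeff (Polynomial.monom 1 j - p) j = 1" using p by simp
    then have "Polynomial.monom 1 j - p \<noteq> 0" by (metis coeff_0 zero_neq_one)
    moreover have "degree (Polynomial.monom 1 j - p) \<le> j" by (rule degree_le) (use p in simp)
    ultimately show False using not_dvd_low_degree p(2) Suc.prems by fastforce
  qed
  from R.Suc_dim[OF poly_residue_hom(1) this Suc.IH]
  have "R.dimension (Suc j) residue_constants (R.line_extension residue_constants ?v ?E)" using Suc.prems by simp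
  also have "R.line_extension residue_constants ?v ?E = poly_residue ` {p. \<forall>i\<ge>Suc j. poly.coeff p i = 0}"
  proof (intro equalityI subsetI)
    fix X assume "X \<in> R.line_extension residue_constants ?v ?E"
    then obtain c p where X: "\<forall>i\<ge>j. poly.coeff p i = 0"
      "X = poly_residue [:c:] \<otimes>\<^bsub>residue_field y\<^esub> ?v \<oplus>\<^bsub>residue_field y\<^esub> poly_residue p"
      unfolding R.line_extension_mem_iff residue_constants_eq by auto
    then have "X = poly_residue ([:c:] * Polynomial.monom 1 j + p)" by (simp only: poly_residue_hom)
    moreover have "\<forall>i\<ge>Suc j. poly.coeff ([:c:] * Polynomial.monom 1 j + p) i = 0" using X(1) by simp
    ultimately show "X \<in> poly_residue ` {p. \<forall>i\<ge>Suc j. poly.coeff p i = 0}" by blast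
  next
    fix X assume "X \<in> poly_residue ` {p. \<forall>i\<ge>Suc j. poly.coeff p i = 0}"
    then obtain p where p: "\<forall>i\<ge>Suc j. poly.coeff p i = 0" "X = poly_residue p" by blast
    define r where "r = p - [:poly.coeff p j:] * Polynomial.monom 1 j"
    have "\<forall>i\<ge>j. poly.coeff r i = 0"
    proof (intro allI impI)
      fix i assume "i \<ge> j"
      then show "poly.coeff r i = 0" using p(1) by (cases "i = j") (simp_all add: r_def)
    qed
    moreover have "X = poly_residue ([:poly.coeff p j:] * Polynomial.monom 1 j + r)" using p(2) by (simp add: r_def)
    then have "X = poly_residue [:poly.coeff p j:] \<otimes>\<^bsub>residue_field y\<^esub> ?v \<oplus>\<^bsub>residue_field y\<^esub> poly_residue r"
      by (simp only: poly_residue_hom)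
    ultimately show "X \<in> R.line_extension residue_constants ?v ?E"
      unfolding R.line_extension_mem_iff residue_constants_eq by blast
  qed
  finally show ?case .
qed

lemma place_degree_eq: "place_degree y = degree (place_poly y)"
proof -
  interpret R: cring "residue_field y" by (rule residue_ring)
  have "poly_residue ` {p. \<forall>i\<ge>degree (place_poly y). poly.coeff p i = 0} = carrier (residue_field y)"
  proof (intro equalityI subsetI)
    fix X assume "X \<in> carrier (residue_field y)"
    then obtain p where "degree p < degree (place_poly y)" "X = poly_residue p" using poly_residue_surj by blast
    then show "X \<in> poly_residue ` {p. \<forall>i\<ge>degree (place_poly y). poly.coeff p i = 0}"
      by (intro image_eqI[of _ _ p]) (auto simp: coeff_eq_0)
  qed (use poly_residue_hom(1) in blast)
  then have "R.dimension (degree (place_poly y)) residue_constants (carrier (residue_field y))"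
    using dimension_low_degree[of "degree (place_poly y)"] by simp
  from R.dimI[OF residue_constants_subfield this] show ?thesis
    unfolding place_degree_def residue_constants_def over_def .
qed

end

end

section \<open>Two by two matrices over the adeles\<close>

lemma matrix_mult_2: "(A ** B) $ i $ j = A $ i $ 1 * B $ 1 $ j + A $ i $ 2 * B $ 2 $ j"
  for A B :: "'a::comm_ring_1^2^2"
  by (simp add: matrix_matrix_mult_def sum_2)

lemma mat1_2: "(mat 1 :: 'a::comm_ring_1^2^2) $ 1 $ 1 = 1" "(mat 1 :: 'a^2^2) $ 2 $ 2 = 1"
  "(mat 1 :: 'a^2^2) $ 1 $ 2 = 0" "(mat 1 :: 'a^2^2) $ 2 $ 1 = 0"
  by (simp_all add: mat_def)

lemma matrix_2_eqI:
  "A $ 1 $ 1 = B $ 1 $ 1 \<Longrightarrow> A $ 1 $ 2 = B $ 1 $ 2 \<Longrightarrow> A $ 2 $ 1 = B $ 2 $ 1 \<Longrightarrow> A $ 2 $ 2 = B $ 2 $ 2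
    \<Longrightarrow> A = (B :: 'a^2^2)"
  by (simp add: vec_eq_iff forall_2)

definition mat2 :: "'a \<Rightarrow> 'a \<Rightarrow> 'a \<Rightarrow> 'a \<Rightarrow> 'a::zero^2^2"
  where "mat2 a b c d = vector [vector [a, b], vector [c, d]]"

lemma mat2_nth [simp]: "mat2 a b c d $ 1 $ 1 = a" "mat2 a b c d $ 1 $ 2 = b"
  "mat2 a b c d $ 2 $ 1 = c" "mat2 a b c d $ 2 $ 2 = d"
  by (simp_all add: mat2_def)

lemma mat2_mult: "mat2 a b c d ** mat2 a' b' c' d' =
  mat2 (a * a' + b * c') (a * b' + b * d') (c * a' + d * c') (c * b' + d * (d' :: 'a::comm_ring_1))"
  by (rule matrix_2_eqI) (simp_all add: matrix_mult_2)

lemma mat2_cases: obtains a b c d where "A = mat2 a b c (d :: 'a::zero)"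
  by (rule that[of "A $ 1 $ 1" "A $ 1 $ 2" "A $ 2 $ 1" "A $ 2 $ 2"]) (rule matrix_2_eqI; simp)

lemma mat2_eq_iff: "mat2 a b c d = mat2 a' b' c' d' \<longleftrightarrow> a = a' \<and> b = b' \<and> c = c' \<and> d = d'"
  by (metis mat2_nth)

lemma mat2_mat1: "mat 1 = mat2 1 0 0 (1 :: 'a::comm_ring_1)"
  by (rule matrix_2_eqI) (simp_all add: mat1_2)

lemma det_mat2: "det (mat2 a b c d) = a * d - b * (c :: 'a::comm_ring_1)"
  by (simp add: det_2)

text \<open>
  Cramer's rule.
\<close>
lemma inverse_entries_2:
  fixes A B :: "'a::comm_ring_1^2^2"
  assumes "A ** B = mat 1"
  shows "B = mat2 (det B * A $ 2 $ 2) (- (det B * A $ 1 $ 2)) (- (det B * A $ 2 $ 1)) (det B * A $ 1 $ 1)"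
proof -
  obtain a b c d where A: "A = mat2 a b c d" by (rule mat2_cases)
  obtain p q r s where B: "B = mat2 p q r s" by (rule mat2_cases)
  have e: "a * p + b * r = 1" "a * q + b * s = 0" "c * p + d * r = 0" "c * q + d * s = 1"
    using assms unfolding A B mat2_mult mat2_mat1 mat2_eq_iff by auto
  have "(p * s - q * r) * d = p * (c * q + d * s) - q * (c * p + d * r)" by (simp add: algebra_simps)
  moreover have "(p * s - q * r) * b = p * (a * q + b * s) - q * (a * p + b * r)" by (simp add: algebra_simps)
  moreover have "(p * s - q * r) * c = s * (c * p + d * r) - r * (c * q + d * s)" by (simp add: algebra_simps)
  moreover have "(p * s - q * r) * a = s * (a * p + b * r) - r * (a * q + b * s)" by (simp add: algebra_simps)
  ultimately show ?thesis unfolding A B det_mat2 mat2_eq_iff using e by simp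
qed

lemma invertible_2_iff: "invertible (A :: 'a::comm_ring_1^2^2) \<longleftrightarrow> (\<exists>e. det A * e = 1)"
proof
  assume "invertible A"
  then obtain B where "A ** B = mat 1" by (auto simp: invertible_def)
  then have "det A * det B = 1" by (metis det_I det_mul)
  then show "\<exists>e. det A * e = 1" by blast
next
  assume "\<exists>e. det A * e = 1"
  then obtain e where e: "det A * e = 1" by blast
  obtain a b c d where A: "A = mat2 a b c d" by (rule mat2_cases)
  have e': "(a * d - b * c) * e = 1" using e unfolding A det_mat2 .
  have "A ** mat2 (e * d) (- (e * b)) (- (e * c)) (e * a) = mat 1"
    "mat2 (e * d) (- (e * b)) (- (e * c)) (e * a) ** A = mat 1"
    unfolding A mat2_mult mat2_mat1 mat2_eq_iff using e' by (simp_all add: algebra_simps)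
  then show "invertible A" unfolding invertible_def by blast
qed

lemma invertible_field_2_iff: "invertible (A :: 'a::field^2^2) \<longleftrightarrow> det A \<noteq> 0"
  unfolding invertible_2_iff by (metis mult_zero_left right_inverse zero_neq_one)

lemma matrix_inv_mult:
  assumes "invertible (A :: 'a::semiring_1^'n^'n)"
  shows "A ** matrix_inv A = mat 1" "matrix_inv A ** A = mat 1"
  using assms someI_ex[of "\<lambda>B. A ** B = mat 1 \<and> B ** A = mat 1"]
  unfolding invertible_def matrix_inv_def by auto

lemma matrix_inv_2:
  assumes "det (A :: 'a::field^2^2) \<noteq> 0"
  shows "A ** matrix_inv A = mat 1" "matrix_inv A ** A = mat 1" "det (matrix_inv A) = inverse (det A)"
    "det (matrix_inv A) \<noteq> 0"
proof -
  have i: "invertible A" using assms by (simp add: invertible_field_2_iff)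
  show r: "A ** matrix_inv A = mat 1" "matrix_inv A ** A = mat 1"
    by (rule matrix_inv_mult[OF i])+
  have "det A * det (matrix_inv A) = 1" using r(1) by (metis det_I det_mul)
  then show "det (matrix_inv A) = inverse (det A)" "det (matrix_inv A) \<noteq> 0"
    using inverse_unique by (metis, auto)
qed

lemma matrix_inv_unique:
  fixes A B :: "'a::field^2^2"
  assumes "det A \<noteq> 0" "A ** B = mat 1" shows "matrix_inv A = B"
proof -
  have "matrix_inv A ** (A ** B) = B"
    by (simp add: matrix_mul_assoc matrix_inv_2(2)[OF assms(1)] matrix_mul_lid)
  then show ?thesis by (simp add: assms(2) matrix_mul_rid)
qed

definition maeq :: "'k::{field,finite} place \<Rightarrow> 'k adele^2^2 \<Rightarrow> 'k adele^2^2 \<Rightarrow> bool"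
  where "maeq y A B \<longleftrightarrow> (\<forall>i j. aeq y (A $ i $ j) (B $ i $ j))"

text \<open>
  The component at \<open>y\<close> lies in the maximal compact subgroup.
\<close>
definition mint :: "'k::{field,finite} place \<Rightarrow> 'k adele^2^2 \<Rightarrow> bool"
  where "mint y A \<longleftrightarrow> (\<forall>i j. age y 0 (A $ i $ j)) \<and> aunit y (det A)"

text \<open>
  The component at \<open>y\<close> lies in the first congruence subgroup.
\<close>
definition mcong :: "'k::{field,finite} place \<Rightarrow> 'k adele^2^2 \<Rightarrow> bool"
  where "mcong y A \<longleftrightarrow> (\<forall>i j. age y 1 (A $ i $ j - mat 1 $ i $ j))"

lemma maeq_refl [simp]: "maeq y A A"
  by (simp add: maeq_def)

lemma maeq_sym: "maeq y A B \<Longrightarrow> maeq y B A"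
  by (simp add: maeq_def aeq_sym)

lemma maeq_trans: "maeq y A B \<Longrightarrow> maeq y B C \<Longrightarrow> maeq y A C"
  unfolding maeq_def using aeq_trans by blast

lemma maeq_mult: "maeq y A B \<Longrightarrow> maeq y A' B' \<Longrightarrow> maeq y (A ** A') (B ** B')"
  unfolding maeq_def matrix_mult_2 by (intro allI aeq_add aeq_mult) auto

lemma maeq_det: "maeq y A B \<Longrightarrow> aeq y (det A) (det B)"
  unfolding maeq_def det_2 by (intro aeq_diff aeq_mult) auto

lemma maeq_mint: "maeq y A B \<Longrightarrow> mint y A \<longleftrightarrow> mint y B"
  unfolding mint_def using aeq_aunit[OF maeq_det] aeq_age unfolding maeq_def by blast

lemma maeq_mcong: "maeq y A B \<Longrightarrow> mcong y A \<longleftrightarrow> mcong y B"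
  unfolding mcong_def maeq_def using aeq_age[OF aeq_diff[OF _ aeq_refl]] by blast

lemma maeq_eqI: "(\<And>y. maeq y A B) \<Longrightarrow> A = B"
  unfolding maeq_def vec_eq_iff by (intro allI adele_eq_aeqI) blast

lemma maeq_cancel_left:
  assumes "A' ** A = mat 1" "maeq y (A ** B) (A ** C)" shows "maeq y B C"
  using maeq_mult[OF maeq_refl[of y A'] assms(2)] by (simp add: matrix_mul_assoc assms(1) matrix_mul_lid)

lemma mint_one [simp]: "mint y (mat 1)"
proof -
  have "age y 0 ((mat 1 :: 'a adele^2^2) $ i $ j)" for i j by (simp add: mat_def)
  then show ?thesis by (simp add: mint_def)
qed

lemma mcong_one [simp]: "mcong y (mat 1)"
  by (simp add: mcong_def)

lemma mcong_imp_mint: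
  assumes "mcong y A" shows "mint y A"
proof -
  have c: "age y 1 (A $ i $ j - mat 1 $ i $ j)" for i j using assms by (simp add: mcong_def)
  have i: "age y 0 (A $ i $ j)" for i j
    using age_cancel[OF age_mono[OF c[of i j]], of 0] by (simp add: mat_def)
  have "det A - 1 = (A $ 1 $ 1 - 1) * A $ 2 $ 2 + (A $ 2 $ 2 - 1) - A $ 1 $ 2 * A $ 2 $ 1"
    by (simp add: det_2 algebra_simps)
  moreover have "age y (1 + 0) ((A $ 1 $ 1 - 1) * A $ 2 $ 2)"
    using c[of 1 1] i by (intro age_mult) (auto simp: mat1_2)
  moreover have "age y 1 (A $ 2 $ 2 - 1)" using c[of 2 2] by (simp add: mat1_2)
  moreover have "age y (1 + 0) (A $ 1 $ 2 * A $ 2 $ 1)"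
    using c[of 1 2] i by (intro age_mult) (auto simp: mat1_2)
  ultimately have "age y 1 (det A - 1)" by (simp only: age_add age_diff add_0_right)
  then have "aunit y (det A)" using aunit_cong by fastforce
  then show ?thesis using i by (simp add: mint_def)
qed

lemma mcong_mult:
  assumes "mcong y A" "mcong y B" shows "mcong y (A ** B)"
proof -
  have "age y 1 ((A ** B) $ i $ j - mat 1 $ i $ j)" for i j
  proof -
    have B0: "age y 0 (B $ k $ j)" for k using mcong_imp_mint[OF assms(2)] by (simp add: mint_def)
    have e: "(A ** B) $ i $ j - mat 1 $ i $ j = (A $ i $ 1 - mat 1 $ i $ 1) * B $ 1 $ j
      + (A $ i $ 2 - mat 1 $ i $ 2) * B $ 2 $ j + (B $ i $ j - mat 1 $ i $ j)"
      using exhaust_2[of i] by (auto simp: matrix_mult_2 mat1_2 algebra_simps)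
    have "age y (1 + 0) ((A $ i $ k - mat 1 $ i $ k) * B $ k $ j)" for k
      using assms(1) B0 by (intro age_mult) (auto simp: mcong_def)
    then show ?thesis unfolding e using assms(2) by (intro age_add) (auto simp: mcong_def)
  qed
  then show ?thesis by (simp add: mcong_def)
qed

context origin_place
begin

lemma mint_mult:
  fixes A B :: "'k adele^2^2"
  assumes "mint y A" "mint y B" shows "mint y (A ** B)"
proof -
  have "age y (0 + 0) (A $ i $ k * B $ k $ j)" for i j k
    using assms by (intro age_mult) (auto simp: mint_def)
  then have "age y 0 ((A ** B) $ i $ j)" for i j unfolding matrix_mult_2 by (intro age_add) auto
  then show ?thesis using assms aunit_mult by (simp add: mint_def det_mul)
qed

lemma mint_inverse:
  fixes A B :: "'k adele^2^2"
  assumes "mint y A" "A ** B = mat 1" shows "mint y B"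
proof -
  have "det A * det B = 1" using assms(2) by (metis det_I det_mul)
  then have d: "aeq y (det A * det B) 1" by simp
  have u: "aunit y (det B)" by (rule aunit_inverse[OF _ d]) (use assms(1) in \<open>simp add: mint_def\<close>)
  have m: "age y (0 + 0) (det B * A $ i $ j)" for i j
    using u assms(1) by (intro age_mult) (auto simp: mint_def aunit_def)
  have "age y 0 (B $ i $ j)" for i j
  proof -
    define C where "C = mat2 (det B * A $ 2 $ 2) (- (det B * A $ 1 $ 2)) (- (det B * A $ 2 $ 1)) (det B * A $ 1 $ 1)"
    have "age y 0 (C $ i $ j)" using exhaust_2[of i] exhaust_2[of j] m by (auto simp: C_def)
    then show ?thesis using inverse_entries_2[OF assms(2)] unfolding C_def by simp
  qed
  then show ?thesis using u by (simp add: mint_def)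
qed

lemma mcong_inverse:
  fixes A B :: "'k adele^2^2"
  assumes "mcong y A" "A ** B = mat 1" shows "mcong y B"
proof -
  have B: "mint y B" by (rule mint_inverse[OF mcong_imp_mint[OF assms(1)] assms(2)])
  have "age y 1 (B $ i $ j - mat 1 $ i $ j)" for i j
  proof -
    have "(A ** B) $ i $ j = mat 1 $ i $ j" using assms(2) by simp
    then have e: "B $ i $ j - mat 1 $ i $ j =
      - ((A $ i $ 1 - mat 1 $ i $ 1) * B $ 1 $ j + (A $ i $ 2 - mat 1 $ i $ 2) * B $ 2 $ j)"
      unfolding matrix_mult_2 using exhaust_2[of i] by (auto simp: mat1_2 algebra_simps)
    have "age y (1 + 0) ((A $ i $ k - mat 1 $ i $ k) * B $ k $ j)" for k
      using assms(1) B by (intro age_mult) (auto simp: mcong_def mint_def)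
    then show ?thesis unfolding e by (intro age_uminus age_add) auto
  qed
  then show ?thesis by (simp add: mcong_def)
qed

definition emat :: "'k ratfun^2^2 \<Rightarrow> 'k adele^2^2"
  where "emat M = (\<chi> i j. emb (M $ i $ j))"

lemma emat_nth [simp]: "emat M $ i $ j = emb (M $ i $ j)"
  by (simp add: emat_def)

lemma emat_mult: "emat (M ** N) = emat M ** emat N"
  by (simp add: vec_eq_iff matrix_mult_2 emb_hom)

lemma emat_one [simp]: "emat (mat 1) = mat 1"
  by (simp add: vec_eq_iff mat_def emb_hom)

lemma det_emat: "det (emat M) = emb (det M)"
  by (simp add: det_2 emb_hom emb_diff)

lemma maeq_emat_iff: "maeq y (emat M) (emat N) \<longleftrightarrow> M = N"
  by (simp add: maeq_def aeq_emb_iff vec_eq_iff)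

text \<open>The rational matrices in the maximal compact subgroup at \<open>y\<close> and in its first congruence
  subgroup.\<close>

definition rat_int :: "'k place \<Rightarrow> 'k ratfun^2^2 \<Rightarrow> bool"
  where "rat_int y M \<longleftrightarrow> (\<forall>i j. val_ge y 0 (M $ i $ j)) \<and> det M \<noteq> 0 \<and> val y (det M) = 0"

definition rat_cong :: "'k place \<Rightarrow> 'k ratfun^2^2 \<Rightarrow> bool"
  where "rat_cong y M \<longleftrightarrow> (\<forall>i j. val_ge y 1 (M $ i $ j - mat 1 $ i $ j))"

lemma mint_emat: "mint y (emat M) \<longleftrightarrow> rat_int y M"
  by (simp add: mint_def rat_int_def det_emat aunit_emb)

lemma mcong_emat: "mcong y (emat M) \<longleftrightarrow> rat_cong y M"
proof -
  have "emat M $ i $ j - mat 1 $ i $ j = emb (M $ i $ j - mat 1 $ i $ j)" for i j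
    by (simp add: emb_diff mat_def emb_hom)
  then show ?thesis by (simp add: mcong_def rat_cong_def del: emat_nth)
qed

lemma rat_int_mult: "rat_int y M \<Longrightarrow> rat_int y N \<Longrightarrow> rat_int y (M ** N)"
  unfolding mint_emat[symmetric] emat_mult by (rule mint_mult)

lemma rat_int_inverse: "rat_int y M \<Longrightarrow> M ** N = mat 1 \<Longrightarrow> rat_int y N"
  unfolding mint_emat[symmetric] using mint_inverse[of y "emat M" "emat N"] by (metis emat_mult emat_one)

lemma rat_cong_inverse: "rat_cong y M \<Longrightarrow> M ** N = mat 1 \<Longrightarrow> rat_cong y N"
  unfolding mcong_emat[symmetric] using mcong_inverse[of y "emat M" "emat N"] by (metis emat_mult emat_one)

lemma rat_cong_imp_rat_int: "rat_cong y M \<Longrightarrow> rat_int y M"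
  unfolding mint_emat[symmetric] mcong_emat[symmetric] by (rule mcong_imp_mint)

lemma rat_int_one [simp]: "rat_int y (mat 1)" and rat_cong_one [simp]: "rat_cong y (mat 1)"
  by (simp_all flip: mint_emat mcong_emat)

end


section \<open>The adelic group\<close>

lemma gl2_mat_det: "\<exists>e. det (gl2_mat g) * e = 1"
  using gl2_mat[of g] by (simp add: invertible_2_iff)

lemma gl2_eqI: "(\<And>y. maeq y (gl2_mat g) (gl2_mat h)) \<Longrightarrow> g = h"
  using maeq_eqI gl2_mat_inject by blast

lemma gl2_mat_Abs: "det A * e = 1 \<Longrightarrow> gl2_mat (Abs_gl2A A) = A"
  by (rule Abs_gl2A_inverse) (auto simp: invertible_2_iff)

text \<open>
  The group structure is only available through its multiplication, so inverses are chosen.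
\<close>
definition ginv :: "'k::{field,finite} gl2A \<Rightarrow> 'k gl2A"
  where "ginv g = (SOME h. g * h = 1 \<and> h * g = 1)"

lemma ginv: "g * ginv g = 1" "ginv g * g = 1"
proof -
  obtain B where B: "gl2_mat g ** B = mat 1" "B ** gl2_mat g = mat 1"
    using gl2_mat[of g] by (auto simp: invertible_def)
  then have "gl2_mat (Abs_gl2A B) = B" by (intro Abs_gl2A_inverse) (auto simp: invertible_def)
  then have "g * Abs_gl2A B = 1" "Abs_gl2A B * g = 1"
    by (simp_all add: gl2_mat_inject[symmetric] gl2_mat_mult gl2_mat_one B)
  then have "\<exists>h. g * h = 1 \<and> h * g = 1" by blast
  from someI_ex[OF this] show "g * ginv g = 1" "ginv g * g = 1" unfolding ginv_def by auto
qed

lemma ginv_assoc [simp]: "g * (ginv g * h) = h" "ginv g * (g * h) = h"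
  by (simp_all add: mult.assoc[symmetric] ginv)

lemma ginv_unique: "g * h = 1 \<Longrightarrow> ginv g = h"
  by (metis ginv_assoc(2) mult.right_neutral)

lemma ginv_mat: "gl2_mat g ** gl2_mat (ginv g) = mat 1" "gl2_mat (ginv g) ** gl2_mat g = mat 1"
  by (simp_all add: gl2_mat_mult[symmetric] ginv gl2_mat_one)

lemma matrix_inv_gl2: "matrix_inv (gl2_mat g) = gl2_mat (ginv g)"
proof -
  have "invertible (gl2_mat g)" using gl2_mat[of g] by simp
  then have "matrix_inv (gl2_mat g) ** gl2_mat g = mat 1" by (rule matrix_inv_mult)
  then have "matrix_inv (gl2_mat g) ** (gl2_mat g ** gl2_mat (ginv g)) = gl2_mat (ginv g)"
    by (simp add: matrix_mul_assoc matrix_mul_lid)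
  then show ?thesis by (simp add: ginv_mat matrix_mul_rid)
qed

lemma integer_ring_minus:
  assumes "X \<in> carrier (integer_ring y)" "Y \<in> carrier (integer_ring y)"
  shows "X \<ominus>\<^bsub>integer_ring y\<^esub> Y = X \<ominus>\<^bsub>local_field y\<^esub> Y"
proof -
  interpret O: cring "integer_ring y" by (rule integer_ring_cring)
  interpret L: cring "local_field y" by (rule local_field_cring)
  have ops: "X \<oplus>\<^bsub>integer_ring y\<^esub> Y = X \<oplus>\<^bsub>local_field y\<^esub> Y" "\<zero>\<^bsub>integer_ring y\<^esub> = \<zero>\<^bsub>local_field y\<^esub>" for X Y
    by (simp_all add: integer_ring_def)
  have "Y \<in> carrier (local_field y)" using assms integer_ring_subset by blast
  then have "\<ominus>\<^bsub>integer_ring y\<^esub> Y = \<ominus>\<^bsub>local_field y\<^esub> Y"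
    by (intro O.minus_equality) (use assms integer_ring_uminus in \<open>auto simp: ops L.l_neg\<close>)
  then show ?thesis by (simp add: a_minus_def ops)
qed

context origin_place
begin

lemma adele_at_diff: "adele_at (a - b) y = adele_at a y \<ominus>\<^bsub>local_field y\<^esub> adele_at b y" for a b :: "'k adele"
  by (simp add: diff_conv_add_uminus adele_at_add adele_at_uminus a_minus_def del: add_uminus_conv_diff)

lemma comp_at_GL2_iff: "comp_at y g \<in> GL2 (integer_ring y) \<longleftrightarrow> mint y (gl2_mat (g :: 'k gl2A))"
proof -
  let ?m = "gl2_mat g"
  have ent: "(\<forall>i j. comp_at y g $ i $ j \<in> carrier (integer_ring y)) \<longleftrightarrow> (\<forall>i j. age y 0 (?m $ i $ j))"
    by (simp add: comp_at_def age_0_iff)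
  have "det2 (integer_ring y) (comp_at y g) \<in> Units (integer_ring y) \<longleftrightarrow> aunit y (det ?m)"
    if i: "\<forall>i j. age y 0 (?m $ i $ j)"
  proof -
    have c: "adele_at (?m $ i $ j) y \<in> carrier (integer_ring y)" for i j using i by (simp add: age_0_iff)
    have mul: "X \<otimes>\<^bsub>integer_ring y\<^esub> Y = X \<otimes>\<^bsub>local_field y\<^esub> Y" for X Y by (simp add: integer_ring_def)
    have "det2 (integer_ring y) (comp_at y g) = adele_at (det ?m) y"
      unfolding det2_def comp_at_def det_2 adele_at_diff adele_at_mult
      by (simp add: mul integer_ring_minus integer_ring_mult c)
    then show ?thesis using Units_integer_ring_iff gl2_mat_det[of g] aeq_refl by metis
  qed
  then show ?thesis unfolding GL2_def mint_def using ent by blast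
qed

lemma max_compact_iff: "g \<in> max_compact \<longleftrightarrow> (\<forall>y. mint y (gl2_mat (g :: 'k gl2A)))"
  by (simp add: max_compact_def comp_at_GL2_iff)

lemma congruence_subgroup_iff:
  assumes "val z p = 1"
  shows "g \<in> congruence_subgroup z p \<longleftrightarrow> (\<forall>y. mint y (gl2_mat (g :: 'k gl2A))) \<and> mcong z (gl2_mat g)"
proof -
  let ?m = "gl2_mat g"
  have "comp_at z g $ i $ j \<ominus>\<^bsub>integer_ring z\<^esub> local_mat z (mat 1) $ i $ j \<in> PIdl\<^bsub>integer_ring z\<^esub> (local_of z p)
    \<longleftrightarrow> age z 1 (?m $ i $ j - mat 1 $ i $ j)" if m: "mint z ?m" for i j
  proof -
    have e: "adele_at (mat 1 $ i $ j :: 'k adele) z = local_mat z (mat 1) $ i $ j"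
      by (simp add: local_mat_def mat_def local_of_hom adele_at_one adele_at_zero)
    have "adele_at (?m $ i $ j) z \<in> carrier (integer_ring z)" "adele_at (mat 1 $ i $ j :: 'k adele) z \<in> carrier (integer_ring z)"
      using m unfolding age_0_iff[symmetric] by (simp_all add: mint_def mat_def)
    then have "comp_at z g $ i $ j \<ominus>\<^bsub>integer_ring z\<^esub> local_mat z (mat 1) $ i $ j
      = adele_at (?m $ i $ j - mat 1 $ i $ j) z"
      unfolding e[symmetric] adele_at_diff by (simp add: comp_at_def integer_ring_minus)
    then show ?thesis by (simp add: PIdl_uniformizer_iff[OF assms] age_def adele_at_closed)
  qed
  then have "comp_at z g \<in> congruence_local z p \<longleftrightarrow> mint z ?m \<and> mcong z ?m"
    unfolding congruence_local_def mcong_def by (auto simp: comp_at_GL2_iff)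
  then show ?thesis unfolding congruence_subgroup_def by (auto simp: comp_at_GL2_iff)
qed

definition agree :: "'k place \<Rightarrow> 'k gl2A \<Rightarrow> 'k ratfun^2^2 \<Rightarrow> bool"
  where "agree y g M \<longleftrightarrow> maeq y (gl2_mat g) (emat M)"

lemma agree_iff_comp_at: "agree y g M \<longleftrightarrow> comp_at y g = local_mat y M"
  by (simp add: agree_def comp_at_def maeq_def aeq_def local_mat_def vec_eq_iff adele_at_emb)

lemma agree_mult: "agree y g M \<Longrightarrow> agree y h N \<Longrightarrow> agree y (g * h) (M ** N)"
  by (simp add: agree_def gl2_mat_mult emat_mult maeq_mult)

lemma agree_one [simp]: "agree y 1 (mat 1)"
  by (simp add: agree_def gl2_mat_one)

lemma agree_ginv:
  assumes "agree y g M" "M ** N = mat 1" shows "agree y (ginv g) N"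
proof -
  have "maeq y (gl2_mat g ** emat N) (emat M ** emat N)"
    using assms(1) by (intro maeq_mult) (auto simp: agree_def)
  then have "maeq y (gl2_mat g ** emat N) (gl2_mat g ** gl2_mat (ginv g))"
    by (simp add: emat_mult[symmetric] assms(2) ginv_mat)
  from maeq_cancel_left[OF ginv_mat(2) this] show ?thesis by (simp add: agree_def maeq_sym)
qed

lemma agree_mint: "agree y g M \<Longrightarrow> mint y (gl2_mat g) \<longleftrightarrow> rat_int y M"
  unfolding agree_def mint_emat[symmetric] by (rule maeq_mint)

lemma agree_mcong: "agree y g M \<Longrightarrow> mcong y (gl2_mat g) \<longleftrightarrow> rat_cong y M"
  unfolding agree_def mcong_emat[symmetric] by (rule maeq_mcong)

lemma gl2_eq_agreeI: "(\<And>y. \<exists>M. agree y g M \<and> agree y h M) \<Longrightarrow> g = h"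
  unfolding agree_def by (rule gl2_eqI) (meson maeq_trans maeq_sym)

definition rat :: "'k ratfun^2^2 \<Rightarrow> 'k gl2A"
  where "rat M = Abs_gl2A (emat M)"

lemma gl2_mat_rat: "det M \<noteq> 0 \<Longrightarrow> gl2_mat (rat M) = emat M"
  unfolding rat_def by (rule gl2_mat_Abs[of _ "emb (inverse (det M))"]) (simp add: det_emat emb_inverse)

lemma agree_rat: "det M \<noteq> 0 \<Longrightarrow> agree y (rat M) M"
  by (simp add: agree_def gl2_mat_rat)

lemma rational_points_iff: "g \<in> rational_points \<longleftrightarrow> (\<exists>M. det M \<noteq> 0 \<and> g = rat M)"
proof
  assume "g \<in> rational_points"
  then obtain M where M: "det M \<noteq> 0" "\<forall>y. agree y g M"
    by (auto simp: rational_points_def invertible_field_2_iff agree_iff_comp_at)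
  then have "g = rat M" using agree_rat by (intro gl2_eq_agreeI) blast
  then show "\<exists>M. det M \<noteq> 0 \<and> g = rat M" using M by blast
qed (auto simp: rational_points_def invertible_field_2_iff agree_iff_comp_at[symmetric] intro: agree_rat)

definition loc :: "'k place \<Rightarrow> 'k ratfun^2^2 \<Rightarrow> 'k gl2A"
  where "loc y M = at_place y (local_mat y M)"

lemma agree_loc:
  assumes "det M \<noteq> 0"
  shows "agree y (loc y M) M" "z \<noteq> y \<Longrightarrow> agree z (loc y M) (mat 1)"
proof -
  define A where "A = (\<chi> i j. splice y (emb (M $ i $ j)) (mat 1 $ i $ j))"
  define e where "e = splice y (emb (inverse (det M))) 1"
  have Ay: "maeq y A (emat M)" by (auto simp: maeq_def A_def aeq_splice)
  have Az: "maeq z A (mat 1)" if "z \<noteq> y" for z using that by (auto simp: maeq_def A_def aeq_splice)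
  have "det A * e = 1"
  proof (rule adele_eq_aeqI)
    fix z
    show "aeq z (det A * e) 1"
    proof (cases "z = y")
      case True
      have "aeq y (det A * e) (det (emat M) * emb (inverse (det M)))"
        unfolding e_def by (intro aeq_mult maeq_det[OF Ay] aeq_splice)
      then show ?thesis using True assms by (simp add: det_emat emb_inverse)
    next
      case False
      have "aeq z (det A * e) (det (mat 1 :: 'k adele^2^2) * 1)"
        unfolding e_def using maeq_det[OF Az[OF False]] aeq_splice(2)[OF False] by (rule aeq_mult)
      then show ?thesis by simp
    qed
  qed
  then have m: "gl2_mat (Abs_gl2A A) = A" by (rule gl2_mat_Abs)
  have "agree y (Abs_gl2A A) M \<and> (\<forall>z. z \<noteq> y \<longrightarrow> agree z (Abs_gl2A A) (mat 1))"
    using Ay Az by (simp add: agree_def m)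
  then have *: "agree y (loc y M) M \<and> (\<forall>z. z \<noteq> y \<longrightarrow> agree z (loc y M) (mat 1))"
    unfolding loc_def at_place_def agree_iff_comp_at[symmetric]
  proof (rule theI)
    fix g assume g: "agree y g M \<and> (\<forall>z. z \<noteq> y \<longrightarrow> agree z g (mat 1))"
    show "g = Abs_gl2A A"
      using g \<open>agree y (Abs_gl2A A) M \<and> _\<close> by (intro gl2_eq_agreeI) metis
  qed
  then show "agree y (loc y M) M" "z \<noteq> y \<Longrightarrow> agree z (loc y M) (mat 1)" by auto
qed

definition scal :: "'k adele \<Rightarrow> 'k gl2A"
  where "scal c = Abs_gl2A (mat2 c 0 0 c)"

lemma gl2_mat_scal: "c * d = 1 \<Longrightarrow> gl2_mat (scal c) = mat2 c 0 0 c"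
  unfolding scal_def
proof (rule gl2_mat_Abs)
  assume c: "c * d = 1"
  have "det (mat2 c 0 0 c) * (d * d) = (c * d) * (c * d)" by (simp add: det_mat2)
  then show "det (mat2 c 0 0 c) * (d * d) = 1" by (simp add: c)
qed

lemma scal_center: "c * d = 1 \<Longrightarrow> scal c \<in> center"
  unfolding center_def
  by (auto simp: gl2_mat_inject[symmetric] gl2_mat_mult gl2_mat_scal matrix_mult_2 vec_eq_iff forall_2 mult.commute)

text \<open>
  Commuting with the two elementary unipotent matrices forces a matrix to be scalar.
\<close>
lemma center_iff: "z \<in> center \<longleftrightarrow> (\<exists>c d. c * d = 1 \<and> z = scal c)"
proof
  assume z: "z \<in> center"
  obtain a b c d where m: "gl2_mat z = mat2 a b c d" by (rule mat2_cases)
  have u: "gl2_mat (Abs_gl2A (mat2 1 1 0 1)) = mat2 1 1 0 (1 :: 'k adele)"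
    "gl2_mat (Abs_gl2A (mat2 1 0 1 1)) = mat2 1 0 1 (1 :: 'k adele)"
    by (rule gl2_mat_Abs[of _ 1], simp add: det_mat2)+
  have comm: "gl2_mat z ** gl2_mat g = gl2_mat g ** gl2_mat z" for g
    using z unfolding center_def gl2_mat_mult[symmetric] gl2_mat_inject by blast
  have "mat2 a b c d ** mat2 1 1 0 1 = mat2 1 1 0 1 ** mat2 a b c d"
    "mat2 a b c d ** mat2 1 0 1 1 = mat2 1 0 1 1 ** mat2 a b c d"
    using comm[of "Abs_gl2A (mat2 1 1 0 1)"] comm[of "Abs_gl2A (mat2 1 0 1 1)"] by (simp_all only: m u)
  then have e: "b = 0" "c = 0" "d = a" unfolding mat2_mult mat2_eq_iff by auto
  obtain f where "det (gl2_mat z) * f = 1" using gl2_mat_det by blast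
  then have "a * (a * f) = 1" by (simp add: m e det_mat2 mult.assoc)
  moreover from this have "z = scal a" by (simp add: gl2_mat_inject[symmetric] gl2_mat_scal m e)
  ultimately show "\<exists>c d. c * d = 1 \<and> z = scal c" by blast
qed (use scal_center in blast)

end

section \<open>Reduction theory of rational matrices\<close>

lemma proj_point_eq_iff:
  "proj_point 1 a = proj_point 1 b \<longleftrightarrow> a = b" "proj_point 1 a \<noteq> proj_point 0 (1 :: 'k::{field,finite})"
proof -
  have m: "(1, a) \<in> proj_point 1 a" for a :: "'k::{field,finite}" unfolding proj_point_def by (auto intro: exI[of _ 1])
  show "proj_point 1 a = proj_point 1 b \<longleftrightarrow> a = b"
  proof
    assume "proj_point 1 a = proj_point 1 b"
    then have "(1, a) \<in> proj_point 1 b" using m by blast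
    then show "a = b" by (auto simp: proj_point_def)
  qed simp
  have "(1, a) \<notin> proj_point 0 1" by (auto simp: proj_point_def)
  then show "proj_point 1 a \<noteq> proj_point 0 1" using m by blast
qed

lemma proj_line_eq:
  "(proj_line :: ('k::{field,finite} \<times> 'k) set set) = insert (proj_point 0 1) (range (proj_point 1))"
proof (intro equalityI subsetI)
  fix w :: "('k \<times> 'k) set" assume "w \<in> proj_line"
  then obtain a b where w: "w = proj_point a b" "(a, b) \<noteq> (0, 0)" by (auto simp: proj_line_def)
  show "w \<in> insert (proj_point 0 1) (range (proj_point 1))"
  proof (cases "a = 0")
    case True
    then have "b \<noteq> 0" using w by simp
    have "proj_point a b = proj_point 0 1" unfolding proj_point_def
    proof (intro equalityI subsetI)
      fix u assume "u \<in> {(c * 0, c * 1) | c :: 'k. c \<noteq> 0}"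
      then obtain c where "u = (0, c)" "c \<noteq> 0" by auto
      then have "u = (c / b * a, c / b * b)" "c / b \<noteq> 0" using True \<open>b \<noteq> 0\<close> by simp_all
      then show "u \<in> {(c * a, c * b) | c. c \<noteq> 0}" by blast
    next
      fix u assume "u \<in> {(c * a, c * b) | c. c \<noteq> 0}"
      then obtain c where "u = (c * a, c * b)" "c \<noteq> 0" by blast
      then have "u = (c * b * 0, c * b * 1)" "c * b \<noteq> 0" using True \<open>b \<noteq> 0\<close> by simp_all
      then show "u \<in> {(c * 0, c * 1) | c :: 'k. c \<noteq> 0}" by blast
    qed
    then show ?thesis using w by simp
  next
    case False
    have "proj_point a b = proj_point 1 (b / a)" unfolding proj_point_def
    proof (intro equalityI subsetI)
      fix u assume "u \<in> {(c * 1, c * (b / a)) | c. c \<noteq> 0}"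
      then obtain c where "u = (c, c * (b / a))" "c \<noteq> 0" by auto
      then have "u = (c / a * a, c / a * b)" "c / a \<noteq> 0" using False by simp_all
      then show "u \<in> {(c * a, c * b) | c. c \<noteq> 0}" by blast
    next
      fix u assume "u \<in> {(c * a, c * b) | c. c \<noteq> 0}"
      then obtain c where "u = (c * a, c * b)" "c \<noteq> 0" by blast
      then have "u = (c * a * 1, c * a * (b / a))" "c * a \<noteq> 0" using False by simp_all
      then show "u \<in> {(c * 1, c * (b / a)) | c. c \<noteq> 0}" by blast
    qed
    then show ?thesis using w by simp
  qed
next
  fix w :: "('k \<times> 'k) set" assume "w \<in> insert (proj_point 0 1) (range (proj_point 1))"
  then obtain a b where "w = proj_point a b" "(a, b) \<noteq> (0, 0)" by (metis insertE rangeE prod.inject zero_neq_one)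
  then show "w \<in> proj_line" unfolding proj_line_def by blast
qed

lemma card_proj_line: "card (proj_line :: ('k::{field,finite} \<times> 'k) set set) = CARD('k) + 1"
proof -
  have "inj (proj_point (1 :: 'k))" by (auto simp: inj_def proj_point_eq_iff)
  then have "card (range (proj_point (1 :: 'k))) = CARD('k)" by (rule card_image)
  moreover have "proj_point 0 1 \<notin> range (proj_point (1 :: 'k))" using proj_point_eq_iff(2) by blast
  ultimately show ?thesis unfolding proj_line_eq by simp
qed

lemma finite_proj_line: "finite (proj_line :: ('k::{field,finite} \<times> 'k) set set)"
  using card_proj_line[where 'k = 'k] card_ge_0_finite by fastforce

lemma proj_line_cases:
  assumes "w \<in> proj_line" obtains "w = proj_point 0 1" | a where "w = proj_point 1 a"
  using assms unfolding proj_line_eq by blast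

lemma theta_simps:
  "theta (proj_point 0 1) = mat2 0 1 1 0"
  "theta (proj_point 1 a) = mat2 1 0 (ratfun_const a) 1"
proof -
  show "theta (proj_point 0 1) = mat2 0 1 1 0" by (simp add: theta_def mat2_def)
  have "(THE b. proj_point 1 a = proj_point 1 b) = a" by (rule the_equality) (simp_all add: proj_point_eq_iff)
  then show "theta (proj_point 1 a) = mat2 1 0 (ratfun_const a) 1"
    using proj_point_eq_iff(2)[of a] by (simp add: theta_def mat2_def)
qed

lemma det_theta: "w \<in> proj_line \<Longrightarrow> det (theta w) \<noteq> 0"
  by (erule proj_line_cases) (simp_all add: theta_simps det_mat2)

lemma p_mat_eq: "p_mat n p = mat2 (inverse p ^ n) 0 0 1"
  by (simp add: p_mat_def mat2_def)

abbreviation scalar_mat :: "'a \<Rightarrow> 'a::comm_ring_1^2^2"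
  where "scalar_mat e \<equiv> mat2 e 0 0 e"

lemma scalar_mat_mult_nth: "(scalar_mat e ** A) $ i $ j = e * (A :: 'a::comm_ring_1^2^2) $ i $ j"
  using exhaust_2[of i] by (auto simp: matrix_mult_2)

lemma scalar_mat_commute: "(A :: 'a::comm_ring_1^2^2) ** scalar_mat e = scalar_mat e ** A"
  by (rule matrix_2_eqI) (simp_all add: matrix_mult_2 mult.commute)

lemma scalar_mat_mult: "scalar_mat e ** scalar_mat f = scalar_mat (e * f)"
  by (simp add: mat2_mult)

context origin_place
begin

abbreviation S :: "'k ratfun" where "S \<equiv> inverse ratfun_t"

lemma S_neq_0 [simp]: "S \<noteq> 0"
  by (simp add: ratfun_t_neq_0)

lemma val_x_S: "val x S = - 1"
  by (simp add: val_inverse val_x_t)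

lemma val_x_S_power: "val x (S ^ n) = - int n"
  unfolding val_power val_x_S by simp

lemma ev_monom: "ev (Polynomial.monom 1 n) = S ^ n"
proof -
  have "ev [:0, 1:] = S" by (simp add: ev_pCons ratfun_const_hom)
  moreover have "Polynomial.monom (1::'k) n = [:0, 1:] ^ n" by (simp add: monom_altdef)
  ultimately show ?thesis by (simp add: ev_power)
qed

lemma val_ge_x_ev: "val_ge x k (ev p) \<longleftrightarrow> p = 0 \<or> int (degree p) \<le> - k"
  by (auto simp: val_ge_def val_x_ev)

lemma val_const_eq: "val_ge y 1 (ratfun_const c) \<longleftrightarrow> c = (0 :: 'k)"
  by (simp add: val_ge_def ratfun_const_eq_0_iff val_const)

text \<open>
  The residue field of \<open>x\<close> consists of constants: compare leading coefficients.
\<close>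
lemma residue_constant:
  assumes "val_ge x 0 f" shows "\<exists>c. val_ge x 1 (f - ratfun_const c)"
proof -
  obtain p q where pq: "q \<noteq> 0" "f = ev p / ev q" using ev_fraction by blast
  define c where "c = poly.coeff p (degree q) / lead_coeff q"
  define r where "r = p - Polynomial.smult c q"
  have dp: "degree p \<le> degree q"
  proof (cases "p = 0")
    case False
    then show ?thesis using assms pq by (simp add: val_ge_def val_divide val_x_ev)
  qed simp
  have e: "f - ratfun_const c = ev r / ev q"
    using pq by (simp add: r_def ev_diff ev_smult diff_divide_distrib)
  have "r = 0 \<or> degree r < degree q"
  proof (rule disjCI)
    assume n: "\<not> degree r < degree q"
    have "degree r \<le> degree q" unfolding r_def using dp by (intro degree_diff_le) auto
    then have "degree r = degree q" using n by simp
    moreover have "poly.coeff r (degree q) = 0" using pq(1) by (simp add: r_def c_def)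
    ultimately show "r = 0" by (metis leading_coeff_0_iff)
  qed
  then have "val_ge x 1 (ev r / ev q)" using pq(1) by (cases "r = 0") (auto simp: val_ge_def val_divide val_x_ev)
  then show ?thesis unfolding e[symmetric] by blast
qed

text \<open>
  The arithmetic group, \<open>GL\<^sub>2\<close> over the polynomials in \<open>1/t\<close>,
  described by local conditions.
\<close>
definition Gam :: "'k ratfun^2^2 \<Rightarrow> bool"
  where "Gam M \<longleftrightarrow> (\<forall>z. z \<noteq> x \<longrightarrow> rat_int z M)"

lemma Gam_mult: "Gam M \<Longrightarrow> Gam N \<Longrightarrow> Gam (M ** N)"
  and Gam_inverse: "Gam M \<Longrightarrow> M ** N = mat 1 \<Longrightarrow> Gam N"
  and Gam_one [simp]: "Gam (mat 1)"
  unfolding Gam_def using rat_int_mult rat_int_inverse rat_int_one by blast+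

lemma other_place_exists: "\<exists>z. z \<noteq> x"
proof -
  have "0 < degree (Polynomial.monom (1::'k) 1)" by (simp add: degree_monom_eq)
  then show ?thesis by (meson place_dividing_poly)
qed

lemma Gam_det_nz: "Gam M \<Longrightarrow> det M \<noteq> 0"
  unfolding Gam_def rat_int_def using other_place_exists by blast

lemma Gam_entry: "Gam M \<Longrightarrow> \<exists>p. M $ i $ j = ev p"
  by (rule regular_outside_x) (auto simp: Gam_def rat_int_def)

lemma Gam_det: "Gam M \<Longrightarrow> \<exists>c. c \<noteq> 0 \<and> det M = ratfun_const c"
  by (rule unit_outside_x[OF Gam_det_nz]) (auto simp: Gam_def rat_int_def)

lemma GamI:
  "(\<And>i j. \<exists>p. M $ i $ j = ev p) \<Longrightarrow> c \<noteq> 0 \<Longrightarrow> det M = ratfun_const c \<Longrightarrow> Gam M"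
  unfolding Gam_def rat_int_def by (metis ratfun_const_eq_0_iff val_const val_ge_ev_finite)

lemma Gam_mat2:
  "a * d - b * c = ratfun_const u \<Longrightarrow> u \<noteq> 0 \<Longrightarrow> \<exists>p. a = ev p \<Longrightarrow> \<exists>p. b = ev p \<Longrightarrow> \<exists>p. c = ev p \<Longrightarrow> \<exists>p. d = ev p
    \<Longrightarrow> Gam (mat2 a b c d)"
proof (rule GamI[of _ u])
  fix i j
  assume "\<exists>p. a = ev p" "\<exists>p. b = ev p" "\<exists>p. c = ev p" "\<exists>p. d = ev p"
  then show "\<exists>p. mat2 a b c d $ i $ j = ev p" using exhaust_2[of i] exhaust_2[of j] by auto
qed (simp_all add: det_mat2)

lemma const_is_ev: "\<exists>p. ratfun_const c = ev p" and zero_is_ev: "\<exists>p. 0 = ev p" and one_is_ev: "\<exists>p. 1 = ev p"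
  using ev_const[of c] ev_0 ev_1 by metis+

lemma Gam_swap: "Gam (mat2 0 1 1 0)"
  by (rule Gam_mat2[of _ _ _ _ "- 1"]) (rule zero_is_ev one_is_ev | simp add: ratfun_const_hom)+

text \<open>
  This relation will turn out to say that the placements of the two matrices at \<open>x\<close> lie
  in the same double coset. The scalar accounts for the center.
\<close>
definition equi :: "'k ratfun^2^2 \<Rightarrow> 'k ratfun^2^2 \<Rightarrow> bool"
  where "equi M N \<longleftrightarrow> (\<exists>e \<gamma> k. e \<noteq> 0 \<and> Gam \<gamma> \<and> rat_cong x k \<and> M = scalar_mat e ** (\<gamma> ** (N ** k)))"

lemma equi_Gam_left:
  assumes "Gam \<gamma>" "equi (\<gamma> ** M) N" shows "equi M N"
proof -
  obtain e \<delta> k where h: "e \<noteq> 0" "Gam \<delta>" "rat_cong x k" "\<gamma> ** M = scalar_mat e ** (\<delta> ** (N ** k))"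
    using assms unfolding equi_def by blast
  note i = matrix_inv_2(1,2)[OF Gam_det_nz[OF assms(1)]]
  have "M = matrix_inv \<gamma> ** (\<gamma> ** M)" by (simp add: matrix_mul_assoc i matrix_mul_lid)
  also have "\<dots> = (matrix_inv \<gamma> ** scalar_mat e) ** (\<delta> ** (N ** k))" unfolding h(4) by (simp add: matrix_mul_assoc)
  also have "\<dots> = scalar_mat e ** ((matrix_inv \<gamma> ** \<delta>) ** (N ** k))"
    unfolding scalar_mat_commute by (simp add: matrix_mul_assoc)
  finally show ?thesis unfolding equi_def
    using h Gam_mult[OF Gam_inverse[OF assms(1) i(1)] h(2)] by blast
qed

lemma equi_scalar_left:
  assumes "f \<noteq> 0" "equi M N" shows "equi (scalar_mat f ** M) N"
proof -
  obtain e \<delta> k where h: "e \<noteq> 0" "Gam \<delta>" "rat_cong x k" "M = scalar_mat e ** (\<delta> ** (N ** k))"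
    using assms unfolding equi_def by blast
  have "scalar_mat f ** M = scalar_mat (f * e) ** (\<delta> ** (N ** k))"
    unfolding h(4) by (simp add: matrix_mul_assoc scalar_mat_mult)
  then show ?thesis unfolding equi_def using h assms(1) by (metis mult_eq_0_iff)
qed

lemma equi_sym:
  assumes "equi M N" shows "equi N M"
proof -
  obtain e \<gamma> k where h: "e \<noteq> 0" "Gam \<gamma>" "rat_cong x k" "M = scalar_mat e ** (\<gamma> ** (N ** k))"
    using assms unfolding equi_def by blast
  note i = matrix_inv_2(1,2)[OF Gam_det_nz[OF h(2)]]
  have dk: "det k \<noteq> 0" using rat_cong_imp_rat_int[OF h(3)] by (simp add: rat_int_def)
  note ik = matrix_inv_2(1,2)[OF dk]
  have "scalar_mat (inverse e) ** (matrix_inv \<gamma> ** (M ** matrix_inv k)) =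
    scalar_mat (inverse e) ** ((matrix_inv \<gamma> ** scalar_mat e) ** \<gamma> ** (N ** (k ** matrix_inv k)))"
    unfolding h(4) by (simp add: matrix_mul_assoc)
  also have "\<dots> = (scalar_mat (inverse e) ** scalar_mat e) ** ((matrix_inv \<gamma> ** \<gamma>) ** (N ** (k ** matrix_inv k)))"
    unfolding scalar_mat_commute[of "matrix_inv \<gamma>"] by (simp add: matrix_mul_assoc)
  also have "\<dots> = N" using h(1) by (simp add: i ik matrix_mul_rid matrix_mul_lid scalar_mat_mult flip: mat2_mat1)
  finally have "N = scalar_mat (inverse e) ** (matrix_inv \<gamma> ** (M ** matrix_inv k))" by simp
  moreover have "Gam (matrix_inv \<gamma>)" "rat_cong x (matrix_inv k)"
    using Gam_inverse[OF h(2) i(1)] rat_cong_inverse[OF h(3) ik(1)] by auto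
  ultimately show ?thesis unfolding equi_def using h(1) nonzero_imp_inverse_nonzero by blast
qed

definition rep :: "nat \<Rightarrow> ('k \<times> 'k) set \<Rightarrow> 'k ratfun^2^2"
  where "rep n w = p_mat n ratfun_t ** theta w"

lemma det_rep: "w \<in> proj_line \<Longrightarrow> det (rep n w) \<noteq> 0"
  unfolding rep_def det_mul p_mat_eq using det_theta[of w] by (simp add: det_mat2 ratfun_t_neq_0)

lemma rat_int_theta: "w \<in> proj_line \<Longrightarrow> rat_int y (theta w)"
proof (erule proj_line_cases)
  have "rat_int y (mat2 a b c d)" if "val_ge y 0 a" "val_ge y 0 b" "val_ge y 0 c" "val_ge y 0 d"
    "a * d - b * c = ratfun_const u" "u \<noteq> 0" for a b c d u
    unfolding rat_int_def using that
    by (auto simp: forall_2 det_mat2 val_const ratfun_const_eq_0_iff)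
  note * = this
  { assume "w = proj_point 0 1"
    then show ?thesis using *[of 0 1 1 0 "- 1"] by (simp add: theta_simps ratfun_const_hom) }
  { fix a assume "w = proj_point 1 a"
    then show ?thesis using *[of 1 0 "ratfun_const a" 1 1] by (simp add: theta_simps ratfun_const_hom val_ge_const) }
qed

text \<open>Bruhat decomposition over the constants: the upper triangular part can be moved to the left
  through the diagonal matrix, where it becomes an element of the arithmetic group.\<close>
lemma equi_constant_matrix:
  assumes "a * d - b * c \<noteq> (0 :: 'k)" "rat_cong x k"
  shows "\<exists>w\<in>proj_line. equi (mat2 (S ^ n) 0 0 1 ** (mat2 (ratfun_const a) (ratfun_const b) (ratfun_const c) (ratfun_const d) ** k)) (rep n w)"
proof -
  let ?c = "ratfun_const :: 'k \<Rightarrow> 'k ratfun"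
  have up: "mat2 (S ^ n) 0 0 1 ** (mat2 (?c u) (?c v) 0 (?c r) ** theta w) = mat2 (?c u) (S ^ n * ?c v) 0 (?c r) ** rep n w" for u v r w
    unfolding rep_def p_mat_eq matrix_mul_assoc by (simp add: mat2_mult mult.commute)
  have G: "Gam (mat2 (?c u) (S ^ n * ?c v) 0 (?c r))" if "u \<noteq> 0" "r \<noteq> 0" for u v r
  proof (rule Gam_mat2[of _ _ _ _ "u * r"])
    have "S ^ n * ?c v = ev (Polynomial.monom 1 n * [:v:])" by (simp only: ev_mult ev_monom ev_const)
    then show "\<exists>p. S ^ n * ?c v = ev p" by blast
  qed (use that in \<open>auto simp: ratfun_const_hom intro: const_is_ev zero_is_ev\<close>)
  have fin: "equi (mat2 (S ^ n) 0 0 1 ** (A ** k)) (rep n w)"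
    if "A = mat2 (?c u) (?c v) 0 (?c r) ** theta w" "u \<noteq> 0" "r \<noteq> 0" for A u v r w
  proof -
    have "mat2 (S ^ n) 0 0 1 ** (A ** k) = scalar_mat 1 ** (mat2 (?c u) (S ^ n * ?c v) 0 (?c r) ** (rep n w ** k))"
      unfolding mat2_mat1[symmetric] matrix_mul_lid using up[of u v r w] by (simp add: that(1) matrix_mul_assoc)
    then show ?thesis unfolding equi_def using G[OF that(2,3)] assms(2) zero_neq_one by metis
  qed
  show ?thesis
  proof (cases "d = 0")
    case True
    have "mat2 (?c a) (?c b) (?c c) (?c d) = mat2 (?c b) (?c a) 0 (?c c) ** theta (proj_point 0 1)"
      using True by (simp add: theta_simps mat2_mult ratfun_const_hom)
    then show ?thesis using fin[of _ b a c] assms(1) True by (intro bexI[of _ "proj_point 0 1"]) (auto simp: proj_line_eq)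
  next
    case False
    have "?c (a - b * c / d) + ?c b * ?c (c / d) = ?c (a - b * c / d + b * (c / d))" by (simp only: ratfun_const_hom)
    also have "\<dots> = ?c a" by simp
    finally have "mat2 (?c a) (?c b) (?c c) (?c d) = mat2 (?c (a - b * c / d)) (?c b) 0 (?c d) ** theta (proj_point 1 (c / d))"
      using False by (simp add: theta_simps mat2_mult ratfun_const_hom(4)[symmetric])
    moreover have "a - b * c / d \<noteq> 0" using assms(1) False by (simp add: field_simps)
    ultimately show ?thesis using fin[of _ "a - b * c / d" b d] False
      by (intro bexI[of _ "proj_point 1 (c / d)"]) (auto simp: proj_line_eq)
  qed
qed


lemma val_power_int: "val y (f powi i) = i * val y f" for f :: "'k ratfun"
  by (simp add: power_int_def val_power val_inverse)

declare ratfun_t_neq_0 [simp]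

lemma S_powi_neq_0: "S powi i \<noteq> 0"
  by simp

lemma val_x_S_powi: "val x (S powi i) = - i"
  unfolding val_power_int val_x_S by simp

lemma val_ge_S_powi: "val_ge x 1 (S powi i * f) \<longleftrightarrow> val_ge x (i + 1) f"
  unfolding val_ge_mult_iff[OF S_powi_neq_0] val_x_S_powi by (simp add: add.commute)

lemma rat_cong_inv_mult:
  assumes "rat_int y A" "\<And>i j. val_ge y 1 (K $ i $ j - A $ i $ j)"
  shows "rat_cong y (matrix_inv A ** K)"
proof -
  have d: "det A \<noteq> 0" using assms(1) by (simp add: rat_int_def)
  note i = matrix_inv_2(1,2)[OF d]
  have "rat_int y (matrix_inv A)" by (rule rat_int_inverse[OF assms(1) i(1)])
  then have v: "val_ge y 0 (matrix_inv A $ i $ j)" for i j by (simp add: rat_int_def)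
  have "val_ge y 1 ((matrix_inv A ** K) $ i $ j - mat 1 $ i $ j)" for i j
  proof -
    have "(matrix_inv A ** K) $ i $ j - (matrix_inv A ** A) $ i $ j
      = matrix_inv A $ i $ 1 * (K $ 1 $ j - A $ 1 $ j) + matrix_inv A $ i $ 2 * (K $ 2 $ j - A $ 2 $ j)"
      by (simp add: matrix_mult_2 algebra_simps)
    moreover have "val_ge y (0 + 1) (matrix_inv A $ i $ l * (K $ l $ j - A $ l $ j))" for l
      by (rule val_ge_mult[OF v assms(2)])
    ultimately show ?thesis unfolding i(2) by (simp add: val_ge_add)
  qed
  then show ?thesis by (simp add: rat_cong_def)
qed

lemma val_ge_det_2:
  fixes M :: "'k ratfun^2^2"
  assumes "\<And>j. val_ge y a (M $ 1 $ j)" "\<And>j. val_ge y b (M $ 2 $ j)"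
  shows "val_ge y (a + b) (det M)"
proof -
  have "val_ge y (a + b) (M $ 1 $ i * M $ 2 $ j)" for i j by (rule val_ge_mult[OF assms])
  then have "val_ge y (a + b) (M $ 1 $ 1 * M $ 2 $ 2)" "val_ge y (a + b) (M $ 1 $ 2 * M $ 2 $ 1)" by blast+
  then show ?thesis unfolding det_2 by (rule val_ge_diff)
qed

text \<open>
  Rows whose orders add up to the order of the determinant form a reduced basis: after scaling they
  give an integral matrix with unit determinant, whose residue is an invertible constant matrix.
\<close>
lemma equi_rep_reduced:
  assumes r: "\<And>j. val_ge x a (M $ 1 $ j)" "\<And>j. val_ge x b (M $ 2 $ j)"
    and d: "det M \<noteq> 0" "val x (det M) = a + b" and ab: "a \<le> b"
  shows "\<exists>n. \<exists>w\<in>proj_line. equi M (rep n w)"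
proof -
  define k where "k = mat2 (S powi a * M $ 1 $ 1) (S powi a * M $ 1 $ 2) (S powi b * M $ 2 $ 1) (S powi b * M $ 2 $ 2)"
  define n where "n = nat (b - a)"
  have pn: "S powi a \<noteq> 0" "S powi b \<noteq> 0" by simp_all
  have vS: "val x (S powi i) = - i" for i unfolding val_power_int val_x_S by simp
  have "val_ge x (- i + i) (S powi i * f)" if "val_ge x i f" for i f
    using that vS[of i] by (intro val_ge_mult) (auto simp: val_ge_def)
  then have k0: "val_ge x 0 (k $ i $ j)" for i j
    using r exhaust_2[of i] exhaust_2[of j] by (auto simp: k_def)
  have "det k = S powi a * S powi b * det M" by (simp add: k_def det_2 algebra_simps)
  then have kd: "det k \<noteq> 0" "val x (det k) = 0" using d pn by (simp_all add: val_mult vS)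
  have M: "M = scalar_mat (S powi (- b)) ** (mat2 (S ^ n) 0 0 1 ** k)"
  proof (rule matrix_2_eqI)
    have "S powi (- b) * S ^ n * S powi a = S powi (- b + int n + a)"
      unfolding power_int_add[OF disjI1[OF S_neq_0]] power_int_of_nat ..
    also have "- b + int n + a = 0" using ab by (simp add: n_def)
    finally have e: "S powi (- b) * (S ^ n * (S powi a * f)) = f" for f by (simp add: mult.assoc[symmetric])
    have e': "S powi (- b) * (S powi b * f) = f" for f by (simp add: power_int_minus)
    show "M $ 1 $ 1 = (scalar_mat (S powi (- b)) ** (mat2 (S ^ n) 0 0 1 ** k)) $ 1 $ 1"
      "M $ 1 $ 2 = (scalar_mat (S powi (- b)) ** (mat2 (S ^ n) 0 0 1 ** k)) $ 1 $ 2"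
      "M $ 2 $ 1 = (scalar_mat (S powi (- b)) ** (mat2 (S ^ n) 0 0 1 ** k)) $ 2 $ 1"
      "M $ 2 $ 2 = (scalar_mat (S powi (- b)) ** (mat2 (S ^ n) 0 0 1 ** k)) $ 2 $ 2"
      by (simp_all only: k_def mat2_mult mat2_nth mult_zero_left mult_zero_right add_0_left add_0_right mult_1_left e e')
  qed
  have "\<exists>c. val_ge x 1 (k $ i $ j - ratfun_const c)" for i j using residue_constant k0 by blast
  then obtain c where c: "\<And>i j. val_ge x 1 (k $ i $ j - ratfun_const (c i j))" by metis
  define A where "A = mat2 (ratfun_const (c 1 1)) (ratfun_const (c 1 2)) (ratfun_const (c 2 1)) (ratfun_const (c 2 2))"
  have A: "A $ i $ j = ratfun_const (c i j)" for i j
    using exhaust_2[of i] exhaust_2[of j] by (auto simp: A_def)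
  have "ratfun_const (c i j) * ratfun_const (c i' j') - ratfun_const (c i'' j'') * ratfun_const (c i3 j3)
    = ratfun_const (c i j * c i' j' - c i'' j'' * c i3 j3)" for i j i' j' i'' j'' i3 j3
    by (simp only: ratfun_const_hom diff_conv_add_uminus)
  then have dA: "det A = ratfun_const (c 1 1 * c 2 2 - c 1 2 * c 2 1)" by (simp add: A_def det_mat2)
  have "c 1 1 * c 2 2 - c 1 2 * c 2 1 \<noteq> 0"
  proof
    assume "c 1 1 * c 2 2 - c 1 2 * c 2 1 = 0"
    then have "det A = 0" unfolding dA by (simp add: ratfun_const_hom)
    then have "det k = k $ 1 $ 1 * (k $ 2 $ 2 - A $ 2 $ 2) + (k $ 1 $ 1 - A $ 1 $ 1) * A $ 2 $ 2
      - (k $ 1 $ 2 * (k $ 2 $ 1 - A $ 2 $ 1) + (k $ 1 $ 2 - A $ 1 $ 2) * A $ 2 $ 1)"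
      by (simp add: det_2 algebra_simps)
    moreover have "val_ge x (0 + 1) (k $ i $ j * (k $ i' $ j' - A $ i' $ j'))" for i j i' j'
      using k0 c by (intro val_ge_mult) (auto simp: A)
    moreover have "val_ge x (1 + 0) ((k $ i $ j - A $ i $ j) * A $ i' $ j')" for i j i' j'
      using c by (intro val_ge_mult) (auto simp: A val_ge_const)
    ultimately have "val_ge x 1 (det k)" by (simp only: add_0_left add_0_right val_ge_add val_ge_diff)
    then show False using kd by (simp add: val_ge_def)
  qed
  note cd = this
  have "rat_int x A"
    unfolding rat_int_def dA using cd by (simp add: A val_ge_const val_const ratfun_const_eq_0_iff)
  then have "rat_cong x (matrix_inv A ** k)" by (rule rat_cong_inv_mult) (use c A in simp)
  from equi_constant_matrix[OF cd this, of n] obtain w where w: "w \<in> proj_line"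
    "equi (mat2 (S ^ n) 0 0 1 ** (A ** (matrix_inv A ** k))) (rep n w)" unfolding A_def by blast
  have "det A \<noteq> 0" using \<open>rat_int x A\<close> by (simp add: rat_int_def)
  then have "A ** (matrix_inv A ** k) = k" by (simp add: matrix_mul_assoc matrix_inv_2 matrix_mul_lid)
  then have "equi M (rep n w)" using w(2) equi_scalar_left[of "S powi (- b)"] unfolding M by simp
  then show ?thesis using w(1) by blast
qed

lemma dependent_constants:
  fixes a b c d :: 'k
  assumes "a * d = b * c" "(c, d) \<noteq> (0, 0)"
  shows "\<exists>e. a = e * c \<and> b = e * d"
proof (cases "c = 0")
  case True
  then show ?thesis using assms by (intro exI[of _ "b / d"]) auto
next
  case False
  then show ?thesis using assms by (intro exI[of _ "a / c"]) (auto simp: field_simps)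
qed

text \<open>
  Row reduction over the polynomials in \<open>1/t\<close>: as long as the orders of the rows at
  \<open>x\<close> do not add up to the order of the determinant, the leading coefficients are
  dependent, and a row operation raises the order of a row.
\<close>
lemma equi_rep_exists:
  assumes "det M \<noteq> 0" shows "\<exists>n. \<exists>w\<in>proj_line. equi M (rep n w)"
proof -
  have main: "\<exists>n. \<exists>w\<in>proj_line. equi M (rep n w)"
    if "\<And>j. val_ge x a (M $ 1 $ j)" "\<And>j. val_ge x b (M $ 2 $ j)" "det M \<noteq> 0" "a \<le> b"
      "nat (val x (det M) - (a + b)) = m" for m a b M
    using that
  proof (induction m arbitrary: a b M)
    case 0
    have "val_ge x (a + b) (det M)" by (rule val_ge_det_2[OF 0(1,2)])
    then have "val x (det M) = a + b" using 0 by (simp add: val_ge_def)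
    then show ?case using 0 equi_rep_reduced by blast
  next
    case (Suc m)
    \<comment> \<open>a matrix with better row orders settles the claim; a swap restores the order of the rows\<close>
    have step: ?case if M': "\<And>j. val_ge x a' (M' $ 1 $ j)" "\<And>j. val_ge x b' (M' $ 2 $ j)"
      "a' + b' = a + b + 1" "Gam \<gamma>" "M' = \<gamma> ** M" for M' a' b' \<gamma>
    proof -
      have "det \<gamma> \<noteq> 0" "val x (det \<gamma>) = 0" using Gam_det[OF M'(4)] by (auto simp: val_const ratfun_const_eq_0_iff)
      then have d: "det M' \<noteq> 0" "val x (det M') = val x (det M)" using Suc.prems(3) by (simp_all add: M'(5) det_mul val_mult)
      have "\<exists>n. \<exists>w\<in>proj_line. equi M' (rep n w)"
      proof (cases "a' \<le> b'")
        case True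
        have "nat (val x (det M') - (a' + b')) = m" using Suc.prems(5) d(2) M'(3) by linarith
        then show ?thesis using Suc.IH[of a' M' b'] M'(1,2) d(1) True by blast
      next
        case False
        define J where "J = mat2 0 1 1 (0 :: 'k ratfun)"
        have "det (J ** M') = - det M'" by (simp add: det_mul J_def det_mat2)
        then have dJ: "det (J ** M') \<noteq> 0" "val x (det (J ** M')) = val x (det M)" using d by simp_all
        have r: "val_ge x b' ((J ** M') $ 1 $ j)" "val_ge x a' ((J ** M') $ 2 $ j)" for j
          using M'(1,2) by (simp_all add: matrix_mult_2 J_def)
        have "nat (val x (det (J ** M')) - (b' + a')) = m" using Suc.prems(5) dJ(2) M'(3) by linarith
        then have "\<exists>n. \<exists>w\<in>proj_line. equi (J ** M') (rep n w)"
          using Suc.IH[of b' "J ** M'" a'] r dJ(1) False by auto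
        then show ?thesis using equi_Gam_left[OF Gam_swap] unfolding J_def by blast
      qed
      then show ?thesis unfolding M'(5) using equi_Gam_left[OF M'(4)] by blast
    qed
    have vS: "val x (S powi i) = - i" for i unfolding val_power_int val_x_S by simp
    have "\<exists>c. val_ge x 1 (S powi i * f - ratfun_const c)" if "val_ge x i f" for i f
    proof -
      have "val_ge x (- i + i) (S powi i * f)" using that vS[of i] by (intro val_ge_mult) (auto simp: val_ge_def)
      then show ?thesis using residue_constant by simp
    qed
    then have "\<exists>c. val_ge x 1 (S powi a * M $ 1 $ j - ratfun_const c)"
      "\<exists>c. val_ge x 1 (S powi b * M $ 2 $ j - ratfun_const c)" for j using Suc.prems(1,2) by blast+
    then obtain c d where c: "\<And>j. val_ge x 1 (S powi a * M $ 1 $ j - ratfun_const (c j))"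
      and d: "\<And>j. val_ge x 1 (S powi b * M $ 2 $ j - ratfun_const (d j))" by metis
    show ?case
    proof (cases "(d 1, d 2) = (0, 0)")
      case True
      have "val_ge x (b + 1) (M $ 2 $ j)" for j
      proof -
        have "d j = 0" using True exhaust_2[of j] by auto
        then have "val_ge x 1 (S powi b * M $ 2 $ j)" using d[of j] by (simp add: ratfun_const_hom)
        then show ?thesis unfolding val_ge_S_powi .
      qed
      then show ?thesis using step[of a M "b + 1" "mat 1"] Suc.prems(1) by (simp add: matrix_mul_lid)
    next
      case False
      have lt: "a + b + 1 \<le> val x (det M)" using Suc.prems(5) by linarith
      have "c 1 * d 2 = c 2 * d 1"
      proof -
        define k where "k = mat2 (S powi a * M $ 1 $ 1) (S powi a * M $ 1 $ 2) (S powi b * M $ 2 $ 1) (S powi b * M $ 2 $ 2)"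
        define A where "A = mat2 (ratfun_const (c 1)) (ratfun_const (c 2)) (ratfun_const (d 1)) (ratfun_const (d 2))"
        have kA: "val_ge x 1 (k $ i $ j - A $ i $ j)" for i j
          using exhaust_2[of i] exhaust_2[of j] c d by (auto simp: k_def A_def)
        have A0: "val_ge x 0 (A $ i $ j)" for i j
          using exhaust_2[of i] exhaust_2[of j] by (auto simp: A_def val_ge_const)
        have k0: "val_ge x 0 (k $ i $ j)" for i j
          using val_ge_add[OF val_ge_mono[OF kA[of i j]] A0[of i j]] by simp
        have "det k = S powi a * S powi b * det M" by (simp add: k_def det_2 algebra_simps)
        then have "val_ge x 1 (det k)" using lt Suc.prems(3) by (simp add: val_ge_def val_mult vS)
        moreover have "det k - det A = k $ 1 $ 1 * (k $ 2 $ 2 - A $ 2 $ 2) + (k $ 1 $ 1 - A $ 1 $ 1) * A $ 2 $ 2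
          - (k $ 1 $ 2 * (k $ 2 $ 1 - A $ 2 $ 1) + (k $ 1 $ 2 - A $ 1 $ 2) * A $ 2 $ 1)"
          by (simp add: det_2 algebra_simps)
        moreover have "val_ge x (0 + 1) (k $ i $ j * (k $ i' $ j' - A $ i' $ j'))" for i j i' j'
          by (rule val_ge_mult[OF k0 kA])
        moreover have "val_ge x (1 + 0) ((k $ i $ j - A $ i $ j) * A $ i' $ j')" for i j i' j'
          by (rule val_ge_mult[OF kA A0])
        ultimately have "val_ge x 1 (det k - (det k - det A))" by (simp only: add_0_left add_0_right val_ge_add val_ge_diff)
        moreover have "det A = ratfun_const (c 1 * d 2 - c 2 * d 1)"
          by (simp only: A_def det_mat2 ratfun_const_hom diff_conv_add_uminus)
        ultimately have "val_ge x 1 (ratfun_const (c 1 * d 2 - c 2 * d 1))" by simp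
        then show ?thesis by (simp add: val_const_eq)
      qed
      then obtain e where e: "c 1 = e * d 1" "c 2 = e * d 2" using dependent_constants False by blast
      then have ej: "c j = e * d j" for j using exhaust_2[of j] by auto
      \<comment> \<open>the exponent of \<open>1/t\<close> that aligns the leading terms of the two rows\<close>
      define r where "r = nat (b - a)"
      have sr: "S powi a * S ^ r = S powi b"
        unfolding power_int_of_nat[symmetric] power_int_add[OF disjI1[OF S_neq_0], symmetric]
      using Suc.prems(4) by (simp add: r_def)
      define f where "f = ratfun_const e * S ^ r"
      define \<gamma> where "\<gamma> = mat2 1 (- f) 0 1"
      have "f = ev (Polynomial.smult e (Polynomial.monom 1 r))" by (simp only: f_def ev_smult ev_monom)
      then have "- f = ev (- Polynomial.smult e (Polynomial.monom 1 r))" by (simp only: ev_minus)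
      then have nf: "\<exists>p. - f = ev p" by blast
      have G: "Gam \<gamma>" unfolding \<gamma>_def
        by (rule Gam_mat2[of _ _ _ _ 1]) (rule nf zero_is_ev one_is_ev | simp add: ratfun_const_hom)+
      have "val_ge x (a + 1) ((\<gamma> ** M) $ 1 $ j)" for j
      proof -
        have "S powi a * (\<gamma> ** M) $ 1 $ j = S powi a * M $ 1 $ j - ratfun_const e * (S powi a * S ^ r * M $ 2 $ j)"
          by (simp add: \<gamma>_def matrix_mult_2 f_def algebra_simps)
        also have "\<dots> = (S powi a * M $ 1 $ j - ratfun_const (c j)) - ratfun_const e * (S powi b * M $ 2 $ j - ratfun_const (d j))"
          unfolding sr ej by (simp add: ratfun_const_hom algebra_simps)
        finally have "val_ge x 1 (S powi a * (\<gamma> ** M) $ 1 $ j)"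
          using val_ge_diff[OF c[of j] val_ge_mult[OF val_ge_const[of x e] d[of j], simplified]] by simp
        then show ?thesis unfolding val_ge_S_powi .
      qed
      moreover have "val_ge x b ((\<gamma> ** M) $ 2 $ j)" for j using Suc.prems(2) by (simp add: \<gamma>_def matrix_mult_2)
      ultimately show ?thesis using step[OF _ _ _ G refl, of "a + 1" b] by simp
    qed
  qed
  define a where "a = Min (range (\<lambda>(i, j). val x (M $ i $ j)))"
  have "val_ge x a (M $ i $ j)" for i j
  proof -
    have "a \<le> (\<lambda>(i, j). val x (M $ i $ j)) (i, j)" unfolding a_def by (intro Min_le finite_imageI) auto
    then show ?thesis by (simp add: val_ge_def)
  qed
  then show ?thesis using main[of a M a] assms by blast
qed


lemma val_x_theta_det: "w \<in> proj_line \<Longrightarrow> val x (det (theta w)) = 0"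
  using rat_int_theta[of w x] by (simp add: rat_int_def)

lemma val_x_det_rep: "w \<in> proj_line \<Longrightarrow> val x (det (rep n w)) = - int n"
proof -
  assume w: "w \<in> proj_line"
  have "det (rep n w) = S ^ n * det (theta w)" unfolding rep_def det_mul p_mat_eq by (simp add: det_mat2)
  then show ?thesis using det_theta[OF w] val_x_theta_det[OF w] S_neq_0 by (simp add: val_mult val_x_S_power)
qed

lemma val_x_det_equi:
  assumes "e \<noteq> 0" "Gam \<gamma>" "rat_cong x k" "w \<in> proj_line" "M = scalar_mat e ** (\<gamma> ** (rep n w ** k))"
  shows "val x (det M) = 2 * val x e - int n"
proof -
  have g: "det \<gamma> \<noteq> 0" "val x (det \<gamma>) = 0" using Gam_det[OF assms(2)] by (auto simp: val_const ratfun_const_eq_0_iff)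
  have k: "det k \<noteq> 0" "val x (det k) = 0" using rat_cong_imp_rat_int[OF assms(3)] by (simp_all add: rat_int_def)
  have "det M = (e * e) * (det \<gamma> * (det (rep n w) * det k))" unfolding assms(5) det_mul by (simp add: det_mat2)
  then show ?thesis using g k assms(1) det_rep[OF assms(4)] val_x_det_rep[OF assms(4)] by (simp add: val_mult)
qed

text \<open>
  The diagonal factor of the representative does not affect its last row. So if \<open>M = e
  \<gamma> R k\<close> with \<open>R\<close> the representative of level \<open>n\<close>, the last
  row of the inverse of \<open>\<gamma>\<close> combines the rows of \<open>M\<close> to a vector
  whose order is that of \<open>e\<close>, and the order of the determinant of \<open>M\<close> is
  twice this order minus \<open>n\<close>.
\<close>
lemma short_vector:
  assumes "equi M (rep n w)" "w \<in> proj_line"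
  obtains e k v1 v2 where "e \<noteq> 0" "rat_cong x k" "val x (det M) = 2 * val x e - int n" "(v1, v2) \<noteq> (0, 0)"
    "\<And>j. ev v1 * M $ 1 $ j + ev v2 * M $ 2 $ j = e * (theta w ** k) $ 2 $ j"
proof -
  obtain e \<gamma> k where h: "e \<noteq> 0" "Gam \<gamma>" "rat_cong x k" "M = scalar_mat e ** (\<gamma> ** (rep n w ** k))"
    using assms unfolding equi_def by blast
  note i = matrix_inv_2(1,2)[OF Gam_det_nz[OF h(2)]]
  define \<delta> where "\<delta> = matrix_inv \<gamma>"
  have \<delta>: "Gam \<delta>" unfolding \<delta>_def by (rule Gam_inverse[OF h(2) i(1)])
  have "\<delta> ** M = (\<delta> ** scalar_mat e) ** (\<gamma> ** (rep n w ** k))" unfolding h(4) by (simp add: matrix_mul_assoc)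
  also have "\<dots> = scalar_mat e ** ((\<delta> ** \<gamma>) ** (rep n w ** k))" unfolding scalar_mat_commute[of \<delta>] by (simp add: matrix_mul_assoc)
  also have "\<dots> = scalar_mat e ** (rep n w ** k)" unfolding \<delta>_def i(2) by (simp add: matrix_mul_lid)
  finally have eq: "\<delta> ** M = scalar_mat e ** (rep n w ** k)" .
  have row: "\<delta> $ 2 $ 1 * M $ 1 $ j + \<delta> $ 2 $ 2 * M $ 2 $ j = e * (theta w ** k) $ 2 $ j" for j
  proof -
    have "rep n w $ 2 $ l = theta w $ 2 $ l" for l unfolding rep_def p_mat_eq by (simp add: matrix_mult_2)
    then have "(rep n w ** k) $ 2 $ j = (theta w ** k) $ 2 $ j" by (simp add: matrix_mult_2)
    then show ?thesis unfolding matrix_mult_2[symmetric] eq by (simp add: scalar_mat_mult_nth)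
  qed
  obtain v1 v2 where v: "\<delta> $ 2 $ 1 = ev v1" "\<delta> $ 2 $ 2 = ev v2" using Gam_entry[OF \<delta>] by metis
  have "(v1, v2) \<noteq> (0, 0)"
  proof
    assume "(v1, v2) = (0, 0)"
    then have "det \<delta> = 0" using v by (simp add: det_2)
    then show False using Gam_det_nz[OF \<delta>] by simp
  qed
  then show thesis using that[OF h(1,3) val_x_det_equi[OF h(1-3) assms(2) h(4)]] row unfolding v by blast
qed

lemma theta_bottom_int:
  assumes "w \<in> proj_line" "rat_cong x k"
  shows "val_ge x 0 ((theta w ** k) $ 2 $ j)"
  using rat_int_mult[OF rat_int_theta[OF assms(1)] rat_cong_imp_rat_int[OF assms(2)]] by (simp add: rat_int_def)

text \<open>
  The matrix \<open>\<theta>\<close> is integral with integral inverse, so multiplying a row by it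
  does not change the order.
\<close>
lemma theta_cancel:
  assumes "w \<in> proj_line" "\<And>j. val_ge x i (u1 * theta w $ 1 $ j + u2 * theta w $ 2 $ j)"
  shows "val_ge x i u1" "val_ge x i u2"
proof -
  from assms(1) have "val_ge x i u1 \<and> val_ge x i u2"
  proof (cases rule: proj_line_cases)
    case 1
    then show ?thesis using assms(2)[of 1] assms(2)[of 2] by (simp add: theta_simps)
  next
    case (2 a)
    have v2: "val_ge x i u2" using assms(2)[of 2] by (simp add: 2 theta_simps)
    have "val_ge x i (u1 + u2 * ratfun_const a)" using assms(2)[of 1] by (simp add: 2 theta_simps)
    moreover have "val_ge x (i + 0) (u2 * ratfun_const a)" by (rule val_ge_mult[OF v2 val_ge_const])
    ultimately have "val_ge x i (u1 + u2 * ratfun_const a - u2 * ratfun_const a)" by (intro val_ge_diff) simp_all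
    then show ?thesis using v2 by simp
  qed
  then show "val_ge x i u1" "val_ge x i u2" by auto
qed

lemma short_vector_val:
  assumes "e \<noteq> 0" "w \<in> proj_line" "rat_cong x k"
  shows "val_ge x (val x e) (e * (theta w ** k) $ 2 $ j)"
  using val_ge_mult[OF _ theta_bottom_int[OF assms(2,3)], of "val x e" e j] assms(1) by (simp add: val_ge_def)

lemma theta_bottom_inj:
  assumes w: "w \<in> proj_line" "w' \<in> proj_line" and c: "c \<noteq> 0" and e: "e \<noteq> 0" "val x e = 0"
    and d: "\<And>j. val_ge x 1 (ratfun_const c * theta w $ 2 $ j - e * theta w' $ 2 $ j)"
  shows "w = w'"
  using w(1)
proof (cases rule: proj_line_cases)
  case w1: 1
  from w(2) show ?thesis
  proof (cases rule: proj_line_cases)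
    case (2 b)
    then have "val_ge x 1 e" using d[of 2] by (simp add: w1 theta_simps)
    then show ?thesis using e by (simp add: val_ge_def)
  qed (simp add: w1)
next
  case w2: (2 a)
  from w(2) show ?thesis
  proof (cases rule: proj_line_cases)
    case 1
    then have "val_ge x 1 (ratfun_const c)" using d[of 2] by (simp add: w2 theta_simps)
    then show ?thesis using c by (simp add: val_const_eq)
  next
    case (2 b)
    have d1: "val_ge x 1 (ratfun_const c * ratfun_const a - e * ratfun_const b)" using d[of 1] by (simp add: w2 2 theta_simps)
    have d2: "val_ge x 1 (ratfun_const c - e)" using d[of 2] by (simp add: w2 2 theta_simps)
    have "val_ge x (1 + 0) ((ratfun_const c - e) * ratfun_const b)" by (rule val_ge_mult[OF d2 val_ge_const])
    then have "val_ge x 1 ((ratfun_const c * ratfun_const a - e * ratfun_const b) - (ratfun_const c - e) * ratfun_const b)"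
      using val_ge_diff[OF d1] by simp
    also have "(ratfun_const c * ratfun_const a - e * ratfun_const b) - (ratfun_const c - e) * ratfun_const b
      = ratfun_const (c * a - c * b)"
      by (simp only: ratfun_const_hom diff_conv_add_uminus) (simp add: algebra_simps)
    finally have "c * a - c * b = 0" by (simp add: val_const_eq)
    then show ?thesis using c by (simp add: w2 2)
  qed
qed

lemma cong_theta_bottom:
  assumes "w \<in> proj_line" "rat_cong x k" "val_ge x 0 e"
  shows "val_ge x 1 (e * (theta w ** k) $ 2 $ j - e * theta w $ 2 $ j)"
proof -
  have k: "val_ge x 1 (k $ i $ j - mat 1 $ i $ j)" for i j using assms(2) by (simp add: rat_cong_def)
  have t: "val_ge x 0 (theta w $ i $ j)" for i j using rat_int_theta[OF assms(1)] by (simp add: rat_int_def)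
  have "theta w $ 2 $ j = (theta w ** mat 1) $ 2 $ j" by (simp only: matrix_mul_rid)
  then have "(theta w ** k) $ 2 $ j - theta w $ 2 $ j = (theta w ** k) $ 2 $ j - (theta w ** mat 1) $ 2 $ j" by simp
  also have "\<dots> = theta w $ 2 $ 1 * (k $ 1 $ j - mat 1 $ 1 $ j) + theta w $ 2 $ 2 * (k $ 2 $ j - mat 1 $ 2 $ j)"
    unfolding matrix_mult_2 by (simp add: algebra_simps)
  finally have "val_ge x 1 ((theta w ** k) $ 2 $ j - theta w $ 2 $ j)"
    using val_ge_add[OF val_ge_mult[OF t k] val_ge_mult[OF t k]] by simp
  from val_ge_mult[OF assms(3) this] show ?thesis by (simp add: right_diff_distrib)
qed

lemma val_ge_ev_S_power:
  assumes "val_ge x 0 (ev v * S ^ n)" "0 < n" shows "v = 0"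
proof (rule ccontr)
  assume "v \<noteq> 0"
  then have "val x (ev v * S ^ n) = - int (degree v) - int n"
    using S_neq_0 by (simp add: val_mult val_x_ev val_x_S_power)
  then show False using assms \<open>v \<noteq> 0\<close> S_neq_0 by (simp add: val_ge_def)
qed

text \<open>
  A polynomial combination of the rows of a representative never has positive order at
  \<open>x\<close>, unless it vanishes; this forces \<open>n = m\<close>. For \<open>n > 0\<close> a
  combination of order 0 can only be a constant multiple of the last row, which carries the point of
  the projective line.
\<close>
lemma rep_unique_aux:
  assumes w: "w \<in> proj_line" "w' \<in> proj_line" and eq: "equi (rep n w) (rep m w')" and nm: "n \<le> m"
  shows "n = m \<and> (n = 0 \<or> w = w')"
proof -
  obtain e k v1 v2 where h: "e \<noteq> 0" "rat_cong x k" "val x (det (rep n w)) = 2 * val x e - int m" "(v1, v2) \<noteq> (0, 0)"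
    "\<And>j. ev v1 * rep n w $ 1 $ j + ev v2 * rep n w $ 2 $ j = e * (theta w' ** k) $ 2 $ j"
    using short_vector[OF eq w(2)] by metis
  have ve: "2 * val x e = int m - int n" using h(3) val_x_det_rep[OF w(1)] by simp
  have r: "rep n w $ 1 $ j = S ^ n * theta w $ 1 $ j" "rep n w $ 2 $ j = theta w $ 2 $ j" for j
    unfolding rep_def p_mat_eq by (simp_all add: matrix_mult_2)
  have row: "(ev v1 * S ^ n) * theta w $ 1 $ j + ev v2 * theta w $ 2 $ j = e * (theta w' ** k) $ 2 $ j" for j
    using h(5)[of j] unfolding r by (simp only: mult.assoc)
  have u: "val_ge x (val x e) (ev v1 * S ^ n)" "val_ge x (val x e) (ev v2)"
    using theta_cancel[OF w(1), of "val x e" "ev v1 * S ^ n" "ev v2"]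
      short_vector_val[OF h(1) w(2) h(2)] unfolding row by blast+
  have e0: "val x e = 0"
  proof (rule ccontr)
    assume "val x e \<noteq> 0"
    then have e: "1 \<le> val x e" using ve nm by linarith
    have "v2 = 0" using val_ge_mono[OF u(2) e] by (auto simp: val_ge_x_ev)
    moreover have "val_ge x 1 (ev (v1 * Polynomial.monom 1 n))" using val_ge_mono[OF u(1) e] by (simp add: ev_mult ev_monom)
    then have "v1 * Polynomial.monom 1 n = 0" by (auto simp only: val_ge_x_ev)
    then have "v1 = 0" by simp
    ultimately show False using h(4) by simp
  qed
  then have nm: "n = m" using ve by simp
  moreover have "w = w'" if "0 < n"
  proof -
    have v1: "v1 = 0" using val_ge_ev_S_power[OF _ that] u(1) e0 by simp
    then have "v2 \<noteq> 0" using h(4) by simp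
    then have "degree v2 = 0" using u(2) e0 by (simp add: val_ge_x_ev)
    then obtain c where c: "v2 = [:c:]" by (metis degree_eq_zeroE)
    have "val_ge x 0 e" using e0 by (simp add: val_ge_def)
    have "val_ge x 1 (ratfun_const c * theta w $ 2 $ j - e * theta w' $ 2 $ j)" for j
      using cong_theta_bottom[OF w(2) h(2) \<open>val_ge x 0 e\<close>, of j] unfolding row[of j, symmetric]
      by (simp add: v1 c ev_const)
    then show ?thesis using theta_bottom_inj[OF w _ h(1) e0] c \<open>v2 \<noteq> 0\<close> by auto
  qed
  ultimately show ?thesis by blast
qed

lemma rep_unique:
  assumes "w \<in> proj_line" "w' \<in> proj_line" "equi (rep n w) (rep m w')"
  shows "n = m \<and> (n = 0 \<or> w = w')"
proof (cases "n \<le> m")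
  case True
  then show ?thesis using rep_unique_aux assms by blast
next
  case False
  then have "m = n \<and> (m = 0 \<or> w' = w)"
    using rep_unique_aux[OF assms(2,1) equi_sym[OF assms(3)]] by simp
  then show ?thesis by blast
qed

lemma val_x_ev_place_poly_monom:
  assumes "y \<noteq> x" "degree (place_poly y) = d"
  shows "val_ge x 1 (ev (place_poly y) / S ^ d - 1)"
proof -
  let ?r = "place_poly y - Polynomial.monom 1 d"
  have e: "ev (place_poly y) / S ^ d - 1 = ev ?r / S ^ d"
    unfolding ev_diff ev_monom diff_divide_distrib using S_neq_0 by simp
  have "degree ?r \<le> d" using assms(2) by (intro degree_diff_le) (auto simp: degree_monom_le)
  moreover have "poly.coeff ?r d = 0" using place_poly(1)[OF assms(1)] assms(2) by simp
  ultimately have "?r = 0 \<or> degree ?r < d" by (metis leading_coeff_0_iff order_le_less)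
  then have "val_ge x 1 (ev ?r / S ^ d)"
  proof
    assume "degree ?r < d"
    then show ?thesis
      using S_neq_0 by (cases "?r = 0") (auto simp: val_ge_def val_divide val_x_ev val_x_S_power)
  qed simp
  then show ?thesis unfolding e .
qed

text \<open>
  As \<open>P\<close> is monic, \<open>P / (1/t)^d\<close> is congruent to 1 modulo the uniformizer
  at \<open>x\<close>, and conjugation with \<open>\<theta>\<close> preserves this congruence.
\<close>
lemma equi_top_neighbour:
  assumes "y \<noteq> x" "degree (place_poly y) = d" "w \<in> proj_line"
  shows "equi (mat2 (ev (place_poly y)) 0 0 1 ** rep n w) (rep (n + d) w)"
proof -
  define u where "u = ev (place_poly y) / S ^ d"
  have u1: "val_ge x 1 (u - 1)" unfolding u_def by (rule val_x_ev_place_poly_monom[OF assms(1,2)])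
  have P: "ev (place_poly y) = S ^ d * u" using S_neq_0 by (simp add: u_def)
  have "\<exists>k. rat_cong x k \<and> mat2 u 0 0 1 ** theta w = theta w ** k"
    using assms(3)
  proof (cases rule: proj_line_cases)
    case 1
    have "rat_cong x (mat2 1 0 0 u)" using u1 by (simp add: rat_cong_def forall_2 mat1_2)
    moreover have "mat2 u 0 0 1 ** theta w = theta w ** mat2 1 0 0 u" by (simp add: 1 theta_simps mat2_mult)
    ultimately show ?thesis by blast
  next
    case (2 a)
    have "val_ge x (0 + 1) (ratfun_const a * - (u - 1))"
      by (rule val_ge_mult[OF val_ge_const]) (use u1 in \<open>simp only: val_ge_minus\<close>)
    then have "rat_cong x (mat2 u 0 (ratfun_const a * (1 - u)) 1)" using u1 by (simp add: rat_cong_def forall_2 mat1_2)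
    moreover have "mat2 u 0 0 1 ** theta w = theta w ** mat2 u 0 (ratfun_const a * (1 - u)) 1"
      by (simp add: 2 theta_simps mat2_mult algebra_simps)
    ultimately show ?thesis by blast
  qed
  then obtain k where k: "rat_cong x k" "mat2 u 0 0 1 ** theta w = theta w ** k" by blast
  have "mat2 (ev (place_poly y)) 0 0 1 ** rep n w = p_mat (n + d) ratfun_t ** (mat2 u 0 0 1 ** theta w)"
    unfolding rep_def matrix_mul_assoc p_mat_eq P by (simp add: mat2_mult power_add mult_ac)
  also have "\<dots> = scalar_mat 1 ** (mat 1 ** (rep (n + d) w ** k))"
    unfolding k(2) rep_def mat2_mat1[symmetric] matrix_mul_lid by (simp add: matrix_mul_assoc)
  finally show ?thesis unfolding equi_def using k(1) Gam_one zero_neq_one by metis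
qed

text \<open>
  Level at least \<open>n + d\<close> would require a nonzero combination of the rows that is
  integral at \<open>x\<close>. For \<open>n > 0\<close> there is none. For \<open>n = 0\<close> the
  only ones are constant multiples of the first row, which are visible in the last row of the
  representative of the class and exclude the point \<open>[1:0]\<close>.
\<close>
lemma equi_lower_neighbour:
  assumes P: "degree P = d" "0 < d" and w: "w \<in> proj_line" "w' \<in> proj_line"
    and eq: "equi (mat2 1 (- ev b) 0 (ev P) ** rep n w) (rep m w')"
  shows "0 < n \<Longrightarrow> m < n + d" "n = 0 \<Longrightarrow> w = proj_point 1 0 \<Longrightarrow> m < d \<or> m = d \<and> w' \<noteq> proj_point 1 0"
proof -
  let ?N = "mat2 1 (- ev b) 0 (ev P) ** rep n w"
  have P0: "P \<noteq> 0" using P by auto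
  obtain e k v1 v2 where h: "e \<noteq> 0" "rat_cong x k" "val x (det ?N) = 2 * val x e - int m" "(v1, v2) \<noteq> (0, 0)"
    "\<And>j. ev v1 * ?N $ 1 $ j + ev v2 * ?N $ 2 $ j = e * (theta w' ** k) $ 2 $ j"
    using short_vector[OF eq w(2)] by metis
  have "det ?N = ev P * det (rep n w)" unfolding det_mul by (simp add: det_mat2)
  then have "val x (det ?N) = - int d - int n"
    using P P0 det_rep[OF w(1)] val_x_det_rep[OF w(1)] by (simp add: val_mult val_x_ev)
  then have ve: "2 * val x e = int m - int d - int n" using h(3) by simp
  define u2 where "u2 = ev (- (v1 * b) + v2 * P)"
  have r: "?N $ 1 $ j = S ^ n * theta w $ 1 $ j - ev b * theta w $ 2 $ j" "?N $ 2 $ j = ev P * theta w $ 2 $ j" for j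
    unfolding rep_def p_mat_eq by (simp_all add: matrix_mult_2)
  have row: "(ev v1 * S ^ n) * theta w $ 1 $ j + u2 * theta w $ 2 $ j = e * (theta w' ** k) $ 2 $ j" for j
    using h(5)[of j] unfolding r u2_def ev_add ev_minus ev_mult by (simp add: algebra_simps)
  have u: "val_ge x (val x e) (ev v1 * S ^ n)" "val_ge x (val x e) u2"
    using theta_cancel[OF w(1), of "val x e" "ev v1 * S ^ n" u2]
      short_vector_val[OF h(1) w(2) h(2)] unfolding row by blast+
  have v2P: False if "v1 = 0" "0 \<le> val x e"
  proof -
    have v2: "v2 \<noteq> 0" using h(4) that by simp
    have "val_ge x 0 u2" using u(2) that(2) by (rule val_ge_mono)
    then have "val_ge x 0 (ev (v2 * P))" by (simp add: u2_def that(1))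
    then have "degree (v2 * P) = 0" using v2 P0 by (simp add: val_ge_x_ev)
    then show False using P v2 P0 by (simp add: degree_mult_eq)
  qed
  show "m < n + d" if n: "0 < n"
  proof (rule ccontr)
    assume "\<not> m < n + d"
    then have e0: "0 \<le> val x e" using ve by linarith
    have "v1 = 0" by (rule val_ge_ev_S_power[OF val_ge_mono[OF u(1) e0] n])
    then show False using v2P e0 by blast
  qed
  show "m < d \<or> m = d \<and> w' \<noteq> proj_point 1 0" if n: "n = 0" "w = proj_point 1 0"
  proof (rule ccontr)
    assume c: "\<not> (m < d \<or> m = d \<and> w' \<noteq> proj_point 1 0)"
    then have e0: "0 \<le> val x e" using ve n by linarith
    have v1: "v1 \<noteq> 0" using v2P e0 by blast
    have u1: "val_ge x (val x e) (ev v1)" using u(1) n(1) by simp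
    then have "val x e = 0" "degree v1 = 0" using e0 v1 by (auto simp: val_ge_x_ev)
    then have "m = d" "w' = proj_point 1 0" using c ve n by auto
    obtain a where a: "v1 = [:a:]" using \<open>degree v1 = 0\<close> by (metis degree_eq_zeroE)
    have "val_ge x 0 e" using \<open>val x e = 0\<close> by (simp add: val_ge_def)
    from cong_theta_bottom[OF w(2) h(2) this, of 1]
    have "val_ge x 1 (ratfun_const a)"
      unfolding row[of 1, symmetric] by (simp add: n theta_simps \<open>w' = proj_point 1 0\<close> ratfun_const_hom a ev_const)
    then show False using v1 a by (simp add: val_const_eq)
  qed
qed

end

section \<open>Strong approximation and the double cosets\<close>

lemma double_coset_eq:
  fixes K :: "'k::{field,finite} gl2A set"
  assumes R1: "\<And>a b :: 'k gl2A. a \<in> rational_points \<Longrightarrow> b \<in> rational_points \<Longrightarrow> a * b \<in> rational_points"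
    and R2: "\<And>a :: 'k gl2A. a \<in> rational_points \<Longrightarrow> ginv a \<in> rational_points"
    and K1: "\<And>a b. a \<in> K \<Longrightarrow> b \<in> K \<Longrightarrow> a * b \<in> K" and K2: "\<And>a. a \<in> K \<Longrightarrow> ginv a \<in> K"
    and h: "h \<in> double_coset K g"
  shows "double_coset K h = double_coset K g"
proof -
  have Z1: "a * b \<in> center" if "a \<in> center" "b \<in> center" for a b :: "'k gl2A"
  proof -
    have c: "a * g = g * a" "b * g = g * b" for g using that by (auto simp: center_def)
    have "a * b * g = g * (a * b)" for g
    proof -
      have "a * b * g = a * (g * b)" by (simp only: mult.assoc c(2))
      also have "\<dots> = g * a * b" by (simp only: mult.assoc[symmetric] c(1))
      finally show ?thesis by (simp only: mult.assoc)
    qed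
    then show ?thesis by (simp add: center_def)
  qed
  have Z2: "ginv a \<in> center" if "a \<in> center" for a :: "'k gl2A"
  proof -
    have "ginv a * g = g * ginv a" for g
    proof -
      have "a * g = g * a" using that by (simp add: center_def)
      have "ginv a * g = ginv a * (g * a) * ginv a" by (simp add: mult.assoc ginv)
      also have "\<dots> = ginv a * (a * g) * ginv a" by (simp only: \<open>a * g = g * a\<close>)
      also have "\<dots> = g * ginv a" by simp
      finally show ?thesis .
    qed
    then show ?thesis by (simp add: center_def)
  qed
  have comm: "z * g = g * z" if "z \<in> center" for z g :: "'k gl2A" using that by (simp add: center_def)
  have sub: "double_coset K h \<subseteq> double_coset K g" if h: "h \<in> double_coset K g" for g h
  proof
    fix u assume "u \<in> double_coset K h"
    then obtain a z k where u: "u = a * h * z * k" "a \<in> rational_points" "z \<in> center" "k \<in> K" unfolding double_coset_def by blast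
    obtain a' z' k' where h': "h = a' * g * z' * k'" "a' \<in> rational_points" "z' \<in> center" "k' \<in> K" using h unfolding double_coset_def by blast
    have "u = a * (a' * g * z' * k') * z * k" using u(1) h'(1) by simp
    also have "\<dots> = (a * a') * g * z' * (k' * z) * k" by (simp only: mult.assoc)
    also have "\<dots> = (a * a') * g * (z' * z) * (k' * k)" unfolding comm[OF u(3), of k', symmetric] by (simp only: mult.assoc)
    finally show "u \<in> double_coset K g" unfolding double_coset_def
      using R1[OF u(2) h'(2)] Z1[OF h'(3) u(3)] K1[OF h'(4) u(4)] by blast
  qed
  obtain a z k where h': "h = a * g * z * k" "a \<in> rational_points" "z \<in> center" "k \<in> K" using h unfolding double_coset_def by blast
  have "ginv a * h * ginv z * ginv k = g * z * k * ginv z * ginv k" unfolding h'(1) by (simp add: mult.assoc)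
  also have "\<dots> = g * z * (k * ginv z) * ginv k" by (simp only: mult.assoc)
  also have "\<dots> = g" unfolding comm[OF Z2[OF h'(3)], of k, symmetric] by (simp add: mult.assoc ginv)
  finally have "g = ginv a * h * ginv z * ginv k" by simp
  then have "g \<in> double_coset K h" unfolding double_coset_def
    using R2[OF h'(2)] Z2[OF h'(3)] K2[OF h'(4)] by blast
  then show ?thesis using sub h by blast
qed

context origin_place
begin

abbreviation Kx :: "'k gl2A set"
  where "Kx \<equiv> congruence_subgroup x ratfun_t"

lemma Kx_iff: "g \<in> Kx \<longleftrightarrow> (\<forall>y. mint y (gl2_mat g)) \<and> mcong x (gl2_mat g)"
  by (rule congruence_subgroup_iff[OF val_x_t])

lemma KxI: "mcong x (gl2_mat g) \<Longrightarrow> (\<And>z. z \<noteq> x \<Longrightarrow> mint z (gl2_mat g)) \<Longrightarrow> g \<in> Kx"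
proof -
  assume h: "mcong x (gl2_mat g)" "\<And>z. z \<noteq> x \<Longrightarrow> mint z (gl2_mat g)"
  have "mint y (gl2_mat g)" for y using h(2) mcong_imp_mint[OF h(1)] by (cases "y = x") auto
  then show ?thesis using h(1) unfolding Kx_iff by blast
qed

lemma Kx_mult: "g \<in> Kx \<Longrightarrow> h \<in> Kx \<Longrightarrow> g * h \<in> Kx"
  unfolding Kx_iff gl2_mat_mult using mint_mult mcong_mult by blast

lemma Kx_ginv: "g \<in> Kx \<Longrightarrow> ginv g \<in> Kx"
  unfolding Kx_iff using mint_inverse[OF _ ginv_mat(1)] mcong_inverse[OF _ ginv_mat(1)] by blast

lemma Kx_one: "1 \<in> Kx"
  by (simp add: Kx_iff gl2_mat_one)

lemma rat_mult:
  assumes "det M \<noteq> 0" "det N \<noteq> 0" shows "rat M * rat N = rat (M ** N)"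
proof -
  have d: "det (M ** N) \<noteq> 0" using assms by (simp add: det_mul)
  show ?thesis
    unfolding gl2_mat_inject[symmetric] gl2_mat_mult gl2_mat_rat[OF assms(1)] gl2_mat_rat[OF assms(2)] gl2_mat_rat[OF d]
    by (rule emat_mult[symmetric])
qed

lemma rat_one: "rat (mat 1) = 1"
proof -
  have "det (mat 1 :: 'k ratfun^2^2) \<noteq> 0" by simp
  from gl2_mat_rat[OF this] show ?thesis unfolding gl2_mat_inject[symmetric] gl2_mat_one emat_one .
qed

lemma ginv_rat: "det M \<noteq> 0 \<Longrightarrow> ginv (rat M) = rat (matrix_inv M)"
  by (rule ginv_unique) (simp add: rat_mult matrix_inv_2 rat_one)

lemma rat_mem: "det M \<noteq> 0 \<Longrightarrow> rat M \<in> rational_points"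
  unfolding rational_points_iff by blast

lemma rational_points_mult:
  fixes a b :: "'k gl2A"
  assumes "a \<in> rational_points" "b \<in> rational_points" shows "a * b \<in> rational_points"
proof -
  obtain M N where MN: "det M \<noteq> 0" "a = rat M" "det N \<noteq> 0" "b = rat N"
    using assms unfolding rational_points_iff by blast
  then have "det (M ** N) \<noteq> 0" by (simp add: det_mul)
  then show ?thesis unfolding MN rat_mult[OF MN(1,3)] by (rule rat_mem)
qed

lemma rational_points_ginv:
  fixes a :: "'k gl2A"
  assumes "a \<in> rational_points" shows "ginv a \<in> rational_points"
proof -
  obtain M where M: "det M \<noteq> 0" "a = rat M" using assms unfolding rational_points_iff by blast
  show ?thesis unfolding M(2) ginv_rat[OF M(1)] by (rule rat_mem[OF matrix_inv_2(4)[OF M(1)]])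
qed

lemma rational_points_one: "(1 :: 'k gl2A) \<in> rational_points"
  unfolding rat_one[symmetric] by (rule rat_mem) simp

lemma center_one: "1 \<in> center"
  by (simp add: center_def)

abbreviation DC :: "'k gl2A \<Rightarrow> 'k gl2A set"
  where "DC \<equiv> double_coset Kx"

lemma DC_eq: "h \<in> DC g \<Longrightarrow> DC h = DC g"
  by (rule double_coset_eq)
    (auto intro: rational_points_mult rational_points_ginv Kx_mult Kx_ginv)

lemma DC_self: "g \<in> DC g"
proof -
  have "g = 1 * g * 1 * 1" by simp
  then show ?thesis unfolding double_coset_def using rational_points_one center_one Kx_one by blast
qed

lemma loc_mult: "det M \<noteq> 0 \<Longrightarrow> det N \<noteq> 0 \<Longrightarrow> loc y M * loc y N = loc y (M ** N)"
proof (rule gl2_eq_agreeI)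
  fix z assume h: "det M \<noteq> 0" "det N \<noteq> 0"
  then have d: "det (M ** N) \<noteq> 0" by (simp add: det_mul)
  show "\<exists>A. agree z (loc y M * loc y N) A \<and> agree z (loc y (M ** N)) A"
  proof (cases "z = y")
    case True
    then show ?thesis using agree_mult[OF agree_loc(1)[OF h(1)] agree_loc(1)[OF h(2)]] agree_loc(1)[OF d] by blast
  next
    case False
    then show ?thesis using agree_mult[OF agree_loc(2)[OF h(1) False] agree_loc(2)[OF h(2) False]] agree_loc(2)[OF d False]
      by (auto simp: matrix_mul_lid)
  qed
qed

lemma loc_one: "loc y (mat 1) = 1"
proof (rule gl2_eq_agreeI)
  fix z
  have d: "det (mat 1 :: 'k ratfun^2^2) \<noteq> 0" by simp
  have "agree z (loc y (mat 1)) (mat 1)"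
    using agree_loc(1)[OF d] agree_loc(2)[OF d] by (cases "z = y") blast+
  then show "\<exists>M. agree z (loc y (mat 1)) M \<and> agree z 1 M" using agree_one by blast
qed

lemma maeq_loc_mult:
  assumes "det M \<noteq> 0"
  shows "maeq y (gl2_mat (loc y M * g)) (emat M ** gl2_mat g)"
    "z \<noteq> y \<Longrightarrow> maeq z (gl2_mat (loc y M * g)) (gl2_mat g)"
proof -
  show "maeq y (gl2_mat (loc y M * g)) (emat M ** gl2_mat g)"
    unfolding gl2_mat_mult using agree_loc(1)[OF assms] by (intro maeq_mult) (auto simp: agree_def)
  assume "z \<noteq> y"
  then have "maeq z (gl2_mat (loc y M)) (mat 1)" using agree_loc(2)[OF assms] by (simp add: agree_def)
  from maeq_mult[OF this maeq_refl[of z "gl2_mat g"]] show "maeq z (gl2_mat (loc y M * g)) (gl2_mat g)"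
    unfolding gl2_mat_mult by (simp only: matrix_mul_lid)
qed

text \<open>
  It is enough to approximate the entries of the inverse of \<open>g\<close> closely.
\<close>
lemma matrix_density: "\<exists>M. det M \<noteq> 0 \<and> mcong y (emat M ** gl2_mat g)"
proof -
  let ?G = "gl2_mat g" and ?B = "gl2_mat (ginv g)"
  have "\<exists>k. age y k (?G $ i $ j)" for i j by (rule age_exists)
  then obtain f where f: "\<And>i j. age y (f i j) (?G $ i $ j)" by metis
  define m where "m = Min (range (\<lambda>(i, j). f i j))"
  have m: "age y m (?G $ i $ j)" for i j
  proof -
    have "m \<le> (\<lambda>(i, j). f i j) (i, j)" unfolding m_def by (intro Min_le finite_imageI) auto
    then show ?thesis using age_mono[OF f] by simp
  qed
  have "\<exists>b. age y (1 - m) (?B $ i $ j - emb b)" for i j by (rule density)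
  then obtain b where b: "\<And>i j. age y (1 - m) (?B $ i $ j - emb (b i j))" by metis
  define M where "M = (\<chi> i j. b i j)"
  have "age y 1 ((emat M ** ?G) $ i $ j - mat 1 $ i $ j)" for i j
  proof -
    have "age y ((1 - m) + m) ((?B $ i $ l - emb (b i l)) * ?G $ l $ j)" for l by (rule age_mult[OF b m])
    then have a: "age y 1 ((?B $ i $ l - emb (b i l)) * ?G $ l $ j)" for l by simp
    have "(emat M ** ?G) $ i $ j - (?B ** ?G) $ i $ j
      = - ((?B $ i $ 1 - emb (b i 1)) * ?G $ 1 $ j + (?B $ i $ 2 - emb (b i 2)) * ?G $ 2 $ j)"
      unfolding matrix_mult_2 by (simp add: M_def algebra_simps)
    then show ?thesis unfolding ginv_mat using age_uminus[OF age_add[OF a a]] by simp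
  qed
  then have c: "mcong y (emat M ** ?G)" by (simp add: mcong_def)
  have "det M \<noteq> 0"
  proof
    assume "det M = 0"
    then have "det (emat M ** ?G) = 0" by (simp add: det_mul det_emat emb_hom)
    moreover have "aunit y (det (emat M ** ?G))" using mcong_imp_mint[OF c] by (simp add: mint_def)
    ultimately show False by (simp add: aunit_def)
  qed
  then show ?thesis using c by blast
qed

lemma idele_density: "c * d = 1 \<Longrightarrow> \<exists>a. a \<noteq> 0 \<and> age y 1 (emb a * c - (1 :: 'k adele))"
proof -
  assume cd: "c * d = 1"
  obtain m where m: "age y m c" using age_exists by blast
  obtain a where a: "age y (1 - m) (d - emb a)" using density by blast
  have "age y ((1 - m) + m) ((d - emb a) * c)" by (rule age_mult[OF a m])
  then have "age y 1 (- ((d - emb a) * c))" by simp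
  moreover have "- ((d - emb a) * c) = emb a * c - 1" using cd by (simp add: algebra_simps)
  ultimately have c: "age y 1 (emb a * c - 1)" by simp
  moreover have "a \<noteq> 0" using c by (auto simp: emb_hom)
  ultimately show ?thesis by blast
qed

text \<open>
  Iwasawa decomposition at \<open>z\<close>. Replacing the diagonal entries by powers of the
  polynomial of \<open>z\<close>, and the unipotent part by its polar part, makes the triangular
  factor integral at all other places except \<open>x\<close>.
\<close>
lemma local_lattice_basis:
  assumes z: "z \<noteq> x" and N: "det N \<noteq> 0"
  shows "\<exists>\<gamma>. det \<gamma> \<noteq> 0 \<and> rat_int z (\<gamma> ** N) \<and> (\<forall>y. y \<noteq> x \<longrightarrow> y \<noteq> z \<longrightarrow> rat_int y \<gamma>)"
proof -
  let ?P = "ev (place_poly z)"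
  have P0: "?P \<noteq> 0" using place_poly_neq_0[OF z] by simp
  have vP: "val z (?P powi i) = i" for i unfolding val_power_int place_poly(2)[OF z] by simp
  have vP': "val y (?P powi i) = 0" if "y \<noteq> x" "y \<noteq> z" for y i
    unfolding val_power_int val_place_poly_other[OF z that] by simp
  have Pi0: "?P powi i \<noteq> 0" for i using P0 by simp
  have main: "\<exists>\<gamma>. det \<gamma> \<noteq> 0 \<and> rat_int z (\<gamma> ** mat2 a b c d) \<and> (\<forall>y. y \<noteq> x \<longrightarrow> y \<noteq> z \<longrightarrow> rat_int y \<gamma>)"
    if D: "a * d - b * c \<noteq> 0" and d: "d \<noteq> 0" and cd: "val_ge z (val z d) c" for a b c d
  proof -
    define j where "j = val z d"
    \<comment> \<open>\<open>i\<close> and \<open>j\<close> are the orders of the diagonal entries of the triangular factor\<close>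
    define i where "i = val z (a * d - b * c) - j"
    define u where "u = d * ?P powi (- j)"
    have u: "u \<noteq> 0" "val z u = 0" using d Pi0 by (simp_all add: u_def val_mult vP j_def)
    obtain g where g: "val_ge z 0 (?P powi (- i) * b / u - g)" "\<forall>y. y \<noteq> x \<longrightarrow> y \<noteq> z \<longrightarrow> val_ge y 0 g"
      using polar_part[OF z] by blast
    define \<gamma> where "\<gamma> = mat2 (?P powi (- i)) (- g * ?P powi (- j)) 0 (?P powi (- j))"
    have dg: "det \<gamma> = ?P powi (- i) * ?P powi (- j)" by (simp add: \<gamma>_def det_mat2)
    have gN: "\<gamma> ** mat2 a b c d = mat2 (?P powi (- i) * a - g * ?P powi (- j) * c) (?P powi (- i) * b - g * u)
      (?P powi (- j) * c) u"
      by (simp add: \<gamma>_def mat2_mult u_def mult_ac)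
    have "?P powi (- i) * b - g * u = u * (?P powi (- i) * b / u - g)" using u(1) by (simp add: algebra_simps)
    then have e12: "val_ge z 0 (?P powi (- i) * b - g * u)" using val_ge_mult[of z 0 u 0, OF _ g(1)] u by (simp add: val_ge_def)
    have "val_ge z (- j + j) (?P powi (- j) * c)" using cd by (intro val_ge_mult) (auto simp: val_ge_def vP j_def)
    then have e21: "val_ge z 0 (?P powi (- j) * c)" by simp
    have e22: "val_ge z 0 u" using u by (simp add: val_ge_def)
    have "val_ge z (- i + (i + j)) (?P powi (- i) * (a * d - b * c))"
      by (intro val_ge_mult) (auto simp: val_ge_def vP i_def)
    moreover have "val_ge z (- j) (inverse d)" using d by (simp add: val_ge_def val_inverse j_def)
    ultimately have "val_ge z (- i + (i + j) + - j) (?P powi (- i) * (a * d - b * c) * inverse d)" by (rule val_ge_mult)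
    then have t1: "val_ge z 0 (?P powi (- i) * (a * d - b * c) * inverse d)" by simp
    have "val_ge z (j + - j) (c * inverse d)" using cd d by (intro val_ge_mult) (auto simp: val_ge_def val_inverse j_def)
    then have "val_ge z (0 + 0) (c * inverse d * (?P powi (- i) * b - g * u))" using e12 by (intro val_ge_mult) simp_all
    moreover have "?P powi (- i) * a - g * ?P powi (- j) * c = ?P powi (- i) * (a * d - b * c) * inverse d
      + c * inverse d * (?P powi (- i) * b - g * u)"
      using d by (simp add: u_def field_simps)
    ultimately have e11: "val_ge z 0 (?P powi (- i) * a - g * ?P powi (- j) * c)" using t1 val_ge_add by simp
    have "det (\<gamma> ** mat2 a b c d) = ?P powi (- i) * ?P powi (- j) * (a * d - b * c)" by (simp add: det_mul dg det_mat2)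
    then have "det (\<gamma> ** mat2 a b c d) \<noteq> 0" "val z (det (\<gamma> ** mat2 a b c d)) = 0"
      using D Pi0 P0 by (simp_all add: val_mult vP i_def)
    then have "rat_int z (\<gamma> ** mat2 a b c d)"
      unfolding rat_int_def using e11 e12 e21 e22 by (simp add: gN forall_2)
    moreover have "rat_int y \<gamma>" if y: "y \<noteq> x" "y \<noteq> z" for y
    proof -
      have Py: "val_ge y 0 (?P powi n)" for n using vP'[OF y] by (simp add: val_ge_def)
      have "val_ge y (0 + 0) (- g * ?P powi (- j))" using g(2) y Py by (intro val_ge_mult) auto
      then show ?thesis unfolding rat_int_def dg using Py vP'[OF y] Pi0 P0 by (simp add: \<gamma>_def forall_2 val_mult)
    qed
    moreover have "det \<gamma> \<noteq> 0" unfolding dg using P0 by simp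
    ultimately show ?thesis by blast
  qed
  obtain a b c d where Ne: "N = mat2 a b c d" by (rule mat2_cases)
  have D: "a * d - b * c \<noteq> 0" using N by (simp add: Ne det_mat2)
  show ?thesis
  proof (cases "d \<noteq> 0 \<and> val_ge z (val z d) c")
    case True
    then show ?thesis using main[OF D] Ne by blast
  next
    case False
    have "c \<noteq> 0"
      using False D by (cases "d = 0") auto
    moreover have "val_ge z (val z c) d"
      using False by (cases "d = 0") (auto simp: val_ge_def)
    moreover have "b * c - a * d \<noteq> 0" using D by auto
    ultimately obtain \<gamma> where g: "det \<gamma> \<noteq> 0" "rat_int z (\<gamma> ** mat2 b a d c)" "\<forall>y. y \<noteq> x \<longrightarrow> y \<noteq> z \<longrightarrow> rat_int y \<gamma>"
      using main[of b c a d] by blast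
    have "rat_int z (mat2 0 1 1 0)" using Gam_swap z by (simp add: Gam_def)
    from rat_int_mult[OF g(2) this] have "rat_int z (\<gamma> ** (mat2 b a d c ** mat2 0 1 1 0))"
      by (simp add: matrix_mul_assoc)
    then have "rat_int z (\<gamma> ** N)" by (simp add: mat2_mult Ne)
    then show ?thesis using g by blast
  qed
qed

lemma finite_not_mint: "finite {z. \<not> mint z (gl2_mat (g :: 'k gl2A))}"
proof -
  let ?G = "gl2_mat g"
  have "{z. \<not> mint z ?G} \<subseteq> (\<Union>(i, j)\<in>UNIV. {z. \<not> age z 0 (?G $ i $ j)}) \<union> {z. \<not> aunit z (det ?G)}"
    by (auto simp: mint_def)
  moreover have "finite {z. \<not> aunit z (det ?G)}" using gl2_mat_det[of g] finite_not_aunit by blast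
  ultimately show ?thesis
    by (elim finite_subset) (auto intro!: finite_UN_I finite_not_age)
qed

text \<open>
  Strong approximation. The finitely many places other than \<open>x\<close> at which
  \<open>g\<close> is not integral are corrected one at a time by a rational matrix that is integral
  at the remaining ones; then \<open>g\<close> is approximated at \<open>x\<close>.
\<close>
lemma adelic_decomposition:
  "\<exists>h M k. h \<in> rational_points \<and> det M \<noteq> 0 \<and> k \<in> Kx \<and> g = h * loc x M * k"
proof (induction "card {z. z \<noteq> x \<and> \<not> mint z (gl2_mat g)}" arbitrary: g rule: less_induct)
  case less
  let ?bad = "\<lambda>g. {z. z \<noteq> x \<and> \<not> mint z (gl2_mat g)}"
  have fin: "finite (?bad g)" for g by (rule finite_subset[OF _ finite_not_mint[of g]]) auto
  show ?case
  proof (cases "?bad g = {}")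
    case True
    obtain M where M: "det M \<noteq> 0" "mcong x (emat M ** gl2_mat g)" using matrix_density by blast
    note i = matrix_inv_2[OF M(1)]
    have "loc x M * g \<in> Kx"
    proof (rule KxI)
      show "mcong x (gl2_mat (loc x M * g))" using M(2) maeq_mcong[OF maeq_loc_mult(1)[OF M(1)]] by blast
      fix z assume "z \<noteq> x"
      then show "mint z (gl2_mat (loc x M * g))" using True maeq_mint[OF maeq_loc_mult(2)[OF M(1)]] by blast
    qed
    moreover have "loc x (matrix_inv M) * loc x M = 1" using i M(1) by (simp add: loc_mult loc_one)
    then have "g = 1 * loc x (matrix_inv M) * (loc x M * g)" by (simp add: mult.assoc[symmetric])
    ultimately show ?thesis using rational_points_one i(4) by blast
  next
    case False
    then obtain z where z: "z \<noteq> x" "\<not> mint z (gl2_mat g)" by blast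
    obtain M where M: "det M \<noteq> 0" "mcong z (emat M ** gl2_mat g)" using matrix_density by blast
    note i = matrix_inv_2[OF M(1)]
    obtain \<gamma> where \<gamma>: "det \<gamma> \<noteq> 0" "rat_int z (\<gamma> ** matrix_inv M)" "\<forall>y. y \<noteq> x \<longrightarrow> y \<noteq> z \<longrightarrow> rat_int y \<gamma>"
      using local_lattice_basis[OF z(1) i(4)] by blast
    have m: "gl2_mat (rat \<gamma> * g) = emat \<gamma> ** gl2_mat g" by (simp add: gl2_mat_mult gl2_mat_rat \<gamma>(1))
    have "\<gamma> = (\<gamma> ** matrix_inv M) ** M" by (simp only: matrix_mul_assoc[symmetric] i(2) matrix_mul_rid)
    then have "emat \<gamma> ** gl2_mat g = emat (\<gamma> ** matrix_inv M) ** (emat M ** gl2_mat g)"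
      by (simp only: matrix_mul_assoc emat_mult[symmetric])
    then have mz: "mint z (gl2_mat (rat \<gamma> * g))"
      unfolding m using \<gamma>(2) mcong_imp_mint[OF M(2)] by (simp add: mint_mult mint_emat)
    have "?bad (rat \<gamma> * g) \<subset> ?bad g"
    proof
      show "?bad (rat \<gamma> * g) \<subseteq> ?bad g"
      proof
        fix y assume y: "y \<in> ?bad (rat \<gamma> * g)"
        then have "y \<noteq> z" using mz by blast
        then have "rat_int y \<gamma>" using \<gamma>(3) y by blast
        then show "y \<in> ?bad g" using y unfolding m by (auto simp: mint_mult mint_emat)
      qed
      show "?bad (rat \<gamma> * g) \<noteq> ?bad g" using z mz by blast
    qed
    then have "card (?bad (rat \<gamma> * g)) < card (?bad g)" by (rule psubset_card_mono[OF fin])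
    from less[OF this] obtain h N k where h: "h \<in> rational_points" "det N \<noteq> 0" "k \<in> Kx" "rat \<gamma> * g = h * loc x N * k" by blast
    have "g = ginv (rat \<gamma>) * (rat \<gamma> * g)" by simp
    also have "\<dots> = (ginv (rat \<gamma>) * h) * loc x N * k" unfolding h(4) by (simp add: mult.assoc)
    finally have "g = (ginv (rat \<gamma>) * h) * loc x N * k" .
    moreover have "ginv (rat \<gamma>) * h \<in> rational_points"
      using \<gamma>(1) h(1) rational_points_iff by (intro rational_points_mult rational_points_ginv) blast+
    ultimately show ?thesis using h by blast
  qed
qed

text \<open>
  The polynomials in \<open>1/t\<close> have class number one: a power of the polynomial of
  \<open>z\<close> corrects the order at \<open>z\<close> and is a unit at the other places except
  \<open>x\<close>.
\<close>
lemma idele_unit_outside_x: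
  fixes c d :: "'k adele"
  assumes "c * d = 1"
  shows "\<exists>e. e \<noteq> 0 \<and> (\<forall>z. z \<noteq> x \<longrightarrow> aunit z (emb e * c))"
  using assms
proof (induction "card {z. z \<noteq> x \<and> \<not> aunit z c}" arbitrary: c d rule: less_induct)
  case less
  let ?bad = "\<lambda>c. {z. z \<noteq> x \<and> \<not> aunit z c}"
  have fin: "finite (?bad c)" by (rule finite_subset[OF _ finite_not_aunit[OF less.prems]]) auto
  show ?case
  proof (cases "?bad c = {}")
    case True
    then have "\<forall>z. z \<noteq> x \<longrightarrow> aunit z c" by blast
    then have "\<forall>z. z \<noteq> x \<longrightarrow> aunit z (emb 1 * c)" by (simp only: emb_hom mult_1_left)
    then show ?thesis by (intro exI[of _ 1] conjI one_neq_zero)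
  next
    case False
    then obtain z where z: "z \<noteq> x" "\<not> aunit z c" by blast
    obtain a where a: "a \<noteq> 0" "age z 1 (emb a * c - 1)" using idele_density[OF less.prems] by blast
    let ?P = "ev (place_poly z)"
    define f where "f = ?P powi (val z a)"
    have P0: "?P \<noteq> 0" using place_poly_neq_0[OF z(1)] by simp
    have f: "f \<noteq> 0" "val z f = val z a" unfolding f_def val_power_int place_poly(2)[OF z(1)] using P0 by simp_all
    have f': "val y f = 0" if "y \<noteq> x" "y \<noteq> z" for y
      unfolding f_def val_power_int val_place_poly_other[OF z(1) that] by simp
    have "aunit z (emb a * c)" using aunit_cong[OF a(2)] by simp
    moreover have "aunit z (emb (f / a))" using f a(1) by (simp add: aunit_emb val_divide)
    ultimately have "aunit z (emb (f / a) * (emb a * c))" by (rule aunit_mult[rotated])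
    then have uz: "aunit z (emb f * c)" using a(1) by (simp add: mult.assoc[symmetric] emb_hom(4)[symmetric])
    have "emb f * c * (emb (inverse f) * d) = (emb f * emb (inverse f)) * (c * d)" by (simp add: mult_ac)
    then have inv: "emb f * c * (emb (inverse f) * d) = 1" by (simp add: emb_inverse f(1) less.prems)
    have "?bad (emb f * c) \<subset> ?bad c"
    proof
      show "?bad (emb f * c) \<subseteq> ?bad c"
      proof
        fix y assume y: "y \<in> ?bad (emb f * c)"
        then have "y \<noteq> z" using uz by blast
        then have "aunit y (emb f)" using f' y f(1) by (simp add: aunit_emb)
        then show "y \<in> ?bad c" using y aunit_mult by blast
      qed
      show "?bad (emb f * c) \<noteq> ?bad c" using z uz by blast
    qed
    then have "card (?bad (emb f * c)) < card (?bad c)" by (rule psubset_card_mono[OF fin])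
    from less.hyps[OF this inv] obtain e where "e \<noteq> 0" "\<forall>z. z \<noteq> x \<longrightarrow> aunit z (emb (e * f) * c)"
      by (auto simp: emb_hom mult.assoc)
    then show ?thesis using f(1) by (intro exI[of _ "e * f"]) simp
  qed
qed

lemma gl2_mat_rat_scalar: "e \<noteq> 0 \<Longrightarrow> gl2_mat (rat (scalar_mat e)) = scalar_mat (emb e)"
proof -
  assume "e \<noteq> 0"
  then have "det (scalar_mat e) \<noteq> 0" by (simp add: det_mat2)
  from gl2_mat_rat[OF this] show ?thesis by (simp only:) (rule matrix_2_eqI; simp add: emb_hom)
qed

lemma agree_scal: "c * d = 1 \<Longrightarrow> aeq y c (emb e) \<Longrightarrow> agree y (scal c) (scalar_mat e)"
  unfolding agree_def maeq_def by (simp add: gl2_mat_scal forall_2 emb_hom)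

text \<open>
  The two placements differ on the right by \<open>k\<close> at \<open>x\<close> and by the inverse
  of \<open>\<gamma>\<close> at the other places, where \<open>\<gamma>\<close> is integral.
\<close>
lemma DC_loc_if_equi:
  assumes "equi M N" "det N \<noteq> 0" shows "det M \<noteq> 0" "loc x M \<in> DC (loc x N)"
proof -
  obtain e \<gamma> k where h: "e \<noteq> 0" "Gam \<gamma>" "rat_cong x k" "M = scalar_mat e ** (\<gamma> ** (N ** k))"
    using assms unfolding equi_def by blast
  have dk: "det k \<noteq> 0" using rat_cong_imp_rat_int[OF h(3)] by (simp add: rat_int_def)
  note dg = Gam_det_nz[OF h(2)]
  show dM: "det M \<noteq> 0" using h(1) dk dg assms(2) by (simp add: h(4) det_mul det_mat2)
  define c where "c = splice x (emb e) 1"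
  define d where "d = splice x (emb (inverse e)) 1"
  have cd: "c * d = 1"
  proof (rule adele_eq_aeqI)
    fix z
    show "aeq z (c * d) 1"
    proof (cases "z = x")
      case True
      have "aeq x (c * d) (emb e * emb (inverse e))" unfolding c_def d_def by (intro aeq_mult aeq_splice)
      then show ?thesis using True h(1) by (simp add: emb_inverse)
    next
      case False
      have "aeq z (c * d) (1 * 1)" unfolding c_def d_def using aeq_splice(2)[OF False] aeq_splice(2)[OF False] by (rule aeq_mult)
      then show ?thesis by simp
    qed
  qed
  define p where "p = rat \<gamma> * loc x N * scal c"
  have "aeq x c (emb e)" unfolding c_def by (rule aeq_splice)
  then have px: "agree x p (\<gamma> ** N ** scalar_mat e)"
    unfolding p_def by (intro agree_mult agree_rat agree_loc agree_scal[OF cd] dg assms(2))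
  have pz: "agree z p \<gamma>" if "z \<noteq> x" for z
  proof -
    have "aeq z c (emb 1)" unfolding c_def emb_hom(2) using that by (rule aeq_splice)
    then have "agree z p (\<gamma> ** mat 1 ** scalar_mat 1)"
      unfolding p_def using that by (intro agree_mult agree_rat agree_loc agree_scal[OF cd] dg assms(2))
    then show ?thesis by (simp only: mat2_mat1[symmetric] matrix_mul_rid)
  qed
  define \<kappa> where "\<kappa> = ginv p * loc x M"
  have Meq: "M = \<gamma> ** N ** scalar_mat e ** k"
    unfolding h(4) by (simp only: matrix_mul_assoc scalar_mat_commute[of "\<gamma> ** N"])
  have "\<kappa> \<in> Kx"
  proof (rule KxI)
    let ?A = "\<gamma> ** N ** scalar_mat e"
    have dA: "det ?A \<noteq> 0" using dg assms(2) h(1) by (simp add: det_mul det_mat2)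
    note i = matrix_inv_2[OF dA]
    have "agree x \<kappa> (matrix_inv ?A ** M)"
      unfolding \<kappa>_def by (intro agree_mult agree_ginv[OF px i(1)] agree_loc dM)
    moreover have "matrix_inv ?A ** M = (matrix_inv ?A ** ?A) ** k" unfolding Meq by (simp only: matrix_mul_assoc)
    ultimately have "agree x \<kappa> k" by (simp only: i(2) matrix_mul_lid)
    then show "mcong x (gl2_mat \<kappa>)" using h(3) agree_mcong by blast
  next
    fix z assume z: "z \<noteq> x"
    note i = matrix_inv_2[OF dg]
    have "agree z \<kappa> (matrix_inv \<gamma> ** mat 1)"
      unfolding \<kappa>_def by (intro agree_mult agree_ginv[OF pz[OF z] i(1)] agree_loc dM z)
    then have "agree z \<kappa> (matrix_inv \<gamma>)" by (simp only: matrix_mul_rid)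
    moreover have "rat_int z (matrix_inv \<gamma>)" using Gam_inverse[OF h(2) i(1)] z by (simp add: Gam_def)
    ultimately show "mint z (gl2_mat \<kappa>)" using agree_mint by blast
  qed
  moreover have "loc x M = rat \<gamma> * loc x N * scal c * \<kappa>" unfolding \<kappa>_def p_def[symmetric] by simp
  moreover have "rat \<gamma> \<in> rational_points" using dg rational_points_iff by blast
  ultimately show "loc x M \<in> DC (loc x N)" unfolding double_coset_def using scal_center[OF cd] by blast
qed

text \<open>
  A rational scalar makes the central idele a unit outside \<open>x\<close>. Moved into the rational
  matrix, it makes this one an element of the arithmetic group. At \<open>x\<close> the remaining
  scalar agrees with a rational one up to a factor congruent to 1.
\<close>
lemma equi_if_DC_loc:
  assumes dM: "det M \<noteq> 0" and dN: "det N \<noteq> 0" and "loc x M \<in> DC (loc x N)"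
  shows "equi M N"
proof -
  obtain \<gamma> z k where h: "det \<gamma> \<noteq> 0" "z \<in> center" "k \<in> Kx" "loc x M = rat \<gamma> * loc x N * z * k"
    using assms(3) unfolding double_coset_def rational_points_iff by blast
  obtain c d where cd: "c * d = 1" "z = scal c" using h(2) center_iff by blast
  obtain e where e: "e \<noteq> 0" "\<forall>z. z \<noteq> x \<longrightarrow> aunit z (emb e * c)" using idele_unit_outside_x[OF cd(1)] by blast
  define c1 where "c1 = emb e * c"
  define d1 where "d1 = emb (inverse e) * d"
  have cd1: "c1 * d1 = 1"
  proof -
    have "c1 * d1 = (emb e * emb (inverse e)) * (c * d)" by (simp add: c1_def d1_def mult_ac)
    then show ?thesis by (simp add: emb_inverse e(1) cd(1))
  qed
  obtain a where a: "a \<noteq> 0" "age x 1 (emb a * c1 - 1)" using idele_density[OF cd1] by blast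
  define \<gamma>0 where "\<gamma>0 = scalar_mat (inverse e) ** \<gamma>"
  have d0: "det \<gamma>0 \<noteq> 0" using h(1) e(1) by (simp add: \<gamma>0_def det_mul det_mat2)
  have eq: "loc x M = rat \<gamma>0 * loc x N * (scal c1 * k)"
  proof -
    have re: "gl2_mat (rat (scalar_mat e)) = scalar_mat (emb e)" by (rule gl2_mat_rat_scalar[OF e(1)])
    have s: "scal c1 = rat (scalar_mat e) * scal c"
      unfolding gl2_mat_inject[symmetric] gl2_mat_mult re gl2_mat_scal[OF cd1] gl2_mat_scal[OF cd(1)] scalar_mat_mult
      by (simp only: c1_def)
    have comm: "loc x N * rat (scalar_mat e) = rat (scalar_mat e) * loc x N"
      unfolding gl2_mat_inject[symmetric] gl2_mat_mult re by (rule scalar_mat_commute)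
    have "rat \<gamma>0 * loc x N * (scal c1 * k) = rat \<gamma>0 * (loc x N * rat (scalar_mat e)) * scal c * k"
      unfolding s by (simp only: mult.assoc)
    also have "\<dots> = rat \<gamma>0 * rat (scalar_mat e) * loc x N * scal c * k"
      unfolding comm by (simp only: mult.assoc)
    also have "rat \<gamma>0 * rat (scalar_mat e) = rat \<gamma>"
    proof -
      have "\<gamma>0 ** scalar_mat e = scalar_mat e ** \<gamma>0" by (rule scalar_mat_commute)
      also have "\<dots> = (scalar_mat e ** scalar_mat (inverse e)) ** \<gamma>"
        unfolding \<gamma>0_def by (simp only: matrix_mul_assoc)
      also have "\<dots> = \<gamma>" using e(1) by (simp add: scalar_mat_mult matrix_mul_lid flip: mat2_mat1)
      finally show ?thesis using d0 e(1) by (simp add: rat_mult det_mat2)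
    qed
    finally show ?thesis unfolding h(4) cd(2) by simp
  qed
  have "Gam \<gamma>0" unfolding Gam_def
  proof (intro allI impI)
    fix z assume z: "z \<noteq> x"
    have u: "aunit z c1" using e(2) z by (simp add: c1_def)
    have "mint z (gl2_mat (scal c1))"
      unfolding gl2_mat_scal[OF cd1] mint_def using u by (simp add: forall_2 det_mat2 aunit_mult) (simp add: aunit_def)
    then have m: "mint z (gl2_mat (scal c1 * k))" unfolding gl2_mat_mult using h(3) by (intro mint_mult) (auto simp: Kx_iff)
    have "rat \<gamma>0 = loc x M * ginv (scal c1 * k) * ginv (loc x N)"
    proof -
      have "a = a * b * u * ginv u * ginv b" for a b u :: "'k gl2A" by (simp add: mult.assoc ginv)
      from this[of "rat \<gamma>0" "loc x N" "scal c1 * k"] show ?thesis unfolding eq .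
    qed
    moreover have "mint z (gl2_mat (loc x M))" using agree_mint[OF agree_loc(2)[OF dM z]] by simp
    moreover have "mint z (gl2_mat (ginv (loc x N)))"
      using agree_mint[OF agree_loc(2)[OF dN z]] mint_inverse[OF _ ginv_mat(1)] by simp
    ultimately have "mint z (gl2_mat (rat \<gamma>0))"
      using mint_inverse[OF m ginv_mat(1)] by (simp add: gl2_mat_mult mint_mult)
    then show "rat_int z \<gamma>0" using agree_mint[OF agree_rat[OF d0]] by simp
  qed
  moreover
  let ?A = "\<gamma>0 ** N"
  have dA: "det ?A \<noteq> 0" using d0 dN by (simp add: det_mul)
  note i = matrix_inv_2[OF dA]
  define k' where "k' = scalar_mat a ** (matrix_inv ?A ** M)"
  have "rat_cong x k'"
  proof -
    have "agree x (ginv (rat \<gamma>0 * loc x N)) (matrix_inv ?A)"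
      by (intro agree_ginv[OF _ i(1)] agree_mult agree_rat agree_loc d0 dN)
    then have "agree x (ginv (rat \<gamma>0 * loc x N) * loc x M) (matrix_inv ?A ** M)"
      by (intro agree_mult agree_loc dM)
    moreover have "ginv (rat \<gamma>0 * loc x N) * loc x M = scal c1 * k" unfolding eq by simp
    ultimately have ag: "agree x (scal c1 * k) (matrix_inv ?A ** M)" by simp
    have "det (scalar_mat a) \<noteq> 0" using a(1) by (simp add: det_mat2)
    from agree_mult[OF agree_rat[OF this] ag] have "agree x (rat (scalar_mat a) * (scal c1 * k)) k'"
      unfolding k'_def .
    moreover have "mcong x (gl2_mat (rat (scalar_mat a) * (scal c1 * k)))"
    proof -
      have "gl2_mat (rat (scalar_mat a) * scal c1) = mat2 (emb a * c1) 0 0 (emb a * c1)"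
        unfolding gl2_mat_mult gl2_mat_rat_scalar[OF a(1)] gl2_mat_scal[OF cd1] scalar_mat_mult ..
      then have "mcong x (gl2_mat (rat (scalar_mat a) * scal c1))"
        using a(2) by (simp add: mcong_def forall_2 mat1_2)
      then show ?thesis using h(3) unfolding mult.assoc[symmetric] by (subst gl2_mat_mult) (auto intro!: mcong_mult simp: Kx_iff)
    qed
    ultimately show ?thesis using agree_mcong by blast
  qed
  moreover have "M = scalar_mat (inverse a) ** (\<gamma>0 ** (N ** k'))"
  proof -
    have "\<gamma>0 ** (N ** k') = (?A ** scalar_mat a) ** (matrix_inv ?A ** M)" unfolding k'_def by (simp only: matrix_mul_assoc)
    also have "\<dots> = scalar_mat a ** ((?A ** matrix_inv ?A) ** M)" unfolding scalar_mat_commute[of ?A] by (simp only: matrix_mul_assoc)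
    also have "\<dots> = scalar_mat a ** M" by (simp only: i(1) matrix_mul_lid)
    finally show ?thesis using a(1) by (simp add: matrix_mul_assoc scalar_mat_mult matrix_mul_lid flip: mat2_mat1)
  qed
  ultimately show "equi M N" unfolding equi_def using a(1) by (metis inverse_zero_imp_zero)
qed

end

section \<open>The Hecke operator as a finite sum\<close>

lemma local_open_congruence:
  fixes z :: "'k::{field,finite} place"
  assumes c: "c \<in> carrier (local_field z)"
  shows "local_open z {X \<in> carrier (local_field z). local_ge z 1 (X \<ominus>\<^bsub>local_field z\<^esub> c)}"
  unfolding local_open_def
proof (intro conjI ballI exI[of _ 1] impI)
  interpret L: cring "local_field z" by (rule local_field_cring)
  fix a b assume a: "a \<in> {X \<in> carrier (local_field z). local_ge z 1 (X \<ominus>\<^bsub>local_field z\<^esub> c)}"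
    and b: "b \<in> carrier (local_field z)" and ab: "local_abs z (b \<ominus>\<^bsub>local_field z\<^esub> a) < 1"
  define e where "e = b \<ominus>\<^bsub>local_field z\<^esub> a"
  have ac: "a \<in> carrier (local_field z)" using a by simp
  have ec: "e \<in> carrier (local_field z)" unfolding e_def using ac b by simp
  have "local_ge z 1 e"
  proof (cases "e = \<zero>\<^bsub>local_field z\<^esub>")
    case True
    then show ?thesis by (simp add: local_ge_zero)
  next
    case False
    have "1 \<le> local_val z e"
    proof (rule ccontr)
      assume "\<not> 1 \<le> local_val z e"
      then have "0 \<le> - (int (place_degree z) * local_val z e)" by (simp add: mult_nonneg_nonpos)
      then have "1 \<le> real CARD('k) powi (- (int (place_degree z) * local_val z e))"
        by (intro one_le_power_int) (simp_all add: Suc_leI)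
      then show False using ab False by (simp add: local_abs_def e_def[symmetric])
    qed
    then show ?thesis using local_ge_iff_local_val[OF ec False] by simp
  qed
  moreover have "b \<ominus>\<^bsub>local_field z\<^esub> c = e \<oplus>\<^bsub>local_field z\<^esub> (a \<ominus>\<^bsub>local_field z\<^esub> c)"
    unfolding e_def using ac b c by (simp add: a_minus_def L.a_assoc) (simp add: L.a_assoc[symmetric] L.l_neg)
  ultimately have "local_ge z 1 (b \<ominus>\<^bsub>local_field z\<^esub> c)"
    using a ec ac c by (simp add: local_ge_add)
  then show "b \<in> {X \<in> carrier (local_field z). local_ge z 1 (X \<ominus>\<^bsub>local_field z\<^esub> c)}" using b by simp
qed auto

text \<open>
  A translate of a set of positive measure is measurable: otherwise its measure would be 0 by
  convention, contradicting invariance.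
\<close>
lemma haar_translate:
  assumes "haar_measure \<mu>" "A \<in> sets \<mu>" "0 < emeasure \<mu> A"
  shows "(\<lambda>h. g * h) ` A \<in> sets \<mu>" "emeasure \<mu> ((\<lambda>h. g * h) ` A) = emeasure \<mu> A"
proof -
  show e: "emeasure \<mu> ((\<lambda>h. g * h) ` A) = emeasure \<mu> A" using assms by (simp add: haar_measure_def)
  show "(\<lambda>h. g * h) ` A \<in> sets \<mu>"
  proof (rule ccontr)
    assume "(\<lambda>h. g * h) ` A \<notin> sets \<mu>"
    then have "emeasure \<mu> ((\<lambda>h. g * h) ` A) = 0" by (rule emeasure_notin_sets)
    then show False using e assms(3) by simp
  qed
qed

context origin_place
begin

lemma open_adele_congruence: "open {a :: 'k adele. (\<forall>z. age z 0 a) \<and> age x 1 (a - c)}"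
  unfolding open_adele_def
proof
  fix a assume a: "a \<in> {a. (\<forall>z. age z 0 a) \<and> age x 1 (a - c)}"
  define W where "W z = (if z = x then {X \<in> carrier (local_field x). local_ge x 1 (X \<ominus>\<^bsub>local_field x\<^esub> adele_at a x)}
    else carrier (integer_ring z))" for z
  have "\<forall>z. local_open z (W z)"
    unfolding W_def using local_open_congruence[OF adele_at_closed] local_open_integers by auto
  moreover have "finite {z. W z \<noteq> carrier (integer_ring z)}"
    by (rule finite_subset[of _ "{x}"]) (auto simp: W_def)
  moreover have at_W: "adele_at b x \<in> W x \<longleftrightarrow> age x 1 (b - a)" for b
    by (simp add: W_def adele_at_closed age_def adele_at_diff)
  have "\<forall>z. adele_at a z \<in> W z"
  proof
    fix z show "adele_at a z \<in> W z"
      using a at_W[of a] by (cases "z = x") (auto simp: W_def age_0_iff[symmetric])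
  qed
  moreover have "{b. \<forall>z. adele_at b z \<in> W z} \<subseteq> {a. (\<forall>z. age z 0 a) \<and> age x 1 (a - c)}"
  proof
    fix b assume "b \<in> {b. \<forall>z. adele_at b z \<in> W z}"
    then have b: "adele_at b z \<in> W z" for z by simp
    have bx: "age x 1 (b - a)" using b at_W by blast
    have "b - c = (b - a) + (a - c)" by simp
    moreover have "age x 1 ((b - a) + (a - c))" using bx a by (intro age_add) simp_all
    ultimately have "age x 1 (b - c)" by simp
    moreover have "age z 0 b" for z
    proof (cases "z = x")
      case True
      have "age x 0 (b - a)" using bx by (rule age_mono) simp
      then show ?thesis using True a age_cancel[of x 0 b a] by simp
    next
      case False
      then show ?thesis using b[of z] by (simp add: W_def age_0_iff)
    qed
    ultimately show "b \<in> {a. (\<forall>z. age z 0 a) \<and> age x 1 (a - c)}" by simp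
  qed
  ultimately show "\<exists>W. (\<forall>y. local_open y (W y)) \<and> finite {y. W y \<noteq> carrier (integer_ring y)} \<and>
    (\<forall>y. adele_at a y \<in> W y) \<and> {b. \<forall>y. adele_at b y \<in> W y} \<subseteq> {a. (\<forall>z. age z 0 a) \<and> age x 1 (a - c)}"
    by (intro exI[of _ W] conjI)
qed

lemma open_matrix_entries:
  assumes "\<And>i j. open (U i j :: 'k adele set)"
  shows "open {M :: 'k adele^2^2. \<forall>i j. M $ i $ j \<in> U i j}"
proof -
  have row: "open {v :: 'k adele^2. \<forall>j. v $ j \<in> U i j}" for i
    unfolding open_vec_def
  proof
    fix v :: "'k adele^2" assume "v \<in> {v. \<forall>j. v $ j \<in> U i j}"
    then show "\<exists>A. (\<forall>j. open (A j) \<and> v $ j \<in> A j) \<and> (\<forall>w. (\<forall>j. w $ j \<in> A j) \<longrightarrow> w \<in> {v. \<forall>j. v $ j \<in> U i j})"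
      using assms by (intro exI[of _ "U i"]) simp
  qed
  have "open {M :: 'k adele^2^2. \<forall>i. M $ i \<in> {v. \<forall>j. v $ j \<in> U i j}}"
  proof (subst open_vec_def, rule ballI)
    fix M :: "'k adele^2^2" assume "M \<in> {M. \<forall>i. M $ i \<in> {v. \<forall>j. v $ j \<in> U i j}}"
    then have M: "M $ i \<in> {v. \<forall>j. v $ j \<in> U i j}" for i by simp
    define A where "A i = {v :: 'k adele^2. \<forall>j. v $ j \<in> U i j}" for i
    show "\<exists>A. (\<forall>i. open (A i) \<and> M $ i \<in> A i) \<and>
        (\<forall>N. (\<forall>i. N $ i \<in> A i) \<longrightarrow> N \<in> {M. \<forall>i. M $ i \<in> {v. \<forall>j. v $ j \<in> U i j}})"
    proof (intro exI[of _ A] conjI allI impI)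
      fix i
      show "open (A i)" unfolding A_def by (rule row)
      show "M $ i \<in> A i" unfolding A_def by (rule M)
    next
      fix N :: "'k adele^2^2" assume "\<forall>i. N $ i \<in> A i"
      then show "N \<in> {M. \<forall>i. M $ i \<in> {v. \<forall>j. v $ j \<in> U i j}}" unfolding A_def by (rule CollectI)
    qed
  qed
  then show ?thesis by simp
qed

text \<open>
  If \<open>g\<close> and its inverse have integral entries, the determinant is a unit, so
  membership is an open condition on the entries of \<open>g\<close> and of its inverse.
\<close>
lemma open_Kx: "open Kx"
proof -
  define U where "U i j = {a :: 'k adele. (\<forall>z. age z 0 a) \<and> age x 1 (a - mat 1 $ i $ j)}" for i j :: 2
  define A where "A = {M :: 'k adele^2^2. \<forall>i j. M $ i $ j \<in> U i j}"
  have "open A" unfolding A_def by (rule open_matrix_entries) (simp add: U_def open_adele_congruence)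
  then have "open (A \<times> A)" by (rule open_Times) fact
  have A: "M \<in> A \<longleftrightarrow> (\<forall>i j z. age z 0 (M $ i $ j)) \<and> mcong x M" for M
    by (auto simp: A_def U_def mcong_def)
  have "Kx = (\<lambda>g. (gl2_mat g, matrix_inv (gl2_mat g))) -` (A \<times> A)"
  proof (intro equalityI subsetI)
    fix g assume g: "g \<in> Kx"
    then show "g \<in> (\<lambda>g. (gl2_mat g, matrix_inv (gl2_mat g))) -` (A \<times> A)"
      using Kx_ginv[OF g] by (simp add: matrix_inv_gl2 A Kx_iff mint_def)
  next
    fix g assume "g \<in> (\<lambda>g. (gl2_mat g, matrix_inv (gl2_mat g))) -` (A \<times> A)"
    then have g: "gl2_mat g \<in> A" "gl2_mat (ginv g) \<in> A" by (simp_all add: matrix_inv_gl2)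
    have det0: "age z 0 (det M)" if "M \<in> A" for M z
    proof -
      have "age z (0 + 0) (M $ i $ j * M $ i' $ j')" for i j i' j'
        using that by (intro age_mult) (auto simp: A)
      then show ?thesis unfolding det_2 by (intro age_diff) auto
    qed
    have "aunit z (det (gl2_mat g))" for z
    proof -
      have e: "det (gl2_mat g) * det (gl2_mat (ginv g)) = 1" by (metis det_I det_mul ginv_mat(1))
      have "\<not> age z 1 (det (gl2_mat g))"
      proof
        assume "age z 1 (det (gl2_mat g))"
        from age_mult[OF this det0[OF g(2)]] show False unfolding e by simp
      qed
      then show ?thesis using det0[OF g(1)] by (simp add: aunit_def)
    qed
    then show "g \<in> Kx" using g(1) by (simp add: A Kx_iff mint_def)
  qed
  then show ?thesis unfolding open_gl2A_def using \<open>open (A \<times> A)\<close> by blast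
qed

text \<open>
  The subgroup is open and contained in the maximal compact subgroup, which is measurable since its
  measure is not 0.
\<close>
lemma measure_Kx:
  assumes "haar_measure \<mu>" "emeasure \<mu> max_compact = 1"
  shows "Kx \<in> sets \<mu>" "0 < emeasure \<mu> Kx" "emeasure \<mu> Kx < \<infinity>"
proof -
  show "Kx \<in> sets \<mu>" using assms(1) open_Kx by (simp add: haar_measure_def)
  show "0 < emeasure \<mu> Kx" using assms(1) open_Kx Kx_one unfolding haar_measure_def by blast
  have "max_compact \<in> sets \<mu>"
  proof (rule ccontr)
    assume "max_compact \<notin> sets \<mu>"
    then show False using assms(2) emeasure_notin_sets by fastforce
  qed
  moreover have "Kx \<subseteq> max_compact" by (auto simp: Kx_iff max_compact_iff)
  ultimately have "emeasure \<mu> Kx \<le> emeasure \<mu> max_compact" by (intro emeasure_mono)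
  then have "emeasure \<mu> Kx \<le> 1" using assms(2) by simp
  then show "emeasure \<mu> Kx < \<infinity>" by (rule le_less_trans) simp
qed

text \<open>Representatives of the cosets in the Hecke double coset at \<open>y\<close>, indexed by the points of the
  projective line over the residue field; \<open>None\<close> is the point at infinity.\<close>
definition hecke_mat :: "'k place \<Rightarrow> 'k poly option \<Rightarrow> 'k ratfun^2^2"
  where "hecke_mat y i = (case i of None \<Rightarrow> mat2 1 0 0 (ev (place_poly y)) | Some b \<Rightarrow> mat2 (ev (place_poly y)) (ev b) 0 1)"

definition hecke_index :: "'k place \<Rightarrow> 'k poly option set"
  where "hecke_index y = insert None (Some ` {b. degree b < degree (place_poly y)})"

lemma finite_hecke_index: "finite (hecke_index y)"
  unfolding hecke_index_def by (intro finite.insertI finite_imageI finite_low_degree)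

context
  fixes y :: "'k place" and p :: "'k ratfun"
  assumes yx: "y \<noteq> x" and vp: "val y p = 1"
begin

lemma p_neq_0: "p \<noteq> 0"
  using vp by auto

abbreviation "Py \<equiv> ev (place_poly y)"

lemma Py: "Py \<noteq> 0" "val y Py = 1"
  using place_poly_neq_0[OF yx] place_poly(2)[OF yx] by simp_all

lemma det_hecke_mat: "det (hecke_mat y i) = Py" "det (hecke_mat y i) \<noteq> 0"
  using Py by (simp_all add: hecke_mat_def det_mat2 split: option.split)

lemma loc_Kx: "rat_int y U \<Longrightarrow> loc y U \<in> Kx"
proof -
  assume U: "rat_int y U"
  then have d: "det U \<noteq> 0" by (simp add: rat_int_def)
  show ?thesis
  proof (rule KxI)
    show "mcong x (gl2_mat (loc y U))" using agree_mcong[OF agree_loc(2)[OF d]] yx by simp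
    fix z show "mint z (gl2_mat (loc y U))"
      using agree_mint[OF agree_loc(1)[OF d]] agree_mint[OF agree_loc(2)[OF d]] U by (cases "z = y") simp_all
  qed
qed

definition "hecke_double_coset \<equiv> {k * loc y (mat2 p 0 0 1) * k' | k k'. k \<in> Kx \<and> k' \<in> Kx}"

abbreviation "hrep i \<equiv> loc y (hecke_mat y i)"

lemma hrep_in: "hrep i \<in> hecke_double_coset"
proof -
  have v: "val y (Py / p) = 0" "Py / p \<noteq> 0" using Py vp p_neq_0 by (simp_all add: val_divide)
  then have v0: "val_ge y 0 (Py / p)" by (simp add: val_ge_def)
  have dp: "det (mat2 p 0 0 1) \<noteq> 0" using p_neq_0 by (simp add: det_mat2)
  have prod: "hrep i \<in> hecke_double_coset"
    if "hecke_mat y i = U ** mat2 p 0 0 1 ** V" "rat_int y U" "rat_int y V" for U V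
  proof -
    have d: "det U \<noteq> 0" "det V \<noteq> 0" using that by (simp_all add: rat_int_def)
    then have "hrep i = loc y U * loc y (mat2 p 0 0 1) * loc y V"
      unfolding that(1) using dp by (simp add: loc_mult det_mul)
    then show ?thesis unfolding hecke_double_coset_def using loc_Kx that(2,3) by blast
  qed
  show ?thesis
  proof (cases i)
    case None
    have "hecke_mat y i = mat2 0 1 1 0 ** mat2 p 0 0 1 ** mat2 0 (Py / p) 1 0"
      using p_neq_0 by (simp add: None hecke_mat_def mat2_mult)
    moreover have "rat_int y (mat2 0 1 1 0)" using Gam_swap yx by (simp add: Gam_def)
    moreover have "rat_int y (mat2 0 (Py / p) 1 0)"
      unfolding rat_int_def using v v0 by (simp add: forall_2 det_mat2)
    ultimately show ?thesis by (rule prod)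
  next
    case (Some b)
    have "hecke_mat y i = mat2 1 (ev b) 0 1 ** mat2 p 0 0 1 ** mat2 (Py / p) 0 0 1"
      using p_neq_0 by (simp add: Some hecke_mat_def mat2_mult)
    moreover have "rat_int y (mat2 1 (ev b) 0 1)"
      unfolding rat_int_def using val_ge_ev_finite[OF yx] by (simp add: forall_2 det_mat2)
    moreover have "rat_int y (mat2 (Py / p) 0 0 1)"
      unfolding rat_int_def using v v0 by (simp add: forall_2 det_mat2)
    ultimately show ?thesis by (rule prod)
  qed
qed

lemma adele_residue_quotient:
  fixes b d :: "'k adele"
  assumes b: "age y 0 b" and d: "aunit y d"
  shows "\<exists>\<beta>. degree \<beta> < degree (place_poly y) \<and> age y 1 (b - emb (ev \<beta>) * d)"
proof -
  obtain b0 where b0: "age y 1 (b - emb b0)" using density by blast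
  obtain d0 where d0: "age y 1 (d - emb d0)" using density by blast
  have d0u: "d0 \<noteq> 0" "val y d0 = 0" using aunit_cong[OF d0] d by (simp_all add: aunit_emb)
  have "age y 0 (emb b0)" using age_cancel[OF age_mono[OF b0], of 0] b by simp
  then have "val_ge y (0 + 0) (b0 * inverse d0)"
    using d0u by (intro val_ge_mult) (auto simp: val_ge_def val_inverse)
  then have r0: "val_ge y 0 (b0 / d0)" by (simp add: divide_inverse)
  then obtain \<beta> where \<beta>: "degree \<beta> < degree (place_poly y)" "val_ge y 1 (b0 / d0 - ev \<beta>)"
    using residue_polynomial[OF yx] by blast
  have "b - emb (ev \<beta>) * d = (b - emb b0) + (emb (b0 / d0) * emb d0 - emb (b0 / d0) * d) + (emb (b0 / d0) - emb (ev \<beta>)) * d"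
    using d0u(1) by (simp add: emb_hom(4)[symmetric] algebra_simps)
  also have "\<dots> = (b - emb b0) + emb (b0 / d0) * (- (d - emb d0)) + emb (b0 / d0 - ev \<beta>) * d"
    by (simp add: emb_diff algebra_simps)
  finally have e: "b - emb (ev \<beta>) * d = (b - emb b0) + emb (b0 / d0) * (- (d - emb d0)) + emb (b0 / d0 - ev \<beta>) * d" .
  have "age y (0 + 1) (emb (b0 / d0) * (- (d - emb d0)))" using r0 d0 by (intro age_mult age_uminus) simp_all
  moreover have "age y (1 + 0) (emb (b0 / d0 - ev \<beta>) * d)" using \<beta>(2) d by (intro age_mult) (simp_all add: aunit_def)
  ultimately have "age y 1 (b - emb (ev \<beta>) * d)" unfolding e using b0 by (simp only: add_0_left add_0_right age_add)
  then show ?thesis using \<beta>(1) by blast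
qed

text \<open>
  Column reduction modulo \<open>y\<close>: if the lower right entry \<open>d\<close> of
  \<open>k\<close> is a unit, the representative is given by a polynomial congruent to
  \<open>b/d\<close>, and otherwise it is the point at infinity.
\<close>
lemma hecke_double_coset_cover:
  assumes k: "k \<in> Kx"
  shows "\<exists>i\<in>hecke_index y. \<exists>k'\<in>Kx. k * loc y (mat2 p 0 0 1) = hrep i * k'"
proof -
  obtain a b c d where K: "gl2_mat k = mat2 a b c d" by (rule mat2_cases)
  have kint: "mint y (gl2_mat k)" using k by (simp add: Kx_iff)
  then have ent: "age y 0 a" "age y 0 b" "age y 0 c" "age y 0 d" and u: "aunit y (a * d - b * c)"
    by (auto simp: K mint_def forall_2 det_mat2)
  have dp: "det (mat2 p 0 0 1) \<noteq> 0" using p_neq_0 by (simp add: det_mat2)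
  have vpP: "val_ge y 0 (p / Py)" "val_ge y (-1) (inverse Py)" "val_ge y 1 p" "val y (p / Py) = 0"
    using Py vp p_neq_0 by (simp_all add: val_ge_def val_divide val_inverse)
  have edp: "emat (mat2 p 0 0 1) = mat2 (emb p) 0 0 1" by (rule matrix_2_eqI) (simp_all add: emb_hom)
  have "\<exists>i\<in>hecke_index y. mint y (emat (matrix_inv (hecke_mat y i)) ** (gl2_mat k ** emat (mat2 p 0 0 1)))"
  proof -
    have det: "aunit y (det (emat (matrix_inv (hecke_mat y i)) ** (gl2_mat k ** emat (mat2 p 0 0 1))))" for i
    proof -
      have "det (emat (matrix_inv (hecke_mat y i)) ** (gl2_mat k ** emat (mat2 p 0 0 1)))
        = emb (p / Py) * (a * d - b * c)"
        by (simp add: det_mul det_emat matrix_inv_2(3)[OF det_hecke_mat(2)] det_hecke_mat(1) K det_mat2 emb_hom divide_inverse mult_ac)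
      moreover have "aunit y (emb (p / Py))" using Py p_neq_0 vpP(4) by (simp add: aunit_emb)
      ultimately show ?thesis using u aunit_mult by simp
    qed
    note inv = matrix_inv_unique[OF det_hecke_mat(2)]
    have Kp: "gl2_mat k ** emat (mat2 p 0 0 1) = mat2 (a * emb p) b (c * emb p) d"
      unfolding K edp by (simp add: mat2_mult)
    show ?thesis
    proof (cases "age y 1 d")
      case True
      have i: "matrix_inv (hecke_mat y None) = mat2 1 0 0 (inverse Py)"
        by (rule inv) (use Py in \<open>simp add: hecke_mat_def mat2_mult mat2_mat1\<close>)
      have e: "emat (mat2 1 0 0 (inverse Py)) = mat2 1 0 0 (emb (inverse Py))" by (rule matrix_2_eqI) (simp_all add: emb_hom)
      have m: "emat (matrix_inv (hecke_mat y None)) ** (gl2_mat k ** emat (mat2 p 0 0 1)) =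
        mat2 (a * emb p) b (c * emb (p / Py)) (emb (inverse Py) * d)"
        unfolding i e Kp by (simp add: mat2_mult emb_hom(4) divide_inverse mult_ac)
      have "age y (0 + 1) (a * emb p)" using ent vpP by (intro age_mult) simp_all
      then have "age y 0 (a * emb p)" by (rule age_mono) simp
      moreover have "age y (0 + 0) (c * emb (p / Py))" using ent vpP by (intro age_mult) simp_all
      moreover have "age y (-1 + 1) (emb (inverse Py) * d)" using True vpP by (intro age_mult) simp_all
      ultimately have "mint y (emat (matrix_inv (hecke_mat y None)) ** (gl2_mat k ** emat (mat2 p 0 0 1)))"
        using det[of None] ent unfolding mint_def m by (simp add: forall_2)
      then show ?thesis by (auto simp: hecke_index_def)
    next
      case False
      then have "aunit y d" using ent by (simp add: aunit_def)
      then obtain \<beta> where \<beta>: "degree \<beta> < degree (place_poly y)" "age y 1 (b - emb (ev \<beta>) * d)"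
        using adele_residue_quotient ent by blast
      have i: "matrix_inv (hecke_mat y (Some \<beta>)) = mat2 (inverse Py) (- (ev \<beta> * inverse Py)) 0 1"
        by (rule inv) (use Py in \<open>simp add: hecke_mat_def mat2_mult mat2_mat1 divide_inverse[symmetric]\<close>)
      have e: "emat (mat2 (inverse Py) (- (ev \<beta> * inverse Py)) 0 1)
        = mat2 (emb (inverse Py)) (- (emb (ev \<beta>) * emb (inverse Py))) 0 1" by (rule matrix_2_eqI) (simp_all add: emb_hom)
      have m: "emat (matrix_inv (hecke_mat y (Some \<beta>))) ** (gl2_mat k ** emat (mat2 p 0 0 1)) =
        mat2 (emb (p / Py) * (a - emb (ev \<beta>) * c)) (emb (inverse Py) * (b - emb (ev \<beta>) * d)) (c * emb p) d"
        unfolding i e Kp by (simp add: mat2_mult emb_hom(4) divide_inverse algebra_simps)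
      have "age y (0 + 0) (emb (ev \<beta>) * c)" using ent val_ge_ev_finite[OF yx] by (intro age_mult) simp_all
      then have "age y (0 + 0) (emb (p / Py) * (a - emb (ev \<beta>) * c))" using ent vpP by (intro age_mult age_diff) simp_all
      moreover have "age y (-1 + 1) (emb (inverse Py) * (b - emb (ev \<beta>) * d))" using \<beta>(2) vpP by (intro age_mult) simp_all
      moreover have "age y (0 + 1) (c * emb p)" using ent vpP by (intro age_mult) simp_all
      then have "age y 0 (c * emb p)" by (rule age_mono) simp
      ultimately have "mint y (emat (matrix_inv (hecke_mat y (Some \<beta>))) ** (gl2_mat k ** emat (mat2 p 0 0 1)))"
        using det[of "Some \<beta>"] ent unfolding mint_def m by (simp add: forall_2)
      then show ?thesis using \<beta>(1) by (auto simp: hecke_index_def)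
    qed
  qed
  then obtain i where i: "i \<in> hecke_index y" "mint y (emat (matrix_inv (hecke_mat y i)) ** (gl2_mat k ** emat (mat2 p 0 0 1)))" by blast
  note h = matrix_inv_2[OF det_hecke_mat(2), of i]
  define k' where "k' = loc y (matrix_inv (hecke_mat y i)) * (k * loc y (mat2 p 0 0 1))"
  have ky: "maeq y (gl2_mat (k * loc y (mat2 p 0 0 1))) (gl2_mat k ** emat (mat2 p 0 0 1))"
    unfolding gl2_mat_mult using agree_loc(1)[OF dp] by (intro maeq_mult) (auto simp: agree_def)
  have kz: "maeq z (gl2_mat (k * loc y (mat2 p 0 0 1))) (gl2_mat k)" if "z \<noteq> y" for z
  proof -
    have "maeq z (gl2_mat (loc y (mat2 p 0 0 1))) (mat 1)" using agree_loc(2)[OF dp that] by (simp add: agree_def)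
    from maeq_mult[OF maeq_refl[of z "gl2_mat k"] this] show ?thesis unfolding gl2_mat_mult by (simp only: matrix_mul_rid)
  qed
  have k'z: "maeq z (gl2_mat k') (gl2_mat k)" if "z \<noteq> y" for z
    unfolding k'_def by (rule maeq_trans[OF maeq_loc_mult(2)[OF h(4) that] kz[OF that]])
  have "k' \<in> Kx"
  proof (rule KxI)
    show "mcong x (gl2_mat k')" using maeq_mcong[OF k'z] yx k by (auto simp: Kx_iff)
    fix z
    show "mint z (gl2_mat k')"
    proof (cases "z = y")
      case True
      have "maeq y (gl2_mat k') (emat (matrix_inv (hecke_mat y i)) ** (gl2_mat k ** emat (mat2 p 0 0 1)))"
        unfolding k'_def by (rule maeq_trans[OF maeq_loc_mult(1)[OF h(4)] maeq_mult[OF maeq_refl ky]])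
      then show ?thesis using maeq_mint i(2) True by blast
    next
      case False
      then show ?thesis using maeq_mint[OF k'z[OF False]] k by (simp add: Kx_iff)
    qed
  qed
  moreover have "hrep i * loc y (matrix_inv (hecke_mat y i)) = 1"
    using h det_hecke_mat(2) by (simp add: loc_mult loc_one)
  then have "k * loc y (mat2 p 0 0 1) = hrep i * k'" unfolding k'_def by (simp add: mult.assoc[symmetric])
  ultimately show ?thesis using i(1) by blast
qed

lemma hecke_double_coset_eq: "hecke_double_coset = (\<Union>i\<in>hecke_index y. (\<lambda>k. hrep i * k) ` Kx)"
proof (intro equalityI subsetI)
  fix g assume "g \<in> hecke_double_coset"
  then obtain k k' where g: "g = k * loc y (mat2 p 0 0 1) * k'" "k \<in> Kx" "k' \<in> Kx" unfolding hecke_double_coset_def by blast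
  obtain i k'' where "i \<in> hecke_index y" "k'' \<in> Kx" "k * loc y (mat2 p 0 0 1) = hrep i * k''"
    using hecke_double_coset_cover[OF g(2)] by blast
  then show "g \<in> (\<Union>i\<in>hecke_index y. (\<lambda>k. hrep i * k) ` Kx)"
    using Kx_mult[OF _ g(3)] by (auto simp: g(1) mult.assoc)
next
  fix g assume "g \<in> (\<Union>i\<in>hecke_index y. (\<lambda>k. hrep i * k) ` Kx)"
  then obtain i k where g: "g = hrep i * k" "k \<in> Kx" by blast
  obtain a b where "hrep i = a * loc y (mat2 p 0 0 1) * b" "a \<in> Kx" "b \<in> Kx"
    using hrep_in[of i] unfolding hecke_double_coset_def by blast
  then show "g \<in> hecke_double_coset" unfolding hecke_double_coset_def
    using g Kx_mult by (auto simp: mult.assoc)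
qed

lemma hrep_disjoint:
  assumes ij: "i \<in> hecke_index y" "j \<in> hecke_index y" and k: "k \<in> Kx" "k' \<in> Kx" and eq: "hrep i * k = hrep j * k'"
  shows "i = j"
proof -
  have main: "rat_int y A" if "hrep i * k = hrep j * k'" "k \<in> Kx" "k' \<in> Kx" "hecke_mat y i ** A = hecke_mat y j" for i j k k' A
  proof -
    have dA: "det A \<noteq> 0" using det_hecke_mat(2)[of j] unfolding that(4)[symmetric] det_mul by auto
    have "hrep j = hrep i * loc y A" using dA det_hecke_mat(2) by (simp add: loc_mult that(4))
    then have "ginv (hrep i) * (hrep i * k) = ginv (hrep i) * (hrep i * (loc y A * k'))"
      using that(1) by (simp add: mult.assoc)
    then have "k = loc y A * k'" by simp
    then have "loc y A = k * ginv k'" by (simp add: mult.assoc ginv)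
    then have "loc y A \<in> Kx" using Kx_mult[OF that(2) Kx_ginv[OF that(3)]] by simp
    then have "mint y (gl2_mat (loc y A))" by (simp add: Kx_iff)
    then show ?thesis unfolding agree_mint[OF agree_loc(1)[OF dA]] .
  qed
  have mixed: False if "hrep None * k = hrep (Some b) * k'" "k \<in> Kx" "k' \<in> Kx" for b k k'
  proof -
    have "hecke_mat y None ** mat2 Py (ev b) 0 (inverse Py) = hecke_mat y (Some b)"
      using Py by (simp add: hecke_mat_def mat2_mult)
    from main[OF that this] have "\<forall>i j. val_ge y 0 (mat2 Py (ev b) 0 (inverse Py) $ i $ j)" by (simp add: rat_int_def)
    then have "val_ge y 0 (inverse Py)" by (simp add: forall_2)
    then show False using Py by (simp add: val_ge_def val_inverse)
  qed
  show ?thesis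
  proof (cases i)
    case None
    then show ?thesis using mixed[OF _ k] eq by (cases j) auto
  next
    case (Some b)
    show ?thesis
    proof (cases j)
      case None
      have "hrep None * k' = hrep (Some b) * k" using eq unfolding Some None by (rule sym)
      then show ?thesis using mixed k by blast
    next
      case j: (Some b')
      have "hecke_mat y i ** mat2 1 ((ev b' - ev b) / Py) 0 1 = hecke_mat y j"
        using Py by (simp add: Some j hecke_mat_def mat2_mult)
      from main[OF eq k this] have "\<forall>i l. val_ge y 0 (mat2 1 ((ev b' - ev b) / Py) 0 1 $ i $ l)" by (simp add: rat_int_def)
      then have "val_ge y 0 ((ev b' - ev b) / Py)" by (simp add: forall_2)
      then have "val_ge y (1 + 0) (Py * ((ev b' - ev b) / Py))" using Py by (intro val_ge_mult) (auto simp: val_ge_def)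
      then have "val_ge y 1 (ev (b' - b))" using Py by (simp add: ev_diff)
      then have "place_poly y dvd b' - b" using place_poly(4)[OF yx] by simp
      moreover have "degree b < degree (place_poly y)" "degree b' < degree (place_poly y)"
        using ij by (auto simp: Some j hecke_index_def)
      then have "degree (b' - b) < degree (place_poly y)"
        using degree_diff_le_max[of b' b] by simp
      ultimately have "b' - b = 0" using dvd_imp_degree_le linorder_not_le by blast
      then show ?thesis by (simp add: Some j)
    qed
  qed
qed

lemma hecke_operator_eq_sum:
  assumes \<mu>: "haar_measure \<mu>" "emeasure \<mu> max_compact = 1"
    and f: "\<And>k g. k \<in> Kx \<Longrightarrow> f (g * k) = f g"
  shows "hecke_operator \<mu> Kx y p f g = (\<Sum>i\<in>hecke_index y. f (g * hrep i))"
proof -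
  let ?C = "\<lambda>i. (\<lambda>k. hrep i * k) ` Kx"
  note K = measure_Kx[OF \<mu>]
  have C: "?C i \<in> sets \<mu>" "emeasure \<mu> (?C i) = emeasure \<mu> Kx" for i
    using haar_translate[OF \<mu>(1) K(1,2)] by blast+
  define v where "v = measure \<mu> Kx"
  have v: "v \<noteq> 0" using K(2,3) unfolding v_def measure_def by (auto simp: enn2real_eq_0_iff)
  have Cv: "measure \<mu> (?C i) = v" for i by (simp add: measure_def C(2) v_def)
  have hf: "hecke_function \<mu> Kx y p h = indicator hecke_double_coset h / complex_of_real v" for h
    unfolding hecke_function_def hecke_double_coset_def v_def loc_def mat2_def ..
  have pt: "hecke_function \<mu> Kx y p h * f (g * h) = (\<Sum>i\<in>hecke_index y. indicator (?C i) h * (f (g * hrep i) / v))" for h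
  proof (cases "h \<in> hecke_double_coset")
    case True
    then obtain i k where i: "i \<in> hecke_index y" "k \<in> Kx" "h = hrep i * k" unfolding hecke_double_coset_eq by blast
    have "(indicator (?C j) h :: complex) = (if j = i then 1 else 0)" if "j \<in> hecke_index y" for j
      using hrep_disjoint[OF i(1) that i(2)] i(2,3) by (auto simp: indicator_def)
    then have "(\<Sum>j\<in>hecke_index y. indicator (?C j) h * (f (g * hrep j) / v)) =
      (\<Sum>j\<in>hecke_index y. if j = i then f (g * hrep j) / v else 0)"
      by (intro sum.cong) auto
    also have "\<dots> = f (g * hrep i) / v" using i(1) finite_hecke_index by simp
    also have "f (g * hrep i) = f (g * h)" unfolding i(3) using f[OF i(2), of "g * hrep i"] by (simp add: mult.assoc)
    finally show ?thesis using True by (simp add: hf)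
  next
    case False
    then have "(indicator (?C j) h :: complex) = 0" if "j \<in> hecke_index y" for j
      using that unfolding hecke_double_coset_eq by (auto simp: indicator_def)
    then show ?thesis using False by (simp add: hf)
  qed
  have int: "integrable \<mu> (\<lambda>h. indicator (?C i) h * (f (g * hrep i) / v))" for i
  proof -
    have "integrable \<mu> (indicator (?C i) :: _ \<Rightarrow> real)" using C K(3) by (intro integrable_real_indicator) auto
    then have "integrable \<mu> (\<lambda>h. complex_of_real (indicator (?C i) h))" by (rule integrable_of_real)
    then show ?thesis by (intro integrable_mult_left) (simp add: of_real_indicator)
  qed
  have "hecke_operator \<mu> Kx y p f g = (\<integral>h. (\<Sum>i\<in>hecke_index y. indicator (?C i) h * (f (g * hrep i) / v)) \<partial>\<mu>)"
    unfolding hecke_operator_def pt ..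
  also have "\<dots> = (\<Sum>i\<in>hecke_index y. \<integral>h. indicator (?C i) h * (f (g * hrep i) / v) \<partial>\<mu>)"
    by (rule Bochner_Integration.integral_sum) (rule int)
  also have "\<dots> = (\<Sum>i\<in>hecke_index y. v * (f (g * hrep i) / v))"
  proof (rule sum.cong[OF refl])
    fix i
    have "space \<mu> = UNIV" using \<mu>(1) sets_eq_imp_space_eq[of \<mu> borel] by (simp add: haar_measure_def)
    then have "(\<integral>h. indicator (?C i) h \<partial>\<mu>) = v" using Cv[of i] by simp
    then have "(\<integral>h. complex_of_real (indicator (?C i) h) \<partial>\<mu>) = complex_of_real v"
      unfolding integral_complex_of_real by simp
    then have "(\<integral>h. indicator (?C i) h \<partial>\<mu>) = complex_of_real v" by (simp add: of_real_indicator)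
    then show "(\<integral>h. indicator (?C i) h * (f (g * hrep i) / v) \<partial>\<mu>) = v * (f (g * hrep i) / v)" by simp
  qed
  also have "\<dots> = (\<Sum>i\<in>hecke_index y. f (g * hrep i))" using v by simp
  finally show ?thesis .
qed

text \<open>
  Multiplying on the left by the rational matrix inverse to the representative makes the component
  at \<open>y\<close> trivial and changes only the component at \<open>x\<close>; at all other
  places this matrix is integral.
\<close>
lemma hrep_to_x:
  assumes dM: "det M \<noteq> 0"
  shows "loc x M * hrep i \<in> DC (loc x (matrix_inv (hecke_mat y i) ** M))"
proof -
  let ?h = "hecke_mat y i"
  note h = matrix_inv_2[OF det_hecke_mat(2), of i]
  let ?N = "matrix_inv ?h ** M"
  have dN: "det ?N \<noteq> 0" using h(4) dM by (simp add: det_mul)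
  define k where "k = ginv (rat ?h * loc x ?N) * (loc x M * hrep i)"
  have hN: "?h ** ?N = M" by (simp add: matrix_mul_assoc h matrix_mul_lid)
  have "k \<in> Kx"
  proof (rule KxI)
    note i = matrix_inv_2[OF dM]
    have "agree x (rat ?h * loc x ?N) M" using agree_mult[OF agree_rat[OF det_hecke_mat(2)[of i]] agree_loc(1)[OF dN]] unfolding hN .
    moreover have "agree x (loc x M * hrep i) (M ** mat 1)"
      by (rule agree_mult[OF agree_loc(1)[OF dM] agree_loc(2)[OF det_hecke_mat(2) yx[symmetric]]])
    ultimately have "agree x k (matrix_inv M ** (M ** mat 1))" unfolding k_def using agree_ginv[OF _ i(1)] agree_mult by blast
    then have "agree x k (mat 1)" by (simp only: matrix_mul_rid i(2))
    then show "mcong x (gl2_mat k)" using agree_mcong by simp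
  next
    fix z assume z: "z \<noteq> x"
    have a: "agree z (rat ?h * loc x ?N) (?h ** mat 1)"
      by (rule agree_mult[OF agree_rat[OF det_hecke_mat(2)] agree_loc(2)[OF dN z]])
    then have "agree z (rat ?h * loc x ?N) ?h" by (simp only: matrix_mul_rid)
    note inv = agree_ginv[OF this h(1)]
    show "mint z (gl2_mat k)"
    proof (cases "z = y")
      case True
      have "agree z (loc x M * hrep i) (mat 1 ** ?h)"
        unfolding True by (rule agree_mult[OF agree_loc(2)[OF dM yx] agree_loc(1)[OF det_hecke_mat(2)]])
      then have "agree z k (matrix_inv ?h ** (mat 1 ** ?h))" unfolding k_def by (rule agree_mult[OF inv])
      then have "agree z k (mat 1)" by (simp only: matrix_mul_lid h(2))
      then show ?thesis using agree_mint by simp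
    next
      case False
      have "agree z (loc x M * hrep i) (mat 1 ** mat 1)"
        by (rule agree_mult[OF agree_loc(2)[OF dM z] agree_loc(2)[OF det_hecke_mat(2) False]])
      then have "agree z k (matrix_inv ?h ** (mat 1 ** mat 1))" unfolding k_def by (rule agree_mult[OF inv])
      then have "agree z k (matrix_inv ?h)" by (simp only: matrix_mul_rid)
      moreover have "rat_int z ?h"
        unfolding rat_int_def using det_hecke_mat val_place_poly_other[OF yx z False] val_ge_ev_finite[OF z]
        by (auto simp: hecke_mat_def forall_2 det_mat2 split: option.split)
      then have "rat_int z (matrix_inv ?h)" by (rule rat_int_inverse[OF _ h(1)])
      ultimately show ?thesis using agree_mint by blast
    qed
  qed
  moreover have "loc x M * hrep i = rat ?h * loc x ?N * 1 * k" unfolding k_def by simp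
  ultimately show ?thesis unfolding double_coset_def using rat_mem[OF det_hecke_mat(2)] center_one by blast
qed

end

end

section \<open>Heights\<close>

lemma power_int_le_iff:
  assumes "1 < (q :: real)" shows "q powi a \<le> q powi b \<longleftrightarrow> a \<le> b"
  using power_int_increasing[of a b q] power_int_strict_increasing[of b a q] assms
  by (cases "a \<le> b") auto

context origin_place
begin

context
  assumes deg_x: "place_degree x = 1"
begin

lemma place_degree_pos: "0 < place_degree (y :: 'k place)"
  using deg_x place_degree_eq[of y] place_poly(3)[of y] by (cases "y = x") auto

lemma residue_degree_eq: "residue_degree y = place_degree (y :: 'k place)"
  using deg_x place_degree_eq[of y] by (simp add: residue_degree_def)

lemma card_k_gt_1: "1 < real CARD('k)"
proof -
  have "card {0, 1 :: 'k} \<le> CARD('k)" by (rule card_mono) auto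
  then show ?thesis by simp
qed

lemma local_abs_le_iff:
  assumes X: "X \<in> carrier (local_field (y :: 'k place))"
  shows "local_abs y X \<le> real CARD('k) powi (int (place_degree y) * e) \<longleftrightarrow> local_ge y (- e) X"
proof (cases "X = \<zero>\<^bsub>local_field y\<^esub>")
  case True
  then show ?thesis by (simp add: local_abs_def local_ge_zero)
next
  case False
  have "local_abs y X \<le> real CARD('k) powi (int (place_degree y) * e) \<longleftrightarrow>
    - (int (place_degree y) * local_val y X) \<le> int (place_degree y) * e"
    using False power_int_le_iff[OF card_k_gt_1] by (simp add: local_abs_def)
  also have "\<dots> \<longleftrightarrow> 0 \<le> int (place_degree y) * (local_val y X + e)" by (simp add: algebra_simps) linarith
  also have "\<dots> \<longleftrightarrow> - e \<le> local_val y X" using place_degree_pos[of y] by (simp add: zero_le_mult_iff) linarith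
  finally show ?thesis using local_ge_iff_local_val[OF X False] by simp
qed

lemma m_inv_det2:
  "m_inv (local_field y) (det2 (local_field y) (comp_at y g)) = adele_at (det (gl2_mat (ginv (g :: 'k gl2A)))) y"
proof -
  interpret L: cring "local_field y" by (rule local_field_cring)
  have d: "det2 (local_field y) (comp_at y g) = adele_at (det (gl2_mat g)) y"
    unfolding det2_def comp_at_def det_2 adele_at_diff adele_at_mult by simp
  have "det (gl2_mat g) * det (gl2_mat (ginv g)) = 1" by (metis det_I det_mul ginv_mat(1))
  then have "adele_at (det (gl2_mat g)) y \<otimes>\<^bsub>local_field y\<^esub> adele_at (det (gl2_mat (ginv g))) y = \<one>\<^bsub>local_field y\<^esub>"
    by (simp add: adele_at_mult[symmetric] adele_at_one)
  then show ?thesis unfolding d by (intro L.comm_inv_char adele_at_closed)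
qed

lemma local_height_le_iff:
  "local_height y g \<le> real CARD('k) powi (int (place_degree y) * e) \<longleftrightarrow>
    (\<forall>i j. age y (- e) (gl2_mat (g :: 'k gl2A) $ i $ j)) \<and> age y (- e) (det (gl2_mat (ginv g)))"
proof -
  let ?q = "real CARD('k) powi (int (place_degree y) * e)"
  have fin: "finite (range (\<lambda>(i, j). local_abs y (comp_at y g $ i $ j)))" by (intro finite_imageI) simp
  have "local_height y g \<le> ?q \<longleftrightarrow> (\<forall>i j. local_abs y (comp_at y g $ i $ j) \<le> ?q) \<and>
    local_abs y (m_inv (local_field y) (det2 (local_field y) (comp_at y g))) \<le> ?q"
    unfolding local_height_def using fin by (subst Max_le_iff) auto
  then show ?thesis
    unfolding m_inv_det2 by (simp add: comp_at_def local_abs_le_iff adele_at_closed age_def)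
qed

text \<open>
  The exponent is not negative: if the entries and the inverse determinant all had positive order,
  so would the product of the determinant with its inverse.
\<close>
lemma local_height_exponent:
  "\<exists>e. 0 \<le> e \<and> local_height y (g :: 'k gl2A) = real CARD('k) powi (int (place_degree y) * e)"
proof -
  let ?D = "det (gl2_mat (ginv g))"
  have one: "det (gl2_mat g) * ?D = 1" by (metis det_I det_mul ginv_mat(1))
  interpret L: cring "local_field y" by (rule local_field_cring)
  have Dnz: "adele_at ?D y \<noteq> \<zero>\<^bsub>local_field y\<^esub>"
  proof
    assume "adele_at ?D y = \<zero>\<^bsub>local_field y\<^esub>"
    then have "adele_at (det (gl2_mat g) * ?D) y = \<zero>\<^bsub>local_field y\<^esub>"
      by (simp add: adele_at_mult adele_at_closed)
    then show False unfolding one adele_at_one using local_field_zero_neq_one[of y] by simp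
  qed
  let ?S = "range (\<lambda>(i, j). local_abs y (comp_at y g $ i $ j)) \<union> {local_abs y (adele_at ?D y)}"
  have lh: "local_height y g = Max ?S" unfolding local_height_def m_inv_det2 ..
  have fin: "finite ?S" by (intro finite_UnI finite_imageI) simp_all
  have in_S: "local_height y g \<in> ?S" unfolding lh using fin by (intro Max_in) auto
  have pos: "0 < local_abs y (adele_at ?D y)" using Dnz card_k_gt_1 by (simp add: local_abs_def)
  have "local_abs y (adele_at ?D y) \<le> local_height y g" unfolding lh using fin by (intro Max_ge) auto
  then have "0 < local_height y g" using pos by linarith
  moreover obtain X where X: "local_height y g = local_abs y X" using in_S by auto
  ultimately have "local_height y g = real CARD('k) powi (- (int (place_degree y) * local_val y X))"
    by (auto simp: local_abs_def split: if_splits)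
  then have e: "local_height y g = real CARD('k) powi (int (place_degree y) * (- local_val y X))" by simp
  \<comment> \<open>the height is attained at some component, whose order is \<open>- e\<close>\<close>
  define e where "e = - local_val y X"
  have "\<not> e < 0"
  proof
    assume neg: "e < 0"
    have a: "age y (- e) (gl2_mat g $ i $ j)" "age y (- e) ?D" for i j
      using local_height_le_iff[of y g e] e unfolding e_def by auto
    have a1: "age y 1 (gl2_mat g $ i $ j)" "age y 1 ?D" for i j
      using age_mono[OF a(1)] age_mono[OF a(2)] neg by auto
    have "age y (1 + 1) (gl2_mat g $ i $ j * gl2_mat g $ i' $ j')" for i j i' j' by (rule age_mult[OF a1(1) a1(1)])
    then have "age y (1 + 1) (det (gl2_mat g))" unfolding det_2 by (intro age_diff)
    from age_mult[OF this a1(2)] show False unfolding one by simp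
  qed
  then show ?thesis using e unfolding e_def[symmetric] by (intro exI[of _ e]) simp
qed

lemma local_height_eq_1:
  assumes "mint y (gl2_mat (g :: 'k gl2A))" shows "local_height y g = 1"
proof -
  have "mint y (gl2_mat (ginv g))" by (rule mint_inverse[OF assms ginv_mat(1)])
  then have "local_height y g \<le> real CARD('k) powi (int (place_degree y) * 0)"
    unfolding local_height_le_iff using assms by (simp add: mint_def aunit_def)
  then have le: "local_height y g \<le> 1" by simp
  obtain e where e: "0 \<le> e" "local_height y g = real CARD('k) powi (int (place_degree y) * e)"
    using local_height_exponent by blast
  have "1 \<le> local_height y g" unfolding e(2) using card_k_gt_1 e(1) by (intro one_le_power_int) auto
  then show ?thesis using le by simp
qed

lemma finite_local_height: "finite {y. local_height y (g :: 'k gl2A) \<noteq> 1}"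
  by (rule finite_subset[OF _ finite_not_mint[of g]]) (use local_height_eq_1 in auto)

lemma height_exponent:
  fixes g :: "'k gl2A"
  obtains e where "\<And>y. 0 \<le> e y" "\<And>y i j. age y (- e y) (gl2_mat g $ i $ j)"
    "\<And>y. age y (- e y) (det (gl2_mat (ginv g)))"
    "\<And>S. finite S \<Longrightarrow> {y. local_height y g \<noteq> 1} \<subseteq> S \<Longrightarrow>
      height g = real CARD('k) powi (\<Sum>y\<in>S. int (place_degree y) * e y)"
proof -
  have "\<forall>y. \<exists>e. 0 \<le> e \<and> local_height y g = real CARD('k) powi (int (place_degree y) * e)"
    using local_height_exponent by blast
  then obtain e where e: "\<And>y. 0 \<le> e y" "\<And>y. local_height y g = real CARD('k) powi (int (place_degree y) * e y)" by metis
  have "(\<forall>i j. age y (- e y) (gl2_mat g $ i $ j)) \<and> age y (- e y) (det (gl2_mat (ginv g)))" for y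
    unfolding local_height_le_iff[symmetric] e(2)[symmetric] ..
  moreover have "height g = real CARD('k) powi (\<Sum>y\<in>S. int (place_degree y) * e y)"
    if S: "finite S" "{y. local_height y g \<noteq> 1} \<subseteq> S" for S
  proof -
    have "height g = (\<Prod>y\<in>S. local_height y g)"
      unfolding height_def using S by (intro prod.mono_neutral_left) auto
    also have "\<dots> = (\<Prod>y\<in>S. real CARD('k) powi (int (place_degree y) * e y))" by (simp only: e(2))
    also have "\<dots> = real CARD('k) powi (\<Sum>y\<in>S. int (place_degree y) * e y)"
      using S(1) card_k_gt_1 by (induction S rule: finite_induct) (auto simp: power_int_add)
    finally show ?thesis .
  qed
  ultimately show thesis using that[of e] e(1) by blast
qed

lemma height_ge_1: "1 \<le> height (g :: 'k gl2A)"
proof -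
  obtain e where e: "\<And>y. 0 \<le> e y" "\<And>S. finite S \<Longrightarrow> {y. local_height y g \<noteq> 1} \<subseteq> S \<Longrightarrow>
      height g = real CARD('k) powi (\<Sum>y\<in>S. int (place_degree y) * e y)"
    by (rule height_exponent[of g]) blast
  show ?thesis unfolding e(2)[OF finite_local_height subset_refl]
    using e(1) card_k_gt_1 by (intro one_le_power_int sum_nonneg) auto
qed

text \<open>The quotient of the square of an entry by the determinant is insensitive to the center and bounded
  by the cube of the local height.\<close>
lemma entry_square_bound:
  fixes g u k :: "'k gl2A"
  assumes B: "agree y u B" "det B \<noteq> 0" and cd: "c * d = 1" and k: "mint y (gl2_mat k)" and g: "g = u * scal c * k"
    and e: "\<And>i j. age y (- e) (gl2_mat g $ i $ j)" "age y (- e) (det (gl2_mat (ginv g)))"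
  shows "val_ge y (- 3 * e) ((B $ i $ j)\<^sup>2 / det B)"
proof -
  have kinv: "mint y (gl2_mat (ginv k))" by (rule mint_inverse[OF k ginv_mat(1)])
  have uc: "u * scal c = g * ginv k" unfolding g by (simp add: mult.assoc ginv)
  have "age y (- e + 0) (gl2_mat g $ i $ l * gl2_mat (ginv k) $ l $ j)" for l
    using e(1) kinv by (intro age_mult) (auto simp: mint_def)
  then have "age y (- e) (gl2_mat (u * scal c) $ i $ j)" unfolding uc gl2_mat_mult matrix_mult_2 by (intro age_add) auto
  moreover have "gl2_mat (u * scal c) $ i $ j = gl2_mat u $ i $ j * c"
    unfolding gl2_mat_mult gl2_mat_scal[OF cd] scalar_mat_commute scalar_mat_mult_nth by (rule mult.commute)
  moreover have "aeq y (gl2_mat u $ i $ j * c) (emb (B $ i $ j) * c)"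
    using B(1) by (intro aeq_mult aeq_refl) (simp add: agree_def maeq_def)
  ultimately have a1: "age y (- e) (emb (B $ i $ j) * c)" using aeq_age by metis
  have dg: "det (gl2_mat g) * det (gl2_mat (ginv g)) = 1" by (metis det_I det_mul ginv_mat(1))
  \<comment> \<open>the inverse of the determinant of \<open>u\<close> times the square of \<open>c\<close>\<close>
  define D where "D = det (gl2_mat (ginv g)) * det (gl2_mat k)"
  have a2: "age y (- e + 0) D" unfolding D_def using e(2) k by (intro age_mult) (auto simp: mint_def aunit_def)
  have "det (gl2_mat g) = det (gl2_mat u) * (c * c) * det (gl2_mat k)"
    unfolding g gl2_mat_mult det_mul gl2_mat_scal[OF cd] by (simp add: det_mat2)
  then have uD: "det (gl2_mat u) * (c * c) * D = 1" unfolding D_def using dg by (simp add: mult_ac)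
  have "aeq y (det (gl2_mat u) * (c * c) * D) (emb (det B) * (c * c) * D)"
    using maeq_det[of y "gl2_mat u" "emat B"] B(1) by (intro aeq_mult aeq_refl) (simp add: agree_def det_emat)
  then have "aeq y 1 (emb (det B) * (c * c) * D)" unfolding uD .
  then have "aeq y (emb ((B $ i $ j)\<^sup>2 * inverse (det B)) * 1) (emb ((B $ i $ j)\<^sup>2 * inverse (det B)) * (emb (det B) * (c * c) * D))"
    by (intro aeq_mult aeq_refl)
  moreover have "emb ((B $ i $ j)\<^sup>2 * inverse (det B)) * (emb (det B) * (c * c) * D)
    = (emb (det B) * emb (inverse (det B))) * ((emb (B $ i $ j) * c) * (emb (B $ i $ j) * c) * D)"
    by (simp add: emb_hom power2_eq_square mult_ac)
  ultimately have q: "aeq y (emb ((B $ i $ j)\<^sup>2 / det B)) ((emb (B $ i $ j) * c) * (emb (B $ i $ j) * c) * D)"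
    by (simp only: emb_inverse[OF B(2)] mult_1_left mult_1_right divide_inverse)
  have "age y (- e + - e + (- e + 0)) ((emb (B $ i $ j) * c) * (emb (B $ i $ j) * c) * D)"
    by (rule age_mult[OF age_mult[OF a1 a1] a2])
  then have "age y (- e + - e + (- e + 0)) (emb ((B $ i $ j)\<^sup>2 / det B))" using aeq_age[OF q] by blast
  moreover have "- e + - e + (- e + 0) = - 3 * e" by simp
  ultimately show ?thesis by (simp only: age_emb)
qed

text \<open>
  Let \<open>a\<close> be a nonzero entry in the first column of the rational factor
  \<open>\<gamma>\<close>. The local bounds apply to \<open>a\<^sup>2 / det \<gamma>\<close>, with
  an additional \<open>n\<close> at \<open>x\<close> where the first column is multiplied by
  \<open>(1/t)^n\<close>. Summing them, the product formula leaves \<open>n\<close>.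
\<close>
lemma height_lower_bound:
  assumes w: "w \<in> proj_line" and g: "g \<in> DC (loc x (rep n w))"
  shows "real CARD('k) powr (real n / 3) \<le> height g"
proof -
  obtain \<gamma> z k where h: "det \<gamma> \<noteq> 0" "z \<in> center" "k \<in> Kx" "g = rat \<gamma> * loc x (rep n w) * z * k"
    using g unfolding double_coset_def rational_points_iff by blast
  obtain c d where cd: "c * d = 1" "z = scal c" using h(2) center_iff by blast
  define p where "p = mat2 (S ^ n) 0 0 (1 :: 'k ratfun)"
  have dp: "det p \<noteq> 0" "det p = S ^ n" by (simp_all add: p_def det_mat2)
  have rep: "rep n w = p ** theta w" by (simp add: rep_def p_mat_eq p_def)
  \<comment> \<open>the integral factor \<open>\<theta>\<close> is moved to the compact part\<close>
  define k' where "k' = loc x (theta w) * k"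
  have k': "mint y (gl2_mat k')" for y
  proof -
    have "mint y (gl2_mat (loc x (theta w)))"
      using agree_mint[OF agree_loc(1)[OF det_theta[OF w]]] agree_mint[OF agree_loc(2)[OF det_theta[OF w]]] rat_int_theta[OF w]
      by (cases "y = x") auto
    then show ?thesis unfolding k'_def gl2_mat_mult using h(3) by (intro mint_mult) (auto simp: Kx_iff)
  qed
  have "z * loc x (theta w) = loc x (theta w) * z" using h(2) by (simp add: center_def)
  moreover have "loc x (rep n w) = loc x p * loc x (theta w)" unfolding rep using dp(1) det_theta[OF w] by (simp add: loc_mult)
  ultimately have gk: "g = (rat \<gamma> * loc x p) * scal c * k'"
    unfolding h(4) k'_def cd(2)[symmetric] by (simp only: mult.assoc) (simp only: mult.assoc[symmetric])
  have ax: "agree x (rat \<gamma> * loc x p) (\<gamma> ** p)" by (intro agree_mult agree_rat agree_loc h(1) dp(1))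
  have ay: "agree y (rat \<gamma> * loc x p) \<gamma>" if "y \<noteq> x" for y
    using agree_mult[OF agree_rat[OF h(1)] agree_loc(2)[OF dp(1) that]] by (simp only: matrix_mul_rid)
  have dxp: "det (\<gamma> ** p) = det \<gamma> * S ^ n" "det (\<gamma> ** p) \<noteq> 0" using h(1) dp by (simp_all add: det_mul)
  have "\<exists>i. \<gamma> $ i $ 1 \<noteq> 0"
  proof (rule ccontr)
    assume "\<not> (\<exists>i. \<gamma> $ i $ 1 \<noteq> 0)"
    then show False using h(1) by (simp add: det_2)
  qed
  then obtain i where i: "\<gamma> $ i $ 1 \<noteq> 0" by blast
  define r where "r = (\<gamma> $ i $ 1)\<^sup>2 / det \<gamma>"
  have r0: "r \<noteq> 0" using i h(1) by (simp add: r_def)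
  obtain e where e: "\<And>y. 0 \<le> e y" "\<And>y i j. age y (- e y) (gl2_mat g $ i $ j)"
    "\<And>y. age y (- e y) (det (gl2_mat (ginv g)))"
    "\<And>S. finite S \<Longrightarrow> {y. local_height y g \<noteq> 1} \<subseteq> S \<Longrightarrow>
      height g = real CARD('k) powi (\<Sum>y\<in>S. int (place_degree y) * e y)"
    by (rule height_exponent[of g]) blast
  have vy: "- 3 * e y \<le> val y r" if "y \<noteq> x" for y
    using entry_square_bound[OF ay[OF that] h(1) cd(1) k' gk e(2) e(3), of i 1] r0 by (simp add: r_def val_ge_def)
  have vx: "- 3 * e x \<le> val x r - int n"
  proof -
    have "(\<gamma> ** p) $ i $ 1 = \<gamma> $ i $ 1 * S ^ n" by (simp add: matrix_mult_2 p_def)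
    then have "((\<gamma> ** p) $ i $ 1)\<^sup>2 / det (\<gamma> ** p) = r * S ^ n"
    proof -
      assume gp: "(\<gamma> ** p) $ i $ 1 = \<gamma> $ i $ 1 * S ^ n"
      have *: "(a * s)\<^sup>2 / (D * s) = a\<^sup>2 / D * s" if "s \<noteq> 0" for a s D :: "'k ratfun"
        using that by (simp add: power2_eq_square)
      have "S ^ n \<noteq> 0" by simp
      from *[OF this] show ?thesis unfolding gp dxp(1) r_def .
    qed
    then have "val_ge x (- 3 * e x) (r * S ^ n)"
      using entry_square_bound[OF ax dxp(2) cd(1) k' gk e(2) e(3), of i 1] by simp
    moreover have "r * S ^ n \<noteq> 0" using r0 S_neq_0 by simp
    moreover have "val x (r * S ^ n) = val x r - int n" using r0 S_neq_0 by (simp add: val_mult val_x_S_power)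
    ultimately show ?thesis by (simp only: val_ge_def simp_thms)
  qed
  obtain S0 where S0: "finite S0" "\<And>S. finite S \<Longrightarrow> S0 \<subseteq> S \<Longrightarrow> (\<Sum>y\<in>S. int (residue_degree y) * val y r) = 0"
    using product_formula[OF r0] by metis
  define T where "T = insert x (S0 \<union> {y. local_height y g \<noteq> 1})"
  have T: "finite T" "x \<in> T" "S0 \<subseteq> T" "{y. local_height y g \<noteq> 1} \<subseteq> T"
    using S0(1) finite_local_height[of g] by (auto simp: T_def)
  define N where "N = (\<Sum>y\<in>T. int (place_degree y) * e y)"
  have "(\<Sum>y\<in>T. int (place_degree y) * (val y r - (if y = x then int n else 0))) \<ge> (\<Sum>y\<in>T. int (place_degree y) * (- 3 * e y))"
    using vx vy by (intro sum_mono mult_left_mono) auto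
  moreover have "(\<Sum>y\<in>T. int (place_degree y) * (val y r - (if y = x then int n else 0)))
    = (\<Sum>y\<in>T. int (place_degree y) * val y r) - (\<Sum>y\<in>T. if y = x then int (place_degree y) * int n else 0)"
    unfolding sum_subtractf[symmetric] by (intro sum.cong) (simp_all add: right_diff_distrib)
  moreover have "(\<Sum>y\<in>T. int (place_degree y) * val y r) = 0"
    using S0(2)[OF T(1,3)] by (simp only: residue_degree_eq)
  moreover have "(\<Sum>y\<in>T. if y = x then int (place_degree y) * int n else 0) = int n"
    using T(1,2) deg_x by simp
  moreover have "(\<Sum>y\<in>T. int (place_degree y) * (- 3 * e y)) = - 3 * N"
    by (simp add: N_def sum_distrib_left mult_ac)
  ultimately have nN: "int n \<le> 3 * N" by linarith
  have "real CARD('k) powr (real n / 3) \<le> real CARD('k) powr (real_of_int N)"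
    using nN card_k_gt_1 by (intro powr_mono) linarith+
  also have "\<dots> = real CARD('k) powi N" using card_k_gt_1 by (simp add: powr_real_of_int')
  also have "\<dots> = height g" using e(4)[OF T(1,4)] by (simp add: N_def)
  finally show ?thesis .
qed

end

end

section \<open>Solving the eigenvalue equation recursively\<close>

text \<open>
  Well-founded recursion along the rank: the equation at \<open>j\<close> prescribes the value at
  \<open>\<tau> j\<close>.
\<close>
lemma recursion_exists:
  fixes \<tau> :: "'i \<Rightarrow> 'i" and \<sigma> :: "'b \<Rightarrow> 'i \<Rightarrow> 'i" and \<rho> :: "'i \<Rightarrow> nat" and l :: complex
  assumes inj: "inj_on \<tau> I" and r1: "\<And>j. j \<in> I \<Longrightarrow> \<rho> j < \<rho> (\<tau> j)"
    and r2: "\<And>b j. b \<in> B \<Longrightarrow> j \<in> I \<Longrightarrow> \<rho> (\<sigma> b j) < \<rho> (\<tau> j)"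
  shows "\<exists>u. (\<forall>i\<in>I - \<tau> ` I. u i = v i) \<and> (\<forall>j\<in>I. u (\<tau> j) + (\<Sum>b\<in>B. u (\<sigma> b j)) = l * u j)"
proof -
  define F where "F u i = (if i \<in> \<tau> ` I then l * u (the_inv_into I \<tau> i) - (\<Sum>b\<in>B. u (\<sigma> b (the_inv_into I \<tau> i))) else v i)" for u i
  define u where "u = wfrec (Wellfounded.measure \<rho>) F"
  have u: "u i = F (cut u (Wellfounded.measure \<rho>) i) i" for i
    unfolding u_def by (rule wfrec) simp
  have "u i = v i" if "i \<in> I - \<tau> ` I" for i using that by (subst u) (simp add: F_def)
  moreover have "u (\<tau> j) + (\<Sum>b\<in>B. u (\<sigma> b j)) = l * u j" if j: "j \<in> I" for j
  proof -
    have t: "the_inv_into I \<tau> (\<tau> j) = j" by (rule the_inv_into_f_f[OF inj j])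
    have "cut u (Wellfounded.measure \<rho>) (\<tau> j) j = u j" using r1[OF j] by (simp add: cut_apply)
    moreover have "cut u (Wellfounded.measure \<rho>) (\<tau> j) (\<sigma> b j) = u (\<sigma> b j)" if "b \<in> B" for b
      using r2[OF that j] by (simp add: cut_apply)
    ultimately have "u (\<tau> j) = l * u j - (\<Sum>b\<in>B. u (\<sigma> b j))"
      using j by (subst u) (simp add: F_def t)
    then show ?thesis by simp
  qed
  ultimately show ?thesis by blast
qed

lemma recursion_unique:
  fixes \<tau> :: "'i \<Rightarrow> 'i" and \<sigma> :: "'b \<Rightarrow> 'i \<Rightarrow> 'i" and \<rho> :: "'i \<Rightarrow> nat" and l :: complex
  assumes r1: "\<And>j. j \<in> I \<Longrightarrow> \<rho> j < \<rho> (\<tau> j)"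
    and r2: "\<And>b j. b \<in> B \<Longrightarrow> j \<in> I \<Longrightarrow> \<rho> (\<sigma> b j) < \<rho> (\<tau> j) \<and> \<sigma> b j \<in> I"
    and u: "\<And>j. j \<in> I \<Longrightarrow> u (\<tau> j) + (\<Sum>b\<in>B. u (\<sigma> b j)) = l * u j"
    and u': "\<And>j. j \<in> I \<Longrightarrow> u' (\<tau> j) + (\<Sum>b\<in>B. u' (\<sigma> b j)) = l * u' j"
    and eq: "\<And>i. i \<in> I - \<tau> ` I \<Longrightarrow> u i = u' i" and i: "i \<in> I"
  shows "u i = u' i"
  using i
proof (induction "\<rho> i" arbitrary: i rule: less_induct)
  case less
  show ?case
  proof (cases "i \<in> \<tau> ` I")
    case True
    then obtain j where j: "j \<in> I" "i = \<tau> j" by blast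
    have "u j = u' j" using less.hyps[of j] r1[OF j(1)] j by simp
    moreover have "u (\<sigma> b j) = u' (\<sigma> b j)" if "b \<in> B" for b using less.hyps[of "\<sigma> b j"] r2[OF that j(1)] j by simp
    then have "(\<Sum>b\<in>B. u (\<sigma> b j)) = (\<Sum>b\<in>B. u' (\<sigma> b j))" by (rule sum.cong[OF refl])
    ultimately show ?thesis using u[OF j(1)] u'[OF j(1)] j(2) by (metis add_right_cancel)
  next
    case False
    then show ?thesis using eq less.prems by blast
  qed
qed

text \<open>
  Each step multiplies the bound by at most the absolute value of the eigenvalue plus the number of
  smaller terms; the additional 1 makes the base at least 1.
\<close>
lemma recursion_growth:
  fixes \<tau> :: "'i \<Rightarrow> 'i" and \<sigma> :: "'b \<Rightarrow> 'i \<Rightarrow> 'i" and \<rho> :: "'i \<Rightarrow> nat" and l :: complex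
  assumes r1: "\<And>j. j \<in> I \<Longrightarrow> \<rho> j < \<rho> (\<tau> j)"
    and r2: "\<And>b j. b \<in> B \<Longrightarrow> j \<in> I \<Longrightarrow> \<rho> (\<sigma> b j) < \<rho> (\<tau> j) \<and> \<sigma> b j \<in> I"
    and u: "\<And>j. j \<in> I \<Longrightarrow> u (\<tau> j) + (\<Sum>b\<in>B. u (\<sigma> b j)) = l * u j"
    and C: "0 \<le> C" "\<And>i. i \<in> I - \<tau> ` I \<Longrightarrow> cmod (u i) \<le> C" and i: "i \<in> I"
  shows "cmod (u i) \<le> C * (cmod l + real (card B) + 1) ^ \<rho> i"
  using i
proof (induction "\<rho> i" arbitrary: i rule: less_induct)
  case less
  let ?A = "cmod l + real (card B) + 1"
  have A: "1 \<le> ?A" by simp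
  show ?case
  proof (cases "i \<in> \<tau> ` I")
    case True
    then obtain j where j: "j \<in> I" "i = \<tau> j" by blast
    define n where "n = \<rho> i - 1"
    have n: "\<rho> i = Suc n" using r1[OF j(1)] j(2) by (simp add: n_def)
    have bd: "cmod (u k) \<le> C * ?A ^ n" if k: "k \<in> I" "\<rho> k < \<rho> i" for k
    proof -
      have "cmod (u k) \<le> C * ?A ^ \<rho> k" by (rule less.hyps[OF k(2,1)])
      also have "\<dots> \<le> C * ?A ^ n" using k(2) n A C(1) by (intro mult_left_mono power_increasing) auto
      finally show ?thesis .
    qed
    have "u i = l * u j - (\<Sum>b\<in>B. u (\<sigma> b j))" using u[OF j(1)] j(2) by (simp add: algebra_simps)
    then have "cmod (u i) \<le> cmod (l * u j) + cmod (\<Sum>b\<in>B. u (\<sigma> b j))" using norm_triangle_ineq4 by metis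
    also have "\<dots> \<le> cmod l * (C * ?A ^ n) + (\<Sum>b\<in>B. C * ?A ^ n)"
    proof (rule add_mono)
      show "cmod (l * u j) \<le> cmod l * (C * ?A ^ n)"
        unfolding norm_mult using bd[OF j(1)] r1[OF j(1)] j(2) by (intro mult_left_mono) auto
      show "cmod (\<Sum>b\<in>B. u (\<sigma> b j)) \<le> (\<Sum>b\<in>B. C * ?A ^ n)"
        using bd r2 j by (intro order_trans[OF norm_sum] sum_mono) auto
    qed
    also have "\<dots> = (cmod l + real (card B)) * (C * ?A ^ n)" by (simp add: algebra_simps)
    also have "\<dots> \<le> ?A * (C * ?A ^ n)" using C(1) A by (intro mult_right_mono) auto
    also have "\<dots> = C * ?A ^ \<rho> i" by (simp add: n)
    finally show ?thesis .
  next
    case False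
    then have "cmod (u i) \<le> C * 1" using C(2) less.prems by simp
    also have "\<dots> \<le> C * ?A ^ \<rho> i" using C(1) A by (intro mult_left_mono one_le_power) auto
    finally show ?thesis .
  qed
qed

lemma sum_fun_apply: "(\<Sum>i\<in>A. f i) x = (\<Sum>i\<in>A. f i x)" for f :: "'i \<Rightarrow> 'a \<Rightarrow> 'b::comm_monoid_add"
  by (induction A rule: infinite_finite_induct) simp_all

text \<open>
  The preimages of the indicator functions of points form a basis.
\<close>
lemma linear_iso_on_dim:
  assumes iso: "linear_iso_on T V (direct_sum N)" and N: "finite N"
  shows "fun_space.dim V = card N"
proof -
  have V: "fun_space.subspace V" and add: "\<And>f g. f \<in> V \<Longrightarrow> g \<in> V \<Longrightarrow> T (f + g) = T f + T g"
    and scale: "\<And>a f. f \<in> V \<Longrightarrow> T (fun_scale a f) = fun_scale a (T f)" and bij: "bij_betw T V (direct_sum N)"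
    using iso by (auto simp: linear_iso_on_def)
  have zero: "T 0 = 0"
  proof -
    have "(0 :: 'a \<Rightarrow> complex) = fun_scale 0 0" by (simp add: fun_scale_def fun_eq_iff)
    then have "T 0 = fun_scale 0 (T 0)" using scale[OF fun_space.subspace_0[OF V], of 0] by simp
    then show ?thesis by (simp add: fun_scale_def fun_eq_iff)
  qed
  define \<delta> where "\<delta> c = (\<lambda>c'. if c' = c then 1 else 0 :: complex)" for c :: 'b
  have \<delta>: "\<delta> c \<in> direct_sum N" if "c \<in> N" for c
    using that finite_subset[of "{c'. \<delta> c c' \<noteq> 0}" "{c}"] by (auto simp: direct_sum_def \<delta>_def split: if_splits)
  define e where "e c = inv_into V T (\<delta> c)" for c
  have e: "e c \<in> V" "T (e c) = \<delta> c" if "c \<in> N" for c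
  proof -
    have m: "\<delta> c \<in> T ` V" using \<delta>[OF that] bij unfolding bij_betw_def by blast
    show "e c \<in> V" "T (e c) = \<delta> c" unfolding e_def using inv_into_into[OF m] f_inv_into_f[OF m] by blast+
  qed
  have Tsum: "(\<Sum>c\<in>A. fun_scale (a c) (e c)) \<in> V \<and> T (\<Sum>c\<in>A. fun_scale (a c) (e c)) = (\<Sum>c\<in>A. fun_scale (a c) (\<delta> c))"
    if "finite A" "A \<subseteq> N" for A a
    using that
  proof (induction A rule: finite_induct)
    case empty
    show ?case unfolding sum.empty using zero fun_space.subspace_0[OF V] by blast
  next
    case (insert c A)
    have c: "c \<in> N" and IH: "(\<Sum>c\<in>A. fun_scale (a c) (e c)) \<in> V"
      "T (\<Sum>c\<in>A. fun_scale (a c) (e c)) = (\<Sum>c\<in>A. fun_scale (a c) (\<delta> c))" using insert by blast+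
    have m: "fun_scale (a c) (e c) \<in> V" by (rule fun_space.subspace_scale[OF V e(1)[OF c]])
    have "T (fun_scale (a c) (e c)) = fun_scale (a c) (\<delta> c)" using scale[OF e(1)[OF c]] e(2)[OF c] by simp
    then show ?case
      unfolding sum.insert[OF insert.hyps] using add[OF m IH(1)] IH(2) fun_space.subspace_add[OF V m IH(1)]
      by (simp only: simp_thms)
  qed
  have coeff: "(\<Sum>c\<in>N. fun_scale (a c) (\<delta> c)) c' = (if c' \<in> N then a c' else 0)" for a c'
    unfolding sum_fun_apply using N by (simp add: fun_scale_def \<delta>_def if_distrib cong: if_cong)
  have einj: "inj_on e N"
  proof (rule inj_onI)
    fix c c' assume c: "c \<in> N" "c' \<in> N" "e c = e c'"
    then have "\<delta> c = \<delta> c'" using e(2) by metis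
    then have "\<delta> c c = \<delta> c' c" by simp
    then show "c = c'" by (simp add: \<delta>_def split: if_splits)
  qed
  have "fun_space.dim V = card (e ` N)"
  proof (rule fun_space.dim_unique[OF _ _ _ refl])
    show "e ` N \<subseteq> V" using e by blast
    show "fun_space.independent (e ` N)"
    proof (rule fun_space.independent_if_scalars_zero)
      show "finite (e ` N)" using N by simp
      fix f b assume s: "(\<Sum>b\<in>e ` N. fun_scale (f b) b) = 0" and b: "b \<in> e ` N"
      obtain c where c: "c \<in> N" "b = e c" using b by blast
      have "(\<Sum>c\<in>N. fun_scale (f (e c)) (e c)) = 0" using s by (simp only: sum.reindex[OF einj] o_def)
      then have "(\<Sum>c\<in>N. fun_scale (f (e c)) (\<delta> c)) = 0" using Tsum[OF N subset_refl, of "\<lambda>c. f (e c)"] zero by (simp only:)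
      then have "(\<Sum>c\<in>N. fun_scale (f (e c)) (\<delta> c)) c = (0 :: 'b \<Rightarrow> complex) c" by (rule fun_cong)
      then show "f b = 0" unfolding coeff using c by simp
    qed
    show "V \<subseteq> fun_space.span (e ` N)"
    proof
      fix f assume f: "f \<in> V"
      have Tf: "T f \<in> direct_sum N" using f bij by (auto simp: bij_betw_def)
      let ?g = "\<Sum>c\<in>N. fun_scale (T f c) (e c)"
      have g: "?g \<in> V" "T ?g = (\<Sum>c\<in>N. fun_scale (T f c) (\<delta> c))" using Tsum[OF N subset_refl] by blast+
      have "T ?g = T f" unfolding g(2) using Tf by (intro ext) (auto simp: coeff direct_sum_def)
      then have "?g = f" using g(1) f bij by (auto simp: bij_betw_def inj_on_def)
      moreover have "?g \<in> fun_space.span (e ` N)"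
        by (intro fun_space.span_sum fun_space.span_scale fun_space.span_base) blast
      ultimately show "f \<in> fun_space.span (e ` N)" by simp
    qed
  qed
  then show ?thesis by (simp add: card_image[OF einj])
qed


section \<open>The double cosets and their neighbours\<close>

abbreviation base_point :: "('k::{field,finite} \<times> 'k) set"
  where "base_point \<equiv> proj_point 1 0"

text \<open>
  At level 0 all points of the projective line give the same class, so only one of them is kept.
\<close>
definition class_index :: "(nat \<times> ('k::{field,finite} \<times> 'k) set) set"
  where "class_index = insert (0, base_point) ({1..} \<times> proj_line)"

lemma base_point_in: "base_point \<in> proj_line"
  by (simp add: proj_line_eq)

lemma class_index_proj: "i \<in> class_index \<Longrightarrow> snd i \<in> proj_line"
  using base_point_in by (auto simp: class_index_def)

lemma class_indexI: "w \<in> proj_line \<Longrightarrow> 0 < n \<or> w = base_point \<Longrightarrow> (n, w) \<in> class_index"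
  by (cases n) (auto simp: class_index_def)

text \<open>
  Compares levels first; at equal level the point \<open>[1:0]\<close> comes last. Then at level
  \<open>d\<close> the equation at the trivial class expresses the value at \<open>[1:0]\<close> by
  the values at the other points.
\<close>
definition class_rank :: "nat \<times> ('k::{field,finite} \<times> 'k) set \<Rightarrow> nat"
  where "class_rank i = 2 * fst i + (if snd i = base_point then 1 else 0)"

definition shift_class :: "nat \<Rightarrow> nat \<times> ('k::{field,finite} \<times> 'k) set \<Rightarrow> nat \<times> ('k \<times> 'k) set"
  where "shift_class d i = (fst i + d, snd i)"

context origin_place
begin

definition class_rep :: "nat \<times> ('k \<times> 'k) set \<Rightarrow> 'k gl2A"
  where "class_rep i = loc x (rep (fst i) (snd i))"

definition rep_class :: "nat \<times> ('k \<times> 'k) set \<Rightarrow> 'k gl2A set"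
  where "rep_class i = DC (class_rep i)"

lemma rep_0_base: "rep 0 base_point = mat 1"
  unfolding rep_def p_mat_eq theta_simps by (simp add: mat2_mult ratfun_const_hom flip: mat2_mat1)

lemma class_rep_0: "class_rep (0, base_point) = 1"
  by (simp add: class_rep_def rep_0_base loc_one)

lemma rep_class_inj: "inj_on rep_class class_index"
proof (rule inj_onI)
  fix i j :: "nat \<times> ('k \<times> 'k) set"
  assume ij: "i \<in> class_index" "j \<in> class_index" "rep_class i = rep_class j"
  have w: "snd i \<in> proj_line" "snd j \<in> proj_line" using ij class_index_proj by blast+
  have "class_rep i \<in> DC (class_rep j)"
    using DC_self[of "class_rep i"] ij(3) unfolding rep_class_def by simp
  then have "equi (rep (fst i) (snd i)) (rep (fst j) (snd j))"
    unfolding class_rep_def using w by (intro equi_if_DC_loc det_rep)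
  from rep_unique[OF w this] have u: "fst i = fst j" "fst i = 0 \<or> snd i = snd j" by blast+
  have "fst i = 0 \<Longrightarrow> snd i = base_point" "fst j = 0 \<Longrightarrow> snd j = base_point"
    using ij(1,2) by (auto simp: class_index_def)
  then show "i = j" using u by (metis prod_eqI)
qed

text \<open>
  At level 0 the matrix \<open>\<theta>\<close> itself belongs to the arithmetic group.
\<close>
lemma equi_class:
  assumes "det M \<noteq> 0"
  shows "\<exists>n w. w \<in> proj_line \<and> equi M (rep n w) \<and> (if n = 0 then (0, base_point) else (n, w)) \<in> class_index \<and>
    loc x M \<in> rep_class (if n = 0 then (0, base_point) else (n, w))"
proof -
  obtain n w where w: "w \<in> proj_line" "equi M (rep n w)" using equi_rep_exists[OF assms] by blast
  have M: "loc x M \<in> DC (loc x (rep n w))" by (rule DC_loc_if_equi(2)[OF w(2) det_rep[OF w(1)]])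
  have "loc x M \<in> rep_class (if n = 0 then (0, base_point) else (n, w))"
  proof (cases "n = 0")
    case True
    have "rep n w = theta w" unfolding True rep_def p_mat_eq by (simp add: matrix_mul_lid flip: mat2_mat1)
    moreover have "Gam (theta w)" unfolding Gam_def using rat_int_theta[OF w(1)] by blast
    then have "equi (theta w) (mat 1)"
      unfolding equi_def by (intro exI[of _ 1] exI[of _ "theta w"] exI[of _ "mat 1"])
        (simp add: matrix_mul_rid matrix_mul_lid flip: mat2_mat1)
    ultimately have "loc x (rep n w) \<in> DC (loc x (mat 1))" using DC_loc_if_equi(2)[of "theta w" "mat 1"] by simp
    from DC_eq[OF this] show ?thesis using True M by (simp add: rep_class_def class_rep_0 loc_one)
  next
    case False
    then show ?thesis using M by (simp add: rep_class_def class_rep_def)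
  qed
  moreover have "(if n = 0 then (0, base_point) else (n, w)) \<in> class_index" using w(1) by (auto simp: class_index_def)
  ultimately show ?thesis using w by blast
qed

definition class_no :: "'k gl2A \<Rightarrow> nat \<times> ('k \<times> 'k) set"
  where "class_no g = (SOME i. i \<in> class_index \<and> g \<in> rep_class i)"

lemma class_no: "class_no g \<in> class_index" "g \<in> rep_class (class_no g)"
proof -
  obtain h M k where h: "h \<in> rational_points" "det M \<noteq> 0" "k \<in> Kx" "g = h * loc x M * k" using adelic_decomposition by blast
  obtain i where i: "i \<in> class_index" "loc x M \<in> rep_class i" using equi_class[OF h(2)] by blast
  have "g = h * loc x M * 1 * k" using h(4) by simp
  then have "g \<in> DC (loc x M)" unfolding double_coset_def using h(1,3) center_one by blast
  then have "g \<in> rep_class i" using DC_eq[OF i(2)[unfolded rep_class_def]] by (simp add: rep_class_def)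
  then have "\<exists>i. i \<in> class_index \<and> g \<in> rep_class i" using i(1) by blast
  from someI_ex[OF this] show "class_no g \<in> class_index" "g \<in> rep_class (class_no g)" unfolding class_no_def by auto
qed

lemma class_no_eq: "i \<in> class_index \<Longrightarrow> g \<in> rep_class i \<Longrightarrow> class_no g = i"
  using class_no[of g] DC_eq rep_class_inj unfolding rep_class_def inj_on_def by metis

lemma class_no_DC: "g \<in> DC h \<Longrightarrow> class_no g = class_no h"
  using class_no[of h] DC_eq by (intro class_no_eq) (auto simp: rep_class_def)

lemma class_no_rep: "i \<in> class_index \<Longrightarrow> class_no (class_rep i) = i"
  by (rule class_no_eq) (auto simp: rep_class_def DC_self)

lemma automorphic_DC:
  assumes "f \<in> automorphic_forms Kx" "h \<in> DC g" shows "f h = f g"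
proof -
  obtain \<gamma> z k where h: "h = \<gamma> * g * z * k" "\<gamma> \<in> rational_points" "z \<in> center" "k \<in> Kx"
    using assms(2) unfolding double_coset_def by blast
  have "\<gamma> * g * z = z * (\<gamma> * g)" using h(3) by (simp add: center_def)
  then show ?thesis unfolding h(1) using assms(1) h by (simp add: automorphic_forms_def)
qed

lemma automorphic_class: "f \<in> automorphic_forms Kx \<Longrightarrow> f g = f (class_rep (class_no g))"
  using automorphic_DC class_no(2)[of g] by (simp add: rep_class_def)

lemma value_on_class:
  assumes "f \<in> automorphic_forms Kx" shows "value_on f (rep_class i) = f (class_rep i)"
  unfolding value_on_def rep_class_def
proof (rule the_equality)
  show "\<forall>g\<in>DC (class_rep i). f g = f (class_rep i)" using automorphic_DC[OF assms] by blast
  show "a = f (class_rep i)" if "\<forall>g\<in>DC (class_rep i). f g = a" for a using that DC_self by metis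
qed

context
  fixes y :: "'k place" and d :: nat
  assumes yx: "y \<noteq> x" and d: "degree (place_poly y) = d"
begin

lemma d_pos: "0 < d"
  using place_poly(3)[OF yx] d by simp

abbreviation "hr i \<equiv> loc y (hecke_mat y i)"

lemma matrix_inv_hecke_mat:
  "matrix_inv (hecke_mat y None) = scalar_mat (inverse (ev (place_poly y))) ** mat2 (ev (place_poly y)) 0 0 1"
  "matrix_inv (hecke_mat y (Some b)) = scalar_mat (inverse (ev (place_poly y))) ** mat2 1 (- ev b) 0 (ev (place_poly y))"
proof -
  have P: "ev (place_poly y) \<noteq> 0" using place_poly_neq_0[OF yx] by simp
  have dh: "det (hecke_mat y i) \<noteq> 0" for i using P by (simp add: hecke_mat_def det_mat2 split: option.split)
  note inv = matrix_inv_unique[OF dh]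
  show "matrix_inv (hecke_mat y None) = scalar_mat (inverse (ev (place_poly y))) ** mat2 (ev (place_poly y)) 0 0 1"
    by (rule inv) (use P in \<open>simp add: hecke_mat_def mat2_mult mat2_mat1\<close>)
  show "matrix_inv (hecke_mat y (Some b)) = scalar_mat (inverse (ev (place_poly y))) ** mat2 1 (- ev b) 0 (ev (place_poly y))"
    by (rule inv) (use P in \<open>simp add: hecke_mat_def mat2_mult mat2_mat1 mat2_eq_iff\<close>)
qed

lemma hecke_uniformizer: "val y (ev (place_poly y)) = 1"
  by (rule place_poly(2)[OF yx])

lemma top_neighbour:
  assumes i: "i \<in> class_index"
  shows "shift_class d i \<in> class_index" "class_rep i * hr None \<in> rep_class (shift_class d i)"
proof -
  obtain n w where nw: "i = (n, w)" by (cases i)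
  have w: "w \<in> proj_line" using class_index_proj[OF i] nw by simp
  have P: "inverse (ev (place_poly y)) \<noteq> 0" using place_poly_neq_0[OF yx] by simp
  show "shift_class d i \<in> class_index" using w d_pos by (auto simp: nw shift_class_def class_index_def)
  have "equi (matrix_inv (hecke_mat y None) ** rep n w) (rep (n + d) w)"
    unfolding matrix_inv_hecke_mat matrix_mul_assoc[symmetric]
    by (rule equi_scalar_left[OF P equi_top_neighbour[OF yx d w]])
  from DC_eq[OF DC_loc_if_equi(2)[OF this det_rep[OF w]]]
    hrep_to_x[OF yx hecke_uniformizer det_rep[OF w], of n None]
  show "class_rep i * hr None \<in> rep_class (shift_class d i)"
    by (simp add: nw class_rep_def rep_class_def shift_class_def)
qed

definition lower_class :: "'k poly \<Rightarrow> nat \<times> ('k \<times> 'k) set \<Rightarrow> nat \<times> ('k \<times> 'k) set"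
  where "lower_class b i = class_no (class_rep i * hr (Some b))"

lemma lower_class_rank:
  assumes i: "i \<in> class_index"
  shows "class_rank (lower_class b i) < class_rank (shift_class d i)"
proof -
  obtain n w where nw: "i = (n, w)" by (cases i)
  have w: "w \<in> proj_line" using class_index_proj[OF i] nw by simp
  have nw': "n = 0 \<Longrightarrow> w = base_point" using i nw by (auto simp: class_index_def)
  let ?P = "ev (place_poly y)"
  have P: "?P \<noteq> 0" using place_poly_neq_0[OF yx] by simp
  let ?N = "mat2 1 (- ev b) 0 ?P ** rep n w"
  let ?M = "matrix_inv (hecke_mat y (Some b)) ** rep n w"
  have M: "?M = scalar_mat (inverse ?P) ** ?N" unfolding matrix_inv_hecke_mat by (simp only: matrix_mul_assoc)
  have dN: "det ?N \<noteq> 0" using P det_rep[OF w] by (simp add: det_mul det_mat2)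
  then have dM: "det ?M \<noteq> 0" unfolding M using P by (simp add: det_mul det_mat2)
  obtain m w' where m: "w' \<in> proj_line" "equi ?M (rep m w')"
    "(if m = 0 then (0, base_point) else (m, w')) \<in> class_index" "loc x ?M \<in> rep_class (if m = 0 then (0, base_point) else (m, w'))"
    using equi_class[OF dM] by blast
  have "?N = scalar_mat ?P ** ?M" unfolding M matrix_mul_assoc scalar_mat_mult using P by (simp add: matrix_mul_lid flip: mat2_mat1)
  then have eq: "equi ?N (rep m w')" using equi_scalar_left[OF P m(2)] by simp
  note low = equi_lower_neighbour[OF d d_pos w m(1) eq]
  have "class_rep i * hr (Some b) \<in> DC (loc x ?M)"
    unfolding class_rep_def nw using hrep_to_x[OF yx hecke_uniformizer det_rep[OF w], of n "Some b"] by simp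
  then have "class_rep i * hr (Some b) \<in> rep_class (if m = 0 then (0, base_point) else (m, w'))"
    using DC_eq[OF m(4)[unfolded rep_class_def]] unfolding rep_class_def by blast
  then have lc: "lower_class b i = (if m = 0 then (0, base_point) else (m, w'))"
    unfolding lower_class_def by (rule class_no_eq[OF m(3)])
  have rk: "class_rank (lower_class b i) = (if m = 0 then 1 else 2 * m + (if w' = base_point then 1 else 0))"
    unfolding lc class_rank_def by simp
  show ?thesis
  proof (cases "n = 0")
    case True
    then have "m < d \<or> m = d \<and> w' \<noteq> base_point" using low(2) nw' by blast
    moreover have "class_rank (shift_class d i) = 2 * d + 1" using True nw'[OF True] by (simp add: nw class_rank_def shift_class_def)
    ultimately show ?thesis unfolding rk using d_pos by (cases "m = 0"; cases "w' = base_point") auto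
  next
    case False
    then have "m < n + d" using low(1) by simp
    moreover have "2 * (n + d) \<le> class_rank (shift_class d i)" by (simp add: nw class_rank_def shift_class_def)
    ultimately show ?thesis unfolding rk by (cases "m = 0"; cases "w' = base_point") auto
  qed
qed

lemma shift_class_rank: "class_rank i < class_rank (shift_class d i)"
  using d_pos by (simp add: class_rank_def shift_class_def)

lemma shift_class_inj: "inj_on (shift_class d) class_index"
  by (auto simp: inj_on_def shift_class_def prod_eq_iff)

text \<open>
  The classes that are not a top neighbour; they form the nucleus.
\<close>
definition initial_index :: "(nat \<times> ('k \<times> 'k) set) set"
  where "initial_index = class_index - shift_class d ` class_index"

lemma initial_index_eq: "initial_index = insert (0, base_point) ({1..d} \<times> proj_line) - {(d, base_point)}"
proof (intro equalityI subsetI)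
  fix i assume i: "i \<in> initial_index"
  obtain n w where nw: "i = (n, w)" by (cases i)
  have ic: "(n, w) \<in> class_index" and ni: "(n, w) \<notin> shift_class d ` class_index" using i by (auto simp: initial_index_def nw)
  have w: "w \<in> proj_line" using class_index_proj[OF ic] by simp
  have "n \<le> d"
  proof (rule ccontr)
    assume "\<not> n \<le> d"
    then have "(n, w) = shift_class d (n - d, w)" "(n - d, w) \<in> class_index" using w by (auto simp: shift_class_def intro: class_indexI)
    then show False using ni by blast
  qed
  moreover have "(n, w) \<noteq> (d, base_point)"
  proof
    assume "(n, w) = (d, base_point)"
    then have "(n, w) = shift_class d (0, base_point)" by (simp add: shift_class_def)
    then show False using ni by (auto simp: class_index_def)
  qed
  ultimately show "i \<in> insert (0, base_point) ({1..d} \<times> proj_line) - {(d, base_point)}"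
    using ic by (auto simp: nw class_index_def)
next
  fix i :: "nat \<times> ('k \<times> 'k) set"
  assume i: "i \<in> insert (0, base_point) ({1..d} \<times> proj_line) - {(d, base_point)}"
  then have "i \<in> class_index" by (auto simp: class_index_def)
  moreover have "i \<notin> shift_class d ` class_index"
    using i d_pos by (auto simp: class_index_def shift_class_def)
  ultimately show "i \<in> initial_index" by (simp add: initial_index_def)
qed

lemma finite_initial_index: "finite initial_index"
  unfolding initial_index_eq using finite_proj_line by simp

lemma card_initial_index: "card initial_index = d * (CARD('k) + 1)"
proof -
  have "(0, base_point) \<notin> {1..d} \<times> proj_line" by simp
  then have "card (insert (0, base_point) ({1..d} \<times> (proj_line :: ('k \<times> 'k) set set))) = Suc (d * (CARD('k) + 1))"
    using finite_proj_line by (simp add: card_cartesian_product card_proj_line)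
  moreover have "(d, base_point) \<in> insert (0, base_point) ({1..d} \<times> proj_line)" using d_pos base_point_in by simp
  ultimately show ?thesis unfolding initial_index_eq by (subst card_Diff_singleton) simp_all
qed

lemma nucleus_eq: "nucleus x ratfun_t d = rep_class ` initial_index"
proof -
  have c0: "class_zero x ratfun_t = rep_class (0, base_point)" by (simp add: class_zero_def rep_class_def class_rep_0)
  have cn: "class_at x ratfun_t n w = rep_class (n, w)" for n w
    by (simp add: class_at_def rep_class_def class_rep_def loc_def rep_def)
  let ?A = "insert (0, base_point) ({1..d} \<times> proj_line)"
  have "nucleus x ratfun_t d = rep_class ` ?A - {rep_class (d, base_point)}"
    unfolding nucleus_def c0 cn by auto
  also have "\<dots> = rep_class ` (?A - {(d, base_point)})"
  proof -
    have sub: "?A \<subseteq> class_index" by (auto simp: class_index_def)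
    have mem: "(d, base_point) \<in> ?A" using d_pos base_point_in by simp
    have "rep_class ` (?A - {(d, base_point)}) = rep_class ` ?A - rep_class ` {(d, base_point)}"
      by (rule inj_on_image_set_diff[OF rep_class_inj]) (use sub mem in blast)+
    then show ?thesis by (simp only: image_insert image_empty)
  qed
  finally show ?thesis by (simp only: initial_index_eq)
qed

lemma card_nucleus: "card (nucleus x ratfun_t d) = d * (CARD('k) + 1)" "finite (nucleus x ratfun_t d)"
proof -
  have "inj_on rep_class initial_index" using rep_class_inj by (rule inj_on_subset) (simp add: initial_index_def)
  then show "card (nucleus x ratfun_t d) = d * (CARD('k) + 1)"
    unfolding nucleus_eq by (simp add: card_image card_initial_index)
  show "finite (nucleus x ratfun_t d)" unfolding nucleus_eq using finite_initial_index by simp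
qed

end

end

section \<open>The eigenspace\<close>

context origin_place
begin

context
  fixes y :: "'k place" and d :: nat and p :: "'k ratfun" and \<mu> :: "'k gl2A measure" and l :: complex
  assumes deg_x: "place_degree x = 1" and yx: "y \<noteq> x" and d: "degree (place_poly y) = d" and vp: "val y p = 1"
    and \<mu>: "haar_measure \<mu>" "emeasure \<mu> max_compact = 1"
begin

abbreviation "A_forms \<equiv> automorphic_forms Kx"

abbreviation "remainders \<equiv> {b :: 'k poly. degree b < degree (place_poly y)}"

abbreviation "\<tau> \<equiv> shift_class d"

abbreviation "\<sigma> \<equiv> lower_class y"

lemma forms_right: "f \<in> A_forms \<Longrightarrow> k \<in> Kx \<Longrightarrow> f (g * k) = f g"
  by (simp add: automorphic_forms_def)

lemma hecke_sum:
  assumes "f \<in> A_forms"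
  shows "hecke_operator \<mu> Kx y p f g = (\<Sum>i\<in>hecke_index y. f (g * loc y (hecke_mat y i)))"
  by (rule hecke_operator_eq_sum[OF yx vp \<mu>]) (rule forms_right[OF assms])

text \<open>Right multiplication by an element of the congruence subgroup permutes the cosets in the Hecke
  double coset, so the Hecke operator preserves invariance.\<close>
lemma hecke_right_invariant:
  assumes f: "f \<in> A_forms" and k: "k \<in> Kx"
  shows "hecke_operator \<mu> Kx y p f (g * k) = hecke_operator \<mu> Kx y p f g"
proof -
  let ?h = "\<lambda>i. loc y (hecke_mat y i)"
  have "\<exists>j\<in>hecke_index y. \<exists>k'\<in>Kx. k * ?h i = ?h j * k'" for i
  proof -
    obtain a b where ab: "a \<in> Kx" "b \<in> Kx" "?h i = a * loc y (mat2 p 0 0 1) * b"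
      using hrep_in[OF yx vp, of i] unfolding hecke_double_coset_def[OF yx vp] by blast
    obtain j k' where "j \<in> hecke_index y" "k' \<in> Kx" "(k * a) * loc y (mat2 p 0 0 1) = ?h j * k'"
      using hecke_double_coset_cover[OF yx vp Kx_mult[OF k ab(1)]] by blast
    note jk = this
    have "k * ?h i = ((k * a) * loc y (mat2 p 0 0 1)) * b" unfolding ab(3) by (simp only: mult.assoc)
    also have "\<dots> = ?h j * (k' * b)" unfolding jk(3) by (simp only: mult.assoc)
    finally show ?thesis using jk(1) Kx_mult[OF jk(2) ab(2)] by blast
  qed
  then obtain \<pi> \<kappa> where pk: "\<And>i. \<pi> i \<in> hecke_index y" "\<And>i. \<kappa> i \<in> Kx" "\<And>i. k * ?h i = ?h (\<pi> i) * \<kappa> i" by metis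
  have inj: "inj_on \<pi> (hecke_index y)"
  proof (rule inj_onI)
    fix i j assume ij: "i \<in> hecke_index y" "j \<in> hecke_index y" "\<pi> i = \<pi> j"
    have "k * ?h i * ginv (\<kappa> i) = k * ?h j * ginv (\<kappa> j)"
      unfolding pk(3) ij(3) by (simp add: mult.assoc ginv)
    then have "ginv k * (k * (?h i * ginv (\<kappa> i))) = ginv k * (k * (?h j * ginv (\<kappa> j)))" by (simp only: mult.assoc)
    then have "?h i * ginv (\<kappa> i) = ?h j * ginv (\<kappa> j)" by simp
    then show "i = j" by (rule hrep_disjoint[OF yx vp ij(1,2) Kx_ginv[OF pk(2)] Kx_ginv[OF pk(2)]])
  qed
  have "\<pi> ` hecke_index y = hecke_index y"
    by (rule endo_inj_surj[OF finite_hecke_index _ inj]) (use pk(1) in blast)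
  then have bij: "bij_betw \<pi> (hecke_index y) (hecke_index y)" using inj by (simp add: bij_betw_def)
  have "hecke_operator \<mu> Kx y p f (g * k) = (\<Sum>i\<in>hecke_index y. f (g * ?h (\<pi> i)))"
    unfolding hecke_sum[OF f]
  proof (rule sum.cong[OF refl])
    fix i
    have "g * k * ?h i = g * ?h (\<pi> i) * \<kappa> i" using pk(3)[of i] by (simp add: mult.assoc)
    then show "f (g * k * ?h i) = f (g * ?h (\<pi> i))" using forms_right[OF f pk(2)] by simp
  qed
  also have "\<dots> = (\<Sum>i\<in>hecke_index y. f (g * ?h i))" by (rule sum.reindex_bij_betw[OF bij])
  finally show ?thesis unfolding hecke_sum[OF f] .
qed

lemma hecke_DC:
  assumes f: "f \<in> A_forms" and h: "h \<in> DC g"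
  shows "hecke_operator \<mu> Kx y p f h = hecke_operator \<mu> Kx y p f g"
proof -
  obtain \<gamma> z k where h: "h = \<gamma> * g * z * k" "\<gamma> \<in> rational_points" "z \<in> center" "k \<in> Kx"
    using h unfolding double_coset_def by blast
  have "f (\<gamma> * g * z * u) = f (g * u)" for u
  proof -
    have "\<gamma> * g * z * u = z * (\<gamma> * (g * u))"
    proof -
      have "\<gamma> * g * z = z * (\<gamma> * g)" using h(3) by (simp add: center_def)
      then show ?thesis by (simp only: mult.assoc)
    qed
    then show ?thesis using f h(2,3) by (simp add: automorphic_forms_def)
  qed
  then have "hecke_operator \<mu> Kx y p f (\<gamma> * g * z) = hecke_operator \<mu> Kx y p f g" unfolding hecke_sum[OF f] by simp
  then show ?thesis unfolding h(1) hecke_right_invariant[OF f h(4)] .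
qed

lemma hecke_at_rep:
  assumes f: "f \<in> A_forms" and i: "i \<in> class_index"
  shows "hecke_operator \<mu> Kx y p f (class_rep i) = f (class_rep (\<tau> i)) + (\<Sum>b\<in>remainders. f (class_rep (\<sigma> b i)))"
proof -
  let ?h = "\<lambda>i. loc y (hecke_mat y i)"
  have "hecke_operator \<mu> Kx y p f (class_rep i) = f (class_rep i * ?h None) + (\<Sum>j\<in>Some ` remainders. f (class_rep i * ?h j))"
    unfolding hecke_sum[OF f] hecke_index_def by (subst sum.insert) (auto intro: finite_low_degree)
  also have "(\<Sum>j\<in>Some ` remainders. f (class_rep i * ?h j)) = (\<Sum>b\<in>remainders. f (class_rep i * ?h (Some b)))"
    by (subst sum.reindex) simp_all
  also have "\<dots> = (\<Sum>b\<in>remainders. f (class_rep (\<sigma> b i)))"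
    unfolding lower_class_def[OF yx d] by (rule sum.cong[OF refl]) (rule automorphic_class[OF f])
  also have "f (class_rep i * ?h None) = f (class_rep (\<tau> i))"
    using automorphic_DC[OF f] top_neighbour(2)[OF yx d i] by (simp add: rep_class_def)
  finally show ?thesis .
qed

abbreviation "eigen \<equiv> hecke_eigenspace \<mu> Kx y p l"

text \<open>
  Both sides of the eigenvalue equation are constant on double cosets, so it may be checked on
  representatives.
\<close>
lemma eigen_iff:
  "f \<in> eigen \<longleftrightarrow> f \<in> A_forms \<and>
    (\<forall>i\<in>class_index. f (class_rep (\<tau> i)) + (\<Sum>b\<in>remainders. f (class_rep (\<sigma> b i))) = l * f (class_rep i))"
proof
  assume f: "f \<in> eigen"
  then have A: "f \<in> A_forms" and e: "\<And>g. hecke_operator \<mu> Kx y p f g = l * f g"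
    by (auto simp: hecke_eigenspace_def)
  then show "f \<in> A_forms \<and>
    (\<forall>i\<in>class_index. f (class_rep (\<tau> i)) + (\<Sum>b\<in>remainders. f (class_rep (\<sigma> b i))) = l * f (class_rep i))"
    using hecke_at_rep[OF A] by metis
next
  assume f: "f \<in> A_forms \<and>
    (\<forall>i\<in>class_index. f (class_rep (\<tau> i)) + (\<Sum>b\<in>remainders. f (class_rep (\<sigma> b i))) = l * f (class_rep i))"
  then have A: "f \<in> A_forms" by blast
  have "hecke_operator \<mu> Kx y p f g = l * f g" for g
  proof -
    have g: "g \<in> DC (class_rep (class_no g))" using class_no(2)[of g] by (simp add: rep_class_def)
    have "hecke_operator \<mu> Kx y p f g = l * f (class_rep (class_no g))"
      unfolding hecke_DC[OF A g] hecke_at_rep[OF A class_no(1)] using f class_no(1) by blast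
    then show ?thesis using automorphic_DC[OF A g] by simp
  qed
  then show "f \<in> eigen" using A by (auto simp: hecke_eigenspace_def)
qed

lemma moderate_growth_add:
  assumes "moderate_growth f" "moderate_growth (g :: 'k gl2A \<Rightarrow> complex)" shows "moderate_growth (f + g)"
proof -
  obtain C N where f: "\<And>u. cmod (f u) \<le> C * height u powr N" using assms(1) unfolding moderate_growth_def by blast
  obtain C' N' where g: "\<And>u. cmod (g u) \<le> C' * height u powr N'" using assms(2) unfolding moderate_growth_def by blast
  have "cmod ((f + g) u) \<le> (\<bar>C\<bar> + \<bar>C'\<bar>) * height u powr max N N'" for u
  proof -
    have h: "1 \<le> height u" by (rule height_ge_1[OF deg_x])
    have "cmod ((f + g) u) \<le> cmod (f u) + cmod (g u)" by (simp add: norm_triangle_ineq)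
    also have "\<dots> \<le> C * height u powr N + C' * height u powr N'" using f g add_mono by blast
    also have "\<dots> \<le> \<bar>C\<bar> * height u powr N + \<bar>C'\<bar> * height u powr N'"
      by (intro add_mono mult_right_mono) auto
    also have "\<dots> \<le> \<bar>C\<bar> * height u powr max N N' + \<bar>C'\<bar> * height u powr max N N'"
      using h by (intro add_mono mult_left_mono powr_mono) auto
    finally show ?thesis by (simp add: algebra_simps)
  qed
  then show ?thesis unfolding moderate_growth_def by blast
qed

lemma moderate_growth_scale:
  assumes "moderate_growth f" shows "moderate_growth (fun_scale a f)"
proof -
  obtain C N where f: "\<And>u. cmod (f u) \<le> C * height u powr N" using assms(1) unfolding moderate_growth_def by blast
  have "cmod (fun_scale a f u) \<le> (cmod a * C) * height u powr N" for u
    using mult_left_mono[OF f[of u], of "cmod a"] by (simp add: fun_scale_def norm_mult mult.assoc)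
  then show ?thesis unfolding moderate_growth_def by blast
qed

lemma forms_add: "f \<in> A_forms \<Longrightarrow> g \<in> A_forms \<Longrightarrow> f + g \<in> A_forms"
  using moderate_growth_add[of f g] unfolding automorphic_forms_def by simp

lemma forms_scale: "f \<in> A_forms \<Longrightarrow> fun_scale a f \<in> A_forms"
  using moderate_growth_scale[of f a] unfolding automorphic_forms_def by (simp add: fun_scale_def)

lemma forms_zero: "0 \<in> A_forms"
proof -
  have "moderate_growth (0 :: 'k gl2A \<Rightarrow> complex)" unfolding moderate_growth_def by (intro exI[of _ 0]) simp
  then show ?thesis unfolding automorphic_forms_def by simp
qed

lemma eigen_subspace: "fun_space.subspace eigen"
proof (rule fun_space.subspaceI)
  show "0 \<in> eigen" unfolding eigen_iff using forms_zero by simp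
next
  fix f g assume fg: "f \<in> eigen" "g \<in> eigen"
  have "(f + g) (class_rep (\<tau> i)) + (\<Sum>b\<in>remainders. (f + g) (class_rep (\<sigma> b i))) = l * (f + g) (class_rep i)"
    if i: "i \<in> class_index" for i
  proof -
    have h: "f (class_rep (\<tau> i)) + (\<Sum>b\<in>remainders. f (class_rep (\<sigma> b i))) = l * f (class_rep i)"
      "g (class_rep (\<tau> i)) + (\<Sum>b\<in>remainders. g (class_rep (\<sigma> b i))) = l * g (class_rep i)"
      using fg i unfolding eigen_iff by blast+
    from arg_cong2[OF h, of "(+)"] show ?thesis by (simp add: sum.distrib distrib_left add_ac)
  qed
  then show "f + g \<in> eigen" using fg forms_add unfolding eigen_iff by blast
next
  fix a f assume f: "f \<in> eigen"
  have "fun_scale a f (class_rep (\<tau> i)) + (\<Sum>b\<in>remainders. fun_scale a f (class_rep (\<sigma> b i))) = l * fun_scale a f (class_rep i)"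
    if i: "i \<in> class_index" for i
  proof -
    have "f (class_rep (\<tau> i)) + (\<Sum>b\<in>remainders. f (class_rep (\<sigma> b i))) = l * f (class_rep i)"
      using f i unfolding eigen_iff by blast
    then have "a * (f (class_rep (\<tau> i)) + (\<Sum>b\<in>remainders. f (class_rep (\<sigma> b i)))) = a * (l * f (class_rep i))" by simp
    then show ?thesis by (simp add: fun_scale_def sum_distrib_left distrib_left mult_ac)
  qed
  then show "fun_scale a f \<in> eigen" using f forms_scale unfolding eigen_iff by blast
qed

lemma direct_sum_subspace: "fun_space.subspace (direct_sum N)"
proof (rule fun_space.subspaceI)
  show "0 \<in> direct_sum N" by (simp add: direct_sum_def)
next
  fix f g assume fg: "f \<in> direct_sum N" "g \<in> direct_sum N"
  have "{c. (f + g) c \<noteq> 0} \<subseteq> {c. f c \<noteq> 0} \<union> {c. g c \<noteq> 0}" by auto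
  then have "finite {c. (f + g) c \<noteq> 0}" by (rule finite_subset) (use fg in \<open>simp add: direct_sum_def\<close>)
  then show "f + g \<in> direct_sum N" using fg by (simp add: direct_sum_def)
next
  fix a f assume f: "f \<in> direct_sum N"
  have "{c. fun_scale a f c \<noteq> 0} \<subseteq> {c. f c \<noteq> 0}" by (auto simp: fun_scale_def)
  then have "finite {c. fun_scale a f c \<noteq> 0}" by (rule finite_subset) (use f in \<open>simp add: direct_sum_def\<close>)
  then show "fun_scale a f \<in> direct_sum N" using f by (simp add: direct_sum_def fun_scale_def)
qed

text \<open>A function on the double cosets that grows at most exponentially with the level is of
  moderate growth, because so does the height.\<close>
lemma exponential_growth_moderate:
  assumes "0 \<le> C" "1 \<le> A" and u: "\<And>i. i \<in> class_index \<Longrightarrow> cmod (u i) \<le> C * A ^ class_rank i"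
  shows "moderate_growth (\<lambda>g. u (class_no g))"
proof -
  define q where "q = real CARD('k)"
  have q: "1 < q" unfolding q_def by (rule card_k_gt_1[OF deg_x])
  \<comment> \<open>chosen such that \<open>q^(n/3)\<close> raised to the power \<open>N\<close> is \<open>A^(2n)\<close>\<close>
  define N where "N = 3 * log q (A ^ 2)"
  have A2: "1 \<le> A ^ 2" using assms(2) by (rule one_le_power)
  have N0: "0 \<le> N" proof -
    have "0 < A ^ 2" using A2 by linarith
    then have "0 \<le> log q (A ^ 2)" using zero_le_log_cancel_iff[OF q] A2 by blast
    then show ?thesis by (simp add: N_def)
  qed
  have "cmod (u (class_no g)) \<le> (C * A) * height g powr N" for g
  proof -
    obtain n w where nw: "class_no g = (n, w)" by (cases "class_no g")
    have ci: "(n, w) \<in> class_index" using class_no(1)[of g] nw by simp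
    have w: "w \<in> proj_line" using class_index_proj[OF ci] by simp
    have "g \<in> DC (loc x (rep n w))" using class_no(2)[of g] nw by (simp add: rep_class_def class_rep_def)
    from height_lower_bound[OF deg_x w this] have h: "q powr (real n / 3) \<le> height g" unfolding q_def .
    have "cmod (u (class_no g)) \<le> C * A ^ class_rank (n, w)" using u[OF ci] nw by simp
    also have "\<dots> \<le> C * A ^ (2 * n + 1)"
      using assms(1,2) by (intro mult_left_mono power_increasing) (auto simp: class_rank_def)
    also have "\<dots> = (C * A) * (A ^ 2) ^ n" by (simp add: power_mult)
    also have "(A ^ 2) ^ n = (q powr log q (A ^ 2)) ^ n"
      by (subst powr_log_cancel) (use q A2 in linarith)+
    also have "\<dots> = (q powr (real n / 3)) powr N" using q by (simp add: N_def powr_powr powr_power mult.commute)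
    also have "(C * A) * (q powr (real n / 3)) powr N \<le> (C * A) * height g powr N"
      using h N0 q assms(1,2) by (intro mult_left_mono powr_mono2) auto
    finally show ?thesis .
  qed
  then show ?thesis unfolding moderate_growth_def by blast
qed

abbreviation "N0 \<equiv> nucleus x ratfun_t d"

lemma restrict_value:
  assumes f: "f \<in> A_forms" and i: "i \<in> initial_index d"
  shows "restrict_values N0 f (rep_class i) = f (class_rep i)"
proof -
  have "rep_class i \<in> N0" unfolding nucleus_eq[OF yx d] using i by blast
  then show ?thesis by (simp add: restrict_values_def value_on_class[OF f])
qed

lemma nucleus_cases:
  assumes "c \<in> N0" obtains i where "i \<in> initial_index d" "c = rep_class i"
  using assms unfolding nucleus_eq[OF yx d] by blast

lemma restrict_values_eqI:
  assumes "\<And>i. i \<in> initial_index d \<Longrightarrow> restrict_values N0 f (rep_class i) = \<phi> (rep_class i)"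
    and "\<And>c. c \<notin> N0 \<Longrightarrow> \<phi> c = 0"
  shows "restrict_values N0 f = \<phi>"
proof
  fix c show "restrict_values N0 f c = \<phi> c"
  proof (cases "c \<in> N0")
    case True
    then show ?thesis using assms(1) nucleus_cases by metis
  next
    case False
    then show ?thesis using assms(2)[OF False] by (simp add: restrict_values_def)
  qed
qed

lemma initial_index_def': "initial_index d = class_index - \<tau> ` class_index"
  by (rule initial_index_def[OF yx d])

lemma lower_class_spec: "i \<in> class_index \<Longrightarrow> class_rank (\<sigma> b i) < class_rank (\<tau> i) \<and> \<sigma> b i \<in> class_index"
  using lower_class_rank[OF yx d] class_no(1) unfolding lower_class_def[OF yx d] by blast

text \<open>
  Injectivity is uniqueness in the recursion for the values on double cosets, surjectivity is
  existence together with the growth estimate.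
\<close>
theorem eigenspace_iso: "linear_iso_on (restrict_values N0) eigen (direct_sum N0)"
  unfolding linear_iso_on_def
proof (intro conjI ballI allI)
  show "fun_space.subspace eigen" by (rule eigen_subspace)
  show "fun_space.subspace (direct_sum N0)" by (rule direct_sum_subspace)
next
  fix f g assume "f \<in> eigen" "g \<in> eigen"
  then have A: "f \<in> A_forms" "g \<in> A_forms" unfolding eigen_iff by blast+
  show "restrict_values N0 (f + g) = restrict_values N0 f + restrict_values N0 g"
    by (rule restrict_values_eqI) (simp add: restrict_value A forms_add, simp add: restrict_values_def)
next
  fix a f assume "f \<in> eigen"
  then have A: "f \<in> A_forms" unfolding eigen_iff by blast
  show "restrict_values N0 (fun_scale a f) = fun_scale a (restrict_values N0 f)"
    by (rule restrict_values_eqI)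
      (simp add: restrict_value A forms_scale fun_scale_def[of a f] fun_scale_def[of a "restrict_values N0 f"]
        forms_scale[OF A, of a, unfolded fun_scale_def], simp add: restrict_values_def fun_scale_def)
next
  show "bij_betw (restrict_values N0) eigen (direct_sum N0)"
    unfolding bij_betw_def
  proof
    show "inj_on (restrict_values N0) eigen"
    proof (rule inj_onI)
      fix f g assume fg: "f \<in> eigen" "g \<in> eigen" "restrict_values N0 f = restrict_values N0 g"
      have A: "f \<in> A_forms" "g \<in> A_forms" using fg unfolding eigen_iff by blast+
      have "f (class_rep i) = g (class_rep i)" if i: "i \<in> class_index" for i
      proof (rule recursion_unique[where \<rho> = class_rank and \<tau> = \<tau> and \<sigma> = \<sigma> and I = class_index
            and B = remainders and u = "\<lambda>i. f (class_rep i)" and u' = "\<lambda>i. g (class_rep i)" and l = l])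
        fix j :: "nat \<times> ('k \<times> 'k) set" assume "j \<in> class_index"
        show "class_rank j < class_rank (\<tau> j)" by (rule shift_class_rank[OF yx d])
        show "f (class_rep (\<tau> j)) + (\<Sum>b\<in>remainders. f (class_rep (\<sigma> b j))) = l * f (class_rep j)"
          using fg(1) \<open>j \<in> class_index\<close> unfolding eigen_iff by blast
        show "g (class_rep (\<tau> j)) + (\<Sum>b\<in>remainders. g (class_rep (\<sigma> b j))) = l * g (class_rep j)"
          using fg(2) \<open>j \<in> class_index\<close> unfolding eigen_iff by blast
      next
        fix b and j :: "nat \<times> ('k \<times> 'k) set" assume "j \<in> class_index"
        then show "class_rank (\<sigma> b j) < class_rank (\<tau> j) \<and> \<sigma> b j \<in> class_index" by (rule lower_class_spec)
      next
        fix j :: "nat \<times> ('k \<times> 'k) set" assume "j \<in> class_index - \<tau> ` class_index"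
        then have "j \<in> initial_index d" by (simp add: initial_index_def')
        then show "f (class_rep j) = g (class_rep j)" using restrict_value[OF A(1)] restrict_value[OF A(2)] fg(3) by metis
      qed (rule i)
      then show "f = g" using automorphic_class[OF A(1)] automorphic_class[OF A(2)] class_no(1) by (intro ext) metis
    qed
    show "restrict_values N0 ` eigen = direct_sum N0"
    proof (intro equalityI subsetI)
      fix \<phi> assume "\<phi> \<in> restrict_values N0 ` eigen"
      then obtain f where "\<phi> = restrict_values N0 f" by blast
      then have "\<phi> c = 0" if "c \<notin> N0" for c using that by (simp add: restrict_values_def)
      moreover from this have "{c. \<phi> c \<noteq> 0} \<subseteq> N0" by blast
      then have "finite {c. \<phi> c \<noteq> 0}" by (rule finite_subset[OF _ card_nucleus(2)[OF yx d]])
      ultimately show "\<phi> \<in> direct_sum N0" unfolding direct_sum_def by blast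
    next
      fix \<phi> assume \<phi>: "\<phi> \<in> direct_sum N0"
      obtain u where u: "\<And>i. i \<in> class_index - \<tau> ` class_index \<Longrightarrow> u i = \<phi> (rep_class i)"
        "\<And>j. j \<in> class_index \<Longrightarrow> u (\<tau> j) + (\<Sum>b\<in>remainders. u (\<sigma> b j)) = l * u j"
        using recursion_exists[OF shift_class_inj[OF yx d], of class_rank remainders \<sigma> "\<lambda>i. \<phi> (rep_class i)" l]
          shift_class_rank[OF yx d] lower_class_spec by blast
      define f where "f g = u (class_no g)" for g
      have frep: "f (class_rep i) = u i" if "i \<in> class_index" for i by (simp add: f_def class_no_rep[OF that])
      \<comment> \<open>the nucleus is finite, so the initial values are bounded\<close>
      define C where "C = (\<Sum>i\<in>initial_index d. cmod (u i))"
      have C: "0 \<le> C" "\<And>i. i \<in> class_index - \<tau> ` class_index \<Longrightarrow> cmod (u i) \<le> C"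
        unfolding C_def initial_index_def'[symmetric] using finite_initial_index[OF yx d]
        by (auto intro: sum_nonneg member_le_sum)
      have "cmod (u i) \<le> C * (cmod l + real (card remainders) + 1) ^ class_rank i" if "i \<in> class_index" for i
      proof (rule recursion_growth[where \<rho> = class_rank and \<tau> = \<tau> and \<sigma> = \<sigma> and I = class_index, OF _ _ u(2) C that])
        show "class_rank j < class_rank (\<tau> j)" for j by (rule shift_class_rank[OF yx d])
      qed (rule lower_class_spec)
      from exponential_growth_moderate[OF C(1) _ this] have "moderate_growth f" unfolding f_def by simp
      moreover have inv: "f h = f g" if "h \<in> DC g" for g h using class_no_DC[OF that] by (simp add: f_def)
      have "f (\<gamma> * g) = f g" if "\<gamma> \<in> rational_points" for \<gamma> g
      proof (rule inv)
        have "\<gamma> * g = \<gamma> * g * 1 * 1" by simp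
        then show "\<gamma> * g \<in> DC g" unfolding double_coset_def using that center_one Kx_one by blast
      qed
      moreover have "f (z * g) = f g" if "z \<in> center" for z g
      proof (rule inv)
        have "z * g = 1 * g * z * 1" using that by (simp add: center_def)
        then show "z * g \<in> DC g" unfolding double_coset_def using that rational_points_one Kx_one by blast
      qed
      moreover have "f (g * k) = f g" if "k \<in> Kx" for k g
      proof (rule inv)
        have "g * k = 1 * g * 1 * k" by simp
        then show "g * k \<in> DC g" unfolding double_coset_def using that rational_points_one center_one by blast
      qed
      ultimately have A: "f \<in> A_forms" unfolding automorphic_forms_def by blast
      have "f \<in> eigen"
        unfolding eigen_iff
      proof (intro conjI ballI A)
        fix i :: "nat \<times> ('k \<times> 'k) set" assume i: "i \<in> class_index"
        have "\<tau> i \<in> class_index" by (rule top_neighbour(1)[OF yx d i])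
        then show "f (class_rep (\<tau> i)) + (\<Sum>b\<in>remainders. f (class_rep (\<sigma> b i))) = l * f (class_rep i)"
          using u(2)[OF i] i lower_class_spec[OF i] by (simp add: frep)
      qed
      moreover have "restrict_values N0 f = \<phi>"
      proof (rule restrict_values_eqI)
        fix i assume i: "i \<in> initial_index d"
        then have "i \<in> class_index - \<tau> ` class_index" by (simp add: initial_index_def')
        then show "restrict_values N0 f (rep_class i) = \<phi> (rep_class i)"
          unfolding restrict_value[OF A i] using frep u(1) by simp
      qed (use \<phi> in \<open>simp add: direct_sum_def\<close>)
      ultimately show "\<phi> \<in> restrict_values N0 ` eigen" by blast
    qed
  qed
qed

lemma eigenspace_dim: "fun_space.dim eigen = d * (CARD('k) + 1)"
  using linear_iso_on_dim[OF eigenspace_iso card_nucleus(2)[OF yx d]] card_nucleus(1)[OF yx d] by simp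

end

end

theorem theorem4p19:
  fixes x y :: "'k::{field,finite} place" and \<pi> :: "'k place \<Rightarrow> 'k ratfun"
    and \<mu> :: "'k gl2A measure" and l :: complex and d :: nat
  assumes "place_degree x = 1" and "\<forall>z. is_uniformizer z (\<pi> z)" and "\<pi> x = ratfun_t"
    and "haar_measure \<mu>" and "emeasure \<mu> max_compact = 1"
    and "y \<noteq> x" and "place_degree y = d" and "l \<noteq> 0"
  shows "linear_iso_on (restrict_values (nucleus x (\<pi> x) d))
      (hecke_eigenspace \<mu> (congruence_subgroup x (\<pi> x)) y (\<pi> y) l)
      (direct_sum (nucleus x (\<pi> x) d)) \<and>
    fun_space.dim (hecke_eigenspace \<mu> (congruence_subgroup x (\<pi> x)) y (\<pi> y) l)
      = d * (CARD('k) + 1)"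
proof -
  interpret origin_place x
    using assms(2,3) by unfold_locales (metis is_uniformizer_def)
  have vp: "val y (\<pi> y) = 1" using assms(2) by (simp add: is_uniformizer_def)
  have d: "degree (place_poly y) = d" using place_degree_eq[OF assms(6)] assms(7) by simp
  show ?thesis
    unfolding assms(3)
    using eigenspace_iso[OF assms(1,6) d vp assms(4,5)] eigenspace_dim[OF assms(1,6) d vp assms(4,5)] by blast
qed

end
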